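(* Let $R\to S$ be a map of rings such that $S$ is a finitely presented right $R$-module of finite flat dimension, and such that $\mathsf{GFlat}(R)$ and $\mathsf{GFlat}(S)$ are definable. Suppose that the functor $S\otimes_R-\colon\underline{\mathsf{GFlatCot}}(R)\to\underline{\mathsf{GFlatCot}}(S)$ is full, and that for all $X\in\mathsf{FlatCot}(R)$ and all pure injective $M\in\mathsf{GFlat}(R)$ both of the following conditions hold: (C1) the canonical map $\mathrm{Hom}_R(M,X)\to\mathrm{Hom}_S(S\otimes_RM,S\otimes_RX)$ is surjective; (C2) the canonical map $\mathrm{Hom}_R(X,M)\to\mathrm{Hom}_S(S\otimes_RX,S\otimes_RM)$ is surjective. Then $S\otimes_R-\colon\mathsf{GFlat}(R)\to\mathsf{GFlat}(S)$ is full on pure injective objects, that is, for all pure injective $M,N\in\mathsf{GFlat}(R)$ the canonical map $\mathrm{Hom}_R(M,N)\to\mathrm{Hom}_S(S\otimes_RM,S\otimes_RN)$ is surjective.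
   Context: Modules are left modules. A module $M$ is cotorsion if $\mathrm{Ext}^1_R(F,M)=0$ for all flat $F$; $\mathsf{FlatCot}(R)$ is the class of flat and cotorsion modules. $M$ is Gorenstein flat if $M=Z_0(F)$ for an acyclic complex $F$ of flat $R$-modules such that $E\otimes_RF$ is acyclic for every injective right $R$-module $E$; $\mathsf{GFlat}(R)$ is the category of Gorenstein flat modules and $\mathsf{GFlatCot}(R)$ that of Gorenstein flat cotorsion modules. A subcategory of $\mathsf{Mod}(R)$ is definable if it is closed under products, direct limits and pure submodules; if $\mathsf{GFlat}(R)$ is definable then $R$ is right coherent. For $R$ right coherent, $\mathsf{GFlatCot}(R)$ is a Frobenius exact category with projective-injective objects $\mathsf{FlatCot}(R)$, with stable triangulated category $\underline{\mathsf{GFlatCot}}(R)$. Under the hypotheses on $R\to S$, extension of scalars $S\otimes_R-$ restricts to functors $\mathsf{GFlat}(R)\to\mathsf{GFlat}(S)$ and $\mathsf{GFlatCot}(R)\to\mathsf{GFlatCot}(S)$ preserving flat cotorsion modules, and hence induces the functor on stable categories. Pure injective modules are cotorsion. *)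

theory Defs
  imports "HOL-Algebra.Module" "HOL-Algebra.AbelCoset" "HOL-Algebra.Free_Abelian_Groups" "HOL-Library.Equipollence"
begin

section \<open>Small sets\<close>

text \<open>
  The category of all modules is taken relative to a type \<open>'u\<close> that serves as a universe: a set is
  small if its cardinality is below that of \<open>'u\<close>.  The predicate \<open>universe\<close> says that the
  cardinality of \<open>'u\<close> is uncountable, a strong limit and regular, i.e. that the small sets form a
  Grothendieck universe up to bijection.  HOL alone does not provide such a type, nor does it refute
  its existence; the type of all ZFC sets (entry \<open>ZFC_in_HOL\<close> of the Archive of Formal
  Proofs) is one, and for it \<open>small\<close> means being in bijection with a set.  The carriers of all
  modules over which the definitions below quantify are small subsets of \<open>'u\<close>.
\<close>

definition small :: "'u set \<Rightarrow> bool" where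
  "small A \<longleftrightarrow> A \<prec> (UNIV :: 'u set)"

definition universe :: "'u itself \<Rightarrow> bool" where
  "universe _ \<longleftrightarrow>
     (\<exists>A :: 'u set. infinite A \<and> small A) \<and>
     (\<forall>A :: 'u set. small A \<longrightarrow> Pow A \<prec> (UNIV :: 'u set)) \<and>
     (\<forall>(I :: 'u set) (A :: 'u \<Rightarrow> 'u set).
        small I \<and> (\<forall>i\<in>I. small (A i)) \<longrightarrow> small (\<Union>i\<in>I. A i))"


section \<open>Modules over noncommutative rings\<close>

text \<open>
  The locale \<open>module\<close> of \<open>HOL-Algebra\<close> requires a commutative ring; this is the same notion
  over an arbitrary ring, on the same record.  As there, the fields \<open>mult\<close> and \<open>one\<close>
  of the module record carry no meaning.
\<close>

locale left_module = R?: ring R + M?: abelian_group M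
  for R :: "('r, 'x) ring_scheme" (structure) and M :: "('r, 'm, 'y) module_scheme" (structure) +
  assumes smult_closed:
      "\<lbrakk>a \<in> carrier R; x \<in> carrier M\<rbrakk> \<Longrightarrow> a \<odot>\<^bsub>M\<^esub> x \<in> carrier M"
    and smult_l_distr:
      "\<lbrakk>a \<in> carrier R; b \<in> carrier R; x \<in> carrier M\<rbrakk> \<Longrightarrow>
        (a \<oplus>\<^bsub>R\<^esub> b) \<odot>\<^bsub>M\<^esub> x = a \<odot>\<^bsub>M\<^esub> x \<oplus>\<^bsub>M\<^esub> b \<odot>\<^bsub>M\<^esub> x"
    and smult_r_distr:
      "\<lbrakk>a \<in> carrier R; x \<in> carrier M; y \<in> carrier M\<rbrakk> \<Longrightarrow>
        a \<odot>\<^bsub>M\<^esub> (x \<oplus>\<^bsub>M\<^esub> y) = a \<odot>\<^bsub>M\<^esub> x \<oplus>\<^bsub>M\<^esub> a \<odot>\<^bsub>M\<^esub> y"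
    and smult_assoc:
      "\<lbrakk>a \<in> carrier R; b \<in> carrier R; x \<in> carrier M\<rbrakk> \<Longrightarrow>
        (a \<otimes>\<^bsub>R\<^esub> b) \<odot>\<^bsub>M\<^esub> x = a \<odot>\<^bsub>M\<^esub> (b \<odot>\<^bsub>M\<^esub> x)"
    and smult_one:
      "x \<in> carrier M \<Longrightarrow> \<one>\<^bsub>R\<^esub> \<odot>\<^bsub>M\<^esub> x = x"

definition Mods :: "'u ring \<Rightarrow> ('u, 'u) module set" where
  "Mods R = {M. left_module R M \<and> small (carrier M)}"

text \<open>
  Right \<open>R\<close>-modules are left modules over the opposite ring: if \<open>A\<close> is an
  \<open>opp R\<close>-module, then \<open>r \<odot>\<^bsub>A\<^esub> a\<close> stands for the product of \<open>a\<close> with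
  \<open>r\<close> on the right.
\<close>

definition opp :: "'r ring \<Rightarrow> 'r ring" where
  "opp R = R\<lparr>monoid.mult := (\<lambda>x y. y \<otimes>\<^bsub>R\<^esub> x)\<rparr>"

text \<open>
  Homomorphisms are extensional functions, so that equality of homomorphisms is equality of functions.
\<close>

definition Hom :: "'r ring \<Rightarrow> ('r, 'a) module \<Rightarrow> ('r, 'b) module \<Rightarrow> ('a \<Rightarrow> 'b) set" where
  "Hom R M N = {f \<in> carrier M \<rightarrow>\<^sub>E carrier N.
     (\<forall>x\<in>carrier M. \<forall>y\<in>carrier M. f (x \<oplus>\<^bsub>M\<^esub> y) = f x \<oplus>\<^bsub>N\<^esub> f y) \<and>
     (\<forall>r\<in>carrier R. \<forall>x\<in>carrier M. f (r \<odot>\<^bsub>M\<^esub> x) = r \<odot>\<^bsub>N\<^esub> f x)}"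

definition mod_iso :: "'r ring \<Rightarrow> ('r, 'a) module \<Rightarrow> ('r, 'b) module \<Rightarrow> bool" where
  "mod_iso R M N \<longleftrightarrow> (\<exists>f\<in>Hom R M N. bij_betw f (carrier M) (carrier N))"

definition free_mod :: "'r ring \<Rightarrow> nat \<Rightarrow> ('r, nat \<Rightarrow> 'r) module" where
  "free_mod R n = \<lparr>carrier = {..<n} \<rightarrow>\<^sub>E carrier R,
     monoid.mult = undefined, one = undefined,
     ring.zero = (\<lambda>i\<in>{..<n}. \<zero>\<^bsub>R\<^esub>),
     ring.add = (\<lambda>x y. \<lambda>i\<in>{..<n}. x i \<oplus>\<^bsub>R\<^esub> y i),
     smult = (\<lambda>r x. \<lambda>i\<in>{..<n}. r \<otimes>\<^bsub>R\<^esub> x i)\<rparr>"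

definition finitely_presented :: "'r ring \<Rightarrow> ('r, 'a) module \<Rightarrow> bool" where
  "finitely_presented R M \<longleftrightarrow>
     (\<exists>m n. \<exists>f\<in>Hom R (free_mod R m) (free_mod R n). \<exists>g\<in>Hom R (free_mod R n) M.
        f ` carrier (free_mod R m) = a_kernel (free_mod R n) M g \<and>
        g ` carrier (free_mod R n) = carrier M)"


section \<open>Tensor products\<close>

text \<open>
  The tensor product of a right module \<open>A\<close> (over \<open>opp R\<close>) and a left module
  \<open>B\<close>: the free abelian group on pairs modulo the balanced biadditive relations.  As with all
  quotient groups in \<open>HOL-Algebra\<close>, the group operation is written multiplicatively.
\<close>

definition tensor_rels ::
  "'r ring \<Rightarrow> ('r, 'a) module \<Rightarrow> ('r, 'b) module \<Rightarrow> ('a \<times> 'b \<Rightarrow>\<^sub>0 int) set" where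
  "tensor_rels R A B =
     {frag_of (a \<oplus>\<^bsub>A\<^esub> a', b) - frag_of (a, b) - frag_of (a', b) | a a' b.
        a \<in> carrier A \<and> a' \<in> carrier A \<and> b \<in> carrier B} \<union>
     {frag_of (a, b \<oplus>\<^bsub>B\<^esub> b') - frag_of (a, b) - frag_of (a, b') | a b b'.
        a \<in> carrier A \<and> b \<in> carrier B \<and> b' \<in> carrier B} \<union>
     {frag_of (r \<odot>\<^bsub>A\<^esub> a, b) - frag_of (a, r \<odot>\<^bsub>B\<^esub> b) | r a b.
        r \<in> carrier R \<and> a \<in> carrier A \<and> b \<in> carrier B}"

definition tensor_sub ::
  "'r ring \<Rightarrow> ('r, 'a) module \<Rightarrow> ('r, 'b) module \<Rightarrow> ('a \<times> 'b \<Rightarrow>\<^sub>0 int) set" where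
  "tensor_sub R A B =
     generate (free_Abelian_group (carrier A \<times> carrier B)) (tensor_rels R A B)"

definition tensor ::
  "'r ring \<Rightarrow> ('r, 'a) module \<Rightarrow> ('r, 'b) module \<Rightarrow> ('a \<times> 'b \<Rightarrow>\<^sub>0 int) set monoid" where
  "tensor R A B = free_Abelian_group (carrier A \<times> carrier B) Mod tensor_sub R A B"

text \<open>
  \<open>tensor_map R A B A' B' f g\<close> is the tensor product of \<open>f : A \<rightarrow> A'\<close> and
  \<open>g : B \<rightarrow> B'\<close>.  For homomorphisms \<open>f\<close> and \<open>g\<close> the cosets in the union all coincide.
\<close>

definition tensor_map ::
  "'r ring \<Rightarrow> ('r, 'a) module \<Rightarrow> ('r, 'b) module \<Rightarrow> ('r, 'c) module \<Rightarrow> ('r, 'd) module \<Rightarrow>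
   ('a \<Rightarrow> 'c) \<Rightarrow> ('b \<Rightarrow> 'd) \<Rightarrow> ('a \<times> 'b \<Rightarrow>\<^sub>0 int) set \<Rightarrow> ('c \<times> 'd \<Rightarrow>\<^sub>0 int) set" where
  "tensor_map R A B A' B' f g =
     (\<lambda>T\<in>carrier (tensor R A B). \<Union>t\<in>T.
        tensor_sub R A' B' #>\<^bsub>free_Abelian_group (carrier A' \<times> carrier B')\<^esub>
          frag_extend (\<lambda>(a, b). frag_of (f a, g b)) t)"


section \<open>Purity, injectivity and flatness\<close>

definition pure_mono ::
  "'u ring \<Rightarrow> ('u, 'u) module \<Rightarrow> ('u, 'u) module \<Rightarrow> ('u \<Rightarrow> 'u) \<Rightarrow> bool" where
  "pure_mono R N M i \<longleftrightarrow> i \<in> Hom R N M \<and> inj_on i (carrier N) \<and>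
     (\<forall>A\<in>Mods (opp R). inj_on (tensor_map R A N A M (\<lambda>a. a) i) (carrier (tensor R A N)))"

definition Injective :: "'u ring \<Rightarrow> ('u, 'u) module set" where
  "Injective R = {E \<in> Mods R. \<forall>A\<in>Mods R. \<forall>B\<in>Mods R. \<forall>i\<in>Hom R A B. \<forall>g\<in>Hom R A E.
     inj_on i (carrier A) \<longrightarrow> (\<exists>h\<in>Hom R B E. compose (carrier A) h i = g)}"

definition Pure_Injective :: "'u ring \<Rightarrow> ('u, 'u) module set" where
  "Pure_Injective R = {E \<in> Mods R. \<forall>A\<in>Mods R. \<forall>B\<in>Mods R. \<forall>i. \<forall>g\<in>Hom R A E.
     pure_mono R A B i \<longrightarrow> (\<exists>h\<in>Hom R B E. compose (carrier A) h i = g)}"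

definition Flat :: "'u ring \<Rightarrow> ('u, 'u) module set" where
  "Flat R = {F \<in> Mods R. \<forall>A\<in>Mods (opp R). \<forall>B\<in>Mods (opp R). \<forall>f\<in>Hom (opp R) A B.
     inj_on f (carrier A) \<longrightarrow>
     inj_on (tensor_map R A F B F f (\<lambda>x. x)) (carrier (tensor R A F))}"

text \<open>A flat resolution of finite length; beyond degree \<open>n\<close> all terms are zero.\<close>

definition finite_flat_dimension :: "'u ring \<Rightarrow> ('u, 'u) module \<Rightarrow> bool" where
  "finite_flat_dimension R M \<longleftrightarrow>
     (\<exists>(n :: nat) (F :: nat \<Rightarrow> ('u, 'u) module) d. \<exists>e\<in>Hom R (F 0) M.
        (\<forall>k. F k \<in> Flat R) \<and> (\<forall>k>n. carrier (F k) = {\<zero>\<^bsub>F k\<^esub>}) \<and>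
        (\<forall>k. d k \<in> Hom R (F (Suc k)) (F k)) \<and>
        e ` carrier (F 0) = carrier M \<and>
        d 0 ` carrier (F 1) = a_kernel (F 0) M e \<and>
        (\<forall>k. d (Suc k) ` carrier (F (Suc (Suc k))) = a_kernel (F (Suc k)) (F k) (d k)))"


section \<open>Cotorsion modules\<close>

text \<open>
  Yoneda's first extension group, as a set: the short exact sequences
  \<open>0 \<rightarrow> M \<rightarrow> Q \<rightarrow> F \<rightarrow> 0\<close> modulo equivalence.  Its zero element is the class of the
  direct sum, which consists of the split sequences.
\<close>

definition extensions ::
  "'u ring \<Rightarrow> ('u, 'u) module \<Rightarrow> ('u, 'u) module \<Rightarrow>
   (('u, 'u) module \<times> ('u \<Rightarrow> 'u) \<times> ('u \<Rightarrow> 'u)) set" where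
  "extensions R F M = {(Q, i, p). Q \<in> Mods R \<and> i \<in> Hom R M Q \<and> p \<in> Hom R Q F \<and>
     inj_on i (carrier M) \<and> i ` carrier M = a_kernel Q F p \<and> p ` carrier Q = carrier F}"

definition ext_equiv ::
  "'u ring \<Rightarrow> ('u, 'u) module \<Rightarrow> ('u, 'u) module \<Rightarrow>
   (('u, 'u) module \<times> ('u \<Rightarrow> 'u) \<times> ('u \<Rightarrow> 'u)) rel" where
  "ext_equiv R F M = {((Q, i, p), (Q', i', p')).
     (Q, i, p) \<in> extensions R F M \<and> (Q', i', p') \<in> extensions R F M \<and>
     (\<exists>u\<in>Hom R Q Q'. compose (carrier M) u i = i' \<and> compose (carrier Q) p' u = p)}"

definition Ext1 ::
  "'u ring \<Rightarrow> ('u, 'u) module \<Rightarrow> ('u, 'u) module \<Rightarrow>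
   (('u, 'u) module \<times> ('u \<Rightarrow> 'u) \<times> ('u \<Rightarrow> 'u)) set set" where
  "Ext1 R F M = extensions R F M // ext_equiv R F M"

definition Ext1_zero ::
  "'u ring \<Rightarrow> ('u, 'u) module \<Rightarrow> ('u, 'u) module \<Rightarrow>
   (('u, 'u) module \<times> ('u \<Rightarrow> 'u) \<times> ('u \<Rightarrow> 'u)) set" where
  "Ext1_zero R F M = {(Q, i, p) \<in> extensions R F M.
     \<exists>s\<in>Hom R F Q. \<forall>y\<in>carrier F. p (s y) = y}"

definition Cotorsion :: "'u ring \<Rightarrow> ('u, 'u) module set" where
  "Cotorsion R = {M \<in> Mods R. \<forall>F\<in>Flat R. Ext1 R F M = {Ext1_zero R F M}}"

definition FlatCot :: "'u ring \<Rightarrow> ('u, 'u) module set" where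
  "FlatCot R = Flat R \<inter> Cotorsion R"


section \<open>Gorenstein flat modules\<close>

text \<open>
  Complexes are indexed homologically: \<open>d n\<close> maps \<open>F n\<close> to \<open>F (n - 1)\<close>.
  Exactness at every place includes that consecutive differentials compose to zero.
\<close>

definition acyclic_flat_complex ::
  "'u ring \<Rightarrow> (int \<Rightarrow> ('u, 'u) module) \<Rightarrow> (int \<Rightarrow> 'u \<Rightarrow> 'u) \<Rightarrow> bool" where
  "acyclic_flat_complex R F d \<longleftrightarrow>
     (\<forall>n. F n \<in> Flat R) \<and> (\<forall>n. d n \<in> Hom R (F n) (F (n - 1))) \<and>
     (\<forall>n. d (n + 1) ` carrier (F (n + 1)) = a_kernel (F n) (F (n - 1)) (d n))"

definition tensor_acyclic ::
  "'u ring \<Rightarrow> ('u, 'u) module \<Rightarrow> (int \<Rightarrow> ('u, 'u) module) \<Rightarrow> (int \<Rightarrow> 'u \<Rightarrow> 'u) \<Rightarrow> bool" where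
  "tensor_acyclic R E F d \<longleftrightarrow>
     (\<forall>n. tensor_map R E (F (n + 1)) E (F n) (\<lambda>x. x) (d (n + 1)) ` carrier (tensor R E (F (n + 1)))
        = kernel (tensor R E (F n)) (tensor R E (F (n - 1)))
            (tensor_map R E (F n) E (F (n - 1)) (\<lambda>x. x) (d n)))"

definition cycles0 ::
  "(int \<Rightarrow> ('u, 'u) module) \<Rightarrow> (int \<Rightarrow> 'u \<Rightarrow> 'u) \<Rightarrow> ('u, 'u) module" where
  "cycles0 F d = (F 0)\<lparr>carrier := a_kernel (F 0) (F (- 1)) (d 0)\<rparr>"

definition GFlat :: "'u ring \<Rightarrow> ('u, 'u) module set" where
  "GFlat R = {M \<in> Mods R. \<exists>F d. acyclic_flat_complex R F d \<and>
     (\<forall>E\<in>Injective (opp R). tensor_acyclic R E F d) \<and> mod_iso R M (cycles0 F d)}"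

definition GFlatCot :: "'u ring \<Rightarrow> ('u, 'u) module set" where
  "GFlatCot R = GFlat R \<inter> Cotorsion R"


section \<open>Definable subcategories\<close>

definition is_product ::
  "'u ring \<Rightarrow> 'u set \<Rightarrow> ('u \<Rightarrow> ('u, 'u) module) \<Rightarrow>
   ('u, 'u) module \<Rightarrow> ('u \<Rightarrow> 'u \<Rightarrow> 'u) \<Rightarrow> bool" where
  "is_product R I M P \<pi> \<longleftrightarrow> P \<in> Mods R \<and> (\<forall>i\<in>I. \<pi> i \<in> Hom R P (M i)) \<and>
     (\<forall>T\<in>Mods R. \<forall>f. (\<forall>i\<in>I. f i \<in> Hom R T (M i)) \<longrightarrow>
        (\<exists>!u. u \<in> Hom R T P \<and> (\<forall>i\<in>I. compose (carrier T) (\<pi> i) u = f i)))"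

definition directed_system ::
  "'u ring \<Rightarrow> 'u set \<Rightarrow> 'u rel \<Rightarrow> ('u \<Rightarrow> ('u, 'u) module) \<Rightarrow> ('u \<Rightarrow> 'u \<Rightarrow> 'u \<Rightarrow> 'u) \<Rightarrow> bool" where
  "directed_system R I \<rho> M \<phi> \<longleftrightarrow>
     I \<noteq> {} \<and> (\<forall>i\<in>I. (i, i) \<in> \<rho>) \<and>
     (\<forall>i\<in>I. \<forall>j\<in>I. \<forall>k\<in>I. (i, j) \<in> \<rho> \<and> (j, k) \<in> \<rho> \<longrightarrow> (i, k) \<in> \<rho>) \<and>
     (\<forall>i\<in>I. \<forall>j\<in>I. \<exists>k\<in>I. (i, k) \<in> \<rho> \<and> (j, k) \<in> \<rho>) \<and>
     (\<forall>i\<in>I. M i \<in> Mods R) \<and>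
     (\<forall>i\<in>I. \<forall>j\<in>I. (i, j) \<in> \<rho> \<longrightarrow> \<phi> i j \<in> Hom R (M i) (M j)) \<and>
     (\<forall>i\<in>I. \<forall>x\<in>carrier (M i). \<phi> i i x = x) \<and>
     (\<forall>i\<in>I. \<forall>j\<in>I. \<forall>k\<in>I. (i, j) \<in> \<rho> \<and> (j, k) \<in> \<rho> \<longrightarrow>
        compose (carrier (M i)) (\<phi> j k) (\<phi> i j) = \<phi> i k)"

definition cocone ::
  "'u ring \<Rightarrow> 'u set \<Rightarrow> 'u rel \<Rightarrow> ('u \<Rightarrow> ('u, 'u) module) \<Rightarrow> ('u \<Rightarrow> 'u \<Rightarrow> 'u \<Rightarrow> 'u) \<Rightarrow>
   ('u, 'u) module \<Rightarrow> ('u \<Rightarrow> 'u \<Rightarrow> 'u) \<Rightarrow> bool" where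
  "cocone R I \<rho> M \<phi> L \<iota> \<longleftrightarrow> L \<in> Mods R \<and> (\<forall>i\<in>I. \<iota> i \<in> Hom R (M i) L) \<and>
     (\<forall>i\<in>I. \<forall>j\<in>I. (i, j) \<in> \<rho> \<longrightarrow> compose (carrier (M i)) (\<iota> j) (\<phi> i j) = \<iota> i)"

definition is_direct_limit ::
  "'u ring \<Rightarrow> 'u set \<Rightarrow> 'u rel \<Rightarrow> ('u \<Rightarrow> ('u, 'u) module) \<Rightarrow> ('u \<Rightarrow> 'u \<Rightarrow> 'u \<Rightarrow> 'u) \<Rightarrow>
   ('u, 'u) module \<Rightarrow> ('u \<Rightarrow> 'u \<Rightarrow> 'u) \<Rightarrow> bool" where
  "is_direct_limit R I \<rho> M \<phi> L \<iota> \<longleftrightarrow> cocone R I \<rho> M \<phi> L \<iota> \<and>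
     (\<forall>T f. cocone R I \<rho> M \<phi> T f \<longrightarrow>
        (\<exists>!u. u \<in> Hom R L T \<and> (\<forall>i\<in>I. compose (carrier (M i)) u (\<iota> i) = f i)))"

text \<open>
  Submodules are taken up to isomorphism, as pure monomorphisms; in particular a definable class
  is closed under isomorphism.
\<close>

definition definable :: "'u ring \<Rightarrow> ('u, 'u) module set \<Rightarrow> bool" where
  "definable R D \<longleftrightarrow> D \<subseteq> Mods R \<and>
     (\<forall>I M P \<pi>. small I \<and> (\<forall>i\<in>I. M i \<in> D) \<and> is_product R I M P \<pi> \<longrightarrow> P \<in> D) \<and>
     (\<forall>I \<rho> M \<phi> L \<iota>. small I \<and> (\<forall>i\<in>I. M i \<in> D) \<and> directed_system R I \<rho> M \<phi> \<and>
        is_direct_limit R I \<rho> M \<phi> L \<iota> \<longrightarrow> L \<in> D) \<and>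
     (\<forall>M\<in>D. \<forall>N\<in>Mods R. \<forall>i. pure_mono R N M i \<longrightarrow> N \<in> D)"


section \<open>Extension of scalars\<close>

text \<open>The ring \<open>S\<close> as a right \<open>R\<close>-module along \<open>h : R \<rightarrow> S\<close>.\<close>

definition restrict_right :: "'s ring \<Rightarrow> ('r \<Rightarrow> 's) \<Rightarrow> ('r, 's) module" where
  "restrict_right S h = \<lparr>carrier = carrier S,
     monoid.mult = monoid.mult S, one = \<one>\<^bsub>S\<^esub>, ring.zero = \<zero>\<^bsub>S\<^esub>, ring.add = ring.add S,
     smult = (\<lambda>r s. s \<otimes>\<^bsub>S\<^esub> h r)\<rparr>"

text \<open>
  The left \<open>S\<close>-module obtained from \<open>M\<close> by extension of scalars; \<open>s\<close> acts through left
  multiplication on the first tensor factor.  Its carrier consists of cosets and is therefore not a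
  subset of \<open>'u\<close>, which is why \<open>Hom\<close> and the stable notions below allow arbitrary carrier types.
\<close>

definition base_change ::
  "'u ring \<Rightarrow> 'u ring \<Rightarrow> ('u \<Rightarrow> 'u) \<Rightarrow> ('u, 'a) module \<Rightarrow>
   ('u, ('u \<times> 'a \<Rightarrow>\<^sub>0 int) set) module" where
  "base_change R S h M =
     (let A = restrict_right S h; T = tensor R A M in
      \<lparr>carrier = carrier T, monoid.mult = undefined, one = undefined,
       ring.zero = \<one>\<^bsub>T\<^esub>, ring.add = monoid.mult T,
       smult = (\<lambda>s. tensor_map R A M A M (\<lambda>t. s \<otimes>\<^bsub>S\<^esub> t) (\<lambda>x. x))\<rparr>)"

definition base_change_map ::
  "'u ring \<Rightarrow> 'u ring \<Rightarrow> ('u \<Rightarrow> 'u) \<Rightarrow> ('u, 'a) module \<Rightarrow> ('u, 'b) module \<Rightarrow>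
   ('a \<Rightarrow> 'b) \<Rightarrow> ('u \<times> 'a \<Rightarrow>\<^sub>0 int) set \<Rightarrow> ('u \<times> 'b \<Rightarrow>\<^sub>0 int) set" where
  "base_change_map R S h M N f =
     tensor_map R (restrict_right S h) M (restrict_right S h) N (\<lambda>s. s) f"

definition base_change_surj ::
  "'u ring \<Rightarrow> 'u ring \<Rightarrow> ('u \<Rightarrow> 'u) \<Rightarrow> ('u, 'a) module \<Rightarrow> ('u, 'b) module \<Rightarrow> bool" where
  "base_change_surj R S h M N \<longleftrightarrow>
     base_change_map R S h M N ` Hom R M N = Hom S (base_change R S h M) (base_change R S h N)"


section \<open>Stable categories\<close>

text \<open>
  Morphisms in the stable category of the Frobenius category of Gorenstein flat cotorsion modules:
  homomorphisms modulo those that factor through a projective-injective object, i.e. through a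
  flat cotorsion module.
\<close>

definition factors_FlatCot ::
  "'u ring \<Rightarrow> ('u, 'a) module \<Rightarrow> ('u, 'b) module \<Rightarrow> ('a \<Rightarrow> 'b) \<Rightarrow> bool" where
  "factors_FlatCot R M N f \<longleftrightarrow>
     (\<exists>Y\<in>FlatCot R. \<exists>a\<in>Hom R M Y. \<exists>b\<in>Hom R Y N. compose (carrier M) b a = f)"

definition stable_rel ::
  "'u ring \<Rightarrow> ('u, 'a) module \<Rightarrow> ('u, 'b) module \<Rightarrow> ('a \<Rightarrow> 'b) rel" where
  "stable_rel R M N = {(f, g). f \<in> Hom R M N \<and> g \<in> Hom R M N \<and>
     factors_FlatCot R M N (\<lambda>x\<in>carrier M. f x \<ominus>\<^bsub>N\<^esub> g x)}"

definition stable_Hom ::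
  "'u ring \<Rightarrow> ('u, 'a) module \<Rightarrow> ('u, 'b) module \<Rightarrow> ('a \<Rightarrow> 'b) set set" where
  "stable_Hom R M N = Hom R M N // stable_rel R M N"

text \<open>The map induced on stable classes; all classes in the union coincide.\<close>

definition stable_base_change_map ::
  "'u ring \<Rightarrow> 'u ring \<Rightarrow> ('u \<Rightarrow> 'u) \<Rightarrow> ('u, 'a) module \<Rightarrow> ('u, 'b) module \<Rightarrow>
   ('a \<Rightarrow> 'b) set \<Rightarrow> (('u \<times> 'a \<Rightarrow>\<^sub>0 int) set \<Rightarrow> ('u \<times> 'b \<Rightarrow>\<^sub>0 int) set) set" where
  "stable_base_change_map R S h M N c =
     (\<Union>f\<in>c. stable_rel S (base_change R S h M) (base_change R S h N) `` {base_change_map R S h M N f})"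

definition stable_base_change_full :: "'u ring \<Rightarrow> 'u ring \<Rightarrow> ('u \<Rightarrow> 'u) \<Rightarrow> bool" where
  "stable_base_change_full R S h \<longleftrightarrow> (\<forall>M\<in>GFlatCot R. \<forall>N\<in>GFlatCot R.
     \<forall>c\<in>stable_Hom S (base_change R S h M) (base_change R S h N).
       \<exists>c'\<in>stable_Hom R M N. stable_base_change_map R S h M N c' = c)"

end

theory Submission
  imports Defs
begin

text \<open>
  By stable fullness a map \<open>g : S \<otimes> M \<rightarrow> S \<otimes> N\<close> agrees with some \<open>S \<otimes> f\<close> up to a map that factors as
  \<open>S \<otimes> M \<rightarrow> Y \<rightarrow> S \<otimes> N\<close> with \<open>Y\<close> flat.  It suffices to find a flat cotorsion module \<open>X\<close> and \<open>X \<rightarrow> N\<close>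
  such that every map from a flat module to \<open>S \<otimes> N\<close> lifts to \<open>S \<otimes> X\<close>: then (C1) realises the
  lifted map \<open>S \<otimes> M \<rightarrow> S \<otimes> X\<close> by a map \<open>M \<rightarrow> X\<close>.

  Let \<open>'\<close> denote the character dual, let a flat module \<open>F\<close> map onto \<open>N\<close>, and take \<open>X = F''\<close>.  As \<open>N\<close>
  is pure injective, it is a retract of \<open>N''\<close>, so \<open>F'' \<rightarrow> N''\<close> gives \<open>X \<rightarrow> N\<close>.  The dual \<open>X\<close> is pure
  injective and thus cotorsion.  It is flat: powers of \<open>F\<close> are Gorenstein flat by definability, hence
  embed into flat modules; the equational criterion applied to the universal solution in such a power
  shows that the solutions in \<open>F\<close> of a linear equation all come from finitely many solutions in \<open>R\<close>,
  and this property passes to \<open>F''\<close>.  Since \<open>S\<close> is finitely presented, \<open>S \<otimes> F'' = (S \<otimes> F)''\<close>, and maps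
  from flat modules lift along \<open>(S \<otimes> F)'' \<rightarrow> (S \<otimes> N)''\<close>.
\<close>

\<comment> \<open>The obstacle is the module Y through which the error term factors: it lives over S
  only, and a map from Y to S \<otimes> N has no reason to pass through S \<otimes> F, even if F
  maps onto N. It passes through after dualising twice: a map from Y into a double dual is a pairing
  of the dual with Y, and for flat Y such pairings extend along the injection (S \<otimes> N)' -> (S
  \<otimes> F)'. Finite presentation of S serves to recognise (S \<otimes> F)'' as the base change
  of an R-module, namely F''. The price is that F'' must be flat. A linear equation has to be
  controlled by finitely many coefficients for this, since finite systems of coefficients are what
  survives dualising.

  Elements of tensor products are hard to compare, so the arguments are made dually. A character of
  A \<otimes> B with values in Q/Z is a \<open>balanced\<close> pairing, and flatness, purity and
  exactness become extension properties of pairings. Stable fullness applies to M and N because pure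
  injective modules are cotorsion; this too is proved with pairings.\<close>
section \<open>The group of rationals modulo the integers\<close>

\<comment> \<open>Q/Z is the target of all characters. It is divisible, so characters extend from
  subgroups; it has nonzero elements killed by any given n > 1, so they separate points; and it is
  countable, so the characters of a small group form a small set.\<close>
quotient_type qz = rat / "\<lambda>x y :: rat. x - y \<in> \<int>"
proof (rule equivpI)
  show "reflp (\<lambda>x y :: rat. x - y \<in> \<int>)" by (auto intro: reflpI)
  show "symp (\<lambda>x y :: rat. x - y \<in> \<int>)"
    by (rule sympI) (metis Ints_minus minus_diff_eq)
  show "transp (\<lambda>x y :: rat. x - y \<in> \<int>)"
  proof (rule transpI)
    fix x y z :: rat assume "x - y \<in> \<int>" "y - z \<in> \<int>"
    then have "(x - y) + (y - z) \<in> \<int>" by (rule Ints_add)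
    then show "x - z \<in> \<int>" by simp
  qed
qed

instantiation qz :: ab_group_add
begin

lift_definition zero_qz :: qz is 0 .

lift_definition plus_qz :: "qz \<Rightarrow> qz \<Rightarrow> qz" is "(+)"
  proof -
  fix a b c d :: rat assume "a - b \<in> \<int>" "c - d \<in> \<int>"
  then have "(a - b) + (c - d) \<in> \<int>" by (rule Ints_add)
  then show "a + c - (b + d) \<in> \<int>" by (simp add: algebra_simps)
qed

lift_definition uminus_qz :: "qz \<Rightarrow> qz" is uminus
  proof -
  fix a b :: rat assume "a - b \<in> \<int>"
  then have "- (a - b) \<in> \<int>" by (rule Ints_minus)
  then show "- a - - b \<in> \<int>" by simp
qed

definition minus_qz :: "qz \<Rightarrow> qz \<Rightarrow> qz" where "minus_qz x y = x + - y"

instance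
  by (standard; (simp add: minus_qz_def)?; transfer; simp)

end

lift_definition qz_of :: "rat \<Rightarrow> qz" is "\<lambda>x. x" .

lemma qz_of_add: "qz_of (x + y) = qz_of x + qz_of y"
  by transfer simp

lemma qz_of_0 [simp]: "qz_of 0 = 0"
  by transfer simp

lemma qz_of_eq_0_iff: "qz_of x = 0 \<longleftrightarrow> x \<in> \<int>"
  by transfer simp

lemma qz_of_surj: "\<exists>q. d = qz_of q"
  by transfer (metis Ints_0 diff_self)

lemma countable_qz: "countable (UNIV :: qz set)"
proof -
  have "(UNIV :: qz set) = range qz_of"
    using qz_of_surj by auto
  then show ?thesis by (metis countableI_type countable_image)
qed

section \<open>Abelian groups as modules over the integers\<close>

definition int_ring :: "int ring" where
  "int_ring = \<lparr>carrier = UNIV, monoid.mult = (*), one = 1, ring.zero = 0, ring.add = (+)\<rparr>"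

lemma int_ring_simps [simp]:
  "carrier int_ring = UNIV" "\<zero>\<^bsub>int_ring\<^esub> = 0" "\<one>\<^bsub>int_ring\<^esub> = 1"
  "x \<oplus>\<^bsub>int_ring\<^esub> y = x + y" "x \<otimes>\<^bsub>int_ring\<^esub> y = x * y"
  by (simp_all add: int_ring_def)

lemma ring_int_ring: "ring int_ring"
proof (rule ringI)
  show "abelian_group int_ring"
  proof (rule abelian_groupI)
    fix x assume "x \<in> carrier int_ring"
    show "\<exists>y\<in>carrier int_ring. y \<oplus>\<^bsub>int_ring\<^esub> x = \<zero>\<^bsub>int_ring\<^esub>"
      by (rule bexI[of _ "- x"]) simp_all
  qed simp_all
  show "monoid int_ring" by (rule monoidI) simp_all
qed (simp_all add: algebra_simps)

text \<open>Lets Baer's criterion, proved below for modules over any ring, also give the extension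
  of characters of abelian groups.\<close>

definition Z_module :: "('a, 'm) ring_scheme \<Rightarrow> (int, 'a) module" where
  "Z_module G = \<lparr>carrier = carrier G, monoid.mult = undefined, one = undefined,
     ring.zero = \<zero>\<^bsub>G\<^esub>, ring.add = ring.add G, smult = (\<lambda>k x. [k] \<cdot>\<^bsub>G\<^esub> x)\<rparr>"

lemma Z_module_simps [simp]:
  "carrier (Z_module G) = carrier G" "\<zero>\<^bsub>Z_module G\<^esub> = \<zero>\<^bsub>G\<^esub>"
  "x \<oplus>\<^bsub>Z_module G\<^esub> y = x \<oplus>\<^bsub>G\<^esub> y" "k \<odot>\<^bsub>Z_module G\<^esub> x = [k] \<cdot>\<^bsub>G\<^esub> x"
  by (simp_all add: Z_module_def)

lemma left_module_Z_module:
  assumes "abelian_group G"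
  shows "left_module int_ring (Z_module G)"
proof -
  interpret G: abelian_group G by fact
  have "abelian_group (Z_module G)"
    by (rule abelian_groupI) (auto simp: G.a_ac intro: G.add.l_inv_ex)
  then show ?thesis
    by (intro left_module.intro ring_int_ring left_module_axioms.intro)
      (auto simp: G.add.int_pow_mult G.add.int_pow_distrib G.add.int_pow_pow mult.commute)
qed

text \<open>\<open>abelian_group\<close> is a predicate on ring records, so additive groups appear
  throughout as rings whose multiplication and unit are arbitrary.\<close>

abbreviation qz_group :: "qz ring" where
  "qz_group \<equiv> \<lparr>carrier = UNIV, monoid.mult = undefined, one = undefined, ring.zero = 0, ring.add = (+)\<rparr>"

lemma abelian_group_qz: "abelian_group qz_group"
proof (rule abelian_groupI)
  fix x :: qz assume "x \<in> carrier qz_group"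
  show "\<exists>y\<in>carrier qz_group. y \<oplus>\<^bsub>qz_group\<^esub> x = \<zero>\<^bsub>qz_group\<^esub>"
    by (rule bexI[of _ "- x"]) simp_all
qed (simp_all add: add.assoc add.commute)

text \<open>Multiples are computed on representatives, where they are products of rational numbers;
  the negative case follows by cancelling a positive one.\<close>

lemma qz_pow: "[k] \<cdot>\<^bsub>qz_group\<^esub> (qz_of q) = qz_of (of_int k * q)"
proof -
  interpret G: abelian_group qz_group by (rule abelian_group_qz)
  have nat: "[n] \<cdot>\<^bsub>qz_group\<^esub> (qz_of q) = qz_of (of_nat n * q)" for n :: nat
    by (induction n) (simp_all add: add_pow_def qz_of_add distrib_right qz_of_0 add.commute)
  show ?thesis
  proof (cases k)
    case (nonneg n)
    then show ?thesis using nat[of n] by (simp add: add_pow_def int_pow_int)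
  next
    case (neg n)
    have "[int (Suc n)] \<cdot>\<^bsub>qz_group\<^esub> (qz_of q) = qz_of (of_nat (Suc n) * q)"
      using nat[of "Suc n"] unfolding add_pow_def int_pow_int .
    moreover have "[k] \<cdot>\<^bsub>qz_group\<^esub> (qz_of q) \<oplus>\<^bsub>qz_group\<^esub> [int (Suc n)] \<cdot>\<^bsub>qz_group\<^esub> (qz_of q) = \<zero>\<^bsub>qz_group\<^esub>"
      using neg int_pow_int[of "add_monoid qz_group" "qz_of q" 0]
      by (subst G.add.int_pow_mult[symmetric]) (simp_all add: add_pow_def)
    ultimately have "[k] \<cdot>\<^bsub>qz_group\<^esub> (qz_of q) + qz_of (of_nat (Suc n) * q) = 0"
      by simp
    moreover have "qz_of (of_int k * q) + qz_of (of_nat (Suc n) * q) = 0"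
      using neg by (simp add: qz_of_add[symmetric] qz_of_eq_0_iff flip: distrib_right)
    ultimately show ?thesis by (metis add_right_cancel)
  qed
qed

section \<open>Modules, graphs of partial homomorphisms, and Baer's criterion\<close>

context left_module
begin

lemma smult_zero_right [simp]: "a \<in> carrier R \<Longrightarrow> a \<odot>\<^bsub>M\<^esub> \<zero>\<^bsub>M\<^esub> = \<zero>\<^bsub>M\<^esub>"
  using smult_r_distr[of a "\<zero>\<^bsub>M\<^esub>" "\<zero>\<^bsub>M\<^esub>"] smult_closed[of a "\<zero>\<^bsub>M\<^esub>"] by simp

lemma smult_zero_left [simp]: "x \<in> carrier M \<Longrightarrow> \<zero>\<^bsub>R\<^esub> \<odot>\<^bsub>M\<^esub> x = \<zero>\<^bsub>M\<^esub>"
  using smult_l_distr[of "\<zero>\<^bsub>R\<^esub>" "\<zero>\<^bsub>R\<^esub>" x] smult_closed[of "\<zero>\<^bsub>R\<^esub>" x] by simp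

lemma smult_uminus_one: "x \<in> carrier M \<Longrightarrow> (\<ominus>\<^bsub>R\<^esub> \<one>\<^bsub>R\<^esub>) \<odot>\<^bsub>M\<^esub> x = \<ominus>\<^bsub>M\<^esub> x"
proof -
  assume x: "x \<in> carrier M"
  have "(\<ominus>\<^bsub>R\<^esub> \<one>\<^bsub>R\<^esub>) \<odot>\<^bsub>M\<^esub> x \<oplus>\<^bsub>M\<^esub> x = ((\<ominus>\<^bsub>R\<^esub> \<one>\<^bsub>R\<^esub>) \<oplus>\<^bsub>R\<^esub> \<one>\<^bsub>R\<^esub>) \<odot>\<^bsub>M\<^esub> x"
    using x by (simp add: smult_l_distr smult_one)
  also have "\<dots> = \<zero>\<^bsub>M\<^esub>" using x by (simp add: R.l_neg)
  finally show ?thesis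
    using x smult_closed by (metis M.minus_equality R.add.inv_closed R.one_closed)
qed

end

definition regular :: "'r ring \<Rightarrow> ('r, 'r) module" where
  "regular R = \<lparr>carrier = carrier R, monoid.mult = undefined, one = undefined,
     ring.zero = \<zero>\<^bsub>R\<^esub>, ring.add = ring.add R, smult = monoid.mult R\<rparr>"

lemma regular_simps [simp]:
  "carrier (regular R) = carrier R" "\<zero>\<^bsub>regular R\<^esub> = \<zero>\<^bsub>R\<^esub>"
  "x \<oplus>\<^bsub>regular R\<^esub> y = x \<oplus>\<^bsub>R\<^esub> y" "k \<odot>\<^bsub>regular R\<^esub> x = k \<otimes>\<^bsub>R\<^esub> x"
  by (simp_all add: regular_def)

lemma left_module_regular:
  assumes "ring R" shows "left_module R (regular R)"
proof -
  interpret R: ring R by fact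
  have "abelian_group (regular R)"
    by (rule abelian_groupI) (auto simp: R.a_ac intro: R.add.l_inv_ex)
  then show ?thesis
    by (intro left_module.intro assms left_module_axioms.intro)
      (auto simp: R.m_assoc R.l_distr R.r_distr)
qed

text \<open>A homomorphism to E defined on a submodule of M, encoded by its graph: a submodule of M
  x E in which 0 is related to 0 only. Extension of homomorphisms is then inclusion of sets, as
  Zorn's lemma wants it. Negatives come from the scalar -1.\<close>

definition mod_graph ::
  "'r ring \<Rightarrow> ('r, 'a) module \<Rightarrow> ('r, 'b) module \<Rightarrow> ('a \<times> 'b) set \<Rightarrow> bool" where
  "mod_graph R M E \<Gamma> \<longleftrightarrow> \<Gamma> \<subseteq> carrier M \<times> carrier E \<and> (\<zero>\<^bsub>M\<^esub>, \<zero>\<^bsub>E\<^esub>) \<in> \<Gamma> \<and>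
     (\<forall>m y m' y'. (m, y) \<in> \<Gamma> \<longrightarrow> (m', y') \<in> \<Gamma> \<longrightarrow> (m \<oplus>\<^bsub>M\<^esub> m', y \<oplus>\<^bsub>E\<^esub> y') \<in> \<Gamma>) \<and>
     (\<forall>r m y. r \<in> carrier R \<longrightarrow> (m, y) \<in> \<Gamma> \<longrightarrow> (r \<odot>\<^bsub>M\<^esub> m, r \<odot>\<^bsub>E\<^esub> y) \<in> \<Gamma>) \<and>
     (\<forall>y. (\<zero>\<^bsub>M\<^esub>, y) \<in> \<Gamma> \<longrightarrow> y = \<zero>\<^bsub>E\<^esub>)"

lemma mod_graphD:
  assumes "mod_graph R M E \<Gamma>"
  shows "(m, y) \<in> \<Gamma> \<Longrightarrow> m \<in> carrier M" "(m, y) \<in> \<Gamma> \<Longrightarrow> y \<in> carrier E"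
    "(\<zero>\<^bsub>M\<^esub>, \<zero>\<^bsub>E\<^esub>) \<in> \<Gamma>"
    "(m, y) \<in> \<Gamma> \<Longrightarrow> (m', y') \<in> \<Gamma> \<Longrightarrow> (m \<oplus>\<^bsub>M\<^esub> m', y \<oplus>\<^bsub>E\<^esub> y') \<in> \<Gamma>"
    "r \<in> carrier R \<Longrightarrow> (m, y) \<in> \<Gamma> \<Longrightarrow> (r \<odot>\<^bsub>M\<^esub> m, r \<odot>\<^bsub>E\<^esub> y) \<in> \<Gamma>"
    "(\<zero>\<^bsub>M\<^esub>, y) \<in> \<Gamma> \<Longrightarrow> y = \<zero>\<^bsub>E\<^esub>"
  using assms unfolding mod_graph_def by blast+

lemma mod_graph_unique:
  assumes M: "left_module R M" and E: "left_module R E" and \<Gamma>: "mod_graph R M E \<Gamma>"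
    and "(m, y) \<in> \<Gamma>" "(m, y') \<in> \<Gamma>"
  shows "y = y'"
proof -
  interpret M: left_module R M by fact
  interpret E: left_module R E by fact
  note g = mod_graphD[OF \<Gamma>]
  have m: "m \<in> carrier M" and y: "y \<in> carrier E" "y' \<in> carrier E" using assms g by blast+
  have "(\<ominus>\<^bsub>M\<^esub> m, \<ominus>\<^bsub>E\<^esub> y') \<in> \<Gamma>"
    using g(5)[OF _ assms(5), of "\<ominus>\<^bsub>R\<^esub> \<one>\<^bsub>R\<^esub>"] m y M.smult_uminus_one E.smult_uminus_one by simp
  then have "(m \<oplus>\<^bsub>M\<^esub> \<ominus>\<^bsub>M\<^esub> m, y \<oplus>\<^bsub>E\<^esub> \<ominus>\<^bsub>E\<^esub> y') \<in> \<Gamma>" using g(4) assms(4) by blast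
  then have "y \<oplus>\<^bsub>E\<^esub> \<ominus>\<^bsub>E\<^esub> y' = \<zero>\<^bsub>E\<^esub>" using g(6) m by (simp add: M.r_neg)
  then show ?thesis using y by (metis E.M.add.inv_closed E.M.minus_equality E.M.minus_minus)
qed

text \<open>Baer's criterion for graphs: \<open>ideals\<close> says that homomorphisms from left
  ideals to E are given by elements of E. It allows a maximal graph to be enlarged by any m, so that
  the maximal graph is total.\<close>

lemma Baer:
  assumes M: "left_module R M" and E: "left_module R E"
    and ideals: "\<And>J. mod_graph R (regular R) E J \<Longrightarrow> \<exists>e\<in>carrier E. \<forall>(r, y)\<in>J. y = r \<odot>\<^bsub>E\<^esub> e"
    and \<Gamma>0: "mod_graph R M E \<Gamma>0"
  shows "\<exists>f\<in>Hom R M E. \<forall>(m, y)\<in>\<Gamma>0. f m = y"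
proof -
  interpret M: left_module R M by fact
  interpret E: left_module R E by fact
  define \<A> where "\<A> = {\<Gamma>. mod_graph R M E \<Gamma> \<and> \<Gamma>0 \<subseteq> \<Gamma>}"
  have "\<exists>\<Gamma>\<in>\<A>. \<forall>X\<in>\<A>. \<Gamma> \<subseteq> X \<longrightarrow> X = \<Gamma>"
  proof (rule subset_Zorn_nonempty)
    show "\<A> \<noteq> {}" using \<Gamma>0 by (auto simp: \<A>_def)
    fix C assume C: "C \<noteq> {}" "subset.chain \<A> C"
    then obtain c where c: "c \<in> C" by blast
    have sub: "C \<subseteq> \<A>" and lin: "\<And>X Y. X \<in> C \<Longrightarrow> Y \<in> C \<Longrightarrow> X \<subseteq> Y \<or> Y \<subseteq> X"
      using C by (auto simp: subset_chain_def)
    then have g: "\<And>X. X \<in> C \<Longrightarrow> mod_graph R M E X" by (auto simp: \<A>_def)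
    have "mod_graph R M E (\<Union>C)"
      unfolding mod_graph_def
    proof (intro conjI allI impI)
      show "\<Union> C \<subseteq> carrier M \<times> carrier E" using g unfolding mod_graph_def by blast
      show "(\<zero>\<^bsub>M\<^esub>, \<zero>\<^bsub>E\<^esub>) \<in> \<Union> C" using mod_graphD(3)[OF g[OF c]] c by blast
      fix m y m' y' assume "(m, y) \<in> \<Union> C" "(m', y') \<in> \<Union> C"
      then obtain Y Y' where Y: "Y \<in> C" "(m, y) \<in> Y" and Y': "Y' \<in> C" "(m', y') \<in> Y'" by blast
      then obtain X where "X \<in> C" "(m, y) \<in> X" "(m', y') \<in> X"
        using lin[of Y Y'] by blast
      then show "(m \<oplus>\<^bsub>M\<^esub> m', y \<oplus>\<^bsub>E\<^esub> y') \<in> \<Union> C"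
        using mod_graphD(4)[OF g, of X] by (intro UnionI)
    next
      fix r m y assume r: "r \<in> carrier R" and "(m, y) \<in> \<Union> C"
      then obtain X where "X \<in> C" "(m, y) \<in> X" by blast
      then show "(r \<odot>\<^bsub>M\<^esub> m, r \<odot>\<^bsub>E\<^esub> y) \<in> \<Union> C"
        using mod_graphD(5)[OF g, of X] r by (intro UnionI)
    next
      fix y assume "(\<zero>\<^bsub>M\<^esub>, y) \<in> \<Union> C"
      then obtain X where "X \<in> C" "(\<zero>\<^bsub>M\<^esub>, y) \<in> X" by blast
      then show "y = \<zero>\<^bsub>E\<^esub>" by (rule mod_graphD(6)[OF g])
    qed
    moreover have "\<Gamma>0 \<subseteq> \<Union>C" using c sub by (auto simp: \<A>_def)
    ultimately show "\<Union>C \<in> \<A>" by (simp add: \<A>_def)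
  qed
  then obtain \<Gamma> where "\<Gamma> \<in> \<A>" and max': "\<forall>X\<in>\<A>. \<Gamma> \<subseteq> X \<longrightarrow> X = \<Gamma>" ..
  then have \<Gamma>: "mod_graph R M E \<Gamma>" "\<Gamma>0 \<subseteq> \<Gamma>" by (simp_all add: \<A>_def)
  have max: "X = \<Gamma>" if "mod_graph R M E X" "\<Gamma> \<subseteq> X" for X
    using max' \<Gamma>(2) that unfolding \<A>_def by auto
  note g = mod_graphD[OF \<Gamma>(1)]
  note uniq = mod_graph_unique[OF M E \<Gamma>(1)]
  have total: "\<exists>y. (m, y) \<in> \<Gamma>" if m: "m \<in> carrier M" for m
  proof -
    \<comment> \<open>The left ideal of all r that move m into the domain of \<Gamma>, with the
      homomorphism that \<Gamma> induces on it.\<close>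
    define J where "J = {(r, y). r \<in> carrier R \<and> (r \<odot>\<^bsub>M\<^esub> m, y) \<in> \<Gamma>}"
    have "mod_graph R (regular R) E J"
      unfolding mod_graph_def
    proof (intro conjI allI impI)
      show "J \<subseteq> carrier (regular R) \<times> carrier E" using g by (auto simp: J_def)
      show "(\<zero>\<^bsub>regular R\<^esub>, \<zero>\<^bsub>E\<^esub>) \<in> J" using g(3) m by (simp add: J_def)
      fix r y r' y' assume "(r, y) \<in> J" "(r', y') \<in> J"
      then show "(r \<oplus>\<^bsub>regular R\<^esub> r', y \<oplus>\<^bsub>E\<^esub> y') \<in> J"
        using g(4) m by (auto simp: J_def M.smult_l_distr)
    next
      fix a r y assume "a \<in> carrier R" "(r, y) \<in> J"
      then show "(a \<odot>\<^bsub>regular R\<^esub> r, a \<odot>\<^bsub>E\<^esub> y) \<in> J"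
        using g(5) m by (auto simp: J_def M.smult_assoc)
    next
      fix y assume "(\<zero>\<^bsub>regular R\<^esub>, y) \<in> J"
      then show "y = \<zero>\<^bsub>E\<^esub>" using g(6) m by (auto simp: J_def)
    qed
    from ideals[OF this] obtain e where e: "e \<in> carrier E" "\<And>r y. (r, y) \<in> J \<Longrightarrow> y = r \<odot>\<^bsub>E\<^esub> e"
      by blast
    \<comment> \<open>The sum of \<Gamma> and the assignment r m -> r e. It is single-valued because
      e represents J: wherever r m lies in the domain of \<Gamma>, both prescriptions agree.\<close>
    define X where "X = {(n \<oplus>\<^bsub>M\<^esub> r \<odot>\<^bsub>M\<^esub> m, y \<oplus>\<^bsub>E\<^esub> r \<odot>\<^bsub>E\<^esub> e) | n y r. (n, y) \<in> \<Gamma> \<and> r \<in> carrier R}"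
    have XI: "(n \<oplus>\<^bsub>M\<^esub> r \<odot>\<^bsub>M\<^esub> m, y \<oplus>\<^bsub>E\<^esub> r \<odot>\<^bsub>E\<^esub> e) \<in> X" if "(n, y) \<in> \<Gamma>" "r \<in> carrier R" for n y r
      using that by (auto simp: X_def)
    have "\<Gamma> \<subseteq> X"
    proof
      fix z assume "z \<in> \<Gamma>"
      then show "z \<in> X" using XI[of "fst z" "snd z" "\<zero>\<^bsub>R\<^esub>"] m e g(1,2)[of "fst z" "snd z"] by simp
    qed
    moreover have "mod_graph R M E X"
      unfolding mod_graph_def
    proof (intro conjI allI impI)
      show "X \<subseteq> carrier M \<times> carrier E"
        using g(1,2) m e(1) M.smult_closed E.smult_closed by (auto simp: X_def)
      show "(\<zero>\<^bsub>M\<^esub>, \<zero>\<^bsub>E\<^esub>) \<in> X" using \<open>\<Gamma> \<subseteq> X\<close> g(3) by blast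
      fix n y n' y' assume "(n, y) \<in> X" "(n', y') \<in> X"
      then obtain k r w k' r' w' where *: "(k, w) \<in> \<Gamma>" "(k', w') \<in> \<Gamma>" "r \<in> carrier R" "r' \<in> carrier R"
        "n = k \<oplus>\<^bsub>M\<^esub> r \<odot>\<^bsub>M\<^esub> m" "n' = k' \<oplus>\<^bsub>M\<^esub> r' \<odot>\<^bsub>M\<^esub> m"
        "y = w \<oplus>\<^bsub>E\<^esub> r \<odot>\<^bsub>E\<^esub> e" "y' = w' \<oplus>\<^bsub>E\<^esub> r' \<odot>\<^bsub>E\<^esub> e"
        unfolding X_def by blast
      have "n \<oplus>\<^bsub>M\<^esub> n' = (k \<oplus>\<^bsub>M\<^esub> k') \<oplus>\<^bsub>M\<^esub> (r \<oplus>\<^bsub>R\<^esub> r') \<odot>\<^bsub>M\<^esub> m"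
        "y \<oplus>\<^bsub>E\<^esub> y' = (w \<oplus>\<^bsub>E\<^esub> w') \<oplus>\<^bsub>E\<^esub> (r \<oplus>\<^bsub>R\<^esub> r') \<odot>\<^bsub>E\<^esub> e"
        using * g(1,2) m e(1) M.smult_closed E.smult_closed
        by (simp_all add: M.smult_l_distr E.smult_l_distr M.M.a_ac E.M.a_ac)
      then show "(n \<oplus>\<^bsub>M\<^esub> n', y \<oplus>\<^bsub>E\<^esub> y') \<in> X" using XI g(4) * by simp
    next
      fix a n y assume a: "a \<in> carrier R" and "(n, y) \<in> X"
      then obtain k r w where *: "(k, w) \<in> \<Gamma>" "r \<in> carrier R"
        "n = k \<oplus>\<^bsub>M\<^esub> r \<odot>\<^bsub>M\<^esub> m" "y = w \<oplus>\<^bsub>E\<^esub> r \<odot>\<^bsub>E\<^esub> e"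
        unfolding X_def by blast
      have "a \<odot>\<^bsub>M\<^esub> n = a \<odot>\<^bsub>M\<^esub> k \<oplus>\<^bsub>M\<^esub> (a \<otimes>\<^bsub>R\<^esub> r) \<odot>\<^bsub>M\<^esub> m"
        "a \<odot>\<^bsub>E\<^esub> y = a \<odot>\<^bsub>E\<^esub> w \<oplus>\<^bsub>E\<^esub> (a \<otimes>\<^bsub>R\<^esub> r) \<odot>\<^bsub>E\<^esub> e"
        using * a g(1,2) m e(1) M.smult_closed E.smult_closed
        by (simp_all add: M.smult_r_distr E.smult_r_distr M.smult_assoc E.smult_assoc)
      then show "(a \<odot>\<^bsub>M\<^esub> n, a \<odot>\<^bsub>E\<^esub> y) \<in> X" using XI g(5) * a by simp
    next
      fix y assume "(\<zero>\<^bsub>M\<^esub>, y) \<in> X"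
      then obtain k r w where *: "(k, w) \<in> \<Gamma>" "r \<in> carrier R"
        "\<zero>\<^bsub>M\<^esub> = k \<oplus>\<^bsub>M\<^esub> r \<odot>\<^bsub>M\<^esub> m" "y = w \<oplus>\<^bsub>E\<^esub> r \<odot>\<^bsub>E\<^esub> e"
        unfolding X_def by blast
      have kw: "k \<in> carrier M" "w \<in> carrier E" using * g by blast+
      have "\<ominus>\<^bsub>M\<^esub> k = r \<odot>\<^bsub>M\<^esub> m"
        using * kw m by (metis M.M.add.inv_equality M.M.minus_minus M.M.a_comm M.smult_closed)
      moreover have "(\<ominus>\<^bsub>M\<^esub> k, \<ominus>\<^bsub>E\<^esub> w) \<in> \<Gamma>"
        using g(5)[OF _ *(1), of "\<ominus>\<^bsub>R\<^esub> \<one>\<^bsub>R\<^esub>"] kw M.smult_uminus_one E.smult_uminus_one by simp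
      ultimately have "(r, \<ominus>\<^bsub>E\<^esub> w) \<in> J" using * by (simp add: J_def)
      then have "\<ominus>\<^bsub>E\<^esub> w = r \<odot>\<^bsub>E\<^esub> e" by (rule e(2))
      then show "y = \<zero>\<^bsub>E\<^esub>" using *(4) kw by (metis E.M.r_neg)
    qed
    ultimately have "X = \<Gamma>" using max by blast
    \<comment> \<open>Taking the zero pair of \<Gamma> and the scalar 1 puts (m, e) into X, hence m
      into the domain.\<close>
    moreover have "(\<zero>\<^bsub>M\<^esub> \<oplus>\<^bsub>M\<^esub> \<one>\<^bsub>R\<^esub> \<odot>\<^bsub>M\<^esub> m, \<zero>\<^bsub>E\<^esub> \<oplus>\<^bsub>E\<^esub> \<one>\<^bsub>R\<^esub> \<odot>\<^bsub>E\<^esub> e) \<in> X"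
      using XI g(3) by blast
    ultimately show ?thesis using m M.smult_one by auto
  qed
  define f where "f = (\<lambda>m\<in>carrier M. THE y. (m, y) \<in> \<Gamma>)"
  have f: "f m = y" if "(m, y) \<in> \<Gamma>" for m y
    using that uniq g(1) unfolding f_def by (auto intro!: the_equality)
  have fin: "(m, f m) \<in> \<Gamma>" if "m \<in> carrier M" for m
    using total[OF that] f by blast
  have "f \<in> Hom R M E"
    unfolding Hom_def
  proof (intro CollectI conjI ballI)
    show "f \<in> carrier M \<rightarrow>\<^sub>E carrier E"
    proof (rule PiE_I)
      show "f x \<in> carrier E" if "x \<in> carrier M" for x using fin[OF that] g(2) by blast
    qed (simp add: f_def)
  next
    fix x y assume "x \<in> carrier M" "y \<in> carrier M"
    then show "f (x \<oplus>\<^bsub>M\<^esub> y) = f x \<oplus>\<^bsub>E\<^esub> f y" using fin g(4) f by blast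
  next
    fix r x assume "r \<in> carrier R" "x \<in> carrier M"
    then show "f (r \<odot>\<^bsub>M\<^esub> x) = r \<odot>\<^bsub>E\<^esub> f x" using fin g(5) f by blast
  qed
  then show ?thesis using f \<Gamma>(2) by blast
qed

lemma add_pow_int_0 [simp]: "add_pow G (0 :: int) x = \<zero>\<^bsub>G\<^esub>"
  using int_pow_int[of "add_monoid G" x 0] by (simp add: add_pow_def)

section \<open>Characters\<close>

definition character :: "('a, 'm) ring_scheme \<Rightarrow> ('a \<Rightarrow> qz) \<Rightarrow> bool" where
  "character G \<chi> \<longleftrightarrow> (\<forall>x\<in>carrier G. \<forall>y\<in>carrier G. \<chi> (x \<oplus>\<^bsub>G\<^esub> y) = \<chi> x + \<chi> y)"

lemma characterD: "character G \<chi> \<Longrightarrow> x \<in> carrier G \<Longrightarrow> y \<in> carrier G \<Longrightarrow> \<chi> (x \<oplus>\<^bsub>G\<^esub> y) = \<chi> x + \<chi> y"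
  by (simp add: character_def)

lemma character_zero:
  assumes "abelian_group G" "character G \<chi>" shows "\<chi> \<zero>\<^bsub>G\<^esub> = 0"
proof -
  interpret abelian_group G by fact
  show ?thesis using characterD[OF assms(2), of "\<zero>\<^bsub>G\<^esub>" "\<zero>\<^bsub>G\<^esub>"] by simp
qed

lemma character_inv:
  assumes "abelian_group G" "character G \<chi>" "x \<in> carrier G" shows "\<chi> (\<ominus>\<^bsub>G\<^esub> x) = - \<chi> x"
proof -
  interpret abelian_group G by fact
  have "\<chi> (\<ominus>\<^bsub>G\<^esub> x) + \<chi> x = \<chi> (\<ominus>\<^bsub>G\<^esub> x \<oplus>\<^bsub>G\<^esub> x)"
    using characterD[OF assms(2)] assms(3) by simp
  then show ?thesis
    using character_zero[OF assms(1,2)] assms(3) by (simp add: l_neg eq_neg_iff_add_eq_0)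
qed

lemma qz_divisible: "n \<noteq> 0 \<Longrightarrow> \<exists>e. [n] \<cdot>\<^bsub>qz_group\<^esub> e = (d :: qz)" for n :: int
proof -
  assume "n \<noteq> 0"
  obtain q where "d = qz_of q" using qz_of_surj by blast
  then have "[n] \<cdot>\<^bsub>qz_group\<^esub> qz_of (q / of_int n) = d"
    using \<open>n \<noteq> 0\<close> by (simp only: qz_pow) simp
  then show ?thesis by blast
qed

text \<open>The least positive member divides every other by division with remainder; the zero ideal
  gets 0.\<close>

lemma int_ideal_generator:
  fixes I :: "int set"
  assumes "0 \<in> I" "\<And>x y. x \<in> I \<Longrightarrow> y \<in> I \<Longrightarrow> x + y \<in> I" "\<And>k x. x \<in> I \<Longrightarrow> k * x \<in> I"
  obtains n where "n \<in> I" "\<And>k. k \<in> I \<Longrightarrow> n dvd k"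
proof (cases "\<exists>x\<in>I. x \<noteq> 0")
  case False
  then show ?thesis using that[of 0] assms(1) by auto
next
  case True
  then obtain x where x: "x \<in> I" "x \<noteq> 0" by blast
  have "\<exists>m. 0 < m \<and> int m \<in> I"
    using x assms(3)[OF x(1), of "sgn x"] by (intro exI[of _ "nat \<bar>x\<bar>"]) (simp add: abs_sgn[symmetric] mult.commute[of "sgn x"])
  then obtain m where m: "0 < m \<and> int m \<in> I" and least: "\<And>k. 0 < k \<and> int k \<in> I \<Longrightarrow> m \<le> k"
    using exists_least_iff[of "\<lambda>m. 0 < m \<and> int m \<in> I"] by (metis not_le)
  show ?thesis
  proof (rule that[of "int m"])
    show "int m \<in> I" using m by simp
    fix k assume k: "k \<in> I"
    have "k mod int m = k + (- (k div int m)) * int m" by (simp add: minus_div_mult_eq_mod)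
    then have "k mod int m \<in> I" using assms(2,3) k m by metis
    moreover have "0 \<le> k mod int m" "k mod int m < int m" using m by simp_all
    ultimately have "k mod int m = 0"
      using least[of "nat (k mod int m)"] by (cases "k mod int m = 0") auto
    then show "int m dvd k" by (simp add: dvd_eq_mod_eq_0)
  qed
qed

text \<open>Divisibility is what makes Q/Z satisfy Baer's condition: an ideal of the integers is
  generated by some n, and dividing the image of n by n yields the required element. For n = 0 the
  image is 0.\<close>

lemma qz_Baer:
  assumes J: "mod_graph int_ring (regular int_ring) (Z_module qz_group) J"
  shows "\<exists>e\<in>carrier (Z_module qz_group). \<forall>(r, y)\<in>J. y = r \<odot>\<^bsub>Z_module qz_group\<^esub> e"
proof -
  note g = mod_graphD[OF J]
  note uniq = mod_graph_unique[OF left_module_regular[OF ring_int_ring]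
      left_module_Z_module[OF abelian_group_qz] J]
  have I1: "0 \<in> fst ` J" using g(3) by force
  have I2: "x + y \<in> fst ` J" if xy: "x \<in> fst ` J" "y \<in> fst ` J" for x y
  proof -
    from xy obtain a b where "(x, a) \<in> J" "(y, b) \<in> J" by auto
    then have "(x + y, a + b) \<in> J" using g(4) by fastforce
    then show ?thesis by force
  qed
  have I3: "k * x \<in> fst ` J" if x: "x \<in> fst ` J" for k x
  proof -
    from x obtain a where "(x, a) \<in> J" by auto
    then have "(k * x, [k] \<cdot>\<^bsub>qz_group\<^esub> a) \<in> J" using g(5)[of k x a] by simp
    then show ?thesis by force
  qed
  obtain n where n: "n \<in> fst ` J" "\<And>k. k \<in> fst ` J \<Longrightarrow> n dvd k"
    using int_ideal_generator[OF I1 I2 I3] by metis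
  then obtain d where d: "(n, d) \<in> J" by auto
  obtain e where e: "[n] \<cdot>\<^bsub>qz_group\<^esub> e = d"
  proof (cases "n = 0")
    case True
    then have "d = 0" using g(6) d by simp
    then have "[n] \<cdot>\<^bsub>qz_group\<^esub> qz_of 0 = d" using True by (simp only: qz_pow) simp
    then show ?thesis using that by blast
  qed (use qz_divisible that in blast)
  have "y = [r] \<cdot>\<^bsub>qz_group\<^esub> e" if ry: "(r, y) \<in> J" for r y
  proof -
    have "n dvd r" using n(2) ry by force
    then obtain q where q: "r = q * n" by (metis dvd_def mult.commute)
    obtain x where x: "e = qz_of x" using qz_of_surj by blast
    have "(r, [q] \<cdot>\<^bsub>qz_group\<^esub> d) \<in> J" using g(5)[of q, OF _ d] q by simp
    then have "y = [q] \<cdot>\<^bsub>qz_group\<^esub> d" using uniq ry by blast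
    also have "\<dots> = [r] \<cdot>\<^bsub>qz_group\<^esub> e"
      unfolding e[symmetric] x q by (simp only: qz_pow) (simp add: mult.assoc)
    finally show ?thesis .
  qed
  then show ?thesis by auto
qed

text \<open>Injectivity of Q/Z among abelian groups, by Baer's criterion over the integers. Closure
  of \<Gamma> under integer multiples is derived from \<open>add\<close> and
  \<open>neg\<close>.\<close>

lemma character_extend:
  assumes G: "abelian_group G" and sub: "\<Gamma> \<subseteq> carrier G \<times> UNIV" and zero: "(\<zero>\<^bsub>G\<^esub>, 0) \<in> \<Gamma>"
    and add: "\<And>x y x' y'. (x, y) \<in> \<Gamma> \<Longrightarrow> (x', y') \<in> \<Gamma> \<Longrightarrow> (x \<oplus>\<^bsub>G\<^esub> x', y + y') \<in> \<Gamma>"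
    and neg: "\<And>x y. (x, y) \<in> \<Gamma> \<Longrightarrow> (\<ominus>\<^bsub>G\<^esub> x, - y) \<in> \<Gamma>"
    and single: "\<And>y. (\<zero>\<^bsub>G\<^esub>, y) \<in> \<Gamma> \<Longrightarrow> y = 0"
  obtains \<chi> where "character G \<chi>" "\<And>x y. (x, y) \<in> \<Gamma> \<Longrightarrow> \<chi> x = y"
proof -
  interpret G: abelian_group G by fact
  interpret Q: abelian_group qz_group by (rule abelian_group_qz)
  have mult: "([k] \<cdot>\<^bsub>G\<^esub> x, [k] \<cdot>\<^bsub>qz_group\<^esub> y) \<in> \<Gamma>" if xy: "(x, y) \<in> \<Gamma>" for k :: int and x y
  proof -
    have x: "x \<in> carrier G" using sub xy by blast
    have nat: "([n] \<cdot>\<^bsub>G\<^esub> x, [n] \<cdot>\<^bsub>qz_group\<^esub> y) \<in> \<Gamma>" for n :: nat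
    proof (induction n)
      case 0 then show ?case using zero by simp
    next
      case (Suc n) then show ?case using add[OF Suc xy] by simp
    qed
    have uminus: "\<ominus>\<^bsub>qz_group\<^esub> z = - z" for z
      by (rule Q.minus_equality) simp_all
    show ?thesis
    proof (cases k)
      case (nonneg n)
      then show ?thesis using nat[of n] by (simp add: add_pow_def int_pow_int)
    next
      case (neg n)
      have "[k] \<cdot>\<^bsub>G\<^esub> x = \<ominus>\<^bsub>G\<^esub> ([Suc n] \<cdot>\<^bsub>G\<^esub> x)"
        using G.add.int_pow_neg[OF x, of "int (Suc n)"] neg by (simp add: add_pow_def int_pow_int del: nat_pow_Suc of_nat_Suc)
      moreover have "[k] \<cdot>\<^bsub>qz_group\<^esub> y = - ([Suc n] \<cdot>\<^bsub>qz_group\<^esub> y)"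
        using Q.add.int_pow_neg[of y "int (Suc n)"] neg
        by (simp add: add_pow_def int_pow_int uminus del: nat_pow_Suc of_nat_Suc)
      ultimately show ?thesis using assms(5)[OF nat[of "Suc n"]] by simp
    qed
  qed
  have "mod_graph int_ring (Z_module G) (Z_module qz_group) \<Gamma>"
    unfolding mod_graph_def using sub zero add mult single by auto
  from Baer[OF left_module_Z_module[OF G] left_module_Z_module[OF abelian_group_qz] qz_Baer this]
  obtain f where f: "f \<in> Hom int_ring (Z_module G) (Z_module qz_group)" "\<forall>(m, y)\<in>\<Gamma>. f m = y"
    by blast
  show ?thesis
  proof (rule that[of f])
    show "character G f" using f(1) by (auto simp: character_def Hom_def)
  qed (use f(2) in auto)
qed

definition additive :: "('a, 'm) ring_scheme \<Rightarrow> ('b, 'n) ring_scheme \<Rightarrow> ('a \<Rightarrow> 'b) \<Rightarrow> bool" where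
  "additive P G u \<longleftrightarrow> u \<in> carrier P \<rightarrow> carrier G \<and>
     (\<forall>x\<in>carrier P. \<forall>y\<in>carrier P. u (x \<oplus>\<^bsub>P\<^esub> y) = u x \<oplus>\<^bsub>G\<^esub> u y)"

lemma additiveD:
  assumes "additive P G u"
  shows "x \<in> carrier P \<Longrightarrow> u x \<in> carrier G"
    "x \<in> carrier P \<Longrightarrow> y \<in> carrier P \<Longrightarrow> u (x \<oplus>\<^bsub>P\<^esub> y) = u x \<oplus>\<^bsub>G\<^esub> u y"
  using assms by (auto simp: additive_def)

lemma additive_zero:
  assumes "abelian_group P" "abelian_group G" "additive P G u" shows "u \<zero>\<^bsub>P\<^esub> = \<zero>\<^bsub>G\<^esub>"
proof -
  interpret P: abelian_group P by fact
  interpret G: abelian_group G by fact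
  show ?thesis
    using additiveD(2)[OF assms(3), of "\<zero>\<^bsub>P\<^esub>" "\<zero>\<^bsub>P\<^esub>"] additiveD(1)[OF assms(3), of "\<zero>\<^bsub>P\<^esub>"] by simp
qed

lemma additive_inv:
  assumes "abelian_group P" "abelian_group G" "additive P G u" "x \<in> carrier P"
  shows "u (\<ominus>\<^bsub>P\<^esub> x) = \<ominus>\<^bsub>G\<^esub> u x"
proof -
  interpret P: abelian_group P by fact
  interpret G: abelian_group G by fact
  have "u (\<ominus>\<^bsub>P\<^esub> x) \<oplus>\<^bsub>G\<^esub> u x = \<zero>\<^bsub>G\<^esub>"
    using additiveD(2)[OF assms(3), of "\<ominus>\<^bsub>P\<^esub> x" x] additive_zero[OF assms(1-3)] assms(4)
    by (simp add: P.l_neg)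
  then show ?thesis using additiveD(1)[OF assms(3)] assms(4) by (metis G.minus_equality P.a_inv_closed)
qed

lemma character_comp: "additive P G u \<Longrightarrow> character G \<chi> \<Longrightarrow> character P (\<lambda>x. \<chi> (u x))"
  by (simp add: character_def additive_def Pi_def)

text \<open>The tool by which characters are produced below: v descends to the image of u and
  extends from there to all of G.\<close>

lemma character_factor:
  assumes P: "abelian_group P" and G: "abelian_group G" and u: "additive P G u" and v: "character P v"
    and ker: "\<And>p. p \<in> carrier P \<Longrightarrow> u p = \<zero>\<^bsub>G\<^esub> \<Longrightarrow> v p = 0"
  obtains \<chi> where "character G \<chi>" "\<And>p. p \<in> carrier P \<Longrightarrow> \<chi> (u p) = v p"
proof -
  interpret P: abelian_group P by fact
  interpret G: abelian_group G by fact
  define \<Gamma> where "\<Gamma> = {(u p, v p) | p. p \<in> carrier P}"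
  have I: "(u p, v p) \<in> \<Gamma>" if "p \<in> carrier P" for p using that by (auto simp: \<Gamma>_def)
  show ?thesis
  proof (rule character_extend[OF G, of \<Gamma>])
    show "\<Gamma> \<subseteq> carrier G \<times> UNIV" using additiveD(1)[OF u] by (auto simp: \<Gamma>_def)
    show "(\<zero>\<^bsub>G\<^esub>, 0) \<in> \<Gamma>"
      using I[of "\<zero>\<^bsub>P\<^esub>"] by (simp add: additive_zero[OF P G u] character_zero[OF P v])
    fix x y assume "(x, y) \<in> \<Gamma>"
    then obtain p where p: "p \<in> carrier P" "x = u p" "y = v p" by (auto simp: \<Gamma>_def)
    show "(\<ominus>\<^bsub>G\<^esub> x, - y) \<in> \<Gamma>"
      using I[of "\<ominus>\<^bsub>P\<^esub> p"] p by (simp add: additive_inv[OF P G u] character_inv[OF P v])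
    fix x' y' assume "(x', y') \<in> \<Gamma>"
    then obtain p' where p': "p' \<in> carrier P" "x' = u p'" "y' = v p'" by (auto simp: \<Gamma>_def)
    show "(x \<oplus>\<^bsub>G\<^esub> x', y + y') \<in> \<Gamma>"
      using I[of "p \<oplus>\<^bsub>P\<^esub> p'"] p p' by (simp add: additiveD(2)[OF u] characterD[OF v])
  next
    fix y assume "(\<zero>\<^bsub>G\<^esub>, y) \<in> \<Gamma>"
    then show "y = 0" using ker by (auto simp: \<Gamma>_def)
  next
    fix \<chi> assume \<chi>: "character G \<chi>" "\<And>x y. (x, y) \<in> \<Gamma> \<Longrightarrow> \<chi> x = y"
    show thesis by (rule that[OF \<chi>(1)]) (use \<chi>(2) I in blast)
  qed
qed

text \<open>On the subgroup T + Zx one prescribes 0 on T and, at x, a nonzero value whose k-th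
  multiple vanishes whenever k x falls into T; the result extends to G.\<close>

lemma character_separates:
  assumes G: "abelian_group G" and T: "T \<subseteq> carrier G" "\<zero>\<^bsub>G\<^esub> \<in> T"
    "\<And>x y. x \<in> T \<Longrightarrow> y \<in> T \<Longrightarrow> x \<oplus>\<^bsub>G\<^esub> y \<in> T" "\<And>x. x \<in> T \<Longrightarrow> \<ominus>\<^bsub>G\<^esub> x \<in> T"
    and x: "x \<in> carrier G" "x \<notin> T"
  obtains \<chi> where "character G \<chi>" "\<And>t. t \<in> T \<Longrightarrow> \<chi> t = 0" "\<chi> x \<noteq> 0"
proof -
  interpret G: abelian_group G by fact
  interpret Q: abelian_group qz_group by (rule abelian_group_qz)
  define I where "I = {k :: int. [k] \<cdot>\<^bsub>G\<^esub> x \<in> T}"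
  have nat_mult: "[n] \<cdot>\<^bsub>G\<^esub> y \<in> T" if "y \<in> T" for n :: nat and y
    by (induction n) (use that T in auto)
  have int_mult: "[k] \<cdot>\<^bsub>G\<^esub> y \<in> T" if y: "y \<in> T" for k :: int and y
  proof (cases k)
    case (nonneg n)
    then show ?thesis using nat_mult[OF y, of n] by (simp add: add_pow_def int_pow_int)
  next
    case (neg n)
    have "[k] \<cdot>\<^bsub>G\<^esub> y = \<ominus>\<^bsub>G\<^esub> ([Suc n] \<cdot>\<^bsub>G\<^esub> y)"
      using G.add.int_pow_neg[of y "int (Suc n)"] neg y T(1)
      by (auto simp: add_pow_def int_pow_int simp del: nat_pow_Suc of_nat_Suc)
    then show ?thesis using T(4) nat_mult[OF y, of "Suc n"] by simp
  qed
  obtain n where n: "n \<in> I" "\<And>k. k \<in> I \<Longrightarrow> n dvd k"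
  proof (rule int_ideal_generator[of I])
    show "0 \<in> I" using T(2) x by (simp add: I_def)
    show "k + l \<in> I" if "k \<in> I" "l \<in> I" for k l
      using that T(3) x by (simp add: I_def G.add.int_pow_mult)
    show "k * l \<in> I" if "l \<in> I" for k l
      using int_mult[of "[l] \<cdot>\<^bsub>G\<^esub> x" k] that x by (simp add: I_def G.add.int_pow_pow mult.commute)
  qed auto
  have n1: "\<not> n dvd 1"
  proof
    assume "n dvd 1"
    then obtain k where "1 = k * n" by (metis dvd_def mult.commute)
    moreover have "[(k * n)] \<cdot>\<^bsub>G\<^esub> x \<in> T"
      using int_mult[of "[n] \<cdot>\<^bsub>G\<^esub> x" k] n(1) x by (simp add: I_def G.add.int_pow_pow mult.commute)
    ultimately show False using x by (metis G.add.int_pow_1)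
  qed
  \<comment> \<open>n generates the ideal I of those k with k x in T. For n = 0 there is no
    condition and 1/2 is just some non-integer; otherwise 1/n becomes an integer after
    multiplication by any member of I, but is none itself, as n does not divide 1.\<close>
  define e :: rat where "e = (if n = 0 then 1 / 2 else 1 / of_int n)"
  have e_int: "of_int k * e \<in> \<int>" if k: "k \<in> I" for k
  proof (cases "n = 0")
    case True
    then show ?thesis using n(2)[OF k] by simp
  next
    case False
    obtain q where "k = n * q" using n(2)[OF k] by (auto simp: dvd_def)
    then show ?thesis using False by (simp add: e_def)
  qed
  have e: "qz_of e \<noteq> 0"
  proof
    assume "qz_of e = 0"
    then have "e \<in> \<int>" by (simp add: qz_of_eq_0_iff)
    then obtain m where m: "e = of_int m" by (elim Ints_cases)
    show False
    proof (cases "n = 0")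
      case True
      then have "of_int (2 * m) = (of_int 1 :: rat)" using m by (simp add: e_def)
      then have "2 * m = 1" by (simp only: of_int_eq_iff)
      then show False by presburger
    next
      case False
      then have "of_int (n * m) = (of_int 1 :: rat)" using m by (simp add: e_def field_simps)
      then have "n * m = 1" by (simp only: of_int_eq_iff)
      then show False using n1 by (metis dvd_triv_left)
    qed
  qed
  define \<Gamma> where "\<Gamma> = {(t \<oplus>\<^bsub>G\<^esub> [k] \<cdot>\<^bsub>G\<^esub> x, qz_of (of_int k * e)) | t k. t \<in> T}"
  have \<Gamma>I: "(t \<oplus>\<^bsub>G\<^esub> [k] \<cdot>\<^bsub>G\<^esub> x, qz_of (of_int k * e)) \<in> \<Gamma>" if "t \<in> T" for t and k :: int
    using that by (auto simp: \<Gamma>_def)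
  have Tc: "t \<in> carrier G" if "t \<in> T" for t using T(1) that by blast
  show ?thesis
  proof (rule character_extend[OF G, of \<Gamma>])
    show "\<Gamma> \<subseteq> carrier G \<times> UNIV" using Tc x by (auto simp: \<Gamma>_def)
    show "(\<zero>\<^bsub>G\<^esub>, 0) \<in> \<Gamma>" using \<Gamma>I[OF T(2), of 0] x by simp
    fix a b assume "(a, b) \<in> \<Gamma>"
    then obtain t k where t: "t \<in> T" "a = t \<oplus>\<^bsub>G\<^esub> [k] \<cdot>\<^bsub>G\<^esub> x" "b = qz_of (of_int k * e)" by (auto simp: \<Gamma>_def)
    have "qz_of (of_int (- k) * e) + b = 0"
      unfolding t qz_of_add[symmetric] by simp
    then have "qz_of (of_int (- k) * e) = - b" by (simp add: eq_neg_iff_add_eq_0)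
    moreover have "\<ominus>\<^bsub>G\<^esub> t \<oplus>\<^bsub>G\<^esub> [(- k)] \<cdot>\<^bsub>G\<^esub> x = \<ominus>\<^bsub>G\<^esub> a"
      using t Tc x by (simp add: G.add.int_pow_neg G.minus_add G.a_comm)
    ultimately show "(\<ominus>\<^bsub>G\<^esub> a, - b) \<in> \<Gamma>" using \<Gamma>I[OF T(4)[OF t(1)], of "- k"] by simp
    fix a' b' assume "(a', b') \<in> \<Gamma>"
    then obtain t' k' where t': "t' \<in> T" "a' = t' \<oplus>\<^bsub>G\<^esub> [k'] \<cdot>\<^bsub>G\<^esub> x" "b' = qz_of (of_int k' * e)" by (auto simp: \<Gamma>_def)
    have "(t \<oplus>\<^bsub>G\<^esub> t') \<oplus>\<^bsub>G\<^esub> [(k + k')] \<cdot>\<^bsub>G\<^esub> x = a \<oplus>\<^bsub>G\<^esub> a'"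
      using t t' Tc x by (simp add: G.add.int_pow_mult G.a_ac)
    moreover have "qz_of (of_int (k + k') * e) = b + b'"
      using t t' by (simp add: qz_of_add distrib_right)
    ultimately show "(a \<oplus>\<^bsub>G\<^esub> a', b + b') \<in> \<Gamma>" using \<Gamma>I[OF T(3)[OF t(1) t'(1)], of "k + k'"] by simp
  next
    fix b assume "(\<zero>\<^bsub>G\<^esub>, b) \<in> \<Gamma>"
    then obtain t k where t: "t \<in> T" "\<zero>\<^bsub>G\<^esub> = t \<oplus>\<^bsub>G\<^esub> [k] \<cdot>\<^bsub>G\<^esub> x" "b = qz_of (of_int k * e)" by (auto simp: \<Gamma>_def)
    have "[k] \<cdot>\<^bsub>G\<^esub> x = \<ominus>\<^bsub>G\<^esub> t"
      using t(2) Tc[OF t(1)] x(1) G.minus_equality[of "[k] \<cdot>\<^bsub>G\<^esub> x" t] by (simp add: G.a_comm)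
    then have "k \<in> I" using T(4) t(1) by (simp add: I_def)
    then show "b = 0" using e_int t(3) by (simp add: qz_of_eq_0_iff)
  next
    fix \<chi> assume \<chi>: "character G \<chi>" "\<And>a b. (a, b) \<in> \<Gamma> \<Longrightarrow> \<chi> a = b"
    show thesis
    proof (rule that[OF \<chi>(1)])
      show "\<chi> t = 0" if "t \<in> T" for t using \<chi>(2)[OF \<Gamma>I[OF that, of 0]] Tc[OF that] x by simp
      show "\<chi> x \<noteq> 0" using \<chi>(2)[OF \<Gamma>I[OF T(2), of 1]] x e by simp
    qed
  qed
qed

lemma character_nonzero:
  assumes G: "abelian_group G" and x: "x \<in> carrier G" "x \<noteq> \<zero>\<^bsub>G\<^esub>"
  obtains \<chi> where "character G \<chi>" "\<chi> x \<noteq> 0"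
proof -
  interpret G: abelian_group G by fact
  show ?thesis
    by (rule character_separates[OF G, of "{\<zero>\<^bsub>G\<^esub>}" x]) (use x that in auto)
qed

lemma character_eqI:
  assumes G: "abelian_group G" and x: "x \<in> carrier G" "y \<in> carrier G"
    and eq: "\<And>\<chi>. character G \<chi> \<Longrightarrow> \<chi> x = \<chi> y"
  shows "x = y"
proof (rule ccontr)
  interpret G: abelian_group G by fact
  assume "x \<noteq> y"
  then have "x \<oplus>\<^bsub>G\<^esub> \<ominus>\<^bsub>G\<^esub> y \<noteq> \<zero>\<^bsub>G\<^esub>"
    using x by (metis G.a_inv_closed G.minus_equality G.minus_minus)
  then obtain \<chi> where \<chi>: "character G \<chi>" "\<chi> (x \<oplus>\<^bsub>G\<^esub> \<ominus>\<^bsub>G\<^esub> y) \<noteq> 0"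
    using character_nonzero[OF G, of "x \<oplus>\<^bsub>G\<^esub> \<ominus>\<^bsub>G\<^esub> y"] x by auto
  then show False
    using eq[OF \<chi>(1)] x characterD[OF \<chi>(1)] character_inv[OF G \<chi>(1)] by simp
qed

section \<open>Tensor products through balanced maps\<close>

text \<open>These pairings correspond to the characters of the tensor product, by
  \<open>balanced_lift\<close> and \<open>pure_balanced\<close>, and replace its elements in most
  arguments. As A is a right module, the third clause identifies (a r, b) with (a, r b).\<close>

definition balanced ::
  "'r ring \<Rightarrow> ('r, 'a) module \<Rightarrow> ('r, 'b) module \<Rightarrow> ('a \<Rightarrow> 'b \<Rightarrow> qz) \<Rightarrow> bool" where
  "balanced R A B \<beta> \<longleftrightarrow>
     (\<forall>a\<in>carrier A. \<forall>a'\<in>carrier A. \<forall>b\<in>carrier B. \<beta> (a \<oplus>\<^bsub>A\<^esub> a') b = \<beta> a b + \<beta> a' b) \<and>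
     (\<forall>a\<in>carrier A. \<forall>b\<in>carrier B. \<forall>b'\<in>carrier B. \<beta> a (b \<oplus>\<^bsub>B\<^esub> b') = \<beta> a b + \<beta> a b') \<and>
     (\<forall>r\<in>carrier R. \<forall>a\<in>carrier A. \<forall>b\<in>carrier B. \<beta> (r \<odot>\<^bsub>A\<^esub> a) b = \<beta> a (r \<odot>\<^bsub>B\<^esub> b))"

lemma balancedD:
  assumes "balanced R A B \<beta>"
  shows "a \<in> carrier A \<Longrightarrow> a' \<in> carrier A \<Longrightarrow> b \<in> carrier B \<Longrightarrow> \<beta> (a \<oplus>\<^bsub>A\<^esub> a') b = \<beta> a b + \<beta> a' b"
    "a \<in> carrier A \<Longrightarrow> b \<in> carrier B \<Longrightarrow> b' \<in> carrier B \<Longrightarrow> \<beta> a (b \<oplus>\<^bsub>B\<^esub> b') = \<beta> a b + \<beta> a b'"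
    "r \<in> carrier R \<Longrightarrow> a \<in> carrier A \<Longrightarrow> b \<in> carrier B \<Longrightarrow> \<beta> (r \<odot>\<^bsub>A\<^esub> a) b = \<beta> a (r \<odot>\<^bsub>B\<^esub> b)"
  using assms by (auto simp: balanced_def)

lemma balanced_character_left: "balanced R A B \<beta> \<Longrightarrow> b \<in> carrier B \<Longrightarrow> character A (\<lambda>a. \<beta> a b)"
  by (simp add: balanced_def character_def)

lemma balanced_character_right: "balanced R A B \<beta> \<Longrightarrow> a \<in> carrier A \<Longrightarrow> character B (\<beta> a)"
  by (simp add: balanced_def character_def)

text \<open>\<open>Hom\<close> without extensionality, so that lambda terms qualify as they stand;
  \<open>linear_restrict_Hom\<close> leads back.\<close>

definition linear :: "'r ring \<Rightarrow> ('r, 'a) module \<Rightarrow> ('r, 'b) module \<Rightarrow> ('a \<Rightarrow> 'b) \<Rightarrow> bool" where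
  "linear R M N f \<longleftrightarrow> additive M N f \<and>
     (\<forall>r\<in>carrier R. \<forall>x\<in>carrier M. f (r \<odot>\<^bsub>M\<^esub> x) = r \<odot>\<^bsub>N\<^esub> f x)"

lemma linearD:
  assumes "linear R M N f"
  shows "x \<in> carrier M \<Longrightarrow> f x \<in> carrier N"
    "x \<in> carrier M \<Longrightarrow> y \<in> carrier M \<Longrightarrow> f (x \<oplus>\<^bsub>M\<^esub> y) = f x \<oplus>\<^bsub>N\<^esub> f y"
    "r \<in> carrier R \<Longrightarrow> x \<in> carrier M \<Longrightarrow> f (r \<odot>\<^bsub>M\<^esub> x) = r \<odot>\<^bsub>N\<^esub> f x"
  using assms by (auto simp: linear_def additive_def)

lemma linearI:
  assumes "\<And>x. x \<in> carrier M \<Longrightarrow> f x \<in> carrier N"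
    "\<And>x y. x \<in> carrier M \<Longrightarrow> y \<in> carrier M \<Longrightarrow> f (x \<oplus>\<^bsub>M\<^esub> y) = f x \<oplus>\<^bsub>N\<^esub> f y"
    "\<And>r x. r \<in> carrier R \<Longrightarrow> x \<in> carrier M \<Longrightarrow> f (r \<odot>\<^bsub>M\<^esub> x) = r \<odot>\<^bsub>N\<^esub> f x"
  shows "linear R M N f"
  using assms by (auto simp: linear_def additive_def)

lemma linear_additive: "linear R M N f \<Longrightarrow> additive M N f"
  by (simp add: linear_def)

lemma Hom_linear: "f \<in> Hom R M N \<Longrightarrow> linear R M N f"
  by (auto simp: Hom_def linear_def additive_def)

lemma Hom_extensional: "f \<in> Hom R M N \<Longrightarrow> f \<in> extensional (carrier M)"
  by (auto simp: Hom_def PiE_def)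

lemma linear_Hom: "linear R M N f \<Longrightarrow> f \<in> extensional (carrier M) \<Longrightarrow> f \<in> Hom R M N"
  by (auto simp: Hom_def linear_def additive_def PiE_def)

lemma left_module_closed:
  assumes "left_module R M"
  shows "x \<in> carrier M \<Longrightarrow> y \<in> carrier M \<Longrightarrow> x \<oplus>\<^bsub>M\<^esub> y \<in> carrier M"
    "r \<in> carrier R \<Longrightarrow> x \<in> carrier M \<Longrightarrow> r \<odot>\<^bsub>M\<^esub> x \<in> carrier M" "\<zero>\<^bsub>M\<^esub> \<in> carrier M"
proof -
  interpret left_module R M by fact
  show "x \<in> carrier M \<Longrightarrow> y \<in> carrier M \<Longrightarrow> x \<oplus>\<^bsub>M\<^esub> y \<in> carrier M"
    "r \<in> carrier R \<Longrightarrow> x \<in> carrier M \<Longrightarrow> r \<odot>\<^bsub>M\<^esub> x \<in> carrier M" "\<zero>\<^bsub>M\<^esub> \<in> carrier M"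
    by (simp_all add: smult_closed)
qed

lemma left_module_abelian_group: "left_module R M \<Longrightarrow> abelian_group M"
  by (simp add: left_module_def)

lemma linear_restrict_Hom:
  assumes "left_module R M" "linear R M N f" shows "restrict f (carrier M) \<in> Hom R M N"
  using assms by (auto simp: Hom_def linear_def additive_def left_module_closed)

lemma linear_comp: "linear R M N f \<Longrightarrow> linear R N P g \<Longrightarrow> linear R M P (\<lambda>x. g (f x))"
  by (auto simp: linear_def additive_def Pi_def)

lemma linear_id: "linear R M M (\<lambda>x. x)"
  by (auto simp: linear_def additive_def)

lemma opp_simps [simp]:
  "carrier (opp R) = carrier R" "\<zero>\<^bsub>opp R\<^esub> = \<zero>\<^bsub>R\<^esub>" "\<one>\<^bsub>opp R\<^esub> = \<one>\<^bsub>R\<^esub>"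
  "x \<oplus>\<^bsub>opp R\<^esub> y = x \<oplus>\<^bsub>R\<^esub> y" "x \<otimes>\<^bsub>opp R\<^esub> y = y \<otimes>\<^bsub>R\<^esub> x" "opp (opp R) = R"
  by (simp_all add: opp_def)

lemma ring_opp: assumes "ring R" shows "ring (opp R)"
proof -
  interpret R: ring R by fact
  have "abelian_group (opp R)"
    by (rule abelian_groupI) (auto simp: R.a_ac)
  moreover have "monoid (opp R)" by (rule monoidI) (auto simp: R.m_assoc)
  ultimately show ?thesis by (rule ringI) (auto simp: R.l_distr R.r_distr)
qed

text \<open>The multiplicatively written group \<open>tensor R A B\<close> as an additive record, to
  which the lemmas on \<open>abelian_group\<close> and \<open>character\<close> apply.\<close>

definition tensor_group ::
  "'r ring \<Rightarrow> ('r, 'a) module \<Rightarrow> ('r, 'b) module \<Rightarrow> ('a \<times> 'b \<Rightarrow>\<^sub>0 int) set ring" where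
  "tensor_group R A B = \<lparr>carrier = carrier (tensor R A B), monoid.mult = undefined, one = undefined,
     ring.zero = \<one>\<^bsub>tensor R A B\<^esub>, ring.add = monoid.mult (tensor R A B)\<rparr>"

lemma tensor_group_simps [simp]:
  "carrier (tensor_group R A B) = carrier (tensor R A B)"
  "\<zero>\<^bsub>tensor_group R A B\<^esub> = \<one>\<^bsub>tensor R A B\<^esub>"
  "x \<oplus>\<^bsub>tensor_group R A B\<^esub> y = x \<otimes>\<^bsub>tensor R A B\<^esub> y"
  by (simp_all add: tensor_group_def)

text \<open>The elementary tensor of a and b.\<close>

definition tensor_pure ::
  "'r ring \<Rightarrow> ('r, 'a) module \<Rightarrow> ('r, 'b) module \<Rightarrow> 'a \<Rightarrow> 'b \<Rightarrow> ('a \<times> 'b \<Rightarrow>\<^sub>0 int) set" where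
  "tensor_pure R A B a b =
     tensor_sub R A B #>\<^bsub>free_Abelian_group (carrier A \<times> carrier B)\<^esub> frag_of (a, b)"

locale tensor_pair =
  fixes R :: "'r ring" and A :: "('r, 'a) module" and B :: "('r, 'b) module"
  assumes A: "left_module (opp R) A" and B: "left_module R B"
begin

abbreviation "FA \<equiv> free_Abelian_group (carrier A \<times> carrier B)"
abbreviation "coset c \<equiv> tensor_sub R A B #>\<^bsub>FA\<^esub> c"

lemmas closed = left_module_closed[OF A] left_module_closed[OF B]

lemma FA_diff: "x \<in> carrier FA \<Longrightarrow> y \<in> carrier FA \<Longrightarrow> x - y \<in> carrier FA"
  using keys_diff[of x y] by auto

lemma FA_add: "x \<in> carrier FA \<Longrightarrow> y \<in> carrier FA \<Longrightarrow> x + y \<in> carrier FA"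
  using keys_add[of x y] by auto

lemma rels_subset: "tensor_rels R A B \<subseteq> carrier FA"
proof
  fix c assume "c \<in> tensor_rels R A B"
  moreover have "x - y - z \<in> carrier FA" if "x \<in> carrier FA" "y \<in> carrier FA" "z \<in> carrier FA" for x y z
    by (intro FA_diff that)
  moreover have "x - y \<in> carrier FA" if "x \<in> carrier FA" "y \<in> carrier FA" for x y
    by (intro FA_diff that)
  moreover have "frag_of (a, b) \<in> carrier FA" if "a \<in> carrier A" "b \<in> carrier B" for a b
    using that by simp
  ultimately show "c \<in> carrier FA"
    using closed unfolding tensor_rels_def by (auto simp del: carrier_free_Abelian_group_iff)
qed

lemma subgroup_sub: "subgroup (tensor_sub R A B) FA"
  unfolding tensor_sub_def by (rule group.generate_is_subgroup[OF group_free_Abelian_group rels_subset])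

lemma normal_sub: "tensor_sub R A B \<lhd> FA"
  by (rule comm_group.subgroup_imp_normal[OF abelian_free_Abelian_group subgroup_sub])

lemma comm_group_tensor: "comm_group (tensor R A B)"
  unfolding tensor_def by (rule comm_group.abelian_FactGroup[OF abelian_free_Abelian_group subgroup_sub])

lemma abelian_group_tensor: "abelian_group (tensor_group R A B)"
proof -
  interpret T: comm_group "tensor R A B" by (rule comm_group_tensor)
  show ?thesis
    by (rule abelian_groupI) (auto simp: T.m_ac)
qed

lemma carrier_tensor: "carrier (tensor R A B) = coset ` carrier FA"
  by (simp add: tensor_def carrier_FactGroup)

lemma coset_hom: "coset \<in> hom FA (tensor R A B)"
  unfolding tensor_def by (rule normal.r_coset_hom_Mod[OF normal_sub])

lemma coset_add:
  assumes "x \<in> carrier FA" "y \<in> carrier FA"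
  shows "coset (x + y) = coset x \<otimes>\<^bsub>tensor R A B\<^esub> coset y"
  using hom_mult[OF coset_hom assms] by simp

lemma coset_diff:
  assumes "x \<in> carrier FA" "y \<in> carrier FA"
  shows "coset (x - y) = coset x \<otimes>\<^bsub>tensor R A B\<^esub> inv\<^bsub>tensor R A B\<^esub> coset y"
proof -
  have "group_hom FA (tensor R A B) coset"
    by (intro group_hom.intro group_hom_axioms.intro coset_hom comm_group.axioms(2)[OF comm_group_tensor] group_free_Abelian_group)
  from group_hom.hom_inv[OF this assms(2)] assms(2)
  have "coset (- y) = inv\<^bsub>tensor R A B\<^esub> coset y" by simp
  moreover have "- y \<in> carrier FA" using assms by simp
  ultimately show ?thesis using coset_add[OF assms(1), of "- y"] by simp
qed

lemma coset_sub_zero: "x \<in> tensor_sub R A B \<Longrightarrow> coset x = \<one>\<^bsub>tensor R A B\<^esub>"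
  using subgroup.rcos_const[OF subgroup_sub group_free_Abelian_group] by (simp add: tensor_def)

lemma coset_eqI:
  assumes "x \<in> carrier FA" "y \<in> carrier FA" "x - y \<in> tensor_sub R A B" shows "coset x = coset y"
proof -
  interpret T: comm_group "tensor R A B" by (rule comm_group_tensor)
  have c: "coset x \<in> carrier (tensor R A B)" "coset y \<in> carrier (tensor R A B)"
    using assms carrier_tensor by blast+
  have "coset x \<otimes>\<^bsub>tensor R A B\<^esub> inv\<^bsub>tensor R A B\<^esub> coset y = \<one>\<^bsub>tensor R A B\<^esub>"
    using coset_diff[OF assms(1,2)] coset_sub_zero[OF assms(3)] by simp
  then show ?thesis using c by (metis T.inv_equality T.inv_inv T.inv_closed)
qed

lemma coset_eqD:
  assumes "x \<in> carrier FA" "y \<in> carrier FA" "coset x = coset y" shows "x - y \<in> tensor_sub R A B"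
proof -
  have "x \<in> coset y"
    using group.rcos_self[OF group_free_Abelian_group assms(1) subgroup_sub] assms(3) by simp
  then show ?thesis by (auto simp: r_coset_def)
qed

lemma pure_closed: "a \<in> carrier A \<Longrightarrow> b \<in> carrier B \<Longrightarrow> tensor_pure R A B a b \<in> carrier (tensor R A B)"
  unfolding carrier_tensor tensor_pure_def by (rule imageI) simp

lemma rels_sub: "x \<in> tensor_rels R A B \<Longrightarrow> x \<in> tensor_sub R A B"
  unfolding tensor_sub_def by (rule generate.incl)

lemma pure_eqI3:
  assumes "frag_of p - frag_of q - frag_of s \<in> tensor_rels R A B"
    "p \<in> carrier A \<times> carrier B" "q \<in> carrier A \<times> carrier B" "s \<in> carrier A \<times> carrier B"
  shows "coset (frag_of p) = coset (frag_of q) \<otimes>\<^bsub>tensor R A B\<^esub> coset (frag_of s)"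
proof -
  have "coset (frag_of p) = coset (frag_of q + frag_of s)"
  proof (rule coset_eqI)
    show "frag_of q + frag_of s \<in> carrier FA"
      using assms(3,4) by (intro FA_add) simp_all
    show "frag_of p - (frag_of q + frag_of s) \<in> tensor_sub R A B"
      using rels_sub[OF assms(1)] by (simp add: diff_diff_eq)
  qed (use assms(2) in simp)
  then show ?thesis using coset_add assms(3,4) by simp
qed

lemma pure_add_left:
  assumes "a \<in> carrier A" "a' \<in> carrier A" "b \<in> carrier B"
  shows "tensor_pure R A B (a \<oplus>\<^bsub>A\<^esub> a') b = tensor_pure R A B a b \<otimes>\<^bsub>tensor R A B\<^esub> tensor_pure R A B a' b"
  unfolding tensor_pure_def
  by (rule pure_eqI3) (use assms closed in \<open>auto simp: tensor_rels_def\<close>)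

lemma pure_add_right:
  assumes "a \<in> carrier A" "b \<in> carrier B" "b' \<in> carrier B"
  shows "tensor_pure R A B a (b \<oplus>\<^bsub>B\<^esub> b') = tensor_pure R A B a b \<otimes>\<^bsub>tensor R A B\<^esub> tensor_pure R A B a b'"
  unfolding tensor_pure_def
  by (rule pure_eqI3) (use assms closed in \<open>auto simp: tensor_rels_def\<close>)

lemma pure_smult:
  assumes "r \<in> carrier R" "a \<in> carrier A" "b \<in> carrier B"
  shows "tensor_pure R A B (r \<odot>\<^bsub>A\<^esub> a) b = tensor_pure R A B a (r \<odot>\<^bsub>B\<^esub> b)"
  unfolding tensor_pure_def
  by (rule coset_eqI) (use assms closed in \<open>auto simp: tensor_rels_def intro!: rels_sub\<close>)

lemma pure_inv:
  assumes "a \<in> carrier A" "b \<in> carrier B"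
  shows "tensor_pure R A B (\<ominus>\<^bsub>A\<^esub> a) b = inv\<^bsub>tensor R A B\<^esub> tensor_pure R A B a b"
proof -
  interpret T: comm_group "tensor R A B" by (rule comm_group_tensor)
  interpret A: left_module "opp R" A by (rule A)
  have "additive A (tensor_group R A B) (\<lambda>a. tensor_pure R A B a b)"
    using assms(2) by (auto simp: additive_def pure_closed pure_add_left)
  from additive_inv[OF A.M.abelian_group_axioms abelian_group_tensor this assms(1)]
    additive_zero[OF A.M.abelian_group_axioms abelian_group_tensor this]
  show ?thesis
    using pure_add_left[of "\<ominus>\<^bsub>A\<^esub> a" a b] assms pure_closed A.M.l_neg T.inv_equality[symmetric]
    by (metis A.M.a_inv_closed tensor_group_simps(2))
qed

text \<open>Inverses need no case of their own because the inverse of an elementary tensor is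
  elementary again. The induction over the free abelian group has a subtraction step, so P is
  carried for an element together with its inverse.\<close>

lemma tensor_induct [consumes 1, case_names zero pure add]:
  assumes t: "t \<in> carrier (tensor R A B)" and zero: "P \<one>\<^bsub>tensor R A B\<^esub>"
    and pure: "\<And>a b. a \<in> carrier A \<Longrightarrow> b \<in> carrier B \<Longrightarrow> P (tensor_pure R A B a b)"
    and add: "\<And>x y. x \<in> carrier (tensor R A B) \<Longrightarrow> y \<in> carrier (tensor R A B) \<Longrightarrow> P x \<Longrightarrow> P y
       \<Longrightarrow> P (x \<otimes>\<^bsub>tensor R A B\<^esub> y)"
  shows "P t"
proof -
  interpret T: comm_group "tensor R A B" by (rule comm_group_tensor)
  obtain c where c: "c \<in> carrier FA" "t = coset c" using t carrier_tensor by blast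
  have keys: "Poly_Mapping.keys c \<subseteq> carrier A \<times> carrier B" using c(1) by simp
  have "P (coset c) \<and> P (inv\<^bsub>tensor R A B\<^esub> coset c)"
  proof (rule free_Abelian_group_induct[OF keys])
    have "0 \<in> tensor_sub R A B" using subgroup.one_closed[OF subgroup_sub] by simp
    then show "P (coset 0) \<and> P (inv\<^bsub>tensor R A B\<^esub> coset 0)" using zero coset_sub_zero by simp
  next
    fix x y assume "Poly_Mapping.keys x \<subseteq> carrier A \<times> carrier B" "Poly_Mapping.keys y \<subseteq> carrier A \<times> carrier B"
      and IH: "P (coset x) \<and> P (inv\<^bsub>tensor R A B\<^esub> coset x)" "P (coset y) \<and> P (inv\<^bsub>tensor R A B\<^esub> coset y)"
    then have xy: "x \<in> carrier FA" "y \<in> carrier FA" by auto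
    then have "coset x \<in> carrier (tensor R A B)" "coset y \<in> carrier (tensor R A B)"
      unfolding carrier_tensor by blast+
    then show "P (coset (x - y)) \<and> P (inv\<^bsub>tensor R A B\<^esub> coset (x - y))"
      using IH add[of "coset x" "inv\<^bsub>tensor R A B\<^esub> coset y"] add[of "inv\<^bsub>tensor R A B\<^esub> coset x" "coset y"]
      by (simp add: coset_diff[OF xy] T.inv_mult)
  next
    fix p assume "p \<in> carrier A \<times> carrier B"
    then obtain a b where p: "p = (a, b)" "a \<in> carrier A" "b \<in> carrier B" by auto
    interpret A: left_module "opp R" A by (rule A)
    show "P (coset (frag_of p)) \<and> P (inv\<^bsub>tensor R A B\<^esub> coset (frag_of p))"
      using pure[OF p(2,3)] pure[of "\<ominus>\<^bsub>A\<^esub> a" b] p pure_inv[OF p(2,3)] by (simp add: tensor_pure_def)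
  qed
  then show ?thesis using c by simp
qed

lemma generate_hom_trivial:
  assumes h: "h \<in> hom FA H" and H: "group H" and rels: "\<And>x. x \<in> tensor_rels R A B \<Longrightarrow> h x = \<one>\<^bsub>H\<^esub>"
    and x: "x \<in> tensor_sub R A B"
  shows "h x = \<one>\<^bsub>H\<^esub>"
proof -
  interpret H: group H by fact
  interpret F: group FA by simp
  interpret h: group_hom FA H h by (intro group_hom.intro group_hom_axioms.intro h H F.is_group)
  from x have "x \<in> carrier FA \<and> h x = \<one>\<^bsub>H\<^esub>"
    unfolding tensor_sub_def
  proof (induction rule: generate.induct)
    case one
    then show ?case using h.hom_one by simp
  next
    case (incl x)
    then show ?case using rels rels_subset by blast
  next
    case (inv x)
    then have "x \<in> carrier FA" "h x = \<one>\<^bsub>H\<^esub>" using rels rels_subset by blast+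
    then show ?case using h.hom_inv[of x] F.inv_closed[of x] by simp
  next
    case (eng x y)
    then show ?case using h.hom_mult[of x y] F.m_closed[of x y] by simp
  qed
  then show ?thesis by blast
qed

text \<open>A homomorphism that kills the relations kills the subgroup they generate, hence is
  constant on its cosets.\<close>

lemma hom_lift:
  assumes h: "h \<in> hom FA H" and H: "group H" and rels: "\<And>x. x \<in> tensor_rels R A B \<Longrightarrow> h x = \<one>\<^bsub>H\<^esub>"
    and xy: "x \<in> carrier FA" "y \<in> carrier FA" "coset x = coset y"
  shows "h x = h y"
proof -
  interpret H: group H by fact
  interpret F: group FA by simp
  interpret h: group_hom FA H h by (intro group_hom.intro group_hom_axioms.intro h H F.is_group)
  have "h (x - y) = \<one>\<^bsub>H\<^esub>" by (rule generate_hom_trivial[OF h H rels coset_eqD[OF xy]])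
  moreover have "x - y = x \<otimes>\<^bsub>FA\<^esub> inv\<^bsub>FA\<^esub> y" using xy by simp
  ultimately have "h x \<otimes>\<^bsub>H\<^esub> inv\<^bsub>H\<^esub> h y = \<one>\<^bsub>H\<^esub>" using xy h.hom_mult h.hom_inv by (metis F.inv_closed)
  then show ?thesis using xy h.hom_closed by (metis H.inv_closed H.inv_equality H.inv_inv)
qed

text \<open>Universal property of the tensor product for the target Q/Z: the pairing extends freely
  from pairs to the free abelian group, and being balanced means vanishing on the relations.\<close>

lemma balanced_lift:
  assumes \<beta>: "balanced R A B \<beta>"
  obtains \<chi> where "character (tensor_group R A B) \<chi>"
    "\<And>a b. a \<in> carrier A \<Longrightarrow> b \<in> carrier B \<Longrightarrow> \<chi> (tensor_pure R A B a b) = \<beta> a b"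
proof -
  interpret Q: abelian_group qz_group by (rule abelian_group_qz)
  let ?Q = "add_monoid qz_group"
  obtain h where h: "h \<in> hom FA ?Q"
    "\<And>p. p \<in> carrier A \<times> carrier B \<Longrightarrow> h (frag_of p) = (case p of (a, b) \<Rightarrow> \<beta> a b)"
    by (rule comm_group.free_Abelian_group_universal[OF Q.a_comm_group, of "\<lambda>(a, b). \<beta> a b"]) auto
  have add: "h (x + y) = h x + h y" if "x \<in> carrier FA" "y \<in> carrier FA" for x y
    using hom_mult[OF h(1) that] by simp
  have diff: "h (x - y) = h x - h y" if "x \<in> carrier FA" "y \<in> carrier FA" for x y
  proof -
    have "x - y \<in> carrier FA"
      by (intro FA_diff that)
    then show ?thesis using add[of "x - y" y] that by simp
  qed
  have diff3: "h (x - y - z) = h x - h y - h z" if "x \<in> carrier FA" "y \<in> carrier FA" "z \<in> carrier FA" for x y z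
  proof -
    have "x - y \<in> carrier FA"
      by (intro FA_diff that)
    then show ?thesis using diff[of "x - y" z] diff[of x y] that by simp
  qed
  have rels: "h x = \<one>\<^bsub>?Q\<^esub>" if "x \<in> tensor_rels R A B" for x
    using that closed unfolding tensor_rels_def
    by (auto simp: diff diff3 h(2) balancedD[OF \<beta>])
  have indep: "h x = h y" if "x \<in> carrier FA" "y \<in> carrier FA" "coset x = coset y" for x y
    by (rule hom_lift[OF h(1) Q.a_group rels that])
  obtain g where g: "g \<in> hom (tensor R A B) ?Q" "\<And>x. x \<in> carrier FA \<Longrightarrow> g (coset x) = h x"
    using FactGroup_universal[OF h(1) normal_sub indep] unfolding tensor_def by metis
  show ?thesis
  proof (rule that[of g])
    show "character (tensor_group R A B) g"
      using g(1) by (auto simp: character_def hom_def)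
    show "g (tensor_pure R A B a b) = \<beta> a b" if "a \<in> carrier A" "b \<in> carrier B" for a b
      unfolding tensor_pure_def using g(2) h(2) that by simp
  qed
qed

lemma pure_balanced:
  assumes "character (tensor_group R A B) \<chi>"
  shows "balanced R A B (\<lambda>a b. \<chi> (tensor_pure R A B a b))"
  unfolding balanced_def using closed pure_closed characterD[OF assms]
  by (auto simp: pure_add_left pure_add_right pure_smult)

lemma additive_eqI:
  assumes G: "abelian_group G" and f: "additive (tensor_group R A B) G f" and g: "additive (tensor_group R A B) G g"
    and eq: "\<And>a b. a \<in> carrier A \<Longrightarrow> b \<in> carrier B \<Longrightarrow> f (tensor_pure R A B a b) = g (tensor_pure R A B a b)"
    and t: "t \<in> carrier (tensor R A B)"
  shows "f t = g t"
  using t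
proof (induction t rule: tensor_induct)
  case zero
  then show ?case
    using additive_zero[OF abelian_group_tensor G f] additive_zero[OF abelian_group_tensor G g] by simp
next
  case (pure a b) then show ?case by (rule eq)
next
  case (add x y)
  then show ?case using additiveD(2)[OF f, of x y] additiveD(2)[OF g, of x y] by simp
qed

lemma character_tensor_eqI:
  assumes f: "character (tensor_group R A B) f" and g: "character (tensor_group R A B) g"
    and eq: "\<And>a b. a \<in> carrier A \<Longrightarrow> b \<in> carrier B \<Longrightarrow> f (tensor_pure R A B a b) = g (tensor_pure R A B a b)"
    and t: "t \<in> carrier (tensor R A B)"
  shows "f t = g t"
proof (rule additive_eqI[OF abelian_group_qz _ _ _ t])
  show "additive (tensor_group R A B) qz_group f" "additive (tensor_group R A B) qz_group g"
    using f g by (auto simp: additive_def character_def)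
qed (rule eq)

end

text \<open>Relations are sent to relations, so the cosets in the union that defines
  \<open>tensor_map\<close> all coincide and the map is induced by the one on free abelian
  groups.\<close>

lemma tensor_map_pure_additive:
  assumes A: "left_module (opp R) A" and B: "left_module R B"
    and A': "left_module (opp R) A'" and B': "left_module R B'"
    and f: "linear (opp R) A A' f" and g: "linear R B B' g"
  shows "additive (tensor_group R A B) (tensor_group R A' B') (tensor_map R A B A' B' f g)"
    "\<And>a b. a \<in> carrier A \<Longrightarrow> b \<in> carrier B \<Longrightarrow>
       tensor_map R A B A' B' f g (tensor_pure R A B a b) = tensor_pure R A' B' (f a) (g b)"
proof -
  interpret T: tensor_pair R A B by (rule tensor_pair.intro[OF A B])
  interpret T': tensor_pair R A' B' by (rule tensor_pair.intro[OF A' B'])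
  let ?e = "frag_extend (\<lambda>(a, b). frag_of (f a, g b))"
  have e_closed: "?e x \<in> carrier T'.FA" if "x \<in> carrier T.FA" for x
  proof -
    have "Poly_Mapping.keys (?e x) \<subseteq> (\<Union>p\<in>Poly_Mapping.keys x. Poly_Mapping.keys (case p of (a, b) \<Rightarrow> frag_of (f a, g b)))"
      by (rule keys_frag_extend)
    also have "\<dots> \<subseteq> carrier A' \<times> carrier B'"
      using that linearD(1)[OF f] linearD(1)[OF g] by fastforce
    finally show ?thesis by simp
  qed
  define h where "h = (\<lambda>x. T'.coset (?e x))"
  have h: "h \<in> hom T.FA (tensor R A' B')"
  proof (rule homI)
    show "h x \<in> carrier (tensor R A' B')" if "x \<in> carrier T.FA" for x
      using e_closed[OF that] by (auto simp: h_def T'.carrier_tensor)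
    show "h (x \<otimes>\<^bsub>T.FA\<^esub> y) = h x \<otimes>\<^bsub>tensor R A' B'\<^esub> h y" if "x \<in> carrier T.FA" "y \<in> carrier T.FA" for x y
      using T'.coset_add[OF e_closed[OF that(1)] e_closed[OF that(2)]] by (simp add: h_def frag_extend_add)
  qed
  have rels: "h x = \<one>\<^bsub>tensor R A' B'\<^esub>" if "x \<in> tensor_rels R A B" for x
  proof -
    have "?e x \<in> tensor_rels R A' B'"
      using that unfolding tensor_rels_def
    proof (elim UnE CollectE exE conjE)
      fix a a' b assume "x = frag_of (a \<oplus>\<^bsub>A\<^esub> a', b) - frag_of (a, b) - frag_of (a', b)"
        "a \<in> carrier A" "a' \<in> carrier A" "b \<in> carrier B"
      then have "?e x = frag_of (f a \<oplus>\<^bsub>A'\<^esub> f a', g b) - frag_of (f a, g b) - frag_of (f a', g b)"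
        "f a \<in> carrier A'" "f a' \<in> carrier A'" "g b \<in> carrier B'"
        using linearD[OF f] linearD[OF g] by (simp_all add: frag_extend_diff)
      then show "?e x \<in> {frag_of (a \<oplus>\<^bsub>A'\<^esub> a', b) - frag_of (a, b) - frag_of (a', b) | a a' b.
          a \<in> carrier A' \<and> a' \<in> carrier A' \<and> b \<in> carrier B'} \<union>
        {frag_of (a, b \<oplus>\<^bsub>B'\<^esub> b') - frag_of (a, b) - frag_of (a, b') | a b b'.
          a \<in> carrier A' \<and> b \<in> carrier B' \<and> b' \<in> carrier B'} \<union>
        {frag_of (r \<odot>\<^bsub>A'\<^esub> a, b) - frag_of (a, r \<odot>\<^bsub>B'\<^esub> b) | r a b.
          r \<in> carrier R \<and> a \<in> carrier A' \<and> b \<in> carrier B'}" by blast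
    next
      fix a b b' assume "x = frag_of (a, b \<oplus>\<^bsub>B\<^esub> b') - frag_of (a, b) - frag_of (a, b')"
        "a \<in> carrier A" "b \<in> carrier B" "b' \<in> carrier B"
      then have "?e x = frag_of (f a, g b \<oplus>\<^bsub>B'\<^esub> g b') - frag_of (f a, g b) - frag_of (f a, g b')"
        "f a \<in> carrier A'" "g b \<in> carrier B'" "g b' \<in> carrier B'"
        using linearD[OF f] linearD[OF g] by (simp_all add: frag_extend_diff)
      then show "?e x \<in> {frag_of (a \<oplus>\<^bsub>A'\<^esub> a', b) - frag_of (a, b) - frag_of (a', b) | a a' b.
          a \<in> carrier A' \<and> a' \<in> carrier A' \<and> b \<in> carrier B'} \<union>
        {frag_of (a, b \<oplus>\<^bsub>B'\<^esub> b') - frag_of (a, b) - frag_of (a, b') | a b b'.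
          a \<in> carrier A' \<and> b \<in> carrier B' \<and> b' \<in> carrier B'} \<union>
        {frag_of (r \<odot>\<^bsub>A'\<^esub> a, b) - frag_of (a, r \<odot>\<^bsub>B'\<^esub> b) | r a b.
          r \<in> carrier R \<and> a \<in> carrier A' \<and> b \<in> carrier B'}" by blast
    next
      fix r a b assume *: "x = frag_of (r \<odot>\<^bsub>A\<^esub> a, b) - frag_of (a, r \<odot>\<^bsub>B\<^esub> b)"
        "r \<in> carrier R" "a \<in> carrier A" "b \<in> carrier B"
      then have "?e x = frag_of (r \<odot>\<^bsub>A'\<^esub> f a, g b) - frag_of (f a, r \<odot>\<^bsub>B'\<^esub> g b)"
        "f a \<in> carrier A'" "g b \<in> carrier B'"
        using linearD[OF f] linearD[OF g] by (simp_all add: frag_extend_diff)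
      then show "?e x \<in> {frag_of (a \<oplus>\<^bsub>A'\<^esub> a', b) - frag_of (a, b) - frag_of (a', b) | a a' b.
          a \<in> carrier A' \<and> a' \<in> carrier A' \<and> b \<in> carrier B'} \<union>
        {frag_of (a, b \<oplus>\<^bsub>B'\<^esub> b') - frag_of (a, b) - frag_of (a, b') | a b b'.
          a \<in> carrier A' \<and> b \<in> carrier B' \<and> b' \<in> carrier B'} \<union>
        {frag_of (r \<odot>\<^bsub>A'\<^esub> a, b) - frag_of (a, r \<odot>\<^bsub>B'\<^esub> b) | r a b.
          r \<in> carrier R \<and> a \<in> carrier A' \<and> b \<in> carrier B'}" using *(2) by blast
    qed
    then show ?thesis unfolding h_def by (intro T'.coset_sub_zero T'.rels_sub)
  qed
  have val: "tensor_map R A B A' B' f g (T.coset x) = h x" if x: "x \<in> carrier T.FA" for x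
  proof -
    have hy: "h y = h x" if y: "y \<in> T.coset x" for y
    proof -
      have "T.coset x \<subseteq> carrier T.FA"
        by (rule monoid.r_coset_subset_G[OF group.is_monoid[OF group_free_Abelian_group] subgroup.subset[OF T.subgroup_sub] x])
      then have yc: "y \<in> carrier T.FA" using y by (rule subsetD)
      have eq: "T.coset y = T.coset x"
        using group.repr_independence[OF group_free_Abelian_group y x T.subgroup_sub] by simp
      show ?thesis
        by (rule T.hom_lift[OF h comm_group.axioms(2)[OF T'.comm_group_tensor] rels yc x eq])
    qed
    have "x \<in> T.coset x" by (rule group.rcos_self[OF group_free_Abelian_group x T.subgroup_sub])
    then have "(\<Union>y\<in>T.coset x. h y) = h x" using hy by (intro SUP_eq_const) blast+
    moreover have "T.coset x \<in> carrier (tensor R A B)" using x unfolding T.carrier_tensor by (rule imageI)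
    ultimately show ?thesis unfolding tensor_map_def h_def by simp
  qed
  show "additive (tensor_group R A B) (tensor_group R A' B') (tensor_map R A B A' B' f g)"
    unfolding additive_def
  proof (intro conjI ballI funcsetI)
    fix s assume "s \<in> carrier (tensor_group R A B)"
    then obtain x where x: "x \<in> carrier T.FA" "s = T.coset x" using T.carrier_tensor by auto
    then show "tensor_map R A B A' B' f g s \<in> carrier (tensor_group R A' B')"
      using hom_in_carrier[OF h] val by simp
    fix t assume "t \<in> carrier (tensor_group R A B)"
    then obtain y where y: "y \<in> carrier T.FA" "t = T.coset y" using T.carrier_tensor by auto
    have xy: "x + y \<in> carrier T.FA"
      by (intro T.FA_add x y)
    then show "tensor_map R A B A' B' f g (s \<oplus>\<^bsub>tensor_group R A B\<^esub> t) =
      tensor_map R A B A' B' f g s \<oplus>\<^bsub>tensor_group R A' B'\<^esub> tensor_map R A B A' B' f g t"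
      using x y val hom_mult[OF h x(1) y(1)] T.coset_add[OF x(1) y(1)] by (simp flip: T.coset_add)
  qed
  show "tensor_map R A B A' B' f g (tensor_pure R A B a b) = tensor_pure R A' B' (f a) (g b)"
    if "a \<in> carrier A" "b \<in> carrier B" for a b
    using val[of "frag_of (a, b)"] that by (simp add: tensor_pure_def h_def)
qed

text \<open>Q/Z is an injective cogenerator, so a homomorphism of abelian groups is injective
  exactly if every character of its source extends along it; and characters of tensor products are
  balanced maps.\<close>

lemma tensor_map_injective_iff:
  assumes A: "left_module (opp R) A" and B: "left_module R B"
    and A': "left_module (opp R) A'" and B': "left_module R B'"
    and f: "linear (opp R) A A' f" and g: "linear R B B' g"
  shows "inj_on (tensor_map R A B A' B' f g) (carrier (tensor R A B)) \<longleftrightarrow>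
    (\<forall>\<beta>. balanced R A B \<beta> \<longrightarrow>
      (\<exists>\<beta>'. balanced R A' B' \<beta>' \<and> (\<forall>a\<in>carrier A. \<forall>b\<in>carrier B. \<beta>' (f a) (g b) = \<beta> a b)))"
    (is "?inj \<longleftrightarrow> ?ext")
proof -
  interpret T: tensor_pair R A B by (rule tensor_pair.intro[OF A B])
  interpret T': tensor_pair R A' B' by (rule tensor_pair.intro[OF A' B'])
  interpret G: abelian_group "tensor_group R A B" by (rule T.abelian_group_tensor)
  interpret G': abelian_group "tensor_group R A' B'" by (rule T'.abelian_group_tensor)
  let ?u = "tensor_map R A B A' B' f g"
  note u = tensor_map_pure_additive[OF A B A' B' f g]
  note u0 = additive_zero[OF T.abelian_group_tensor T'.abelian_group_tensor u(1)]
  show ?thesis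
  proof
    assume inj: ?inj
    show ?ext
    proof (intro allI impI)
      fix \<beta> assume "balanced R A B \<beta>"
      then obtain \<chi> where \<chi>: "character (tensor_group R A B) \<chi>"
        "\<And>a b. a \<in> carrier A \<Longrightarrow> b \<in> carrier B \<Longrightarrow> \<chi> (tensor_pure R A B a b) = \<beta> a b"
        by (rule T.balanced_lift) blast
      have ker: "\<chi> p = 0" if "p \<in> carrier (tensor_group R A B)" "?u p = \<zero>\<^bsub>tensor_group R A' B'\<^esub>" for p
      proof -
        have "p = \<zero>\<^bsub>tensor_group R A B\<^esub>"
          using inj_onD[OF inj, of p "\<zero>\<^bsub>tensor_group R A B\<^esub>"] that u0 G.zero_closed
          by (simp del: tensor_group_simps(2) add: tensor_group_simps(2)[symmetric])
        then show ?thesis using character_zero[OF T.abelian_group_tensor \<chi>(1)] by simp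
      qed
      obtain \<chi>' where \<chi>': "character (tensor_group R A' B') \<chi>'"
        "\<And>p. p \<in> carrier (tensor_group R A B) \<Longrightarrow> \<chi>' (?u p) = \<chi> p"
        by (rule character_factor[OF T.abelian_group_tensor T'.abelian_group_tensor u(1) \<chi>(1) ker]) auto
      show "\<exists>\<beta>'. balanced R A' B' \<beta>' \<and> (\<forall>a\<in>carrier A. \<forall>b\<in>carrier B. \<beta>' (f a) (g b) = \<beta> a b)"
        by (rule exI[of _ "\<lambda>a b. \<chi>' (tensor_pure R A' B' a b)"])
          (use T'.pure_balanced[OF \<chi>'(1)] \<chi>(2) \<chi>'(2) T.pure_closed u(2)[symmetric] in simp)
    qed
  next
    assume ext: ?ext
    show ?inj
    proof (rule inj_onI)
      fix s t assume st: "s \<in> carrier (tensor R A B)" "t \<in> carrier (tensor R A B)" "?u s = ?u t"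
      show "s = t"
      proof (rule character_eqI[OF T.abelian_group_tensor])
        fix \<chi> assume \<chi>: "character (tensor_group R A B) \<chi>"
        obtain \<beta>' where \<beta>': "balanced R A' B' \<beta>'"
          "\<And>a b. a \<in> carrier A \<Longrightarrow> b \<in> carrier B \<Longrightarrow> \<beta>' (f a) (g b) = \<chi> (tensor_pure R A B a b)"
          using ext T.pure_balanced[OF \<chi>] by blast
        obtain \<chi>' where \<chi>': "character (tensor_group R A' B') \<chi>'"
          "\<And>a b. a \<in> carrier A' \<Longrightarrow> b \<in> carrier B' \<Longrightarrow> \<chi>' (tensor_pure R A' B' a b) = \<beta>' a b"
          by (rule T'.balanced_lift[OF \<beta>'(1)]) blast
        have "\<chi>' (?u r) = \<chi> r" if "r \<in> carrier (tensor R A B)" for r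
          by (rule T.character_tensor_eqI[OF character_comp[OF u(1) \<chi>'(1)] \<chi> _ that])
            (simp add: u(2) \<chi>'(2) \<beta>'(2) linearD(1)[OF f] linearD(1)[OF g])
        then show "\<chi> s = \<chi> t" using st by metis
      qed (use st in simp_all)
    qed
  qed
qed

section \<open>Small sets and transport of modules\<close>

text \<open>Smallness for sets of any type: \<open>small\<close> speaks of subsets of the universe
  type only, whereas function spaces and character modules live in other types.\<close>

definition small_sized :: "'u itself \<Rightarrow> 'b set \<Rightarrow> bool" where
  "small_sized _ X \<longleftrightarrow> (\<exists>A :: 'u set. small A \<and> X \<lesssim> A)"

lemma small_lepoll: "small (B :: 'u set) \<Longrightarrow> A \<lesssim> B \<Longrightarrow> small (A :: 'u set)"
  unfolding small_def by (rule lesspoll_trans1)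

lemma small_sizedI: "small A \<Longrightarrow> small_sized (U :: 'u itself) (A :: 'u set)"
  unfolding small_sized_def by blast

lemma small_sized_lepoll: "small_sized U Y \<Longrightarrow> X \<lesssim> Y \<Longrightarrow> small_sized U X"
  unfolding small_sized_def using lepoll_trans[of X Y] by blast

lemma small_sized_subset: "small_sized U Y \<Longrightarrow> X \<subseteq> Y \<Longrightarrow> small_sized U X"
  by (rule small_sized_lepoll[OF _ subset_imp_lepoll])

text \<open>Brings modules built from functions or pairs back to carriers in \<open>'u\<close>, over
  which flatness and the related notions quantify.\<close>

definition transport :: "('r, 'a) module \<Rightarrow> ('a \<Rightarrow> 'b) \<Rightarrow> ('r, 'b) module" where
  "transport M e = (let d = inv_into (carrier M) e in
     \<lparr>carrier = e ` carrier M, monoid.mult = undefined, one = undefined,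
      ring.zero = e \<zero>\<^bsub>M\<^esub>, ring.add = (\<lambda>x y. e (d x \<oplus>\<^bsub>M\<^esub> d y)), smult = (\<lambda>r x. e (r \<odot>\<^bsub>M\<^esub> d x))\<rparr>)"

lemma transport:
  assumes M: "left_module R M" and inj: "inj_on e (carrier M)"
  shows "left_module R (transport M e)" "linear R M (transport M e) e"
    "linear R (transport M e) M (inv_into (carrier M) e)"
proof -
  interpret M: left_module R M by fact
  note [simp] = inv_into_f_f[OF inj] M.smult_closed
  have "abelian_group (transport M e)"
  proof (rule abelian_groupI)
    fix x assume "x \<in> carrier (transport M e)"
    then obtain y where y: "y \<in> carrier M" "x = e y" by (auto simp: transport_def Let_def)
    then show "\<exists>y\<in>carrier (transport M e). y \<oplus>\<^bsub>transport M e\<^esub> x = \<zero>\<^bsub>transport M e\<^esub>"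
      by (intro bexI[of _ "e (\<ominus>\<^bsub>M\<^esub> y)"]) (auto simp: transport_def Let_def M.l_neg)
  qed (auto simp: transport_def Let_def M.M.a_ac)
  then show "left_module R (transport M e)"
    by (intro left_module.intro left_module_axioms.intro M.R.ring_axioms)
      (auto simp: transport_def Let_def M.smult_l_distr M.smult_r_distr M.smult_assoc M.smult_one)
  show "linear R M (transport M e) e" "linear R (transport M e) M (inv_into (carrier M) e)"
    by (auto intro!: linearI simp: transport_def Let_def)
qed

lemma transport_small:
  fixes R :: "'u ring" and M :: "('u, 'a) module"
  assumes M: "left_module R M" and small: "small_sized TYPE('u) (carrier M)"
  obtains M' :: "('u, 'u) module" and e d where "M' \<in> Mods R" "linear R M M' e" "linear R M' M d"
    "\<And>x. x \<in> carrier M \<Longrightarrow> d (e x) = x" "\<And>y. y \<in> carrier M' \<Longrightarrow> e (d y) = y"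
proof -
  obtain A :: "'u set" where A: "small A" "carrier M \<lesssim> A" using small unfolding small_sized_def by blast
  then obtain e where e: "inj_on e (carrier M)" "e ` carrier M \<subseteq> A" by (auto simp: lepoll_def)
  have "small (e ` carrier M)" by (rule small_lepoll[OF A(1) subset_imp_lepoll[OF e(2)]])
  then have "transport M e \<in> Mods R"
    using transport(1)[OF M e(1)] by (simp add: Mods_def transport_def Let_def)
  then show ?thesis
    by (rule that[OF _ transport(2,3)[OF M e(1)]])
      (auto simp: transport_def Let_def inv_into_f_f[OF e(1)])
qed

lemma ModsD: "M \<in> Mods R \<Longrightarrow> left_module R M" "M \<in> Mods R \<Longrightarrow> small (carrier M)"
  by (simp_all add: Mods_def)

locale universe_type =
  fixes U :: "'u itself"
  assumes universe: "universe U"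
begin

lemma infinite_small: "\<exists>A :: 'u set. infinite A \<and> small A"
  using universe unfolding universe_def by blast

lemma infinite_universe: "infinite (UNIV :: 'u set)"
proof -
  obtain A :: "'u set" where "infinite A" using infinite_small by blast
  then show ?thesis by (rule infinite_super[OF subset_UNIV])
qed

lemma small_Pow: "small (A :: 'u set) \<Longrightarrow> Pow A \<prec> (UNIV :: 'u set)"
  using universe unfolding universe_def by blast

lemma small_Union: "small (I :: 'u set) \<Longrightarrow> (\<And>i. i \<in> I \<Longrightarrow> small (A i :: 'u set)) \<Longrightarrow> small (\<Union>i\<in>I. A i)"
  using universe unfolding universe_def by blast

lemma small_finite: "finite A \<Longrightarrow> small (A :: 'u set)"
proof -
  have "infinite (UNIV :: 'u set)" by (rule infinite_universe)
  then show "finite A \<Longrightarrow> small (A :: 'u set)"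
    unfolding small_def by (simp add: finite_lesspoll_infinite)
qed

lemma small_Un: "small (A :: 'u set) \<Longrightarrow> small B \<Longrightarrow> small (A \<union> B)"
proof -
  assume AB: "small A" "small B"
  have "infinite (UNIV :: 'u set)" by (rule infinite_universe)
  then have "(UNIV :: 'u set) \<noteq> {u}" for u by (metis finite.emptyI finite.insertI)
  then obtain u v :: 'u where uv: "u \<noteq> v" by blast
  \<comment> \<open>Unions are available for index sets in the universe only; two distinct elements
    of it index A and B.\<close>
  have "small (\<Union>i\<in>{u, v}. if i = u then A else B)"
    by (rule small_Union) (use AB small_finite in auto)
  moreover have "(\<Union>i\<in>{u, v}. if i = u then A else B) = A \<union> B" using uv by auto
  ultimately show ?thesis by simp
qed

lemma small_sized_Pow: "small_sized U X \<Longrightarrow> small_sized U (Pow X)"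
proof -
  assume "small_sized U X"
  then obtain A :: "'u set" where A: "small A" "X \<lesssim> A" unfolding small_sized_def by blast
  then obtain f where f: "inj_on f X" "f ` X \<subseteq> A" by (auto simp: lepoll_def)
  have p1: "Pow X \<lesssim> Pow A"
    unfolding lepoll_def using inj_on_image_Pow[OF f(1)] f(2) by (intro exI[of _ "image f"]) blast
  obtain g :: "'u set \<Rightarrow> 'u" where g: "inj_on g (Pow A)"
    using small_Pow[OF A(1)] by (auto simp: lesspoll_def lepoll_def)
  have g': "g ` Pow A \<approx> Pow A" by (rule inj_on_image_eqpoll_self[OF g])
  then have p2: "Pow A \<lesssim> g ` Pow A" by (rule eqpoll_imp_lepoll[OF eqpoll_sym])
  have p3: "small (g ` Pow A)"
    unfolding small_def by (rule eq_lesspoll_trans[OF g' small_Pow[OF A(1)]])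
  show ?thesis by (rule small_sized_lepoll[OF small_sizedI[OF p3] lepoll_trans[OF p1 p2]])
qed

lemma small_sized_Times: "small_sized U X \<Longrightarrow> small_sized U Y \<Longrightarrow> small_sized U (X \<times> Y)"
proof -
  assume "small_sized U X" "small_sized U Y"
  then obtain A B :: "'u set" where AB: "small A" "X \<lesssim> A" "small B" "Y \<lesssim> B"
    unfolding small_sized_def by blast
  \<comment> \<open>Kuratowski pairs reduce products to power sets and avoid cardinal
    arithmetic.\<close>
  have "inj_on (\<lambda>(a, b). {{a}, {a, b}}) (A \<times> B)"
  proof (rule inj_onI, clarify)
    fix a b a' b' :: 'u assume "{{a}, {a, b}} = {{a'}, {a', b'}}"
    then have "{a} = {a'} \<and> {a, b} = {a', b'} \<or> {a} = {a', b'} \<and> {a, b} = {a'}"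
      by (simp only: doubleton_eq_iff)
    then show "a = a' \<and> b = b'" by (auto simp: doubleton_eq_iff)
  qed
  moreover have "(\<lambda>(a, b). {{a}, {a, b}}) ` (A \<times> B) \<subseteq> Pow (Pow (A \<union> B))" by auto
  ultimately have p1: "A \<times> B \<lesssim> Pow (Pow (A \<union> B))" unfolding lepoll_def by blast
  have p2: "X \<times> Y \<lesssim> A \<times> B" by (rule times_lepoll_mono[OF AB(2,4)])
  have p3: "small_sized U (Pow (Pow (A \<union> B)))"
    by (intro small_sized_Pow small_sizedI small_Un AB(1,3))
  show ?thesis by (rule small_sized_lepoll[OF p3 lepoll_trans[OF p2 p1]])
qed

lemma small_sized_PiE: "small_sized U X \<Longrightarrow> small_sized U Y \<Longrightarrow> small_sized U (X \<rightarrow>\<^sub>E Y)"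
proof -
  assume XY: "small_sized U X" "small_sized U Y"
  let ?g = "\<lambda>f. {(x, f x) | x. x \<in> X}"
  have "inj_on ?g (X \<rightarrow>\<^sub>E Y)"
  proof (rule inj_onI)
    fix f f' assume f: "f \<in> X \<rightarrow>\<^sub>E Y" "f' \<in> X \<rightarrow>\<^sub>E Y" and eq: "?g f = ?g f'"
    have "f x = f' x" if "x \<in> X" for x
    proof -
      have "(x, f x) \<in> ?g f'" unfolding eq[symmetric] using that by blast
      then show ?thesis by simp
    qed
    then show "f = f'" using f by (rule PiE_ext[rotated 2]) auto
  qed
  moreover have "?g ` (X \<rightarrow>\<^sub>E Y) \<subseteq> Pow (X \<times> Y)" by auto
  ultimately have "(X \<rightarrow>\<^sub>E Y) \<lesssim> Pow (X \<times> Y)" unfolding lepoll_def by blast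
  then show ?thesis by (rule small_sized_lepoll[OF small_sized_Pow[OF small_sized_Times[OF XY]]])
qed

lemma small_sized_countable: "countable X \<Longrightarrow> small_sized U X"
proof -
  assume X: "countable X"
  obtain A :: "'u set" where A: "infinite A" "small A" using infinite_small by blast
  have "X \<lesssim> (UNIV :: nat set)" using X unfolding lepoll_def countable_def by blast
  also have "(UNIV :: nat set) \<lesssim> A" using A(1) by (simp add: infinite_le_lepoll)
  finally show ?thesis by (rule small_sized_lepoll[OF small_sizedI[OF A(2)]])
qed

end

section \<open>Character modules\<close>

text \<open>The dual M' with the action (\<chi> r)(x) = \<chi>(r x), which turns left modules into
  right ones. Members are extensional, so that characters that agree on M are equal.\<close>

definition character_module :: "('r, 'a) module \<Rightarrow> ('r, 'a \<Rightarrow> qz) module" where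
  "character_module M = \<lparr>carrier = {\<chi> \<in> extensional (carrier M). character M \<chi>},
     monoid.mult = undefined, one = undefined,
     ring.zero = (\<lambda>x\<in>carrier M. 0), ring.add = (\<lambda>\<chi> \<psi>. \<lambda>x\<in>carrier M. \<chi> x + \<psi> x),
     smult = (\<lambda>r \<chi>. \<lambda>x\<in>carrier M. \<chi> (r \<odot>\<^bsub>M\<^esub> x))\<rparr>"

lemma left_module_character_module:
  assumes "left_module R M" shows "left_module (opp R) (character_module M)"
proof -
  interpret M: left_module R M by fact
  note [simp] = M.smult_closed
  have "abelian_group (character_module M)"
  proof (rule abelian_groupI)
    fix \<chi> assume "\<chi> \<in> carrier (character_module M)"
    then show "\<exists>\<psi>\<in>carrier (character_module M). \<psi> \<oplus>\<^bsub>character_module M\<^esub> \<chi> = \<zero>\<^bsub>character_module M\<^esub>"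
      by (intro bexI[of _ "\<lambda>x\<in>carrier M. - \<chi> x"])
        (auto simp: character_module_def character_def fun_eq_iff)
  qed (auto simp: character_module_def character_def fun_eq_iff add.commute add.left_commute extensional_def)
  then show ?thesis
    by (intro left_module.intro left_module_axioms.intro ring_opp M.R.ring_axioms)
      (auto simp: character_module_def character_def fun_eq_iff extensional_def
         M.smult_l_distr M.smult_r_distr M.smult_assoc M.smult_one)
qed

text \<open>A copy M' of the character module inside the universe, with evaluation e. The last two
  clauses say that e identifies M' with the characters of M; nothing else about the copy is used.
  Outside the carriers e is unconstrained.\<close>

definition dual_pair ::
  "'u ring \<Rightarrow> ('u, 'a) module \<Rightarrow> ('u, 'u) module \<Rightarrow> ('u \<Rightarrow> 'a \<Rightarrow> qz) \<Rightarrow> bool" where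
  "dual_pair R M M' e \<longleftrightarrow> M' \<in> Mods (opp R) \<and> balanced R M' M e \<and>
     (\<forall>\<xi>\<in>carrier M'. \<forall>\<xi>'\<in>carrier M'. (\<forall>x\<in>carrier M. e \<xi> x = e \<xi>' x) \<longrightarrow> \<xi> = \<xi>') \<and>
     (\<forall>\<chi>. character M \<chi> \<longrightarrow> (\<exists>\<xi>\<in>carrier M'. \<forall>x\<in>carrier M. e \<xi> x = \<chi> x))"

lemma dual_pairD:
  assumes "dual_pair R M M' e"
  shows "M' \<in> Mods (opp R)" "balanced R M' M e"
    "\<And>\<xi> \<xi>'. \<xi> \<in> carrier M' \<Longrightarrow> \<xi>' \<in> carrier M' \<Longrightarrow> (\<And>x. x \<in> carrier M \<Longrightarrow> e \<xi> x = e \<xi>' x) \<Longrightarrow> \<xi> = \<xi>'"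
    "\<And>\<chi>. character M \<chi> \<Longrightarrow> \<exists>\<xi>\<in>carrier M'. \<forall>x\<in>carrier M. e \<xi> x = \<chi> x"
  using assms unfolding dual_pair_def by blast+

text \<open>Characters are functions into the countable group Q/Z, so there are few enough of them
  for a copy to fit into the universe.\<close>

lemma (in universe_type) dual_pair_exists:
  fixes R :: "'u ring" and M :: "('u, 'a) module"
  assumes M: "left_module R M" and small: "small_sized U (carrier M)"
  obtains M' e where "dual_pair R M M' e"
proof -
  have "carrier (character_module M) \<subseteq> carrier M \<rightarrow>\<^sub>E UNIV"
    by (auto simp: character_module_def extensional_def)
  moreover have "small_sized U (carrier M \<rightarrow>\<^sub>E (UNIV :: qz set))"
    by (intro small_sized_PiE small small_sized_countable countable_qz)
  ultimately have "small_sized TYPE('u) (carrier (character_module M))"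
    by (simp add: small_sized_def) (meson lepoll_trans subset_imp_lepoll)
  then obtain M' :: "('u, 'u) module" and e d where M':
    "M' \<in> Mods (opp R)" "linear (opp R) (character_module M) M' e" "linear (opp R) M' (character_module M) d"
    "\<And>x. x \<in> carrier (character_module M) \<Longrightarrow> d (e x) = x" "\<And>y. y \<in> carrier M' \<Longrightarrow> e (d y) = y"
    using transport_small[OF left_module_character_module[OF M]] by blast
  note d = linearD[OF M'(3)]
  have dc: "d \<xi> \<in> extensional (carrier M)" "character M (d \<xi>)" if "\<xi> \<in> carrier M'" for \<xi>
    using d(1)[OF that] by (auto simp: character_module_def)
  show ?thesis
  proof (rule that[of M' d], unfold dual_pair_def, intro conjI ballI allI impI)
    show "balanced R M' M d"
      unfolding balanced_def
      using d(2,3) dc(2) by (auto simp: character_def character_module_def)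
    fix \<xi> \<xi>' assume \<xi>: "\<xi> \<in> carrier M'" "\<xi>' \<in> carrier M'" "\<forall>x\<in>carrier M. d \<xi> x = d \<xi>' x"
    then have "d \<xi> = d \<xi>'" using dc by (intro extensionalityI[of _ "carrier M"]) auto
    then show "\<xi> = \<xi>'" using M'(5) \<xi> by metis
  next
    fix \<chi> assume "character M \<chi>"
    then have "restrict \<chi> (carrier M) \<in> carrier (character_module M)"
      using left_module_closed(1)[OF M] by (auto simp: character_module_def character_def)
    then show "\<exists>\<xi>\<in>carrier M'. \<forall>x\<in>carrier M. d \<xi> x = \<chi> x"
      using M'(4) linearD(1)[OF M'(2)] by (intro bexI[of _ "e (restrict \<chi> (carrier M))"]) auto
  qed (fact M'(1))
qed

lemma (in universe_type) dual_pair_exists_Mods: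
  fixes R :: "'u ring" and M :: "('u, 'u) module"
  assumes "M \<in> Mods R"
  obtains M' e where "dual_pair R M M' e"
proof -
  have "small_sized U (carrier M)" using ModsD(2)[OF assms] unfolding small_sized_def by blast
  then show ?thesis using dual_pair_exists[OF ModsD(1)[OF assms]] that by blast
qed

lemma balanced_flip: "balanced R A B \<beta> \<Longrightarrow> balanced (opp R) B A (\<lambda>b a. \<beta> a b)"
  by (auto simp: balanced_def)

text \<open>Tensor-hom adjunction: pairings of A with M are homomorphisms from A to M'. Linearity of
  f follows since members of M' are determined by their values.\<close>

lemma dual_hom:
  assumes D: "dual_pair R M M' e" and M: "left_module R M" and A: "left_module (opp R) A"
    and \<beta>: "balanced R A M \<beta>"
  obtains f where "f \<in> Hom (opp R) A M'" "\<And>a x. a \<in> carrier A \<Longrightarrow> x \<in> carrier M \<Longrightarrow> e (f a) x = \<beta> a x"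
proof -
  note D = dual_pairD[OF D]
  note M' = ModsD(1)[OF D(1)]
  define f where "f = (\<lambda>a\<in>carrier A. SOME \<xi>. \<xi> \<in> carrier M' \<and> (\<forall>x\<in>carrier M. e \<xi> x = \<beta> a x))"
  have f: "f a \<in> carrier M' \<and> (\<forall>x\<in>carrier M. e (f a) x = \<beta> a x)" if "a \<in> carrier A" for a
  proof -
    have "\<exists>\<xi>. \<xi> \<in> carrier M' \<and> (\<forall>x\<in>carrier M. e \<xi> x = \<beta> a x)"
      using D(4)[OF balanced_character_right[OF \<beta> that]] by blast
    from someI_ex[OF this] that show ?thesis by (simp add: f_def)
  qed
  note cl = left_module_closed[OF A] left_module_closed[OF M'] left_module_closed[OF M]
  have "f \<in> Hom (opp R) A M'"
  proof (rule linear_Hom)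
    show "linear (opp R) A M' f"
    proof (rule linearI)
      fix a a' assume "a \<in> carrier A" "a' \<in> carrier A"
      then show "f (a \<oplus>\<^bsub>A\<^esub> a') = f a \<oplus>\<^bsub>M'\<^esub> f a'"
        using f cl by (intro D(3)) (simp_all add: balancedD(1)[OF D(2)] balancedD(1)[OF \<beta>])
    next
      fix r a assume "r \<in> carrier (opp R)" "a \<in> carrier A"
      then show "f (r \<odot>\<^bsub>A\<^esub> a) = r \<odot>\<^bsub>M'\<^esub> f a"
        using f cl by (intro D(3)) (simp_all add: balancedD(3)[OF D(2)] balancedD(3)[OF \<beta>])
    qed (use f in blast)
  qed (simp add: f_def)
  then show ?thesis using that f by blast
qed

section \<open>Flatness, purity and pure injectivity\<close>

lemma linear_zero: "left_module R M \<Longrightarrow> left_module R N \<Longrightarrow> linear R M N f \<Longrightarrow> f \<zero>\<^bsub>M\<^esub> = \<zero>\<^bsub>N\<^esub>"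
  by (rule additive_zero[OF left_module_abelian_group left_module_abelian_group linear_additive])

lemma linear_inv:
  "left_module R M \<Longrightarrow> left_module R N \<Longrightarrow> linear R M N f \<Longrightarrow> x \<in> carrier M \<Longrightarrow> f (\<ominus>\<^bsub>M\<^esub> x) = \<ominus>\<^bsub>N\<^esub> f x"
  by (rule additive_inv[OF left_module_abelian_group left_module_abelian_group linear_additive])

lemma balanced_zero:
  assumes "left_module (opp R) A" "left_module R B" "balanced R A B \<beta>"
  shows "a \<in> carrier A \<Longrightarrow> \<beta> a \<zero>\<^bsub>B\<^esub> = 0" "b \<in> carrier B \<Longrightarrow> \<beta> \<zero>\<^bsub>A\<^esub> b = 0"
  using character_zero[OF left_module_abelian_group[OF assms(2)] balanced_character_right[OF assms(3)]]
    character_zero[OF left_module_abelian_group[OF assms(1)] balanced_character_left[OF assms(3)]] by auto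

text \<open>By \<open>dual_hom\<close> the condition on pairings says that homomorphisms into the
  dual of F extend along injections. \<open>dual_Flat_Injective\<close> and the end of
  \<open>bidual_Flat\<close> use this in the two directions.\<close>

lemma Flat_iff:
  assumes F: "F \<in> Mods R"
  shows "F \<in> Flat R \<longleftrightarrow> (\<forall>A\<in>Mods (opp R). \<forall>B\<in>Mods (opp R). \<forall>f\<in>Hom (opp R) A B.
    inj_on f (carrier A) \<longrightarrow> (\<forall>\<beta>. balanced R A F \<beta> \<longrightarrow>
      (\<exists>\<beta>'. balanced R B F \<beta>' \<and> (\<forall>a\<in>carrier A. \<forall>x\<in>carrier F. \<beta>' (f a) x = \<beta> a x))))"
proof -
  have eq: "inj_on (tensor_map R A F B F f (\<lambda>x. x)) (carrier (tensor R A F)) \<longleftrightarrow>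
      (\<forall>\<beta>. balanced R A F \<beta> \<longrightarrow>
        (\<exists>\<beta>'. balanced R B F \<beta>' \<and> (\<forall>a\<in>carrier A. \<forall>x\<in>carrier F. \<beta>' (f a) x = \<beta> a x)))"
    if "A \<in> Mods (opp R)" "B \<in> Mods (opp R)" "f \<in> Hom (opp R) A B" for A B f
    by (rule tensor_map_injective_iff[OF ModsD(1)[OF that(1)] ModsD(1)[OF F] ModsD(1)[OF that(2)]
          ModsD(1)[OF F] Hom_linear[OF that(3)] linear_id])
  show ?thesis unfolding Flat_def using F by (simp add: eq cong: ball_cong)
qed

lemma pure_mono_iff:
  assumes N: "N \<in> Mods R" and M: "M \<in> Mods R"
  shows "pure_mono R N M i \<longleftrightarrow> i \<in> Hom R N M \<and> inj_on i (carrier N) \<and>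
    (\<forall>A\<in>Mods (opp R). \<forall>\<beta>. balanced R A N \<beta> \<longrightarrow>
      (\<exists>\<beta>'. balanced R A M \<beta>' \<and> (\<forall>a\<in>carrier A. \<forall>x\<in>carrier N. \<beta>' a (i x) = \<beta> a x)))"
proof -
  have eq: "inj_on (tensor_map R A N A M (\<lambda>a. a) i) (carrier (tensor R A N)) \<longleftrightarrow>
      (\<forall>\<beta>. balanced R A N \<beta> \<longrightarrow>
        (\<exists>\<beta>'. balanced R A M \<beta>' \<and> (\<forall>a\<in>carrier A. \<forall>x\<in>carrier N. \<beta>' a (i x) = \<beta> a x)))"
    if "A \<in> Mods (opp R)" "i \<in> Hom R N M" for A
    by (rule tensor_map_injective_iff[OF ModsD(1)[OF that(1)] ModsD(1)[OF N] ModsD(1)[OF that(1)]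
          ModsD(1)[OF M] linear_id Hom_linear[OF that(2)]])
  show ?thesis unfolding pure_mono_def by (simp add: eq cong: ball_cong conj_cong)
qed

text \<open>\<open>Flat\<close> quantifies over modules with carrier in the universe; passing to
  copies of A and B covers small carriers of any type, such as modules of characters.\<close>

lemma (in universe_type) Flat_extend:
  fixes R :: "'u ring" and A :: "('u, 'a) module" and B :: "('u, 'b) module"
  assumes F: "F \<in> Flat R" and A: "left_module (opp R) A" "small_sized U (carrier A)"
    and B: "left_module (opp R) B" "small_sized U (carrier B)"
    and f: "linear (opp R) A B f" "inj_on f (carrier A)" and \<beta>: "balanced R A F \<beta>"
  obtains \<beta>' where "balanced R B F \<beta>'" "\<And>a x. a \<in> carrier A \<Longrightarrow> x \<in> carrier F \<Longrightarrow> \<beta>' (f a) x = \<beta> a x"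
proof -
  have F': "F \<in> Mods R" using F by (simp add: Flat_def)
  obtain A' :: "('u, 'u) module" and eA dA where A': "A' \<in> Mods (opp R)" "linear (opp R) A A' eA"
    "linear (opp R) A' A dA" "\<And>x. x \<in> carrier A \<Longrightarrow> dA (eA x) = x" "\<And>y. y \<in> carrier A' \<Longrightarrow> eA (dA y) = y"
    using transport_small[OF A(1)] A(2) unfolding small_sized_def by metis
  obtain B' :: "('u, 'u) module" and eB dB where B': "B' \<in> Mods (opp R)" "linear (opp R) B B' eB"
    "linear (opp R) B' B dB" "\<And>x. x \<in> carrier B \<Longrightarrow> dB (eB x) = x" "\<And>y. y \<in> carrier B' \<Longrightarrow> eB (dB y) = y"
    using transport_small[OF B(1)] B(2) unfolding small_sized_def by metis
  define f' where "f' = restrict (\<lambda>a. eB (f (dA a))) (carrier A')"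
  have f': "f' \<in> Hom (opp R) A' B'"
    unfolding f'_def
    by (rule linear_restrict_Hom[OF ModsD(1)[OF A'(1)]])
      (intro linear_comp[OF A'(3)] linear_comp[OF f(1) B'(2)])
  have "inj_on f' (carrier A')"
  proof (rule inj_onI)
    fix x y assume xy: "x \<in> carrier A'" "y \<in> carrier A'" "f' x = f' y"
    then have "f (dA x) = f (dA y)"
      using B'(4) linearD(1)[OF f(1)] linearD(1)[OF A'(3)] by (simp add: f'_def) metis
    then have "dA x = dA y" using inj_onD[OF f(2)] xy linearD(1)[OF A'(3)] by blast
    then show "x = y" using A'(5) xy by metis
  qed
  moreover have "balanced R A' F (\<lambda>a x. \<beta> (dA a) x)"
    using \<beta> A'(3) by (auto simp: balanced_def linear_def additive_def Pi_def)
  ultimately obtain \<beta>' where \<beta>': "balanced R B' F \<beta>'"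
    "\<And>a x. a \<in> carrier A' \<Longrightarrow> x \<in> carrier F \<Longrightarrow> \<beta>' (f' a) x = \<beta> (dA a) x"
    using F[unfolded Flat_iff[OF F']] A'(1) B'(1) f' by blast
  show ?thesis
  proof (rule that[of "\<lambda>b x. \<beta>' (eB b) x"])
    show "balanced R B F (\<lambda>b x. \<beta>' (eB b) x)"
      using \<beta>'(1) B'(2) by (auto simp: balanced_def linear_def additive_def Pi_def)
    show "\<beta>' (eB (f a)) x = \<beta> a x" if "a \<in> carrier A" "x \<in> carrier F" for a x
      using \<beta>'(2)[of "eA a" x] that A'(4) linearD(1)[OF A'(2)] by (simp add: f'_def)
  qed
qed

text \<open>Homomorphisms into F' are pairings with F, which extend along injections because F is
  flat.\<close>

lemma (in universe_type) dual_Flat_Injective: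
  fixes R :: "'u ring"
  assumes F: "F \<in> Flat R" and D: "dual_pair R F F' e"
  shows "F' \<in> Injective (opp R)"
proof -
  have FM: "F \<in> Mods R" using F by (simp add: Flat_def)
  note D' = dual_pairD[OF D]
  show ?thesis
    unfolding Injective_def
  proof (intro CollectI conjI ballI impI D'(1))
    fix A B :: "('u, 'u) module" and i g
    assume A: "A \<in> Mods (opp R)" and B: "B \<in> Mods (opp R)" and i: "i \<in> Hom (opp R) A B"
      and g: "g \<in> Hom (opp R) A F'" and inj: "inj_on i (carrier A)"
    have "balanced R A F (\<lambda>a x. e (g a) x)"
      using D'(2) Hom_linear[OF g] by (auto simp: balanced_def linear_def additive_def Pi_def)
    then obtain \<beta> where \<beta>: "balanced R B F \<beta>"
      "\<And>a x. a \<in> carrier A \<Longrightarrow> x \<in> carrier F \<Longrightarrow> \<beta> (i a) x = e (g a) x"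
      using F[unfolded Flat_iff[OF FM]] A B i inj by blast
    obtain h where h: "h \<in> Hom (opp R) B F'"
      "\<And>b x. b \<in> carrier B \<Longrightarrow> x \<in> carrier F \<Longrightarrow> e (h b) x = \<beta> b x"
      using dual_hom[OF D ModsD(1)[OF FM] ModsD(1)[OF B] \<beta>(1)] by blast
    note il = linearD(1)[OF Hom_linear[OF i]] and gl = linearD(1)[OF Hom_linear[OF g]]
      and hl = linearD(1)[OF Hom_linear[OF h(1)]]
    have "compose (carrier A) h i = g"
    proof (rule extensionalityI[of _ "carrier A"])
      fix a assume a: "a \<in> carrier A"
      have "h (i a) = g a" by (rule D'(3)) (use a il gl hl h(2) \<beta>(2) in auto)
      then show "compose (carrier A) h i a = g a" using a by (simp add: compose_def)
    qed (use Hom_extensional[OF g] in simp_all)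
    then show "\<exists>h\<in>Hom (opp R) B F'. compose (carrier A) h i = g" using h(1) by blast
  qed
qed

text \<open>Homomorphisms into A' are pairings with A, and pairings extend along pure
  monomorphisms.\<close>

lemma dual_Pure_Injective:
  assumes A: "A \<in> Mods (opp R)" and D: "dual_pair (opp R) A A' e"
  shows "A' \<in> Pure_Injective R"
proof -
  note D' = dual_pairD[OF D, simplified]
  show ?thesis
    unfolding Pure_Injective_def
  proof (intro CollectI conjI ballI allI impI D'(1))
    fix N M i g
    assume N: "N \<in> Mods R" and M: "M \<in> Mods R" and g: "g \<in> Hom R N A'" and pure: "pure_mono R N M i"
    have i: "i \<in> Hom R N M" using pure by (simp add: pure_mono_def)
    have "balanced R A N (\<lambda>a x. e (g x) a)"
      using D'(2) Hom_linear[OF g] by (auto simp: balanced_def linear_def additive_def Pi_def)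
    then obtain \<beta> where \<beta>: "balanced R A M \<beta>"
      "\<And>a x. a \<in> carrier A \<Longrightarrow> x \<in> carrier N \<Longrightarrow> \<beta> a (i x) = e (g x) a"
      using pure[unfolded pure_mono_iff[OF N M]] A by blast
    obtain h where h: "h \<in> Hom R M A'"
      "\<And>y a. y \<in> carrier M \<Longrightarrow> a \<in> carrier A \<Longrightarrow> e (h y) a = \<beta> a y"
      using dual_hom[OF D ModsD(1)[OF A] _ balanced_flip[OF \<beta>(1)], simplified] ModsD(1)[OF M] by blast
    note il = linearD(1)[OF Hom_linear[OF i]] and gl = linearD(1)[OF Hom_linear[OF g]]
      and hl = linearD(1)[OF Hom_linear[OF h(1)]]
    have "compose (carrier N) h i = g"
    proof (rule extensionalityI[of _ "carrier N"])
      fix x assume x: "x \<in> carrier N"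
      have "h (i x) = g x" by (rule D'(3)) (use x il gl hl h(2) \<beta>(2) in auto)
      then show "compose (carrier N) h i x = g x" using x by (simp add: compose_def)
    qed (use Hom_extensional[OF g] in simp_all)
    then show "\<exists>h\<in>Hom R M A'. compose (carrier N) h i = g" using h(1) by blast
  qed
qed

text \<open>Evaluation at elements of M is pure because a pairing of A with M is a homomorphism f
  from A to M', and sending a, \<phi> to \<phi>(f a) extends the pairing to M''.\<close>

lemma bidual_embedding:
  assumes M: "M \<in> Mods R" and D: "dual_pair R M M' e" and D2: "dual_pair (opp R) M' M'' e2"
  obtains \<epsilon> where "\<epsilon> \<in> Hom R M M''" "\<And>x \<xi>. x \<in> carrier M \<Longrightarrow> \<xi> \<in> carrier M' \<Longrightarrow> e2 (\<epsilon> x) \<xi> = e \<xi> x"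
    "pure_mono R M M'' \<epsilon>"
proof -
  note D' = dual_pairD[OF D] and D2' = dual_pairD[OF D2, simplified]
  note Ml = ModsD(1)[OF M]
  obtain \<epsilon> where \<epsilon>: "\<epsilon> \<in> Hom R M M''" "\<And>x \<xi>. x \<in> carrier M \<Longrightarrow> \<xi> \<in> carrier M' \<Longrightarrow> e2 (\<epsilon> x) \<xi> = e \<xi> x"
    using dual_hom[OF D2 ModsD(1)[OF D'(1)] _ balanced_flip[OF D'(2)], simplified] Ml by blast
  have "inj_on \<epsilon> (carrier M)"
  proof (rule inj_onI)
    fix x y assume xy: "x \<in> carrier M" "y \<in> carrier M" "\<epsilon> x = \<epsilon> y"
    show "x = y"
    proof (rule character_eqI[OF left_module_abelian_group[OF Ml] xy(1,2)])
      fix \<chi> assume "character M \<chi>"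
      then obtain \<xi> where "\<xi> \<in> carrier M'" "\<forall>x\<in>carrier M. e \<xi> x = \<chi> x" using D'(4) by blast
      then show "\<chi> x = \<chi> y" using \<epsilon>(2) xy by metis
    qed
  qed
  moreover have "\<exists>\<beta>'. balanced R A M'' \<beta>' \<and> (\<forall>a\<in>carrier A. \<forall>x\<in>carrier M. \<beta>' a (\<epsilon> x) = \<beta> a x)"
    if A: "A \<in> Mods (opp R)" and \<beta>: "balanced R A M \<beta>" for A \<beta>
  proof -
    obtain f where f: "f \<in> Hom (opp R) A M'" "\<And>a x. a \<in> carrier A \<Longrightarrow> x \<in> carrier M \<Longrightarrow> e (f a) x = \<beta> a x"
      using dual_hom[OF D Ml ModsD(1)[OF A] \<beta>] by blast
    have "balanced R A M'' (\<lambda>a \<phi>. e2 \<phi> (f a))"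
      using D2'(2) Hom_linear[OF f(1)] by (auto simp: balanced_def linear_def additive_def Pi_def)
    then show ?thesis
      using f(2) \<epsilon>(2) linearD(1)[OF Hom_linear[OF f(1)]] by (intro exI[of _ "\<lambda>a \<phi>. e2 \<phi> (f a)"]) auto
  qed
  ultimately have "pure_mono R M M'' \<epsilon>"
    using \<epsilon>(1) pure_mono_iff[OF M D2'(1)] by blast
  then show ?thesis using that \<epsilon> by blast
qed

lemma pure_injective_retract:
  assumes M: "M \<in> Pure_Injective R" and Q: "Q \<in> Mods R" and i: "pure_mono R M Q i"
  obtains \<rho> where "\<rho> \<in> Hom R Q M" "\<And>x. x \<in> carrier M \<Longrightarrow> \<rho> (i x) = x"
proof -
  have Mm: "M \<in> Mods R" using M by (simp add: Pure_Injective_def)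
  have "restrict (\<lambda>x. x) (carrier M) \<in> Hom R M M"
    by (rule linear_restrict_Hom[OF ModsD(1)[OF Mm] linear_id])
  then obtain \<rho> where \<rho>: "\<rho> \<in> Hom R Q M" "compose (carrier M) \<rho> i = restrict (\<lambda>x. x) (carrier M)"
    using M Mm Q i unfolding Pure_Injective_def by blast
  show ?thesis
  proof (rule that[OF \<rho>(1)])
    fix x assume "x \<in> carrier M"
    then show "\<rho> (i x) = x" using fun_cong[OF \<rho>(2), of x] by (simp add: compose_def)
  qed
qed

section \<open>Pure injective modules are cotorsion\<close>

lemma a_kernel_iff: "x \<in> a_kernel M N f \<longleftrightarrow> x \<in> carrier M \<and> f x = \<zero>\<^bsub>N\<^esub>"
  by (simp add: a_kernel_def kernel_def)

text \<open>Flatness of F splits the dual sequence 0 -> F' -> Q' -> M' -> 0. A section M' -> Q'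
  allows pairings with M, which are homomorphisms into M', to be extended to Q.\<close>

lemma (in universe_type) flat_extension_pure:
  fixes R :: "'u ring"
  assumes M: "M \<in> Mods R" and F: "F \<in> Flat R" and ext: "(Q, i, p) \<in> extensions R F M"
  shows "pure_mono R M Q i"
proof -
  have Fm: "F \<in> Mods R" using F by (simp add: Flat_def)
  have Q: "Q \<in> Mods R" and i: "i \<in> Hom R M Q" and p: "p \<in> Hom R Q F" and inj: "inj_on i (carrier M)"
    and ker: "i ` carrier M = a_kernel Q F p" and surj: "p ` carrier Q = carrier F"
    using ext by (auto simp: extensions_def)
  note mods = ModsD(1)[OF M] ModsD(1)[OF Fm] ModsD(1)[OF Q]
  obtain M' eM where DM: "dual_pair R M M' eM" using dual_pair_exists_Mods[OF M] .
  obtain F' eF where DF: "dual_pair R F F' eF" using dual_pair_exists_Mods[OF Fm] .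
  obtain Q' eQ where DQ: "dual_pair R Q Q' eQ" using dual_pair_exists_Mods[OF Q] .
  note M' = dual_pairD[OF DM] and F' = dual_pairD[OF DF] and Q' = dual_pairD[OF DQ]
  note il = linearD[OF Hom_linear[OF i]] and pl = linearD[OF Hom_linear[OF p]]
  note cl = left_module_closed[OF ModsD(1)[OF M'(1)]] left_module_closed[OF ModsD(1)[OF F'(1)]]
    left_module_closed[OF ModsD(1)[OF Q'(1)]] left_module_closed[OF mods(1)]
    left_module_closed[OF mods(2)] left_module_closed[OF mods(3)]
  note ag = left_module_abelian_group[OF mods(1)] left_module_abelian_group[OF mods(2)] left_module_abelian_group[OF mods(3)]
  have "balanced R F' Q (\<lambda>\<eta> y. eF \<eta> (p y))"
    using F'(2) Hom_linear[OF p] by (auto simp: balanced_def linear_def additive_def Pi_def)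
  then obtain ps where ps: "ps \<in> Hom (opp R) F' Q'"
    "\<And>\<eta> y. \<eta> \<in> carrier F' \<Longrightarrow> y \<in> carrier Q \<Longrightarrow> eQ (ps \<eta>) y = eF \<eta> (p y)"
    using dual_hom[OF DQ mods(3) ModsD(1)[OF F'(1)]] by blast
  note psl = linearD(1)[OF Hom_linear[OF ps(1)]]
  have "inj_on ps (carrier F')"
  proof (rule inj_onI)
    fix \<eta> \<eta>' assume \<eta>: "\<eta> \<in> carrier F'" "\<eta>' \<in> carrier F'" "ps \<eta> = ps \<eta>'"
    show "\<eta> = \<eta>'"
    proof (rule F'(3)[OF \<eta>(1,2)])
      fix z assume "z \<in> carrier F"
      then obtain y where "y \<in> carrier Q" "z = p y" using surj by blast
      then show "eF \<eta> z = eF \<eta>' z" using ps(2) \<eta> by metis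
    qed
  qed
  \<comment> \<open>The evaluation pairing of F' with F extends along the injection ps : F' -> Q';
    in other words, \<gamma> is a retraction Q' -> F'.\<close>
  then obtain \<gamma> where \<gamma>: "balanced R Q' F \<gamma>"
    "\<And>\<eta> z. \<eta> \<in> carrier F' \<Longrightarrow> z \<in> carrier F \<Longrightarrow> \<gamma> (ps \<eta>) z = eF \<eta> z"
    using F[unfolded Flat_iff[OF Fm]] F'(1,2) Q'(1) ps(1) by blast
  \<comment> \<open>The complementary projection of Q': the identity minus the retraction followed
    by ps. It kills the image of F', hence depends only on the restriction of \<zeta> to M.\<close>
  define \<delta> where "\<delta> = (\<lambda>\<zeta> y. eQ \<zeta> y - \<gamma> \<zeta> (p y))"
  have \<delta>: "balanced R Q' Q \<delta>"
    using Q'(2) \<gamma>(1) pl cl unfolding \<delta>_def balanced_def by (auto simp: algebra_simps)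
  note \<delta>D = balancedD[OF \<delta>]
  have \<delta>0: "\<delta> \<zeta> y = 0" if \<zeta>: "\<zeta> \<in> carrier Q'" and y: "y \<in> carrier Q"
    and van: "\<And>x. x \<in> carrier M \<Longrightarrow> eQ \<zeta> (i x) = 0" for \<zeta> y
  proof -
    have "eQ \<zeta> q = 0" if "q \<in> carrier Q" "p q = \<zero>\<^bsub>F\<^esub>" for q
    proof -
      have "q \<in> i ` carrier M" using ker that by (simp add: a_kernel_iff)
      then show ?thesis using van by blast
    qed
    then obtain \<chi> where \<chi>: "character F \<chi>" "\<And>q. q \<in> carrier Q \<Longrightarrow> \<chi> (p q) = eQ \<zeta> q"
      using character_factor[OF ag(3,2) linear_additive[OF Hom_linear[OF p]]
          balanced_character_right[OF Q'(2) \<zeta>]] by blast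
    obtain \<eta> where \<eta>: "\<eta> \<in> carrier F'" "\<forall>z\<in>carrier F. eF \<eta> z = \<chi> z" using F'(4)[OF \<chi>(1)] by blast
    have "\<zeta> = ps \<eta>" by (rule Q'(3)[OF \<zeta> psl[OF \<eta>(1)]]) (use \<eta> \<chi>(2) ps(2) pl(1) in auto)
    then show ?thesis unfolding \<delta>_def using ps(2) \<gamma>(2) \<eta>(1) y pl(1) by simp
  qed
  have ex: "\<exists>\<zeta>. \<zeta> \<in> carrier Q' \<and> (\<forall>x\<in>carrier M. eQ \<zeta> (i x) = eM \<xi> x)" if \<xi>: "\<xi> \<in> carrier M'" for \<xi>
  proof -
    have "eM \<xi> x = 0" if "x \<in> carrier M" "i x = \<zero>\<^bsub>Q\<^esub>" for x
    proof -
      have "x = \<zero>\<^bsub>M\<^esub>"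
        using inj_onD[OF inj, of x "\<zero>\<^bsub>M\<^esub>"] that linear_zero[OF mods(1,3) Hom_linear[OF i]] cl by simp
      then show ?thesis using character_zero[OF ag(1) balanced_character_right[OF M'(2) \<xi>]] by simp
    qed
    then obtain \<chi> where \<chi>: "character Q \<chi>" "\<And>x. x \<in> carrier M \<Longrightarrow> \<chi> (i x) = eM \<xi> x"
      using character_factor[OF ag(1,3) linear_additive[OF Hom_linear[OF i]]
          balanced_character_right[OF M'(2) \<xi>]] by blast
    then show ?thesis using Q'(4)[OF \<chi>(1)] il(1) by metis
  qed
  \<comment> \<open>Some extension of \<xi> from M to Q. The choice does not matter after \<delta>
    is applied, so the result is additive and linear in \<xi> although c need not be.\<close>
  define c where "c \<xi> = (SOME \<zeta>. \<zeta> \<in> carrier Q' \<and> (\<forall>x\<in>carrier M. eQ \<zeta> (i x) = eM \<xi> x))" for \<xi>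
  have c: "c \<xi> \<in> carrier Q'" "\<And>x. x \<in> carrier M \<Longrightarrow> eQ (c \<xi>) (i x) = eM \<xi> x" if "\<xi> \<in> carrier M'" for \<xi>
    using someI_ex[OF ex[OF that]] by (auto simp: c_def)
  interpret Q': abelian_group Q' by (rule left_module_abelian_group[OF ModsD(1)[OF Q'(1)]])
  have indep: "\<delta> \<zeta> y = \<delta> \<zeta>' y" if \<zeta>: "\<zeta> \<in> carrier Q'" "\<zeta>' \<in> carrier Q'" and y: "y \<in> carrier Q"
    and eq: "\<And>x. x \<in> carrier M \<Longrightarrow> eQ \<zeta> (i x) = eQ \<zeta>' (i x)" for \<zeta> \<zeta>' y
  proof -
    have "eQ (\<ominus>\<^bsub>Q'\<^esub> \<zeta>') z = - eQ \<zeta>' z" if "z \<in> carrier Q" for z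
      by (rule character_inv[OF Q'.abelian_group_axioms balanced_character_left[OF Q'(2) that] \<zeta>(2)])
    then have "\<delta> (\<zeta> \<oplus>\<^bsub>Q'\<^esub> \<ominus>\<^bsub>Q'\<^esub> \<zeta>') y = 0"
      using \<zeta> y eq il(1) by (intro \<delta>0) (simp_all add: balancedD(1)[OF Q'(2)])
    moreover have "\<delta> (\<ominus>\<^bsub>Q'\<^esub> \<zeta>') y = - \<delta> \<zeta>' y"
      by (rule character_inv[OF Q'.abelian_group_axioms balanced_character_left[OF \<delta> y] \<zeta>(2)])
    ultimately show ?thesis using \<delta>D(1)[OF \<zeta>(1) _ y, of "\<ominus>\<^bsub>Q'\<^esub> \<zeta>'"] \<zeta> by simp
  qed
  have bal: "balanced R M' Q (\<lambda>\<xi> y. \<delta> (c \<xi>) y)"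
    unfolding balanced_def
  proof (intro conjI ballI)
    fix \<xi> \<xi>' y assume \<xi>: "\<xi> \<in> carrier M'" "\<xi>' \<in> carrier M'" and y: "y \<in> carrier Q"
    have "\<delta> (c (\<xi> \<oplus>\<^bsub>M'\<^esub> \<xi>')) y = \<delta> (c \<xi> \<oplus>\<^bsub>Q'\<^esub> c \<xi>') y"
      using \<xi> y c cl il(1) by (intro indep) (simp_all add: balancedD(1)[OF Q'(2)] balancedD(1)[OF M'(2)])
    then show "\<delta> (c (\<xi> \<oplus>\<^bsub>M'\<^esub> \<xi>')) y = \<delta> (c \<xi>) y + \<delta> (c \<xi>') y" using \<delta>D(1) c \<xi> y by simp
  next
    fix \<xi> y y' assume "\<xi> \<in> carrier M'" "y \<in> carrier Q" "y' \<in> carrier Q"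
    then show "\<delta> (c \<xi>) (y \<oplus>\<^bsub>Q\<^esub> y') = \<delta> (c \<xi>) y + \<delta> (c \<xi>) y'" using \<delta>D(2) c by simp
  next
    fix r \<xi> y assume r: "r \<in> carrier R" and \<xi>: "\<xi> \<in> carrier M'" and y: "y \<in> carrier Q"
    have "\<delta> (c (r \<odot>\<^bsub>M'\<^esub> \<xi>)) y = \<delta> (r \<odot>\<^bsub>Q'\<^esub> c \<xi>) y"
    proof (rule indep)
      fix x assume x: "x \<in> carrier M"
      have "eQ (r \<odot>\<^bsub>Q'\<^esub> c \<xi>) (i x) = eQ (c \<xi>) (i (r \<odot>\<^bsub>M\<^esub> x))"
        using r \<xi> x c il by (simp add: balancedD(3)[OF Q'(2)])
      also have "\<dots> = eM (r \<odot>\<^bsub>M'\<^esub> \<xi>) x"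
        using r \<xi> x c cl by (simp add: balancedD(3)[OF M'(2)])
      also have "\<dots> = eQ (c (r \<odot>\<^bsub>M'\<^esub> \<xi>)) (i x)" using r \<xi> x c cl by simp
      finally show "eQ (c (r \<odot>\<^bsub>M'\<^esub> \<xi>)) (i x) = eQ (r \<odot>\<^bsub>Q'\<^esub> c \<xi>) (i x)" by simp
    qed (use r \<xi> y c cl in simp_all)
    then show "\<delta> (c (r \<odot>\<^bsub>M'\<^esub> \<xi>)) y = \<delta> (c \<xi>) (r \<odot>\<^bsub>Q\<^esub> y)" using \<delta>D(3) r c \<xi> y by simp
  qed
  have val: "\<delta> (c \<xi>) (i x) = eM \<xi> x" if "\<xi> \<in> carrier M'" "x \<in> carrier M" for \<xi> x
  proof -
    have "i x \<in> a_kernel Q F p" unfolding ker[symmetric] using that by blast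
    then have "p (i x) = \<zero>\<^bsub>F\<^esub>" by (simp add: a_kernel_iff)
    then show ?thesis
      using that c balanced_zero(1)[OF ModsD(1)[OF Q'(1)] mods(2) \<gamma>(1)] by (simp add: \<delta>_def)
  qed
  have "\<exists>\<beta>'. balanced R A Q \<beta>' \<and> (\<forall>a\<in>carrier A. \<forall>x\<in>carrier M. \<beta>' a (i x) = \<beta> a x)"
    if A: "A \<in> Mods (opp R)" and \<beta>: "balanced R A M \<beta>" for A \<beta>
  proof -
    obtain f where f: "f \<in> Hom (opp R) A M'" "\<And>a x. a \<in> carrier A \<Longrightarrow> x \<in> carrier M \<Longrightarrow> eM (f a) x = \<beta> a x"
      using dual_hom[OF DM mods(1) ModsD(1)[OF A] \<beta>] by blast
    have "balanced R A Q (\<lambda>a y. \<delta> (c (f a)) y)"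
      using bal Hom_linear[OF f(1)] by (auto simp: balanced_def linear_def additive_def Pi_def)
    then show ?thesis
      using f(2) val linearD(1)[OF Hom_linear[OF f(1)]]
      by (intro exI[of _ "\<lambda>a y. \<delta> (c (f a)) y"]) auto
  qed
  then show ?thesis using pure_mono_iff[OF M Q] i inj by blast
qed

section \<open>Splitting of extensions\<close>

definition direct_sum :: "('r, 'a) module \<Rightarrow> ('r, 'b) module \<Rightarrow> ('r, 'a \<times> 'b) module" where
  "direct_sum M N = \<lparr>carrier = carrier M \<times> carrier N, monoid.mult = undefined, one = undefined,
     ring.zero = (\<zero>\<^bsub>M\<^esub>, \<zero>\<^bsub>N\<^esub>), ring.add = (\<lambda>(x, y) (x', y'). (x \<oplus>\<^bsub>M\<^esub> x', y \<oplus>\<^bsub>N\<^esub> y')),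
     smult = (\<lambda>r (x, y). (r \<odot>\<^bsub>M\<^esub> x, r \<odot>\<^bsub>N\<^esub> y))\<rparr>"

lemma left_module_direct_sum:
  assumes "left_module R M" "left_module R N" shows "left_module R (direct_sum M N)"
proof -
  interpret M: left_module R M by fact
  interpret N: left_module R N by fact
  have "abelian_group (direct_sum M N)"
  proof (rule abelian_groupI)
    fix z assume "z \<in> carrier (direct_sum M N)"
    then obtain x y where "z = (x, y)" "x \<in> carrier M" "y \<in> carrier N" by (auto simp: direct_sum_def)
    then show "\<exists>w\<in>carrier (direct_sum M N). w \<oplus>\<^bsub>direct_sum M N\<^esub> z = \<zero>\<^bsub>direct_sum M N\<^esub>"
      by (intro bexI[of _ "(\<ominus>\<^bsub>M\<^esub> x, \<ominus>\<^bsub>N\<^esub> y)"]) (auto simp: direct_sum_def M.l_neg N.l_neg)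
  qed (auto simp: direct_sum_def M.M.a_ac N.M.a_ac)
  then show ?thesis
    by (intro left_module.intro left_module_axioms.intro M.R.ring_axioms)
      (auto simp: direct_sum_def M.smult_closed N.smult_closed M.smult_l_distr N.smult_l_distr
        M.smult_r_distr N.smult_r_distr M.smult_assoc N.smult_assoc M.smult_one N.smult_one)
qed

text \<open>Without any extension the quotient \<open>Ext1\<close> would be empty and not the
  singleton that \<open>Cotorsion\<close> demands. The direct sum, copied into the universe, is
  one.\<close>

lemma (in universe_type) extensions_nonempty:
  fixes R :: "'u ring"
  assumes M: "M \<in> Mods R" and F: "F \<in> Mods R"
  shows "extensions R F M \<noteq> {}"
proof -
  note mods = ModsD(1)[OF M] ModsD(1)[OF F]
  interpret M: left_module R M by (rule mods)
  interpret F: left_module R F by (rule mods)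
  have "small_sized U (carrier (direct_sum M F))"
    using small_sized_Times[OF small_sizedI small_sizedI, OF ModsD(2)[OF M] ModsD(2)[OF F]]
    by (simp add: direct_sum_def)
  then obtain Q :: "('u, 'u) module" and e d where Q: "Q \<in> Mods R" "linear R (direct_sum M F) Q e"
    "linear R Q (direct_sum M F) d" "\<And>x. x \<in> carrier (direct_sum M F) \<Longrightarrow> d (e x) = x"
    "\<And>y. y \<in> carrier Q \<Longrightarrow> e (d y) = y"
    using transport_small[OF left_module_direct_sum[OF mods]] unfolding small_sized_def by metis
  define i where "i = (\<lambda>x\<in>carrier M. e (x, \<zero>\<^bsub>F\<^esub>))"
  define p where "p = (\<lambda>y\<in>carrier Q. snd (d y))"
  have "linear R M (direct_sum M F) (\<lambda>x. (x, \<zero>\<^bsub>F\<^esub>))"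
    by (rule linearI) (auto simp: direct_sum_def)
  then have i: "i \<in> Hom R M Q"
    unfolding i_def by (intro linear_restrict_Hom[OF mods(1)] linear_comp[OF _ Q(2)])
  have "linear R (direct_sum M F) F snd"
    by (rule linearI) (auto simp: direct_sum_def)
  then have p: "p \<in> Hom R Q F"
    unfolding p_def by (intro linear_restrict_Hom[OF ModsD(1)[OF Q(1)]] linear_comp[OF Q(3)])
  have c: "(x, z) \<in> carrier (direct_sum M F) \<longleftrightarrow> x \<in> carrier M \<and> z \<in> carrier F" for x z
    by (auto simp: direct_sum_def)
  have "inj_on i (carrier M)"
  proof (rule inj_onI)
    fix x y assume xy: "x \<in> carrier M" "y \<in> carrier M" "i x = i y"
    then have "d (e (x, \<zero>\<^bsub>F\<^esub>)) = d (e (y, \<zero>\<^bsub>F\<^esub>))" by (simp add: i_def)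
    then show "x = y" using Q(4) xy c by simp
  qed
  moreover have "i ` carrier M = a_kernel Q F p"
  proof
    show "i ` carrier M \<subseteq> a_kernel Q F p"
      using Q(4) c linearD(1)[OF Q(2)] by (auto simp: a_kernel_iff i_def p_def)
    show "a_kernel Q F p \<subseteq> i ` carrier M"
    proof
      fix y assume "y \<in> a_kernel Q F p"
      then have y: "y \<in> carrier Q" "snd (d y) = \<zero>\<^bsub>F\<^esub>" by (auto simp: a_kernel_iff p_def)
      then have "d y = (fst (d y), \<zero>\<^bsub>F\<^esub>)" by (metis prod.collapse)
      moreover from this have "fst (d y) \<in> carrier M" using linearD(1)[OF Q(3) y(1)] c by metis
      ultimately have "y = i (fst (d y))" using Q(5)[OF y(1)] by (simp add: i_def)
      then show "y \<in> i ` carrier M" using \<open>fst (d y) \<in> carrier M\<close> by blast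
    qed
  qed
  moreover have "p ` carrier Q = carrier F"
  proof
    show "p ` carrier Q \<subseteq> carrier F" using linearD(1)[OF Hom_linear[OF p]] by blast
    show "carrier F \<subseteq> p ` carrier Q"
    proof
      fix z assume "z \<in> carrier F"
      then have "(\<zero>\<^bsub>M\<^esub>, z) \<in> carrier (direct_sum M F)" by (simp add: c)
      then have "p (e (\<zero>\<^bsub>M\<^esub>, z)) = z" "e (\<zero>\<^bsub>M\<^esub>, z) \<in> carrier Q"
        using Q(4) linearD(1)[OF Q(2)] by (simp_all add: p_def)
      then show "z \<in> p ` carrier Q" by force
    qed
  qed
  ultimately have "(Q, i, p) \<in> extensions R F M" using Q(1) i p by (simp add: extensions_def)
  then show ?thesis by blast
qed

text \<open>The map 1 - i r kills the image of i, which is the kernel of p, and therefore factors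
  through p.\<close>

lemma extension_section:
  assumes M: "M \<in> Mods R" and F: "F \<in> Mods R" and ext: "(Q, i, p) \<in> extensions R F M"
    and r: "r \<in> Hom R Q M" "\<And>x. x \<in> carrier M \<Longrightarrow> r (i x) = x"
  obtains s where "s \<in> Hom R F Q" "\<And>z. z \<in> carrier F \<Longrightarrow> p (s z) = z"
proof -
  have Q: "Q \<in> Mods R" and i: "i \<in> Hom R M Q" and p: "p \<in> Hom R Q F"
    and ker: "i ` carrier M = a_kernel Q F p" and surj: "p ` carrier Q = carrier F"
    using ext by (auto simp: extensions_def)
  note mods = ModsD(1)[OF M] ModsD(1)[OF F] ModsD(1)[OF Q]
  interpret M: left_module R M by (rule mods)
  interpret F: left_module R F by (rule mods)
  interpret Q: left_module R Q by (rule mods)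
  note il = Hom_linear[OF i] and pl = Hom_linear[OF p] and rl = Hom_linear[OF r(1)]
  define w where "w y = y \<oplus>\<^bsub>Q\<^esub> \<ominus>\<^bsub>Q\<^esub> i (r y)" for y
  have ir: "linear R Q Q (\<lambda>y. i (r y))" by (rule linear_comp[OF rl il])
  note irl = linearD[OF ir]
  have w: "linear R Q Q w"
  proof (rule linearI)
    fix x y assume "x \<in> carrier Q" "y \<in> carrier Q"
    then show "w (x \<oplus>\<^bsub>Q\<^esub> y) = w x \<oplus>\<^bsub>Q\<^esub> w y"
      unfolding w_def using irl by (simp add: Q.M.minus_add Q.M.a_ac)
  next
    fix a y assume a: "a \<in> carrier R" and y: "y \<in> carrier Q"
    have "\<ominus>\<^bsub>Q\<^esub> (a \<odot>\<^bsub>Q\<^esub> i (r y)) = a \<odot>\<^bsub>Q\<^esub> \<ominus>\<^bsub>Q\<^esub> i (r y)"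
    proof (rule Q.M.minus_equality)
      show "a \<odot>\<^bsub>Q\<^esub> \<ominus>\<^bsub>Q\<^esub> i (r y) \<oplus>\<^bsub>Q\<^esub> a \<odot>\<^bsub>Q\<^esub> i (r y) = \<zero>\<^bsub>Q\<^esub>"
        using a irl(1)[OF y] by (simp add: Q.smult_r_distr[symmetric] Q.M.l_neg)
    qed (use a irl(1)[OF y] in \<open>simp_all add: Q.smult_closed\<close>)
    then show "w (a \<odot>\<^bsub>Q\<^esub> y) = a \<odot>\<^bsub>Q\<^esub> w y"
      unfolding w_def using irl(1,3) a y by (simp add: Q.smult_r_distr)
  qed (use irl in \<open>simp add: w_def\<close>)
  have pw: "p (w y) = p y" if y: "y \<in> carrier Q" for y
  proof -
    have "i (r y) \<in> a_kernel Q F p" unfolding ker[symmetric] using linearD(1)[OF rl y] by blast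
    then have "p (i (r y)) = \<zero>\<^bsub>F\<^esub>" by (simp add: a_kernel_iff)
    then have "p (\<ominus>\<^bsub>Q\<^esub> i (r y)) = \<zero>\<^bsub>F\<^esub>"
      using linear_inv[OF mods(3,2) pl irl(1)[OF y]] by simp
    then show ?thesis unfolding w_def using linearD[OF pl] irl(1)[OF y] y by simp
  qed
  have w0: "w y = w y'" if y: "y \<in> carrier Q" "y' \<in> carrier Q" "p y = p y'" for y y'
  proof -
    have "p (y \<oplus>\<^bsub>Q\<^esub> \<ominus>\<^bsub>Q\<^esub> y') = \<zero>\<^bsub>F\<^esub>"
      using y linearD[OF pl] linear_inv[OF mods(3,2) pl] by (simp add: F.M.r_neg)
    then have "y \<oplus>\<^bsub>Q\<^esub> \<ominus>\<^bsub>Q\<^esub> y' \<in> i ` carrier M" using ker y by (simp add: a_kernel_iff)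
    then obtain x where x: "x \<in> carrier M" "y \<oplus>\<^bsub>Q\<^esub> \<ominus>\<^bsub>Q\<^esub> y' = i x" by blast
    have "w (i x) = \<zero>\<^bsub>Q\<^esub>" unfolding w_def using r(2) x linearD(1)[OF il] by (simp add: Q.M.r_neg)
    then have "w y \<oplus>\<^bsub>Q\<^esub> \<ominus>\<^bsub>Q\<^esub> w y' = \<zero>\<^bsub>Q\<^esub>"
      using x(2)[symmetric] y linearD[OF w] linear_inv[OF mods(3,3) w] by simp
    then show ?thesis
      using linearD(1)[OF w] y by (metis Q.M.a_inv_closed Q.M.minus_equality Q.M.minus_minus)
  qed
  define s where "s = (\<lambda>z\<in>carrier F. w (SOME y. y \<in> carrier Q \<and> p y = z))"
  have s: "s (p y) = w y" if y: "y \<in> carrier Q" for y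
  proof -
    define t where "t = (SOME y'. y' \<in> carrier Q \<and> p y' = p y)"
    have "t \<in> carrier Q \<and> p t = p y" unfolding t_def by (rule someI[of _ y]) (use y in simp)
    then have "w t = w y" using w0 y by blast
    then show ?thesis using linearD(1)[OF pl y] by (simp add: s_def t_def)
  qed
  show ?thesis
  proof (rule that[of s])
    show "s \<in> Hom R F Q"
    proof (rule linear_Hom[OF linearI])
      fix z assume "z \<in> carrier F"
      then obtain y where y: "y \<in> carrier Q" "z = p y" using surj by blast
      then show "s z \<in> carrier Q" using s linearD(1)[OF w] by simp
      fix z' assume "z' \<in> carrier F"
      then obtain y' where y': "y' \<in> carrier Q" "z' = p y'" using surj by blast
      show "s (z \<oplus>\<^bsub>F\<^esub> z') = s z \<oplus>\<^bsub>Q\<^esub> s z'"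
        using y y' s[of "y \<oplus>\<^bsub>Q\<^esub> y'"] s linearD(2)[OF w] linearD(2)[OF pl] by simp
    next
      fix a z assume a: "a \<in> carrier R" and "z \<in> carrier F"
      then obtain y where y: "y \<in> carrier Q" "z = p y" using surj by blast
      then show "s (a \<odot>\<^bsub>F\<^esub> z) = a \<odot>\<^bsub>Q\<^esub> s z"
        using a s[of "a \<odot>\<^bsub>Q\<^esub> y"] s linearD(3)[OF w] linearD(3)[OF pl] by (simp add: Q.smult_closed)
    qed (simp add: s_def)
    fix z assume "z \<in> carrier F"
    then obtain y where "y \<in> carrier Q" "z = p y" using surj by blast
    then show "p (s z) = z" using s pw by simp
  qed
qed

text \<open>Extensions by a flat module are pure, so a pure injective M is a retract of the middle
  term and every extension splits. As \<open>Ext1\<close> is a set of classes, it remains to see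
  that any two split extensions are equivalent.\<close>

lemma (in universe_type) Pure_Injective_Cotorsion:
  fixes R :: "'u ring"
  assumes PI: "M \<in> Pure_Injective R"
  shows "M \<in> Cotorsion R"
proof -
  have M: "M \<in> Mods R" using PI by (simp add: Pure_Injective_def)
  have "Ext1 R F M = {Ext1_zero R F M}" if F: "F \<in> Flat R" for F
  proof -
    have Fm: "F \<in> Mods R" using F by (simp add: Flat_def)
    have split: "\<exists>r s. r \<in> Hom R Q M \<and> (\<forall>x\<in>carrier M. r (i x) = x) \<and> s \<in> Hom R F Q \<and> (\<forall>z\<in>carrier F. p (s z) = z)"
      if ext: "(Q, i, p) \<in> extensions R F M" for Q i p
    proof -
      have "Q \<in> Mods R" using ext by (simp add: extensions_def)
      then obtain r where r: "r \<in> Hom R Q M" "\<And>x. x \<in> carrier M \<Longrightarrow> r (i x) = x"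
        using pure_injective_retract[OF PI _ flat_extension_pure[OF M F ext]] by blast
      obtain s where "s \<in> Hom R F Q" "\<And>z. z \<in> carrier F \<Longrightarrow> p (s z) = z"
        by (rule extension_section[OF M Fm ext r]) blast+
      then show ?thesis using r by blast
    qed
    have zero: "Ext1_zero R F M = extensions R F M"
    proof
      show "Ext1_zero R F M \<subseteq> extensions R F M" by (auto simp: Ext1_zero_def)
      show "extensions R F M \<subseteq> Ext1_zero R F M"
      proof
        fix X assume X: "X \<in> extensions R F M"
        obtain Q i p where eq: "X = (Q, i, p)" by (rule prod_cases3)
        obtain s where "s \<in> Hom R F Q" "\<forall>z\<in>carrier F. p (s z) = z" using split X eq by blast
        then show "X \<in> Ext1_zero R F M" using X unfolding eq Ext1_zero_def by auto
      qed
    qed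
    have equiv: "(X, Y) \<in> ext_equiv R F M" if XY: "X \<in> extensions R F M" "Y \<in> extensions R F M" for X Y
    proof -
      obtain Q i p Q' i' p' where eq: "X = (Q, i, p)" "Y = (Q', i', p')" by (metis prod_cases3)
      have Q: "Q \<in> Mods R" and i: "i \<in> Hom R M Q" and p: "p \<in> Hom R Q F"
        and ker: "i ` carrier M = a_kernel Q F p"
        using XY(1) eq by (auto simp: extensions_def)
      have Q': "Q' \<in> Mods R" and i': "i' \<in> Hom R M Q'" and p': "p' \<in> Hom R Q' F"
        and ker': "i' ` carrier M = a_kernel Q' F p'"
        using XY(2) eq by (auto simp: extensions_def)
      obtain r where r: "r \<in> Hom R Q M" "\<forall>x\<in>carrier M. r (i x) = x" using split XY(1) eq by blast
      obtain s where s: "s \<in> Hom R F Q'" "\<forall>z\<in>carrier F. p' (s z) = z" using split XY(2) eq by blast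
      interpret Q: left_module R Q by (rule ModsD(1)[OF Q])
      interpret Q': left_module R Q' by (rule ModsD(1)[OF Q'])
      interpret F: left_module R F by (rule ModsD(1)[OF Fm])
      note l = linearD[OF Hom_linear[OF r(1)]] linearD[OF Hom_linear[OF s(1)]]
        linearD[OF Hom_linear[OF i]] linearD[OF Hom_linear[OF i']]
        linearD[OF Hom_linear[OF p]] linearD[OF Hom_linear[OF p']]
      have pi: "p (i x) = \<zero>\<^bsub>F\<^esub>" "p' (i' x) = \<zero>\<^bsub>F\<^esub>" if "x \<in> carrier M" for x
      proof -
        have "i x \<in> a_kernel Q F p" "i' x \<in> a_kernel Q' F p'"
          unfolding ker[symmetric] ker'[symmetric] using that by blast+
        then show "p (i x) = \<zero>\<^bsub>F\<^esub>" "p' (i' x) = \<zero>\<^bsub>F\<^esub>" by (simp_all add: a_kernel_iff)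
      qed
      \<comment> \<open>The first extension is split into its two ends by r and p, which are sent to
        the second by i' and s.\<close>
      define u where "u = (\<lambda>y\<in>carrier Q. i' (r y) \<oplus>\<^bsub>Q'\<^esub> s (p y))"
      have "u \<in> Hom R Q Q'"
        unfolding u_def
      proof (rule linear_restrict_Hom[OF ModsD(1)[OF Q] linearI])
        fix x y assume "x \<in> carrier Q" "y \<in> carrier Q"
        then show "i' (r (x \<oplus>\<^bsub>Q\<^esub> y)) \<oplus>\<^bsub>Q'\<^esub> s (p (x \<oplus>\<^bsub>Q\<^esub> y)) = i' (r x) \<oplus>\<^bsub>Q'\<^esub> s (p x) \<oplus>\<^bsub>Q'\<^esub> (i' (r y) \<oplus>\<^bsub>Q'\<^esub> s (p y))"
          using l by (simp add: Q'.M.a_ac)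
      next
        fix a x assume "a \<in> carrier R" "x \<in> carrier Q"
        then show "i' (r (a \<odot>\<^bsub>Q\<^esub> x)) \<oplus>\<^bsub>Q'\<^esub> s (p (a \<odot>\<^bsub>Q\<^esub> x)) = a \<odot>\<^bsub>Q'\<^esub> (i' (r x) \<oplus>\<^bsub>Q'\<^esub> s (p x))"
          using l by (simp add: Q'.smult_r_distr)
      qed (use l in simp)
      moreover have "compose (carrier M) u i = i'"
      proof (rule extensionalityI[of _ "carrier M"])
        fix x assume "x \<in> carrier M"
        then show "compose (carrier M) u i x = i' x"
          using l r(2) pi(1) linear_zero[OF ModsD(1)[OF Fm] ModsD(1)[OF Q'] Hom_linear[OF s(1)]]
          by (simp add: compose_def u_def)
      qed (use Hom_extensional[OF i'] in simp_all)
      moreover have "compose (carrier Q) p' u = p"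
      proof (rule extensionalityI[of _ "carrier Q"])
        fix y assume "y \<in> carrier Q"
        then show "compose (carrier Q) p' u y = p y"
          using l s(2) pi(2) by (simp add: compose_def u_def)
      qed (use Hom_extensional[OF p] in simp_all)
      ultimately have "\<exists>u\<in>Hom R Q Q'. compose (carrier M) u i = i' \<and> compose (carrier Q) p' u = p" by blast
      then show ?thesis using XY unfolding eq ext_equiv_def by simp
    qed
    have "ext_equiv R F M `` {X} = extensions R F M" if X: "X \<in> extensions R F M" for X
    proof
      show "ext_equiv R F M `` {X} \<subseteq> extensions R F M" by (auto simp: ext_equiv_def)
      show "extensions R F M \<subseteq> ext_equiv R F M `` {X}" using equiv[OF X] by blast
    qed
    then have "extensions R F M // ext_equiv R F M = {extensions R F M}"
      using extensions_nonempty[OF M Fm] unfolding quotient_def by blast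
    then show ?thesis by (simp add: Ext1_def zero)
  qed
  then show ?thesis using M by (simp add: Cotorsion_def)
qed

section \<open>Finite sums and tuples\<close>

text \<open>Recursion on the length suits inductions over partial sums and the concatenation of
  families in \<open>msum_append\<close>.\<close>

primrec msum :: "('a, 'm) ring_scheme \<Rightarrow> (nat \<Rightarrow> 'a) \<Rightarrow> nat \<Rightarrow> 'a" where
  "msum G f 0 = \<zero>\<^bsub>G\<^esub>"
| "msum G f (Suc n) = msum G f n \<oplus>\<^bsub>G\<^esub> f n"

lemma msum_closed:
  assumes "abelian_group G" "\<And>i. i < n \<Longrightarrow> f i \<in> carrier G" shows "msum G f n \<in> carrier G"
proof -
  interpret abelian_group G by fact
  show ?thesis using assms(2) by (induction n) auto
qed

lemma msum_cong: "(\<And>i. i < n \<Longrightarrow> f i = g i) \<Longrightarrow> msum G f n = msum G g n"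
  by (induction n) auto

lemma msum_add:
  assumes "abelian_group G" "\<And>i. i < n \<Longrightarrow> f i \<in> carrier G" "\<And>i. i < n \<Longrightarrow> g i \<in> carrier G"
  shows "msum G (\<lambda>i. f i \<oplus>\<^bsub>G\<^esub> g i) n = msum G f n \<oplus>\<^bsub>G\<^esub> msum G g n"
proof -
  interpret abelian_group G by fact
  show ?thesis
    using assms(2,3)
    by (induction n) (auto simp: a_ac msum_closed[OF assms(1)])
qed

lemma msum_additive:
  assumes "abelian_group P" "abelian_group G" "additive P G u" "\<And>i. i < n \<Longrightarrow> f i \<in> carrier P"
  shows "u (msum P f n) = msum G (\<lambda>i. u (f i)) n"
  using assms(4)
  by (induction n) (auto simp: additive_zero[OF assms(1-3)] additiveD(2)[OF assms(3)] msum_closed[OF assms(1)])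

lemma msum_character:
  assumes "abelian_group P" "character P u" "\<And>i. i < n \<Longrightarrow> f i \<in> carrier P"
  shows "u (msum P f n) = (\<Sum>i<n. u (f i))"
  using assms(3)
  by (induction n) (auto simp: character_zero[OF assms(1,2)] characterD[OF assms(2)] msum_closed[OF assms(1)])

lemma msum_smult:
  assumes "left_module R M" "r \<in> carrier R" "\<And>i. i < n \<Longrightarrow> f i \<in> carrier M"
  shows "r \<odot>\<^bsub>M\<^esub> msum M f n = msum M (\<lambda>i. r \<odot>\<^bsub>M\<^esub> f i) n"
proof -
  interpret left_module R M by fact
  show ?thesis
    by (rule msum_additive[OF _ _ _ assms(3)]) (use assms smult_closed in \<open>auto simp: additive_def smult_r_distr M.abelian_group_axioms\<close>)
qed

lemma msum_split:
  assumes "abelian_group G" "\<And>i. i < n + m \<Longrightarrow> f i \<in> carrier G"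
  shows "msum G f (n + m) = msum G f n \<oplus>\<^bsub>G\<^esub> msum G (\<lambda>i. f (n + i)) m"
proof -
  interpret abelian_group G by fact
  show ?thesis
    using assms(2) by (induction m) (auto simp: a_assoc msum_closed[OF assms(1)])
qed

lemma msum_append:
  assumes "abelian_group G" "\<And>i. i < n \<Longrightarrow> f i \<in> carrier G" "\<And>i. i < m \<Longrightarrow> g i \<in> carrier G"
  shows "msum G (\<lambda>i. if i < n then f i else g (i - n)) (n + m) = msum G f n \<oplus>\<^bsub>G\<^esub> msum G g m"
  using assms by (subst msum_split) (auto intro!: arg_cong2[where f = "ring.add G"] msum_cong)

lemma sum_append:
  fixes f g :: "nat \<Rightarrow> 'a :: ab_group_add"
  shows "(\<Sum>i<n + m. if i < n then f i else g (i - n)) = (\<Sum>i<n. f i) + (\<Sum>i<m. g i)"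
  by (induction m) (auto simp: add.assoc)

text \<open>The power G^n as a group only: over a noncommutative ring, linear equations define
  additive maps between such powers that need not be linear.\<close>

definition tuples :: "nat \<Rightarrow> ('a, 'm) ring_scheme \<Rightarrow> (nat \<Rightarrow> 'a) ring" where
  "tuples n G = \<lparr>carrier = {..<n} \<rightarrow>\<^sub>E carrier G, monoid.mult = undefined, one = undefined,
     ring.zero = (\<lambda>i\<in>{..<n}. \<zero>\<^bsub>G\<^esub>), ring.add = (\<lambda>x y. \<lambda>i\<in>{..<n}. x i \<oplus>\<^bsub>G\<^esub> y i)\<rparr>"

lemma tuples_simps [simp]:
  "carrier (tuples n G) = {..<n} \<rightarrow>\<^sub>E carrier G" "\<zero>\<^bsub>tuples n G\<^esub> = (\<lambda>i\<in>{..<n}. \<zero>\<^bsub>G\<^esub>)"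
  "x \<oplus>\<^bsub>tuples n G\<^esub> y = (\<lambda>i\<in>{..<n}. x i \<oplus>\<^bsub>G\<^esub> y i)"
  by (simp_all add: tuples_def)

lemma abelian_group_tuples:
  assumes "abelian_group G" shows "abelian_group (tuples n G)"
proof -
  interpret G: abelian_group G by fact
  show ?thesis
  proof (rule abelian_groupI)
    fix x assume "x \<in> carrier (tuples n G)"
    then show "\<exists>y\<in>carrier (tuples n G). y \<oplus>\<^bsub>tuples n G\<^esub> x = \<zero>\<^bsub>tuples n G\<^esub>"
      by (intro bexI[of _ "\<lambda>i\<in>{..<n}. \<ominus>\<^bsub>G\<^esub> x i"]) (auto simp: fun_eq_iff PiE_iff G.l_neg)
  qed (auto simp: fun_eq_iff PiE_iff G.a_ac extensional_def)
qed

definition unit_tuple :: "nat \<Rightarrow> ('a, 'm) ring_scheme \<Rightarrow> nat \<Rightarrow> 'a \<Rightarrow> nat \<Rightarrow> 'a" where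
  "unit_tuple n G i x = (\<lambda>j\<in>{..<n}. if j = i then x else \<zero>\<^bsub>G\<^esub>)"

lemma unit_tuple_closed:
  "abelian_group G \<Longrightarrow> x \<in> carrier G \<Longrightarrow> unit_tuple n G i x \<in> carrier (tuples n G)"
  by (auto simp: unit_tuple_def abelian_group_def abelian_monoid.zero_closed)

lemma character_tuples_component:
  assumes "abelian_group G" "character (tuples n G) \<chi>"
  shows "character G (\<lambda>x. \<chi> (unit_tuple n G i x))"
proof -
  interpret G: abelian_group G by fact
  have "\<chi> (unit_tuple n G i (x \<oplus>\<^bsub>G\<^esub> y)) = \<chi> (unit_tuple n G i x) + \<chi> (unit_tuple n G i y)"
    if "x \<in> carrier G" "y \<in> carrier G" for x y
  proof -
    have "unit_tuple n G i (x \<oplus>\<^bsub>G\<^esub> y) = unit_tuple n G i x \<oplus>\<^bsub>tuples n G\<^esub> unit_tuple n G i y"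
      using that by (auto simp: unit_tuple_def fun_eq_iff)
    then show ?thesis using characterD[OF assms(2)] unit_tuple_closed[OF assms(1)] that by metis
  qed
  then show ?thesis by (simp add: character_def)
qed

text \<open>Induction on the number of entries of w that are filled in, the others being 0. Together
  with \<open>character_tuples_component\<close> this identifies the dual of a power with the power
  of the dual.\<close>

lemma character_tuples_sum:
  assumes G: "abelian_group G" and \<chi>: "character (tuples n G) \<chi>" and w: "w \<in> carrier (tuples n G)"
  shows "\<chi> w = (\<Sum>i<n. \<chi> (unit_tuple n G i (w i)))"
proof -
  interpret G: abelian_group G by fact
  have wc: "w i \<in> carrier G" if "i < n" for i using w that by auto
  define W where "W k = (\<lambda>j\<in>{..<n}. if j < k then w j else \<zero>\<^bsub>G\<^esub>)" for k
  have Wc: "W k \<in> carrier (tuples n G)" for k using wc by (auto simp: W_def)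
  have "k \<le> n \<Longrightarrow> \<chi> (W k) = (\<Sum>i<k. \<chi> (unit_tuple n G i (w i)))" for k
  proof (induction k)
    case 0
    have "W 0 = \<zero>\<^bsub>tuples n G\<^esub>" by (simp add: W_def)
    then show ?case using character_zero[OF abelian_group_tuples[OF G] \<chi>] by (simp del: tuples_simps)
  next
    case (Suc k)
    have "W (Suc k) = W k \<oplus>\<^bsub>tuples n G\<^esub> unit_tuple n G k (w k)"
      using Suc wc by (auto simp: W_def unit_tuple_def fun_eq_iff less_Suc_eq)
    then have "\<chi> (W (Suc k)) = \<chi> (W k) + \<chi> (unit_tuple n G k (w k))"
      using characterD[OF \<chi> Wc unit_tuple_closed[OF G wc]] Suc by simp
    then show ?case using Suc by simp
  qed
  moreover have "W n = w" using w by (auto simp: W_def fun_eq_iff PiE_def extensional_def)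
  ultimately show ?thesis by auto
qed

section \<open>The equational criterion\<close>

text \<open>Equational criterion for flatness. If x were no combination, with coefficients in F, of
  solutions in R, some character of F^n would vanish on all such combinations but not on x. It
  induces a pairing of F with the right ideal generated by the r i, and an extension of this pairing
  to R shows that the character does vanish on x.\<close>

lemma (in universe_type) Flat_relation:
  fixes R :: "'u ring"
  assumes F: "F \<in> Flat R" and R: "small (carrier R)"
    and r: "\<And>i. i < n \<Longrightarrow> r i \<in> carrier R" and x: "\<And>i. i < n \<Longrightarrow> x i \<in> carrier F"
    and rel: "msum F (\<lambda>i. r i \<odot>\<^bsub>F\<^esub> x i) n = \<zero>\<^bsub>F\<^esub>"
  obtains m :: nat and s :: "nat \<Rightarrow> nat \<Rightarrow> 'u" and z :: "nat \<Rightarrow> 'u"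
  where "\<And>j i. j < m \<Longrightarrow> i < n \<Longrightarrow> s j i \<in> carrier R" "\<And>j. j < m \<Longrightarrow> z j \<in> carrier F"
    "\<And>j. j < m \<Longrightarrow> msum R (\<lambda>i. r i \<otimes>\<^bsub>R\<^esub> s j i) n = \<zero>\<^bsub>R\<^esub>"
    "\<And>i. i < n \<Longrightarrow> x i = msum F (\<lambda>j. s j i \<odot>\<^bsub>F\<^esub> z j) m"
proof -
  have Fm: "F \<in> Mods R" using F by (simp add: Flat_def)
  interpret F: left_module R F by (rule ModsD(1)[OF Fm])
  note Fg = F.M.abelian_group_axioms and Rg = F.R.abelian_group_axioms
  \<comment> \<open>The solutions in R; T collects the tuples over F that are combinations of
    them.\<close>
  define K where "K = {c. (\<forall>i<n. c i \<in> carrier R) \<and> msum R (\<lambda>i. r i \<otimes>\<^bsub>R\<^esub> c i) n = \<zero>\<^bsub>R\<^esub>}"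
  define T where "T = {w \<in> carrier (tuples n F). \<exists>m s z. (\<forall>j<m. s j \<in> K \<and> z j \<in> carrier F) \<and>
      (\<forall>i<n. w i = msum F (\<lambda>j. s j i \<odot>\<^bsub>F\<^esub> z j) m)}"
  have KR: "c i \<in> carrier R" if "c \<in> K" "i < n" for c i using that by (simp add: K_def)
  have TI: "w \<in> T" if "w \<in> carrier (tuples n F)" "\<And>j. j < m \<Longrightarrow> s j \<in> K" "\<And>j. j < m \<Longrightarrow> z j \<in> carrier F"
    "\<And>i. i < n \<Longrightarrow> w i = msum F (\<lambda>j. s j i \<odot>\<^bsub>F\<^esub> z j) m" for w m s z
    using that unfolding T_def by blast
  have TD: "\<exists>m s z. (\<forall>j<m. s j \<in> K) \<and> (\<forall>j<m. z j \<in> carrier F) \<and> (\<forall>i<n. w i = msum F (\<lambda>j. s j i \<odot>\<^bsub>F\<^esub> z j) m)"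
    if "w \<in> T" for w using that unfolding T_def by blast
  interpret W: abelian_group "tuples n F" by (rule abelian_group_tuples[OF Fg])
  define w where "w = (\<lambda>i\<in>{..<n}. x i)"
  have w: "w \<in> carrier (tuples n F)" using x by (auto simp: w_def)
  have "w \<in> T"
  proof (rule ccontr)
    assume "w \<notin> T"
    moreover have "T \<subseteq> carrier (tuples n F)" by (auto simp: T_def)
    moreover have "\<zero>\<^bsub>tuples n F\<^esub> \<in> T" by (rule TI[of _ 0 _ _]) auto
    moreover have "a \<oplus>\<^bsub>tuples n F\<^esub> b \<in> T" if ab: "a \<in> T" "b \<in> T" for a b
    proof -
      obtain m s z where a: "\<forall>j<m. s j \<in> K" "\<forall>j<m. z j \<in> carrier F" "\<forall>i<n. a i = msum F (\<lambda>j. s j i \<odot>\<^bsub>F\<^esub> z j) m"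
        using TD[OF ab(1)] by blast
      obtain m' s' z' where b: "\<forall>j<m'. s' j \<in> K" "\<forall>j<m'. z' j \<in> carrier F" "\<forall>i<n. b i = msum F (\<lambda>j. s' j i \<odot>\<^bsub>F\<^esub> z' j) m'"
        using TD[OF ab(2)] by blast
      show ?thesis
      proof (rule TI[of _ "m + m'" "\<lambda>j. if j < m then s j else s' (j - m)" "\<lambda>j. if j < m then z j else z' (j - m)"])
        show "a \<oplus>\<^bsub>tuples n F\<^esub> b \<in> carrier (tuples n F)"
          using ab by (intro W.a_closed) (auto simp: T_def)
        fix i assume i: "i < n"
        have "msum F (\<lambda>j. (if j < m then s j else s' (j - m)) i \<odot>\<^bsub>F\<^esub> (if j < m then z j else z' (j - m))) (m + m')
          = msum F (\<lambda>j. if j < m then s j i \<odot>\<^bsub>F\<^esub> z j else s' (j - m) i \<odot>\<^bsub>F\<^esub> z' (j - m)) (m + m')"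
          by (rule msum_cong) simp
        also have "\<dots> = msum F (\<lambda>j. s j i \<odot>\<^bsub>F\<^esub> z j) m \<oplus>\<^bsub>F\<^esub> msum F (\<lambda>j. s' j i \<odot>\<^bsub>F\<^esub> z' j) m'"
          by (rule msum_append[OF Fg]) (use a b KR i in \<open>auto intro: F.smult_closed\<close>)
        finally show "(a \<oplus>\<^bsub>tuples n F\<^esub> b) i = msum F (\<lambda>j. (if j < m then s j else s' (j - m)) i \<odot>\<^bsub>F\<^esub> (if j < m then z j else z' (j - m))) (m + m')"
          using a b i by simp
      qed (use a b in auto)
    qed
    moreover have "\<ominus>\<^bsub>tuples n F\<^esub> a \<in> T" if aT: "a \<in> T" for a
    proof -
      obtain m s z where a: "\<forall>j<m. s j \<in> K" "\<forall>j<m. z j \<in> carrier F" "\<forall>i<n. a i = msum F (\<lambda>j. s j i \<odot>\<^bsub>F\<^esub> z j) m"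
        using TD[OF aT] by blast
      have ac: "a \<in> carrier (tuples n F)" using aT by (simp add: T_def)
      define b where "b = (\<lambda>i\<in>{..<n}. msum F (\<lambda>j. s j i \<odot>\<^bsub>F\<^esub> \<ominus>\<^bsub>F\<^esub> z j) m)"
      have bc: "b \<in> carrier (tuples n F)"
        using a KR by (auto simp: b_def intro!: msum_closed[OF Fg] F.smult_closed)
      have "b \<in> T"
        by (rule TI[OF bc, of m s "\<lambda>j. \<ominus>\<^bsub>F\<^esub> z j"]) (use a in \<open>auto simp: b_def\<close>)
      moreover have "b \<oplus>\<^bsub>tuples n F\<^esub> a = \<zero>\<^bsub>tuples n F\<^esub>"
      proof -
        have "msum F (\<lambda>j. s j i \<odot>\<^bsub>F\<^esub> \<ominus>\<^bsub>F\<^esub> z j) m \<oplus>\<^bsub>F\<^esub> msum F (\<lambda>j. s j i \<odot>\<^bsub>F\<^esub> z j) m = \<zero>\<^bsub>F\<^esub>" if i: "i < n" for i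
        proof -
          have "msum F (\<lambda>j. s j i \<odot>\<^bsub>F\<^esub> \<ominus>\<^bsub>F\<^esub> z j) m \<oplus>\<^bsub>F\<^esub> msum F (\<lambda>j. s j i \<odot>\<^bsub>F\<^esub> z j) m
            = msum F (\<lambda>j. s j i \<odot>\<^bsub>F\<^esub> \<ominus>\<^bsub>F\<^esub> z j \<oplus>\<^bsub>F\<^esub> s j i \<odot>\<^bsub>F\<^esub> z j) m"
            by (rule msum_add[OF Fg, symmetric]) (use a KR i in \<open>auto intro: F.smult_closed\<close>)
          also have "\<dots> = msum F (\<lambda>j. \<zero>\<^bsub>F\<^esub>) m"
            by (rule msum_cong) (use a KR i in \<open>simp add: F.smult_r_distr[symmetric] F.M.l_neg\<close>)
          also have "\<dots> = \<zero>\<^bsub>F\<^esub>" by (induction m) auto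
          finally show ?thesis .
        qed
        then show ?thesis using a by (auto simp: b_def fun_eq_iff)
      qed
      ultimately show ?thesis using W.minus_equality[OF _ ac bc] by simp
    qed
    ultimately obtain \<chi> where \<chi>: "character (tuples n F) \<chi>" "\<And>t. t \<in> T \<Longrightarrow> \<chi> t = 0" "\<chi> w \<noteq> 0"
      using character_separates[OF W.abelian_group_axioms _ _ _ _ w, of T] by metis
    define X where "X i y = \<chi> (unit_tuple n F i y)" for i y
    have X: "character F (X i)" for i
      unfolding X_def by (rule character_tuples_component[OF Fg \<chi>(1)])
    have Xsum: "\<chi> v = (\<Sum>i<n. X i (v i))" if "v \<in> carrier (tuples n F)" for v
      using character_tuples_sum[OF Fg \<chi>(1) that] by (simp add: X_def)
    \<comment> \<open>The value of \<chi> at the tuple (c i y). It depends on c only through L c: if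
      L c = 0, then c lies in K and the tuple in T, where \<chi> vanishes.\<close>
    define V where "V c y = (\<Sum>i<n. X i (c i \<odot>\<^bsub>F\<^esub> y))" for c y
    define L where "L c = msum R (\<lambda>i. r i \<otimes>\<^bsub>R\<^esub> c i) n" for c
    define C where "C = {c. \<forall>i<n. c i \<in> carrier R}"
    have Cc: "c i \<in> carrier R" if "c \<in> C" "i < n" for c i using that by (simp add: C_def)
    have Lc: "L c \<in> carrier R" if "c \<in> C" for c
      unfolding L_def by (rule msum_closed[OF Rg]) (use that r Cc in auto)
    have Ladd: "L (\<lambda>i. c i \<oplus>\<^bsub>R\<^esub> c' i) = L c \<oplus>\<^bsub>R\<^esub> L c'" if "c \<in> C" "c' \<in> C" for c c'
    proof -
      have "L (\<lambda>i. c i \<oplus>\<^bsub>R\<^esub> c' i) = msum R (\<lambda>i. r i \<otimes>\<^bsub>R\<^esub> c i \<oplus>\<^bsub>R\<^esub> r i \<otimes>\<^bsub>R\<^esub> c' i) n"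
        unfolding L_def by (rule msum_cong) (use that r Cc in \<open>simp add: F.R.r_distr\<close>)
      also have "\<dots> = L c \<oplus>\<^bsub>R\<^esub> L c'"
        unfolding L_def by (rule msum_add[OF Rg]) (use that r Cc in auto)
      finally show ?thesis .
    qed
    have Lmult: "L (\<lambda>i. c i \<otimes>\<^bsub>R\<^esub> t) = L c \<otimes>\<^bsub>R\<^esub> t" if "c \<in> C" "t \<in> carrier R" for c t
    proof -
      have "L c \<otimes>\<^bsub>R\<^esub> t = msum R (\<lambda>i. (r i \<otimes>\<^bsub>R\<^esub> c i) \<otimes>\<^bsub>R\<^esub> t) n"
        unfolding L_def
        by (rule msum_additive[OF Rg Rg]) (use that r Cc in \<open>auto simp: additive_def F.R.l_distr\<close>)
      also have "\<dots> = L (\<lambda>i. c i \<otimes>\<^bsub>R\<^esub> t)"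
        unfolding L_def by (rule msum_cong) (use that r Cc in \<open>simp add: F.R.m_assoc\<close>)
      finally show ?thesis by simp
    qed
    have V0: "V c y = 0" if c: "c \<in> C" "L c = \<zero>\<^bsub>R\<^esub>" and y: "y \<in> carrier F" for c y
    proof -
      let ?v = "\<lambda>i\<in>{..<n}. c i \<odot>\<^bsub>F\<^esub> y"
      have v: "?v \<in> carrier (tuples n F)" using c y Cc by (auto intro: F.smult_closed)
      have "c \<in> K" using c unfolding K_def C_def L_def by simp
      then have "?v \<in> T"
        by (intro TI[OF v, of 1 "\<lambda>_. c" "\<lambda>_. y"]) (simp_all add: y Cc[OF c(1)] F.smult_closed)
      then have "\<chi> ?v = 0" by (rule \<chi>(2))
      then show ?thesis using Xsum[OF v] by (simp add: V_def)
    qed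
    have Vadd: "V (\<lambda>i. c i \<oplus>\<^bsub>R\<^esub> c' i) y = V c y + V c' y" if "c \<in> C" "c' \<in> C" "y \<in> carrier F" for c c' y
      unfolding V_def sum.distrib[symmetric]
      by (rule sum.cong) (use that Cc characterD[OF X] in \<open>simp_all add: F.smult_l_distr F.smult_closed\<close>)
    have Vindep: "V c y = V c' y" if c: "c \<in> C" "c' \<in> C" "L c = L c'" and y: "y \<in> carrier F" for c c' y
    proof -
      let ?d = "\<lambda>i. \<ominus>\<^bsub>R\<^esub> c' i"
      have d: "?d \<in> C" using c by (simp add: C_def)
      have z: "(\<lambda>i. c' i \<oplus>\<^bsub>R\<^esub> ?d i) \<in> C" "(\<lambda>i. c i \<oplus>\<^bsub>R\<^esub> ?d i) \<in> C" using c by (simp_all add: C_def)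
      have "L (\<lambda>i. c' i \<oplus>\<^bsub>R\<^esub> ?d i) = msum R (\<lambda>i. \<zero>\<^bsub>R\<^esub>) n"
        unfolding L_def by (rule msum_cong) (use Cc[OF c(2)] r in \<open>simp add: F.R.r_neg\<close>)
      also have "\<dots> = \<zero>\<^bsub>R\<^esub>" by (induction n) auto
      finally have L0: "L (\<lambda>i. c' i \<oplus>\<^bsub>R\<^esub> ?d i) = \<zero>\<^bsub>R\<^esub>" .
      then have "L (\<lambda>i. c i \<oplus>\<^bsub>R\<^esub> ?d i) = \<zero>\<^bsub>R\<^esub>" using Ladd c d by simp
      then have "V c y + V ?d y = 0" using V0[OF z(2) _ y] Vadd[OF c(1) d y] by simp
      moreover have "V c' y + V ?d y = 0" using V0[OF z(1) L0 y] Vadd[OF c(2) d y] by simp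
      ultimately show ?thesis by (metis add_right_cancel)
    qed
    \<comment> \<open>The right ideal generated by the r i, as a submodule of R over
      \<open>opp R\<close>.\<close>
    define I where "I = (regular (opp R))\<lparr>carrier := L ` C\<rparr>"
    interpret Rr: left_module "opp R" "regular (opp R)"
      by (rule left_module_regular[OF ring_opp[OF F.R.ring_axioms]])
    have Isimps: "carrier I = L ` C" "a \<oplus>\<^bsub>I\<^esub> b = a \<oplus>\<^bsub>R\<^esub> b" "\<zero>\<^bsub>I\<^esub> = \<zero>\<^bsub>R\<^esub>" "t \<odot>\<^bsub>I\<^esub> a = a \<otimes>\<^bsub>R\<^esub> t" for a b t
      by (simp_all add: I_def regular_def)
    have C0: "(\<lambda>i. \<zero>\<^bsub>R\<^esub>) \<in> C" by (simp add: C_def)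
    have C1: "(\<lambda>i. c i \<oplus>\<^bsub>R\<^esub> c' i) \<in> C" if "c \<in> C" "c' \<in> C" for c c' using that by (simp add: C_def)
    have C2: "(\<lambda>i. c i \<otimes>\<^bsub>R\<^esub> t) \<in> C" if "c \<in> C" "t \<in> carrier R" for c t using that by (simp add: C_def)
    have L0: "L (\<lambda>i. \<zero>\<^bsub>R\<^esub>) = \<zero>\<^bsub>R\<^esub>"
    proof -
      have "L (\<lambda>i. \<zero>\<^bsub>R\<^esub>) = L (\<lambda>i. \<zero>\<^bsub>R\<^esub> \<otimes>\<^bsub>R\<^esub> \<zero>\<^bsub>R\<^esub>)" by simp
      also have "\<dots> = \<zero>\<^bsub>R\<^esub>" using Lmult[OF C0, of "\<zero>\<^bsub>R\<^esub>"] Lc[OF C0] by simp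
      finally show ?thesis .
    qed
    have Iadd: "a \<oplus>\<^bsub>R\<^esub> b \<in> carrier I" if "a \<in> carrier I" "b \<in> carrier I" for a b
    proof -
      obtain c c' where c: "c \<in> C" "c' \<in> C" "a = L c" "b = L c'" using \<open>a \<in> carrier I\<close> \<open>b \<in> carrier I\<close> by (auto simp: Isimps)
      show ?thesis unfolding Isimps by (rule rev_image_eqI[OF C1[OF c(1,2)]]) (simp add: Ladd c)
    qed
    have Imult: "a \<otimes>\<^bsub>R\<^esub> t \<in> carrier I" if "a \<in> carrier I" "t \<in> carrier R" for a t
    proof -
      obtain c where c: "c \<in> C" "a = L c" using \<open>a \<in> carrier I\<close> by (auto simp: Isimps)
      show ?thesis unfolding Isimps by (rule rev_image_eqI[OF C2[OF c(1) that(2)]]) (simp add: Lmult c that)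
    qed
    have IR: "a \<in> carrier R" if "a \<in> carrier I" for a using that Lc by (auto simp: Isimps)
    have I: "left_module (opp R) I"
    proof (intro left_module.intro left_module_axioms.intro Rr.R.ring_axioms)
      show "abelian_group I"
      proof (rule abelian_groupI)
        fix a assume a: "a \<in> carrier I"
        have "a \<otimes>\<^bsub>R\<^esub> (\<ominus>\<^bsub>R\<^esub> \<one>\<^bsub>R\<^esub>) \<in> carrier I" by (rule Imult[OF a]) simp
        then show "\<exists>b\<in>carrier I. b \<oplus>\<^bsub>I\<^esub> a = \<zero>\<^bsub>I\<^esub>"
          using IR[OF a] by (intro bexI[of _ "a \<otimes>\<^bsub>R\<^esub> (\<ominus>\<^bsub>R\<^esub> \<one>\<^bsub>R\<^esub>)"]) (simp_all add: Isimps(2-) F.R.r_minus F.R.l_neg)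
      next
        show "\<zero>\<^bsub>I\<^esub> \<in> carrier I" unfolding Isimps by (rule rev_image_eqI[OF C0]) (simp add: L0)
      qed (use Iadd IR in \<open>auto simp: Isimps(2-) F.R.a_ac\<close>)
    qed (use Imult IR in \<open>auto simp: Isimps(2-) F.R.r_distr F.R.l_distr F.R.m_assoc\<close>)
    define cc where "cc a = (SOME c. c \<in> C \<and> L c = a)" for a
    have cc: "cc a \<in> C" "L (cc a) = a" if "a \<in> carrier I" for a
    proof -
      have "\<exists>c. c \<in> C \<and> L c = a" using that by (auto simp: Isimps)
      from someI_ex[OF this] show "cc a \<in> C" "L (cc a) = a" by (simp_all add: cc_def)
    qed
    have bal: "balanced R I F (\<lambda>a y. V (cc a) y)"
      unfolding balanced_def
    proof (intro conjI ballI)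
      fix a b y assume *: "a \<in> carrier I" "b \<in> carrier I" "y \<in> carrier F"
      have "V (cc (a \<oplus>\<^bsub>I\<^esub> b)) y = V (\<lambda>i. cc a i \<oplus>\<^bsub>R\<^esub> cc b i) y"
        using * cc Iadd C1 Ladd by (intro Vindep) (simp_all add: Isimps(2-))
      then show "V (cc (a \<oplus>\<^bsub>I\<^esub> b)) y = V (cc a) y + V (cc b) y" using Vadd cc * by simp
    next
      fix a y y' assume *: "a \<in> carrier I" "y \<in> carrier F" "y' \<in> carrier F"
      show "V (cc a) (y \<oplus>\<^bsub>F\<^esub> y') = V (cc a) y + V (cc a) y'"
        unfolding V_def sum.distrib[symmetric]
        by (rule sum.cong) (use * Cc[OF cc(1)] characterD[OF X] in \<open>simp_all add: F.smult_r_distr F.smult_closed\<close>)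
    next
      fix t a y assume *: "t \<in> carrier R" "a \<in> carrier I" "y \<in> carrier F"
      have "V (cc (t \<odot>\<^bsub>I\<^esub> a)) y = V (\<lambda>i. cc a i \<otimes>\<^bsub>R\<^esub> t) y"
        using * cc Imult C2 Lmult by (intro Vindep) (simp_all add: Isimps(2-))
      also have "\<dots> = V (cc a) (t \<odot>\<^bsub>F\<^esub> y)"
        unfolding V_def by (rule sum.cong) (use * Cc[OF cc(1)] in \<open>simp_all add: F.smult_assoc\<close>)
      finally show "V (cc (t \<odot>\<^bsub>I\<^esub> a)) y = V (cc a) (t \<odot>\<^bsub>F\<^esub> y)" .
    qed
    have sz: "small_sized U (carrier (regular (opp R)))" using small_sizedI[OF R] by simp
    have "carrier I \<subseteq> carrier (regular (opp R))" using IR by auto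
    then have szI: "small_sized U (carrier I)" by (rule small_sized_subset[OF sz])
    have inc: "linear (opp R) I (regular (opp R)) (\<lambda>a. a)"
      by (rule linearI) (use IR in \<open>auto simp: Isimps(2-)\<close>)
    obtain \<beta> where \<beta>: "balanced R (regular (opp R)) F \<beta>"
      "\<And>a y. a \<in> carrier I \<Longrightarrow> y \<in> carrier F \<Longrightarrow> \<beta> a y = V (cc a) y"
      using Flat_extend[OF F I szI Rr.left_module_axioms sz inc inj_on_id2 bal] by blast
    have \<beta>r: "\<beta> (r i) y = X i y" if i: "i < n" and y: "y \<in> carrier F" for i y
    proof -
      let ?e = "\<lambda>j. if j = i then \<one>\<^bsub>R\<^esub> else \<zero>\<^bsub>R\<^esub>"
      have e: "?e \<in> C" by (simp add: C_def)
      have "k \<le> n \<Longrightarrow> msum R (\<lambda>j. r j \<otimes>\<^bsub>R\<^esub> ?e j) k = (if i < k then r i else \<zero>\<^bsub>R\<^esub>)" for k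
        using r i by (induction k) (auto simp: less_Suc_eq)
      then have Le: "L ?e = r i" unfolding L_def using i by simp
      have rI: "r i \<in> carrier I" unfolding Isimps by (rule rev_image_eqI[OF e]) (simp only: Le)
      have "\<beta> (r i) y = V ?e y"
        using \<beta>(2)[OF rI y] Vindep[OF cc(1)[OF rI] e _ y] cc(2)[OF rI] Le by simp
      also have "\<dots> = (\<Sum>j<n. if j = i then X i y else 0)"
        unfolding V_def
        by (rule sum.cong) (use y character_zero[OF Fg X] in \<open>simp_all add: F.smult_one\<close>)
      also have "\<dots> = X i y" using i by simp
      finally show ?thesis .
    qed
    have one: "\<one>\<^bsub>R\<^esub> \<in> carrier (regular (opp R))" by simp
    \<comment> \<open>Once the pairing is defined on all of R, the r i can be moved across: \<Sum>
      \<beta>(r i, x i) = \<beta>(1, \<Sum> r i x i) = 0.\<close>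
    have "(\<Sum>i<n. \<beta> \<one>\<^bsub>R\<^esub> (r i \<odot>\<^bsub>F\<^esub> x i)) = \<beta> \<one>\<^bsub>R\<^esub> (msum F (\<lambda>i. r i \<odot>\<^bsub>F\<^esub> x i) n)"
      by (rule msum_character[OF Fg balanced_character_right[OF \<beta>(1) one], symmetric]) (use r x in \<open>simp add: F.smult_closed\<close>)
    also have "\<dots> = 0" unfolding rel by (rule balanced_zero(1)[OF Rr.left_module_axioms F.left_module_axioms \<beta>(1) one])
    finally have "(\<Sum>i<n. \<beta> \<one>\<^bsub>R\<^esub> (r i \<odot>\<^bsub>F\<^esub> x i)) = 0" .
    moreover have "(\<Sum>i<n. \<beta> \<one>\<^bsub>R\<^esub> (r i \<odot>\<^bsub>F\<^esub> x i)) = (\<Sum>i<n. X i (x i))"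
      by (rule sum.cong) (use balancedD(3)[OF \<beta>(1) r one x] r x \<beta>r in \<open>simp_all\<close>)
    moreover have "\<chi> w = (\<Sum>i<n. X i (x i))"
      unfolding Xsum[OF w] by (rule sum.cong) (simp_all add: w_def)
    ultimately show False using \<chi>(3) by simp
  qed
  then obtain m s z where *: "\<forall>j<m. s j \<in> K" "\<forall>j<m. z j \<in> carrier F" "\<forall>i<n. w i = msum F (\<lambda>j. s j i \<odot>\<^bsub>F\<^esub> z j) m"
    using TD by blast
  show ?thesis
    by (rule that[of m s z]) (use * in \<open>auto simp: K_def w_def\<close>)
qed

section \<open>Gorenstein flat modules\<close>

text \<open>Exactness is tested by characters: an element of the kernel outside the image is
  detected by a character that vanishes on the image, and such a character is required to come from
  N.\<close>

lemma tensor_exact_iff: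
  assumes E: "left_module (opp R) E" and L: "left_module R L" and M: "left_module R M" and N: "left_module R N"
    and u: "linear R L M u" and v: "linear R M N v" and vu: "\<And>y. y \<in> carrier L \<Longrightarrow> v (u y) = \<zero>\<^bsub>N\<^esub>"
  shows "tensor_map R E L E M (\<lambda>x. x) u ` carrier (tensor R E L) =
      kernel (tensor R E M) (tensor R E N) (tensor_map R E M E N (\<lambda>x. x) v) \<longleftrightarrow>
    (\<forall>\<gamma>. balanced R E M \<gamma> \<longrightarrow> (\<forall>a\<in>carrier E. \<forall>y\<in>carrier L. \<gamma> a (u y) = 0) \<longrightarrow>
      (\<exists>\<delta>. balanced R E N \<delta> \<and> (\<forall>a\<in>carrier E. \<forall>x\<in>carrier M. \<delta> a (v x) = \<gamma> a x)))"
    (is "?U ` _ = kernel _ _ ?V \<longleftrightarrow> ?dual")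
proof -
  interpret TL: tensor_pair R E L by (rule tensor_pair.intro[OF E L])
  interpret TM: tensor_pair R E M by (rule tensor_pair.intro[OF E M])
  interpret TN: tensor_pair R E N by (rule tensor_pair.intro[OF E N])
  note U = tensor_map_pure_additive[OF E L E M linear_id u]
  note V = tensor_map_pure_additive[OF E M E N linear_id v]
  note ag = TL.abelian_group_tensor TM.abelian_group_tensor TN.abelian_group_tensor
  interpret GM: abelian_group "tensor_group R E M" by (rule ag)
  have ker: "t \<in> kernel (tensor R E M) (tensor R E N) ?V \<longleftrightarrow> t \<in> carrier (tensor R E M) \<and> ?V t = \<one>\<^bsub>tensor R E N\<^esub>" for t
    by (simp add: kernel_def)
  show ?thesis
  proof
    assume eq: "?U ` carrier (tensor R E L) = kernel (tensor R E M) (tensor R E N) ?V"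
    show ?dual
    proof (intro allI impI)
      fix \<gamma> assume \<gamma>: "balanced R E M \<gamma>" and van: "\<forall>a\<in>carrier E. \<forall>y\<in>carrier L. \<gamma> a (u y) = 0"
      obtain \<chi> where \<chi>: "character (tensor_group R E M) \<chi>"
        "\<And>a x. a \<in> carrier E \<Longrightarrow> x \<in> carrier M \<Longrightarrow> \<chi> (tensor_pure R E M a x) = \<gamma> a x"
        by (rule TM.balanced_lift[OF \<gamma>]) blast
      have 0: "\<chi> (?U s) = 0" if "s \<in> carrier (tensor R E L)" for s
        by (rule TL.character_tensor_eqI[OF character_comp[OF U(1) \<chi>(1)] _ _ that, of "\<lambda>_. 0"])
          (use van in \<open>simp_all add: character_def U(2) \<chi>(2) linearD(1)[OF u]\<close>)
      have k: "\<chi> t = 0" if "t \<in> carrier (tensor_group R E M)" "?V t = \<zero>\<^bsub>tensor_group R E N\<^esub>" for t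
      proof -
        have "t \<in> ?U ` carrier (tensor R E L)" unfolding eq ker using that by simp
        then show ?thesis using 0 by blast
      qed
      obtain \<chi>' where \<chi>': "character (tensor_group R E N) \<chi>'"
        "\<And>t. t \<in> carrier (tensor_group R E M) \<Longrightarrow> \<chi>' (?V t) = \<chi> t"
        using character_factor[OF ag(2,3) V(1) \<chi>(1) k] by blast
      show "\<exists>\<delta>. balanced R E N \<delta> \<and> (\<forall>a\<in>carrier E. \<forall>x\<in>carrier M. \<delta> a (v x) = \<gamma> a x)"
        by (rule exI[of _ "\<lambda>a x. \<chi>' (tensor_pure R E N a x)"])
          (use TN.pure_balanced[OF \<chi>'(1)] \<chi>(2) \<chi>'(2) TM.pure_closed V(2)[symmetric] in simp)
    qed
  next
    assume dual: ?dual
    show "?U ` carrier (tensor R E L) = kernel (tensor R E M) (tensor R E N) ?V"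
    proof (intro equalityI subsetI)
      fix t assume "t \<in> ?U ` carrier (tensor R E L)"
      then obtain s where s: "s \<in> carrier (tensor R E L)" "t = ?U s" by blast
      have tc: "t \<in> carrier (tensor R E M)" using additiveD(1)[OF U(1)] s by simp
      have "?V (?U s) = \<zero>\<^bsub>tensor_group R E N\<^esub>"
      proof (rule character_eqI[OF ag(3)])
        fix \<chi> assume \<chi>: "character (tensor_group R E N) \<chi>"
        have "\<chi> (?V (?U s)) = 0"
          by (rule TL.character_tensor_eqI[OF character_comp[OF U(1) character_comp[OF V(1) \<chi>]] _ _ s(1), of "\<lambda>_. 0"])
            (simp_all add: character_def U(2) V(2) linearD(1)[OF u] vu balanced_zero[OF E N TN.pure_balanced[OF \<chi>]])
        then show "\<chi> (?V (?U s)) = \<chi> \<zero>\<^bsub>tensor_group R E N\<^esub>" using character_zero[OF ag(3) \<chi>] by simp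
      next
        show "?V (?U s) \<in> carrier (tensor_group R E N)"
          using additiveD(1)[OF V(1)] tc s by simp
        show "\<zero>\<^bsub>tensor_group R E N\<^esub> \<in> carrier (tensor_group R E N)"
          by (rule abelian_groupE(2)[OF ag(3)])
      qed
      then show "t \<in> kernel (tensor R E M) (tensor R E N) ?V" unfolding ker using tc s by simp
    next
      fix t assume "t \<in> kernel (tensor R E M) (tensor R E N) ?V"
      then have t: "t \<in> carrier (tensor R E M)" "?V t = \<one>\<^bsub>tensor R E N\<^esub>" by (simp_all add: ker)
      show "t \<in> ?U ` carrier (tensor R E L)"
      proof (rule ccontr)
        assume not: "t \<notin> ?U ` carrier (tensor R E L)"
        let ?T = "?U ` carrier (tensor R E L)"
        interpret GL: abelian_group "tensor_group R E L" by (rule ag)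
        have T1: "?T \<subseteq> carrier (tensor_group R E M)" using additiveD(1)[OF U(1)] by auto
        have T2: "\<zero>\<^bsub>tensor_group R E M\<^esub> \<in> ?T"
          using additive_zero[OF ag(1,2) U(1)] GL.zero_closed by (metis imageI tensor_group_simps(1))
        have T3: "x \<oplus>\<^bsub>tensor_group R E M\<^esub> y \<in> ?T" if xy: "x \<in> ?T" "y \<in> ?T" for x y
        proof -
          obtain a b where "a \<in> carrier (tensor R E L)" "b \<in> carrier (tensor R E L)" "x = ?U a" "y = ?U b"
            using xy by blast
          then show ?thesis using additiveD(2)[OF U(1), of a b] GL.a_closed[of a b]
            by (metis imageI tensor_group_simps(1))
        qed
        have T4: "\<ominus>\<^bsub>tensor_group R E M\<^esub> x \<in> ?T" if x: "x \<in> ?T" for x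
        proof -
          obtain a where "a \<in> carrier (tensor R E L)" "x = ?U a" using x by blast
          then show ?thesis using additive_inv[OF ag(1,2) U(1), of a] GL.a_inv_closed[of a]
            by (metis imageI tensor_group_simps(1))
        qed
        obtain \<chi> where \<chi>: "character (tensor_group R E M) \<chi>" "\<And>s. s \<in> ?T \<Longrightarrow> \<chi> s = 0" "\<chi> t \<noteq> 0"
          using character_separates[OF ag(2) T1 T2 T3 T4 _ not] t by auto
        let ?\<gamma> = "\<lambda>a x. \<chi> (tensor_pure R E M a x)"
        have "?\<gamma> a (u y) = 0" if "a \<in> carrier E" "y \<in> carrier L" for a y
          using \<chi>(2) U(2)[OF that] TL.pure_closed[OF that] by (metis imageI)
        then obtain \<delta> where \<delta>: "balanced R E N \<delta>" "\<And>a x. a \<in> carrier E \<Longrightarrow> x \<in> carrier M \<Longrightarrow> \<delta> a (v x) = ?\<gamma> a x"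
          using dual TM.pure_balanced[OF \<chi>(1)] by blast
        obtain \<chi>' where \<chi>': "character (tensor_group R E N) \<chi>'"
          "\<And>a x. a \<in> carrier E \<Longrightarrow> x \<in> carrier N \<Longrightarrow> \<chi>' (tensor_pure R E N a x) = \<delta> a x"
          by (rule TN.balanced_lift[OF \<delta>(1)]) blast
        have "\<chi>' (?V t) = \<chi> t"
          by (rule TM.character_tensor_eqI[OF character_comp[OF V(1) \<chi>'(1)] \<chi>(1) _ t(1)])
            (simp add: V(2) \<chi>'(2) \<delta>(2) linearD(1)[OF v])
        moreover have "\<chi>' (?V t) = 0" using character_zero[OF ag(3) \<chi>'(1)] t(2) by simp
        ultimately show False using \<chi>(3) by simp
      qed
    qed
  qed
qed

text \<open>The part of the complex around P = Z_0 that is needed: the term at 1 maps onto P, and P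
  maps by \<iota> into the term at 0. The last clause, dually the injectivity of E \<otimes> P -> E
  \<otimes> G for injective E, comes from exactness of the tensored complex at place 1: pulled back
  to that place, a pairing with P vanishes on boundaries.\<close>

lemma GFlat_resolution:
  assumes P: "P \<in> GFlat R"
  obtains F q G \<iota> where "F \<in> Flat R" "q \<in> Hom R F P" "q ` carrier F = carrier P"
    "G \<in> Flat R" "linear R P G \<iota>"
    "\<And>E \<gamma>. E \<in> Injective (opp R) \<Longrightarrow> balanced R E P \<gamma> \<Longrightarrow>
      \<exists>\<delta>. balanced R E G \<delta> \<and> (\<forall>a\<in>carrier E. \<forall>x\<in>carrier P. \<delta> a (\<iota> x) = \<gamma> a x)"
proof -
  obtain F d \<phi> where cx: "acyclic_flat_complex R F d" and ta: "\<And>E. E \<in> Injective (opp R) \<Longrightarrow> tensor_acyclic R E F d"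
    and \<phi>: "\<phi> \<in> Hom R P (cycles0 F d)" "bij_betw \<phi> (carrier P) (carrier (cycles0 F d))"
    using P unfolding GFlat_def mod_iso_def by blast
  have Pm: "P \<in> Mods R" using P by (simp add: GFlat_def)
  have F: "F n \<in> Flat R" and d: "d n \<in> Hom R (F n) (F (n - 1))"
    and ex: "d (n + 1) ` carrier (F (n + 1)) = a_kernel (F n) (F (n - 1)) (d n)" for n
    using cx by (auto simp: acyclic_flat_complex_def)
  have Fm: "left_module R (F n)" for n using F[of n] by (simp add: Flat_def ModsD)
  have d1: "linear R (F 1) (F 0) (d 1)" and d2: "linear R (F 2) (F 1) (d 2)"
    using Hom_linear[OF d[of 1]] Hom_linear[OF d[of 2]] by simp_all
  have Z: "carrier (cycles0 F d) = d 1 ` carrier (F 1)"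
    using ex[of 0] by (simp add: cycles0_def)
  have dd: "d 1 (d 2 y) = \<zero>\<^bsub>F 0\<^esub>" if "y \<in> carrier (F 2)" for y
  proof -
    have "d 2 y \<in> a_kernel (F 1) (F (1 - 1)) (d 1)" using ex[of 1] that by auto
    then show ?thesis by (simp add: a_kernel_iff)
  qed
  have \<phi>0: "linear R P (F 0) \<phi>"
    using Hom_linear[OF \<phi>(1)] by (auto simp: linear_def additive_def cycles0_def a_kernel_iff Pi_def)
  \<comment> \<open>The differential d 1 takes values in the cycles at 0, which are identified with
    P by \<phi>.\<close>
  define q where "q = (\<lambda>y\<in>carrier (F 1). inv_into (carrier P) \<phi> (d 1 y))"
  have q: "q y \<in> carrier P" "\<phi> (q y) = d 1 y" if "y \<in> carrier (F 1)" for y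
    using that \<phi>(2) Z unfolding q_def by (auto simp: bij_betw_def inv_into_into f_inv_into_f)
  have inj: "x = y" if "x \<in> carrier P" "y \<in> carrier P" "\<phi> x = \<phi> y" for x y
    using \<phi>(2) that by (auto simp: bij_betw_def inj_on_def)
  interpret P: left_module R P by (rule ModsD(1)[OF Pm])
  note [simp] = left_module_closed[OF Fm] P.smult_closed
  have ql: "linear R (F 1) P q"
  proof (rule linearI)
    fix x y assume xy: "x \<in> carrier (F 1)" "y \<in> carrier (F 1)"
    show "q (x \<oplus>\<^bsub>F 1\<^esub> y) = q x \<oplus>\<^bsub>P\<^esub> q y"
      by (rule inj) (simp_all add: xy q linearD(2)[OF d1] linearD(2)[OF \<phi>0])
  next
    fix r x assume rx: "r \<in> carrier R" "x \<in> carrier (F 1)"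
    show "q (r \<odot>\<^bsub>F 1\<^esub> x) = r \<odot>\<^bsub>P\<^esub> q x"
      by (rule inj) (simp_all add: rx q linearD(3)[OF d1] linearD(3)[OF \<phi>0])
  qed (rule q)
  then have qH: "q \<in> Hom R (F 1) P" by (rule linear_Hom) (simp add: q_def)
  have surj: "\<exists>y\<in>carrier (F 1). q y = x \<and> \<phi> x = d 1 y" if x: "x \<in> carrier P" for x
  proof -
    have "\<phi> x \<in> d 1 ` carrier (F 1)" using linearD(1)[OF Hom_linear[OF \<phi>(1)] x] Z by blast
    then obtain y where y: "y \<in> carrier (F 1)" "\<phi> x = d 1 y" by blast
    have "q y = x" by (rule inj[OF _ x]) (simp_all add: q y)
    then show ?thesis using y by blast
  qed
  show ?thesis
  proof (rule that[OF F qH _ F \<phi>0])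
    show "q ` carrier (F 1) = carrier P" using q(1) surj by blast
    fix E \<gamma> assume E: "E \<in> Injective (opp R)" and \<gamma>: "balanced R E P \<gamma>"
    have Em: "left_module (opp R) E" using E by (simp add: Injective_def ModsD)
    have "tensor_map R E (F (1 + 1)) E (F 1) (\<lambda>x. x) (d (1 + 1)) ` carrier (tensor R E (F (1 + 1))) =
        kernel (tensor R E (F 1)) (tensor R E (F (1 - 1))) (tensor_map R E (F 1) E (F (1 - 1)) (\<lambda>x. x) (d 1))"
      using ta[OF E] unfolding tensor_acyclic_def by blast
    then have ex1: "tensor_map R E (F 2) E (F 1) (\<lambda>x. x) (d 2) ` carrier (tensor R E (F 2)) =
        kernel (tensor R E (F 1)) (tensor R E (F 0)) (tensor_map R E (F 1) E (F 0) (\<lambda>x. x) (d 1))"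
      by simp
    have bal: "balanced R E (F 1) (\<lambda>a y. \<gamma> a (q y))"
      using \<gamma> ql by (auto simp: balanced_def linear_def additive_def Pi_def)
    have van: "\<gamma> a (q (d 2 y)) = 0" if "a \<in> carrier E" "y \<in> carrier (F 2)" for a y
    proof -
      have "q (d 2 y) = \<zero>\<^bsub>P\<^esub>"
        by (rule inj)
          (simp_all add: q linearD(1)[OF d2] that dd linear_zero[OF P.left_module_axioms Fm \<phi>0])
      then show ?thesis using balanced_zero(1)[OF Em P.left_module_axioms \<gamma> that(1)] by simp
    qed
    have "\<exists>\<delta>. balanced R E (F 0) \<delta> \<and> (\<forall>a\<in>carrier E. \<forall>y\<in>carrier (F 1). \<delta> a (d 1 y) = \<gamma> a (q y))"
      using iffD1[OF tensor_exact_iff[OF Em Fm Fm Fm d2 d1 dd] ex1, rule_format, OF _ bal] van by simp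
    then obtain \<delta> where \<delta>: "balanced R E (F 0) \<delta>"
      "\<And>a y. a \<in> carrier E \<Longrightarrow> y \<in> carrier (F 1) \<Longrightarrow> \<delta> a (d 1 y) = \<gamma> a (q y)"
      by blast
    have "\<delta> a (\<phi> x) = \<gamma> a x" if "a \<in> carrier E" "x \<in> carrier P" for a x
      using surj[OF that(2)] \<delta>(2)[OF that(1)] by auto
    then show "\<exists>\<delta>. balanced R E (F 0) \<delta> \<and> (\<forall>a\<in>carrier E. \<forall>x\<in>carrier P. \<delta> a (\<phi> x) = \<gamma> a x)"
      using \<delta>(1) by blast
  qed
qed

section \<open>Zero modules, and flat modules as Gorenstein flat ones\<close>

definition zero_module :: "('r, 'a) module \<Rightarrow> ('r, 'a) module" where
  "zero_module M = M\<lparr>carrier := {\<zero>\<^bsub>M\<^esub>}\<rparr>"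

lemma zero_module_simps [simp]:
  "carrier (zero_module M) = {\<zero>\<^bsub>M\<^esub>}" "\<zero>\<^bsub>zero_module M\<^esub> = \<zero>\<^bsub>M\<^esub>"
  "x \<oplus>\<^bsub>zero_module M\<^esub> y = x \<oplus>\<^bsub>M\<^esub> y" "r \<odot>\<^bsub>zero_module M\<^esub> x = r \<odot>\<^bsub>M\<^esub> x"
  by (simp_all add: zero_module_def)

lemma left_module_zero_module:
  assumes "left_module R M" shows "left_module R (zero_module M)"
proof -
  interpret M: left_module R M by fact
  have "abelian_group (zero_module M)"
    by (rule abelian_groupI) auto
  then show ?thesis
    by (intro left_module.intro left_module_axioms.intro M.R.ring_axioms) auto
qed

lemma (in universe_type) zero_module_Mods:
  fixes M :: "('u, 'u) module"
  shows "M \<in> Mods R \<Longrightarrow> zero_module M \<in> Mods R"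
  by (simp add: Mods_def left_module_zero_module small_finite)

lemma (in universe_type) zero_module_Flat:
  fixes M :: "('u, 'u) module"
  assumes M: "M \<in> Mods R" shows "zero_module M \<in> Flat R"
  unfolding Flat_iff[OF zero_module_Mods[OF M]]
proof (intro ballI allI impI)
  fix A B f \<beta> assume A: "A \<in> Mods (opp R)" and \<beta>: "balanced R A (zero_module M) \<beta>"
  have "\<beta> a \<zero>\<^bsub>M\<^esub> = 0" if "a \<in> carrier A" for a
    using balanced_zero(1)[OF ModsD(1)[OF A] left_module_zero_module[OF ModsD(1)[OF M]] \<beta> that] by simp
  then show "\<exists>\<beta>'. balanced R B (zero_module M) \<beta>' \<and>
      (\<forall>a\<in>carrier A. \<forall>x\<in>carrier (zero_module M). \<beta>' (f a) x = \<beta> a x)"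
    by (intro exI[of _ "\<lambda>_ _. 0"]) (simp add: balanced_def)
qed

lemma (in universe_type) zero_module_Pure_Injective:
  fixes M :: "('u, 'u) module"
  assumes M: "M \<in> Mods R" shows "zero_module M \<in> Pure_Injective R"
  unfolding Pure_Injective_def
proof (intro CollectI conjI ballI allI impI zero_module_Mods[OF M])
  fix A B :: "('u, 'u) module" and i g
  assume B: "B \<in> Mods R" and g: "g \<in> Hom R A (zero_module M)" and i: "pure_mono R A B i"
  interpret M: left_module R M by (rule ModsD(1)[OF M])
  have "linear R B (zero_module M) (\<lambda>_. \<zero>\<^bsub>M\<^esub>)" by (rule linearI) simp_all
  then have h: "(\<lambda>x\<in>carrier B. \<zero>\<^bsub>M\<^esub>) \<in> Hom R B (zero_module M)"
    by (rule linear_restrict_Hom[OF ModsD(1)[OF B]])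
  have "i x \<in> carrier B" if "x \<in> carrier A" for x
    using i that linearD(1)[OF Hom_linear] by (auto simp: pure_mono_def)
  moreover have "g x = \<zero>\<^bsub>M\<^esub>" if "x \<in> carrier A" for x
    using linearD(1)[OF Hom_linear[OF g] that] by simp
  ultimately have "compose (carrier A) (\<lambda>x\<in>carrier B. \<zero>\<^bsub>M\<^esub>) i = g"
    using Hom_extensional[OF g] by (intro extensionalityI[of _ "carrier A"]) (simp_all add: compose_def)
  then show "\<exists>h\<in>Hom R B (zero_module M). compose (carrier A) h i = g" using h by blast
qed

text \<open>The witness is the contractible complex with F in places 1 and 0, the identity between
  them and zero elsewhere; it stays exact under tensor products, and its cycles at 0 are F.\<close>

lemma (in universe_type) Flat_GFlat:
  fixes R :: "'u ring"
  assumes F: "F \<in> Flat R" shows "F \<in> GFlat R"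
proof -
  have Fm: "F \<in> Mods R" using F by (simp add: Flat_def)
  interpret F: left_module R F by (rule ModsD(1)[OF Fm])
  define G where "G = (\<lambda>n :: int. if n = 0 \<or> n = 1 then F else zero_module F)"
  define d where "d = (\<lambda>n :: int. if n = 1 then (\<lambda>x\<in>carrier F. x) else (\<lambda>x\<in>carrier (G n). \<zero>\<^bsub>F\<^esub>))"
  have G0: "\<zero>\<^bsub>G n\<^esub> = \<zero>\<^bsub>F\<^esub>" "\<zero>\<^bsub>F\<^esub> \<in> carrier (G n)" for n by (simp_all add: G_def)
  have GF: "G n \<in> Flat R" for n using F zero_module_Flat[OF Fm] by (simp add: G_def)
  then have Gm: "left_module R (G n)" for n by (simp add: Flat_def ModsD)
  have dl: "d n \<in> Hom R (G n) (G (n - 1))" for n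
  proof (cases "n = 1")
    case True
    then show ?thesis using linear_restrict_Hom[OF F.left_module_axioms linear_id] by (simp add: G_def d_def)
  next
    case False
    have "linear R (G n) (G (n - 1)) (\<lambda>_. \<zero>\<^bsub>F\<^esub>)"
      by (rule linearI) (auto simp: G_def)
    then show ?thesis using linear_restrict_Hom[OF Gm] False by (simp add: d_def)
  qed
  have ex: "d (n + 1) ` carrier (G (n + 1)) = a_kernel (G n) (G (n - 1)) (d n)" for n
  proof -
    consider "n = 0" | "n = 1" | "n \<noteq> 0" "n \<noteq> 1" by blast
    then show ?thesis
    proof cases
      case 1
      then show ?thesis by (auto simp: d_def G_def a_kernel_iff)
    next
      case 2
      then show ?thesis by (auto simp: d_def G_def a_kernel_iff)
    next
      case 3
      then have "carrier (G n) = {\<zero>\<^bsub>F\<^esub>}" by (simp add: G_def)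
      moreover have "d (n + 1) ` carrier (G (n + 1)) = {\<zero>\<^bsub>F\<^esub>}"
        using 3 G0(2)[of "n + 1"] by (auto simp: d_def)
      moreover have "d n \<zero>\<^bsub>F\<^esub> = \<zero>\<^bsub>F\<^esub>" using 3 G0(2)[of n] by (simp add: d_def)
      ultimately show ?thesis by (auto simp: a_kernel_iff G0(1))
    qed
  qed
  have "acyclic_flat_complex R G d" unfolding acyclic_flat_complex_def using GF dl ex by blast
  moreover have "tensor_acyclic R E G d" if E: "E \<in> Injective (opp R)" for E
    unfolding tensor_acyclic_def
  proof
    fix n :: int
    have Em: "left_module (opp R) E" using E by (simp add: Injective_def ModsD)
    have d1: "linear R (G (n + 1)) (G n) (d (n + 1))" using Hom_linear[OF dl[of "n + 1"]] by simp
    have dd: "d n (d (n + 1) y) = \<zero>\<^bsub>G (n - 1)\<^esub>" if "y \<in> carrier (G (n + 1))" for y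
      using ex[of n] that by (auto simp: a_kernel_iff)
    show "tensor_map R E (G (n + 1)) E (G n) (\<lambda>x. x) (d (n + 1)) ` carrier (tensor R E (G (n + 1))) =
        kernel (tensor R E (G n)) (tensor R E (G (n - 1))) (tensor_map R E (G n) E (G (n - 1)) (\<lambda>x. x) (d n))"
    proof (rule iffD2[OF tensor_exact_iff[OF Em Gm Gm Gm d1 Hom_linear[OF dl[of n]] dd]], assumption, intro allI impI)
      fix \<gamma> assume \<gamma>: "balanced R E (G n) \<gamma>"
        and van: "\<forall>a\<in>carrier E. \<forall>y\<in>carrier (G (n + 1)). \<gamma> a (d (n + 1) y) = 0"
      show "\<exists>\<delta>. balanced R E (G (n - 1)) \<delta> \<and> (\<forall>a\<in>carrier E. \<forall>x\<in>carrier (G n). \<delta> a (d n x) = \<gamma> a x)"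
      proof (cases "n = 1")
        case True
        then show ?thesis using \<gamma> by (intro exI[of _ \<gamma>]) (simp add: G_def d_def)
      next
        case False
        have "\<gamma> a x = 0" if "a \<in> carrier E" "x \<in> carrier (G n)" for a x
        proof (cases "n = 0")
          case True
          then show ?thesis using van that by (simp add: G_def d_def)
        next
          case False2: False
          then have "x = \<zero>\<^bsub>G n\<^esub>" using that False by (simp add: G_def)
          then show ?thesis using balanced_zero(1)[OF Em Gm \<gamma> that(1)] by simp
        qed
        then show ?thesis by (intro exI[of _ "\<lambda>_ _. 0"]) (simp add: balanced_def)
      qed
    qed
  qed
  moreover have "mod_iso R F (cycles0 G d)"
  proof -
    have c: "carrier (cycles0 G d) = carrier F" by (auto simp: cycles0_def a_kernel_iff G_def d_def)
    have "(\<lambda>x\<in>carrier F. x) \<in> Hom R F (cycles0 G d)"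
      by (rule linear_restrict_Hom[OF F.left_module_axioms], rule linearI, unfold c)
        (simp_all add: cycles0_def G_def)
    moreover have "bij_betw (\<lambda>x\<in>carrier F. x) (carrier F) (carrier (cycles0 G d))"
      unfolding c by (auto simp: bij_betw_def inj_on_def)
    ultimately show ?thesis unfolding mod_iso_def by blast
  qed
  ultimately show ?thesis using Fm unfolding GFlat_def by blast
qed

section \<open>Powers of flat modules\<close>

definition power_module :: "'i set \<Rightarrow> ('r, 'a) module \<Rightarrow> ('r, 'i \<Rightarrow> 'a) module" where
  "power_module I M = \<lparr>carrier = I \<rightarrow>\<^sub>E carrier M, monoid.mult = undefined, one = undefined,
     ring.zero = (\<lambda>i\<in>I. \<zero>\<^bsub>M\<^esub>), ring.add = (\<lambda>x y. \<lambda>i\<in>I. x i \<oplus>\<^bsub>M\<^esub> y i),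
     smult = (\<lambda>r x. \<lambda>i\<in>I. r \<odot>\<^bsub>M\<^esub> x i)\<rparr>"

lemma power_module_simps [simp]:
  "carrier (power_module I M) = I \<rightarrow>\<^sub>E carrier M" "\<zero>\<^bsub>power_module I M\<^esub> = (\<lambda>i\<in>I. \<zero>\<^bsub>M\<^esub>)"
  "x \<oplus>\<^bsub>power_module I M\<^esub> y = (\<lambda>i\<in>I. x i \<oplus>\<^bsub>M\<^esub> y i)"
  "r \<odot>\<^bsub>power_module I M\<^esub> x = (\<lambda>i\<in>I. r \<odot>\<^bsub>M\<^esub> x i)"
  by (simp_all add: power_module_def)

lemma left_module_power_module:
  assumes "left_module R M" shows "left_module R (power_module I M)"
proof -
  interpret M: left_module R M by fact
  let ?P = "power_module I M"
  have c: "x i \<in> carrier M" if "x \<in> carrier ?P" "i \<in> I" for x i using that by auto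
  have ext: "(\<lambda>i\<in>I. f i) = x" if "x \<in> carrier ?P" "\<And>i. i \<in> I \<Longrightarrow> f i = x i" for f x
    by (rule extensionalityI[of _ I]) (use that in \<open>auto simp: PiE_def\<close>)
  have "abelian_group ?P"
  proof (rule abelian_groupI)
    fix x y z assume x: "x \<in> carrier ?P" and y: "y \<in> carrier ?P"
    show "x \<oplus>\<^bsub>?P\<^esub> y \<in> carrier ?P" using c[OF x] c[OF y] by auto
    show "x \<oplus>\<^bsub>?P\<^esub> y = y \<oplus>\<^bsub>?P\<^esub> x"
      unfolding power_module_simps by (rule restrict_ext) (use c[OF x] c[OF y] M.M.a_comm in blast)
    assume z: "z \<in> carrier ?P"
    show "x \<oplus>\<^bsub>?P\<^esub> y \<oplus>\<^bsub>?P\<^esub> z = x \<oplus>\<^bsub>?P\<^esub> (y \<oplus>\<^bsub>?P\<^esub> z)"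
      unfolding power_module_simps
      by (rule restrict_ext) (use c[OF x] c[OF y] c[OF z] M.M.a_assoc in simp)
  next
    fix x assume x: "x \<in> carrier ?P"
    show "\<zero>\<^bsub>?P\<^esub> \<oplus>\<^bsub>?P\<^esub> x = x"
      unfolding power_module_simps by (rule ext[OF x]) (use c[OF x] in simp)
    show "\<exists>y\<in>carrier ?P. y \<oplus>\<^bsub>?P\<^esub> x = \<zero>\<^bsub>?P\<^esub>"
    proof (rule bexI[of _ "\<lambda>i\<in>I. \<ominus>\<^bsub>M\<^esub> x i"])
      show "(\<lambda>i\<in>I. \<ominus>\<^bsub>M\<^esub> x i) \<oplus>\<^bsub>?P\<^esub> x = \<zero>\<^bsub>?P\<^esub>"
        unfolding power_module_simps by (rule restrict_ext) (use c[OF x] in \<open>simp add: M.l_neg\<close>)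
    qed (use c[OF x] in auto)
  qed auto
  then show ?thesis
  proof (intro left_module.intro left_module_axioms.intro M.R.ring_axioms)
    fix a x assume a: "a \<in> carrier R" and x: "x \<in> carrier ?P"
    show "a \<odot>\<^bsub>?P\<^esub> x \<in> carrier ?P" using a c[OF x] by (auto intro: M.smult_closed)
    fix b assume b: "b \<in> carrier R"
    show "(a \<oplus>\<^bsub>R\<^esub> b) \<odot>\<^bsub>?P\<^esub> x = a \<odot>\<^bsub>?P\<^esub> x \<oplus>\<^bsub>?P\<^esub> b \<odot>\<^bsub>?P\<^esub> x"
      unfolding power_module_simps
      by (rule restrict_ext) (use a b c[OF x] in \<open>simp add: M.smult_l_distr\<close>)
    show "(a \<otimes>\<^bsub>R\<^esub> b) \<odot>\<^bsub>?P\<^esub> x = a \<odot>\<^bsub>?P\<^esub> (b \<odot>\<^bsub>?P\<^esub> x)"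
      unfolding power_module_simps
      by (rule restrict_ext) (use a b c[OF x] in \<open>simp add: M.smult_assoc\<close>)
  next
    fix a x y assume a: "a \<in> carrier R" and x: "x \<in> carrier ?P" and y: "y \<in> carrier ?P"
    show "a \<odot>\<^bsub>?P\<^esub> (x \<oplus>\<^bsub>?P\<^esub> y) = a \<odot>\<^bsub>?P\<^esub> x \<oplus>\<^bsub>?P\<^esub> a \<odot>\<^bsub>?P\<^esub> y"
      unfolding power_module_simps
      by (rule restrict_ext) (use a c[OF x] c[OF y] in \<open>simp add: M.smult_r_distr\<close>)
  next
    fix x assume x: "x \<in> carrier ?P"
    show "\<one>\<^bsub>R\<^esub> \<odot>\<^bsub>?P\<^esub> x = x"
      unfolding power_module_simps by (rule ext[OF x]) (use c[OF x] in \<open>simp add: M.smult_one\<close>)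
  qed
qed

text \<open>Here definability of \<open>GFlat R\<close> enters, through closure under products. P is
  a copy of the power F^I inside the universe; the last two clauses say that \<pi> identifies it
  with the families indexed by I.\<close>

lemma (in universe_type) Flat_power_GFlat:
  fixes R :: "'u ring" and I :: "'u set"
  assumes def: "definable R (GFlat R)" and F: "F \<in> Flat R" and I: "small I"
  obtains P \<pi> where "P \<in> GFlat R" "\<And>i. i \<in> I \<Longrightarrow> \<pi> i \<in> Hom R P F"
    "\<And>x. (\<And>i. i \<in> I \<Longrightarrow> x i \<in> carrier F) \<Longrightarrow> \<exists>y\<in>carrier P. \<forall>i\<in>I. \<pi> i y = x i"
    "\<And>y y'. y \<in> carrier P \<Longrightarrow> y' \<in> carrier P \<Longrightarrow> (\<And>i. i \<in> I \<Longrightarrow> \<pi> i y = \<pi> i y') \<Longrightarrow> y = y'"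
proof -
  have Fm: "F \<in> Mods R" using F by (simp add: Flat_def)
  interpret F: left_module R F by (rule ModsD(1)[OF Fm])
  note pm = left_module_power_module[OF F.left_module_axioms, of I]
  have "small_sized U (carrier (power_module I F))"
    using small_sized_PiE[OF small_sizedI[OF I] small_sizedI[OF ModsD(2)[OF Fm]]] by simp
  then have "small_sized TYPE('u) (carrier (power_module I F))" unfolding small_sized_def .
  then obtain P :: "('u, 'u) module" and e d where P: "P \<in> Mods R" "linear R (power_module I F) P e"
    "linear R P (power_module I F) d" "\<And>x. x \<in> carrier (power_module I F) \<Longrightarrow> d (e x) = x"
    "\<And>y. y \<in> carrier P \<Longrightarrow> e (d y) = y"
    by (rule transport_small[OF pm]) blast
  define \<pi> where "\<pi> i = (\<lambda>y\<in>carrier P. d y i)" for i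
  have \<pi>: "\<pi> i \<in> Hom R P F" if i: "i \<in> I" for i
  proof -
    have "linear R (power_module I F) F (\<lambda>x. x i)"
      by (rule linearI) (use i in \<open>auto simp: power_module_def\<close>)
    then show ?thesis
      unfolding \<pi>_def by (intro linear_restrict_Hom[OF ModsD(1)[OF P(1)]] linear_comp[OF P(3)])
  qed
  have dext: "d y \<in> extensional I" "i \<in> I \<Longrightarrow> d y i \<in> carrier F" if "y \<in> carrier P" for y i
    using linearD(1)[OF P(3) that] by (auto simp: power_module_def PiE_def)
  have joint: "y = y'" if "y \<in> carrier P" "y' \<in> carrier P" "\<And>i. i \<in> I \<Longrightarrow> \<pi> i y = \<pi> i y'" for y y'
  proof -
    have "d y = d y'" using that dext by (intro extensionalityI[of _ I]) (auto simp: \<pi>_def)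
    then show ?thesis using P(5) that by metis
  qed
  have surj: "\<exists>y\<in>carrier P. \<forall>i\<in>I. \<pi> i y = x i" if "\<And>i. i \<in> I \<Longrightarrow> x i \<in> carrier F" for x
  proof -
    have "restrict x I \<in> carrier (power_module I F)" using that by (auto simp: power_module_def)
    then show ?thesis
      using P(4) linearD(1)[OF P(2)] by (intro bexI[of _ "e (restrict x I)"]) (auto simp: \<pi>_def)
  qed
  have prod: "is_product R I (\<lambda>_. F) P \<pi>"
    unfolding is_product_def
  proof (intro conjI ballI allI impI P(1) \<pi>)
    fix T f assume T: "T \<in> Mods R" and f: "\<forall>i\<in>I. f i \<in> Hom R T F"
    note fl = linearD[OF Hom_linear[OF bspec[OF f]]]
    have lin: "linear R T (power_module I F) (\<lambda>t. \<lambda>i\<in>I. f i t)"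
      by (rule linearI) (use fl in \<open>auto simp: power_module_def fun_eq_iff\<close>)
    define u where "u = (\<lambda>t\<in>carrier T. e (\<lambda>i\<in>I. f i t))"
    have u: "u \<in> Hom R T P"
      unfolding u_def by (intro linear_restrict_Hom[OF ModsD(1)[OF T]] linear_comp[OF lin P(2)])
    have pu: "\<pi> i (u t) = f i t" if "i \<in> I" "t \<in> carrier T" for i t
      using that P(4) linearD(1)[OF lin that(2)] linearD(1)[OF P(2)] by (simp add: u_def \<pi>_def)
    show "\<exists>!u. u \<in> Hom R T P \<and> (\<forall>i\<in>I. compose (carrier T) (\<pi> i) u = f i)"
    proof (rule ex1I[of _ u])
      have "compose (carrier T) (\<pi> i) u = f i" if i: "i \<in> I" for i
        using pu[OF i] Hom_extensional[OF bspec[OF f i]]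
        by (intro extensionalityI[of _ "carrier T"]) (simp_all add: compose_def)
      then show "u \<in> Hom R T P \<and> (\<forall>i\<in>I. compose (carrier T) (\<pi> i) u = f i)" using u by blast
    next
      fix v assume v: "v \<in> Hom R T P \<and> (\<forall>i\<in>I. compose (carrier T) (\<pi> i) v = f i)"
      then have vH: "v \<in> Hom R T P" by blast
      show "v = u"
      proof (rule extensionalityI[OF Hom_extensional[OF vH] Hom_extensional[OF u]])
        fix t assume t: "t \<in> carrier T"
        have "\<pi> i (v t) = f i t" if "i \<in> I" for i
        proof -
          have "compose (carrier T) (\<pi> i) v = f i" using v that by blast
          then show ?thesis using t by (metis compose_eq)
        qed
        then show "v t = u t"
          using joint linearD(1)[OF Hom_linear[OF vH] t] linearD(1)[OF Hom_linear[OF u] t] pu t by simp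
      qed
    qed
  qed
  have "P \<in> GFlat R"
  proof -
    have "\<forall>I M P \<pi>. small I \<and> (\<forall>i\<in>I. M i \<in> GFlat R) \<and> is_product R I M P \<pi> \<longrightarrow> P \<in> GFlat R"
      using def unfolding definable_def by (elim conjE)
    from this[rule_format, of I "\<lambda>_. F" P \<pi>] show ?thesis using I Flat_GFlat[OF F] prod by simp
  qed
  then show ?thesis using that \<pi> surj joint by blast
qed

section \<open>Biduals of flat modules are flat\<close>

text \<open>The last clause is exactness of F' -> F'^n -> F'^m, the dual form of the statement that
  the solutions in F are spanned by the s j. Their finite number comes from treating all solutions
  at once: together they are a single solution in a power of F, to which the equational criterion
  applies after mapping the power to a flat module by \<iota>.\<close>

lemma (in universe_type) Flat_relations_finitely_generated:
  fixes R :: "'u ring"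
  assumes def: "definable R (GFlat R)" and R: "small (carrier R)" and F: "F \<in> Flat R"
    and D: "dual_pair R F F' e" and r: "\<And>i. i < n \<Longrightarrow> r i \<in> carrier R"
  obtains m :: nat and s :: "nat \<Rightarrow> nat \<Rightarrow> 'u"
  where "\<forall>j<m. \<forall>i<n. s j i \<in> carrier R"
    "\<forall>j<m. msum R (\<lambda>i. r i \<otimes>\<^bsub>R\<^esub> s j i) n = \<zero>\<^bsub>R\<^esub>"
    "\<forall>\<chi>. (\<forall>i<n. \<chi> i \<in> carrier F') \<longrightarrow>
       (\<forall>j<m. msum F' (\<lambda>i. s j i \<odot>\<^bsub>F'\<^esub> \<chi> i) n = \<zero>\<^bsub>F'\<^esub>) \<longrightarrow>
       (\<exists>\<xi>\<in>carrier F'. \<forall>i<n. \<chi> i = r i \<odot>\<^bsub>F'\<^esub> \<xi>)"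
proof -
  have Fm: "F \<in> Mods R" using F by (simp add: Flat_def)
  interpret F: left_module R F by (rule ModsD(1)[OF Fm])
  note Fg = F.M.abelian_group_axioms
  note D' = dual_pairD[OF D]
  interpret F': left_module "opp R" F' by (rule ModsD(1)[OF D'(1)])
  note F'g = F'.M.abelian_group_axioms
  define rel where "rel x = msum F (\<lambda>i. r i \<odot>\<^bsub>F\<^esub> x i) n" for x
  \<comment> \<open>All solutions in F. They index the power of F, after being coded by g as
    elements of the universe.\<close>
  define K where "K = {x \<in> {..<n} \<rightarrow>\<^sub>E carrier F. rel x = \<zero>\<^bsub>F\<^esub>}"
  have "small_sized U ({..<n} \<rightarrow>\<^sub>E carrier F)"
    by (intro small_sized_PiE small_sized_countable small_sizedI ModsD(2)[OF Fm]) simp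
  then have "small_sized U K" by (rule small_sized_subset) (auto simp: K_def)
  then obtain A :: "'u set" where A: "small A" "K \<lesssim> A" unfolding small_sized_def by blast
  then obtain g where g: "inj_on g K" "g ` K \<subseteq> A" by (auto simp: lepoll_def)
  have I: "small (g ` K)" by (rule small_lepoll[OF A(1) subset_imp_lepoll[OF g(2)]])
  define k where "k = inv_into K g"
  have k: "k (g x) = x" if "x \<in> K" for x using that g(1) by (simp add: k_def)
  have kK: "k i \<in> K" if "i \<in> g ` K" for i using that k by auto
  have kF: "k \<kappa> i \<in> carrier F" if "\<kappa> \<in> g ` K" "i < n" for \<kappa> i using kK[OF that(1)] that(2) by (auto simp: K_def)
  obtain P \<pi> where P: "P \<in> GFlat R" and \<pi>: "\<And>i. i \<in> g ` K \<Longrightarrow> \<pi> i \<in> Hom R P F"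
    and Psurj: "\<And>x. (\<And>i. i \<in> g ` K \<Longrightarrow> x i \<in> carrier F) \<Longrightarrow> \<exists>y\<in>carrier P. \<forall>i\<in>g ` K. \<pi> i y = x i"
    and Pinj: "\<And>y y'. y \<in> carrier P \<Longrightarrow> y' \<in> carrier P \<Longrightarrow> (\<And>i. i \<in> g ` K \<Longrightarrow> \<pi> i y = \<pi> i y') \<Longrightarrow> y = y'"
    by (rule Flat_power_GFlat[OF def F I]) blast
  have Pm: "P \<in> Mods R" using P by (simp add: GFlat_def)
  interpret P: left_module R P by (rule ModsD(1)[OF Pm])
  note Pg = P.M.abelian_group_axioms
  \<comment> \<open>The universal solution: its component at the index of a solution x is x itself,
    so every solution is a projection of X.\<close>
  define X where "X i = (SOME y. y \<in> carrier P \<and> (\<forall>\<kappa>\<in>g ` K. \<pi> \<kappa> y = k \<kappa> i))" for i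
  have X: "X i \<in> carrier P \<and> (\<forall>\<kappa>\<in>g ` K. \<pi> \<kappa> (X i) = k \<kappa> i)" if "i < n" for i
  proof -
    have "\<exists>y. y \<in> carrier P \<and> (\<forall>\<kappa>\<in>g ` K. \<pi> \<kappa> y = k \<kappa> i)" using Psurj[of "\<lambda>\<kappa>. k \<kappa> i"] kF that by blast
    then show ?thesis unfolding X_def by (rule someI_ex)
  qed
  have relX: "msum P (\<lambda>i. r i \<odot>\<^bsub>P\<^esub> X i) n = \<zero>\<^bsub>P\<^esub>"
  proof (rule Pinj)
    show "msum P (\<lambda>i. r i \<odot>\<^bsub>P\<^esub> X i) n \<in> carrier P"
      by (rule msum_closed[OF Pg]) (use r X P.smult_closed in blast)
    fix \<kappa> assume \<kappa>: "\<kappa> \<in> g ` K"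
    note \<pi>l = Hom_linear[OF \<pi>[OF \<kappa>]]
    have "\<pi> \<kappa> (msum P (\<lambda>i. r i \<odot>\<^bsub>P\<^esub> X i) n) = msum F (\<lambda>i. \<pi> \<kappa> (r i \<odot>\<^bsub>P\<^esub> X i)) n"
      by (rule msum_additive[OF Pg Fg linear_additive[OF \<pi>l]]) (use r X P.smult_closed in blast)
    also have "\<dots> = rel (k \<kappa>)"
      unfolding rel_def
    proof (rule msum_cong)
      fix i assume i: "i < n"
      have "X i \<in> carrier P" "\<pi> \<kappa> (X i) = k \<kappa> i" using X[OF i] \<kappa> by blast+
      then show "\<pi> \<kappa> (r i \<odot>\<^bsub>P\<^esub> X i) = r i \<odot>\<^bsub>F\<^esub> k \<kappa> i" using r[OF i] linearD(3)[OF \<pi>l] by simp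
    qed
    also have "\<dots> = \<zero>\<^bsub>F\<^esub>" using kK[OF \<kappa>] by (simp add: K_def)
    also have "\<dots> = \<pi> \<kappa> \<zero>\<^bsub>P\<^esub>" by (rule linear_zero[OF P.left_module_axioms F.left_module_axioms \<pi>l, symmetric])
    finally show "\<pi> \<kappa> (msum P (\<lambda>i. r i \<odot>\<^bsub>P\<^esub> X i) n) = \<pi> \<kappa> \<zero>\<^bsub>P\<^esub>" .
  qed simp
  obtain G \<iota> where G: "G \<in> Flat R" and \<iota>: "linear R P G \<iota>"
    and lift: "\<And>E \<gamma>. E \<in> Injective (opp R) \<Longrightarrow> balanced R E P \<gamma> \<Longrightarrow>
      \<exists>\<delta>. balanced R E G \<delta> \<and> (\<forall>a\<in>carrier E. \<forall>x\<in>carrier P. \<delta> a (\<iota> x) = \<gamma> a x)"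
    by (rule GFlat_resolution[OF P]) blast
  have Gm: "G \<in> Mods R" using G by (simp add: Flat_def)
  interpret G: left_module R G by (rule ModsD(1)[OF Gm])
  note Gg = G.M.abelian_group_axioms
  have \<iota>X: "\<iota> (X i) \<in> carrier G" if "i < n" for i using linearD(1)[OF \<iota>] X[OF that] by blast
  have "msum G (\<lambda>i. r i \<odot>\<^bsub>G\<^esub> \<iota> (X i)) n = msum G (\<lambda>i. \<iota> (r i \<odot>\<^bsub>P\<^esub> X i)) n"
    by (rule msum_cong) (use r X linearD(3)[OF \<iota>] in simp)
  also have "\<dots> = \<iota> (msum P (\<lambda>i. r i \<odot>\<^bsub>P\<^esub> X i) n)"
    by (rule msum_additive[OF Pg Gg linear_additive[OF \<iota>], symmetric]) (use r X P.smult_closed in blast)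
  also have "\<dots> = \<zero>\<^bsub>G\<^esub>" unfolding relX by (rule linear_zero[OF P.left_module_axioms G.left_module_axioms \<iota>])
  finally have relG: "msum G (\<lambda>i. r i \<odot>\<^bsub>G\<^esub> \<iota> (X i)) n = \<zero>\<^bsub>G\<^esub>" .
  obtain m s z where s: "\<And>j i. j < m \<Longrightarrow> i < n \<Longrightarrow> s j i \<in> carrier R" and z: "\<And>j. j < m \<Longrightarrow> z j \<in> carrier G"
    and rs: "\<And>j. j < m \<Longrightarrow> msum R (\<lambda>i. r i \<otimes>\<^bsub>R\<^esub> s j i) n = \<zero>\<^bsub>R\<^esub>"
    and Xz: "\<And>i. i < n \<Longrightarrow> \<iota> (X i) = msum G (\<lambda>j. s j i \<odot>\<^bsub>G\<^esub> z j) m"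
    by (rule Flat_relation[OF G R r \<iota>X relG]) blast+
  show ?thesis
  proof (rule that[of m s], use s in blast, use rs in blast, intro allI impI)
    fix \<chi> assume "\<forall>i<n. \<chi> i \<in> carrier F'"
      and "\<forall>j<m. msum F' (\<lambda>i. s j i \<odot>\<^bsub>F'\<^esub> \<chi> i) n = \<zero>\<^bsub>F'\<^esub>"
    then have \<chi>: "\<And>i. i < n \<Longrightarrow> \<chi> i \<in> carrier F'"
      and \<chi>s: "\<And>j. j < m \<Longrightarrow> msum F' (\<lambda>i. s j i \<odot>\<^bsub>F'\<^esub> \<chi> i) n = \<zero>\<^bsub>F'\<^esub>" by blast+
    \<comment> \<open>F' is injective, so its pairing with P through the projection at x extends
      along \<iota> to G. There X is a combination of the s j, which are moved across to \<chi> and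
      give 0 by assumption.\<close>
    have vanish: "(\<Sum>i<n. e (\<chi> i) (x i)) = 0" if x: "x \<in> K" for x
    proof -
      have \<kappa>: "g x \<in> g ` K" using x by blast
      have "balanced R F' P (\<lambda>\<xi> p. e \<xi> (\<pi> (g x) p))"
        using D'(2) Hom_linear[OF \<pi>[OF \<kappa>]] by (auto simp: balanced_def linear_def additive_def Pi_def)
      then obtain \<delta> where \<delta>: "balanced R F' G \<delta>"
        "\<And>\<xi> p. \<xi> \<in> carrier F' \<Longrightarrow> p \<in> carrier P \<Longrightarrow> \<delta> \<xi> (\<iota> p) = e \<xi> (\<pi> (g x) p)"
        using lift[OF dual_Flat_Injective[OF F D]] by blast
      have "(\<Sum>i<n. e (\<chi> i) (x i)) = (\<Sum>i<n. \<delta> (\<chi> i) (\<iota> (X i)))"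
        by (rule sum.cong) (use \<delta>(2) X \<chi> \<kappa> k[OF x] in auto)
      also have "\<dots> = (\<Sum>i<n. \<Sum>j<m. \<delta> (\<chi> i) (s j i \<odot>\<^bsub>G\<^esub> z j))"
      proof (rule sum.cong)
        fix i assume "i \<in> {..<n}"
        then show "\<delta> (\<chi> i) (\<iota> (X i)) = (\<Sum>j<m. \<delta> (\<chi> i) (s j i \<odot>\<^bsub>G\<^esub> z j))"
          using s z Xz \<chi> msum_character[OF Gg balanced_character_right[OF \<delta>(1)], of "\<chi> i" m "\<lambda>j. s j i \<odot>\<^bsub>G\<^esub> z j"]
          by (simp add: G.smult_closed)
      qed simp
      also have "\<dots> = (\<Sum>j<m. \<Sum>i<n. \<delta> (\<chi> i) (s j i \<odot>\<^bsub>G\<^esub> z j))" by (rule sum.swap)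
      also have "\<dots> = (\<Sum>j<m. 0)"
      proof (rule sum.cong)
        fix j assume j: "j \<in> {..<m}"
        then have j': "j < m" by simp
        have "(\<Sum>i<n. \<delta> (\<chi> i) (s j i \<odot>\<^bsub>G\<^esub> z j)) = (\<Sum>i<n. \<delta> (s j i \<odot>\<^bsub>F'\<^esub> \<chi> i) (z j))"
          by (rule sum.cong) (use balancedD(3)[OF \<delta>(1)] s z \<chi> j' in simp_all)
        also have "\<dots> = \<delta> (msum F' (\<lambda>i. s j i \<odot>\<^bsub>F'\<^esub> \<chi> i) n) (z j)"
          by (rule msum_character[OF F'g balanced_character_left[OF \<delta>(1) z[OF j']], symmetric])
            (use s \<chi> j' in \<open>simp add: F'.smult_closed\<close>)
        also have "\<dots> = 0"
          unfolding \<chi>s[OF j'] by (rule balanced_zero(2)[OF F'.left_module_axioms G.left_module_axioms \<delta>(1) z[OF j']])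
        finally show "(\<Sum>i<n. \<delta> (\<chi> i) (s j i \<odot>\<^bsub>G\<^esub> z j)) = 0" .
      qed simp
      finally show ?thesis by simp
    qed
    note Tg = abelian_group_tuples[OF Fg, of n]
    have u: "additive (tuples n F) F rel"
      unfolding additive_def
    proof (intro conjI ballI funcsetI)
      fix x assume x: "x \<in> carrier (tuples n F)"
      show "rel x \<in> carrier F"
        unfolding rel_def by (rule msum_closed[OF Fg]) (use x r in \<open>auto intro: F.smult_closed\<close>)
      fix y assume y: "y \<in> carrier (tuples n F)"
      have "rel (x \<oplus>\<^bsub>tuples n F\<^esub> y) = msum F (\<lambda>i. r i \<odot>\<^bsub>F\<^esub> x i \<oplus>\<^bsub>F\<^esub> r i \<odot>\<^bsub>F\<^esub> y i) n"
        unfolding rel_def by (rule msum_cong) (use x y r in \<open>auto simp: F.smult_r_distr PiE_iff\<close>)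
      also have "\<dots> = rel x \<oplus>\<^bsub>F\<^esub> rel y"
        unfolding rel_def by (rule msum_add[OF Fg]) (use x y r in \<open>auto intro: F.smult_closed\<close>)
      finally show "rel (x \<oplus>\<^bsub>tuples n F\<^esub> y) = rel x \<oplus>\<^bsub>F\<^esub> rel y" .
    qed
    have v: "character (tuples n F) (\<lambda>x. \<Sum>i<n. e (\<chi> i) (x i))"
      unfolding character_def
    proof (intro ballI)
      fix x y assume x: "x \<in> carrier (tuples n F)" and y: "y \<in> carrier (tuples n F)"
      show "(\<Sum>i<n. e (\<chi> i) ((x \<oplus>\<^bsub>tuples n F\<^esub> y) i)) = (\<Sum>i<n. e (\<chi> i) (x i)) + (\<Sum>i<n. e (\<chi> i) (y i))"
        unfolding sum.distrib[symmetric]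
        by (rule sum.cong) (use x y \<chi> in \<open>auto simp: balancedD(2)[OF D'(2)] PiE_iff\<close>)
    qed
    \<comment> \<open>As a character of F^n, \<chi> vanishes on the kernel of \<open>rel\<close> and
      so factors through it. The factor is the required \<xi>: evaluation at unit tuples gives
      \<chi> i = r i \<xi>.\<close>
    obtain \<psi> where \<psi>: "character F \<psi>" "\<And>x. x \<in> carrier (tuples n F) \<Longrightarrow> \<psi> (rel x) = (\<Sum>i<n. e (\<chi> i) (x i))"
      by (rule character_factor[OF Tg Fg u v]) (use vanish in \<open>auto simp: K_def\<close>)
    obtain \<xi> where \<xi>: "\<xi> \<in> carrier F'" "\<And>x. x \<in> carrier F \<Longrightarrow> e \<xi> x = \<psi> x" using D'(4)[OF \<psi>(1)] by blast
    have "\<chi> i = r i \<odot>\<^bsub>F'\<^esub> \<xi>" if i: "i < n" for i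
    proof (rule D'(3))
      fix x assume x: "x \<in> carrier F"
      have ux: "unit_tuple n F i x \<in> carrier (tuples n F)" by (rule unit_tuple_closed[OF Fg x])
      have "l \<le> n \<Longrightarrow> msum F (\<lambda>j. r j \<odot>\<^bsub>F\<^esub> unit_tuple n F i x j) l = (if i < l then r i \<odot>\<^bsub>F\<^esub> x else \<zero>\<^bsub>F\<^esub>)" for l
        using r i x by (induction l) (auto simp: less_Suc_eq unit_tuple_def F.smult_closed)
      then have "rel (unit_tuple n F i x) = r i \<odot>\<^bsub>F\<^esub> x" unfolding rel_def using i by simp
      then have "\<psi> (r i \<odot>\<^bsub>F\<^esub> x) = (\<Sum>j<n. e (\<chi> j) (unit_tuple n F i x j))" using \<psi>(2)[OF ux] by simp
      also have "\<dots> = (\<Sum>j<n. if j = i then e (\<chi> i) x else 0)"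
        by (rule sum.cong)
          (use \<chi> balanced_zero(1)[OF F'.left_module_axioms F.left_module_axioms D'(2)] in \<open>auto simp: unit_tuple_def\<close>)
      also have "\<dots> = e (\<chi> i) x" using i by simp
      finally show "e (\<chi> i) x = e (r i \<odot>\<^bsub>F'\<^esub> \<xi>) x"
        using balancedD(3)[OF D'(2) r[OF i] \<xi>(1) x] \<xi>(2) r[OF i] x by (simp add: F.smult_closed)
    qed (use \<chi> \<xi> r i in \<open>simp_all add: F'.smult_closed\<close>)
    then show "\<exists>\<xi>\<in>carrier F'. \<forall>i<n. \<chi> i = r i \<odot>\<^bsub>F'\<^esub> \<xi>" using \<xi>(1) by blast
  qed
qed

text \<open>A tuple \<phi> in F''^n is a character of F'^n. If it kills the kernel of the map F'^n
  -> F'^m given by s, it factors through this map, and the factor is a tuple \<psi> in F''^m. It is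
  used both for solutions of equations and for the relations that present S.\<close>

lemma bidual_factor:
  assumes F': "left_module (opp R) F'" and D2: "dual_pair (opp R) F' F'' e2"
    and s: "\<And>j i. j < m \<Longrightarrow> i < n \<Longrightarrow> s j i \<in> carrier R" and \<phi>: "\<And>i. i < n \<Longrightarrow> \<phi> i \<in> carrier F''"
    and van: "\<And>\<chi>. \<forall>i<n. \<chi> i \<in> carrier F' \<Longrightarrow> \<forall>j<m. msum F' (\<lambda>i. s j i \<odot>\<^bsub>F'\<^esub> \<chi> i) n = \<zero>\<^bsub>F'\<^esub>
      \<Longrightarrow> (\<Sum>i<n. e2 (\<phi> i) (\<chi> i)) = 0"
  obtains \<psi> where "\<And>j. \<psi> j \<in> carrier F''" "\<And>i. i < n \<Longrightarrow> \<phi> i = msum F'' (\<lambda>j. s j i \<odot>\<^bsub>F''\<^esub> \<psi> j) m"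
proof -
  note D2' = dual_pairD[OF D2, simplified]
  interpret F': left_module "opp R" F' by (rule F')
  interpret F'': left_module R F'' by (rule ModsD(1)[OF D2'(1)])
  note F'g = F'.M.abelian_group_axioms and F''g = F''.M.abelian_group_axioms
  note e2D = balancedD[OF D2'(2), simplified]
  define u where "u \<chi> = (\<lambda>j\<in>{..<m}. msum F' (\<lambda>i. s j i \<odot>\<^bsub>F'\<^esub> \<chi> i) n)" for \<chi>
  note Tn = abelian_group_tuples[OF F'g, of n] and Tm = abelian_group_tuples[OF F'g, of m]
  have uc: "msum F' (\<lambda>i. s j i \<odot>\<^bsub>F'\<^esub> \<chi> i) n \<in> carrier F'" if "j < m" "\<chi> \<in> carrier (tuples n F')" for j \<chi>
    by (rule msum_closed[OF F'g]) (use that s in \<open>auto intro: F'.smult_closed\<close>)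
  have u: "additive (tuples n F') (tuples m F') u"
    unfolding additive_def
  proof (intro conjI ballI funcsetI)
    fix x assume x: "x \<in> carrier (tuples n F')"
    show "u x \<in> carrier (tuples m F')" using uc x by (auto simp: u_def)
    fix y assume y: "y \<in> carrier (tuples n F')"
    have "msum F' (\<lambda>i. s j i \<odot>\<^bsub>F'\<^esub> (x \<oplus>\<^bsub>tuples n F'\<^esub> y) i) n =
        msum F' (\<lambda>i. s j i \<odot>\<^bsub>F'\<^esub> x i) n \<oplus>\<^bsub>F'\<^esub> msum F' (\<lambda>i. s j i \<odot>\<^bsub>F'\<^esub> y i) n" if j: "j < m" for j
    proof -
      have "msum F' (\<lambda>i. s j i \<odot>\<^bsub>F'\<^esub> (x \<oplus>\<^bsub>tuples n F'\<^esub> y) i) n =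
          msum F' (\<lambda>i. s j i \<odot>\<^bsub>F'\<^esub> x i \<oplus>\<^bsub>F'\<^esub> s j i \<odot>\<^bsub>F'\<^esub> y i) n"
        by (rule msum_cong) (use x y s j in \<open>auto simp: F'.smult_r_distr PiE_iff\<close>)
      also have "\<dots> = msum F' (\<lambda>i. s j i \<odot>\<^bsub>F'\<^esub> x i) n \<oplus>\<^bsub>F'\<^esub> msum F' (\<lambda>i. s j i \<odot>\<^bsub>F'\<^esub> y i) n"
        by (rule msum_add[OF F'g]) (use x y s j in \<open>auto intro: F'.smult_closed\<close>)
      finally show ?thesis .
    qed
    then show "u (x \<oplus>\<^bsub>tuples n F'\<^esub> y) = u x \<oplus>\<^bsub>tuples m F'\<^esub> u y"
      unfolding u_def tuples_simps(3) by (intro restrict_ext) simp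
  qed
  have v: "character (tuples n F') (\<lambda>\<chi>. \<Sum>i<n. e2 (\<phi> i) (\<chi> i))"
    unfolding character_def
  proof (intro ballI)
    fix x y assume x: "x \<in> carrier (tuples n F')" and y: "y \<in> carrier (tuples n F')"
    show "(\<Sum>i<n. e2 (\<phi> i) ((x \<oplus>\<^bsub>tuples n F'\<^esub> y) i)) = (\<Sum>i<n. e2 (\<phi> i) (x i)) + (\<Sum>i<n. e2 (\<phi> i) (y i))"
      unfolding sum.distrib[symmetric]
      by (rule sum.cong) (use x y \<phi> in \<open>auto simp: e2D(2) PiE_iff\<close>)
  qed
  have ker: "(\<Sum>i<n. e2 (\<phi> i) (\<chi> i)) = 0"
    if \<chi>: "\<chi> \<in> carrier (tuples n F')" and u0: "u \<chi> = \<zero>\<^bsub>tuples m F'\<^esub>" for \<chi>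
  proof (rule van)
    show "\<forall>i<n. \<chi> i \<in> carrier F'" using \<chi> by auto
    show "\<forall>j<m. msum F' (\<lambda>i. s j i \<odot>\<^bsub>F'\<^esub> \<chi> i) n = \<zero>\<^bsub>F'\<^esub>"
    proof (intro allI impI)
      fix j assume "j < m"
      then show "msum F' (\<lambda>i. s j i \<odot>\<^bsub>F'\<^esub> \<chi> i) n = \<zero>\<^bsub>F'\<^esub>"
        using fun_cong[OF u0, of j] by (simp add: u_def)
    qed
  qed
  obtain h where h: "character (tuples m F') h" "\<And>\<chi>. \<chi> \<in> carrier (tuples n F') \<Longrightarrow> h (u \<chi>) = (\<Sum>i<n. e2 (\<phi> i) (\<chi> i))"
    by (rule character_factor[OF Tn Tm u v ker]) blast+
  define \<psi> where "\<psi> j = (SOME p. p \<in> carrier F'' \<and> (\<forall>\<xi>\<in>carrier F'. e2 p \<xi> = h (unit_tuple m F' j \<xi>)))" for j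
  have \<psi>: "\<psi> j \<in> carrier F''" "\<And>\<xi>. \<xi> \<in> carrier F' \<Longrightarrow> e2 (\<psi> j) \<xi> = h (unit_tuple m F' j \<xi>)" for j
  proof -
    have "\<exists>p. p \<in> carrier F'' \<and> (\<forall>\<xi>\<in>carrier F'. e2 p \<xi> = h (unit_tuple m F' j \<xi>))"
      using D2'(4)[OF character_tuples_component[OF F'g h(1)]] by blast
    from someI_ex[OF this] show "\<psi> j \<in> carrier F''" "\<And>\<xi>. \<xi> \<in> carrier F' \<Longrightarrow> e2 (\<psi> j) \<xi> = h (unit_tuple m F' j \<xi>)"
      unfolding \<psi>_def by blast+
  qed
  have "\<phi> i = msum F'' (\<lambda>j. s j i \<odot>\<^bsub>F''\<^esub> \<psi> j) m" if i: "i < n" for i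
  proof (rule D2'(3))
    show "\<phi> i \<in> carrier F''" using \<phi> i .
    show "msum F'' (\<lambda>j. s j i \<odot>\<^bsub>F''\<^esub> \<psi> j) m \<in> carrier F''"
      by (rule msum_closed[OF F''g]) (use s \<psi> i in \<open>simp add: F''.smult_closed\<close>)
    fix \<xi> assume \<xi>: "\<xi> \<in> carrier F'"
    let ?t = "unit_tuple n F' i \<xi>"
    have t: "?t \<in> carrier (tuples n F')" by (rule unit_tuple_closed[OF F'g \<xi>])
    have ut: "u ?t j = s j i \<odot>\<^bsub>F'\<^esub> \<xi>" if j: "j < m" for j
    proof -
      have "l \<le> n \<Longrightarrow> msum F' (\<lambda>k. s j k \<odot>\<^bsub>F'\<^esub> ?t k) l = (if i < l then s j i \<odot>\<^bsub>F'\<^esub> \<xi> else \<zero>\<^bsub>F'\<^esub>)" for l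
        using s i j \<xi> by (induction l) (auto simp: less_Suc_eq unit_tuple_def F'.smult_closed)
      then show ?thesis using i j by (simp add: u_def)
    qed
    have "e2 (\<phi> i) \<xi> = (\<Sum>k<n. if k = i then e2 (\<phi> i) \<xi> else 0)" using i by simp
    also have "\<dots> = (\<Sum>k<n. e2 (\<phi> k) (?t k))"
      by (rule sum.cong)
        (use \<phi> character_zero[OF F'g balanced_character_right[OF D2'(2)]] in \<open>auto simp: unit_tuple_def\<close>)
    also have "\<dots> = h (u ?t)" using h(2)[OF t] by simp
    also have "\<dots> = (\<Sum>j<m. h (unit_tuple m F' j (u ?t j)))"
      by (rule character_tuples_sum[OF F'g h(1) additiveD(1)[OF u t]])
    also have "\<dots> = (\<Sum>j<m. e2 (s j i \<odot>\<^bsub>F''\<^esub> \<psi> j) \<xi>)"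
      by (rule sum.cong) (use ut \<psi> s i \<xi> e2D(3) in \<open>simp_all add: F'.smult_closed\<close>)
    also have "\<dots> = e2 (msum F'' (\<lambda>j. s j i \<odot>\<^bsub>F''\<^esub> \<psi> j) m) \<xi>"
      by (rule msum_character[OF F''g balanced_character_left[OF D2'(2) \<xi>], symmetric])
        (use s \<psi> i in \<open>simp add: F''.smult_closed\<close>)
    finally show "e2 (\<phi> i) \<xi> = e2 (msum F'' (\<lambda>j. s j i \<odot>\<^bsub>F''\<^esub> \<psi> j) m) \<xi>" .
  qed
  then show ?thesis using that \<psi>(1) by blast
qed

text \<open>The equation says that \<phi> vanishes on all tuples (r i \<xi>), and these include
  every tuple killed by s; so \<open>bidual_factor\<close> applies. The coefficients s are those
  already found for F.\<close>

lemma (in universe_type) bidual_relation: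
  fixes R :: "'u ring"
  assumes def: "definable R (GFlat R)" and R: "small (carrier R)" and F: "F \<in> Flat R"
    and D: "dual_pair R F F' e" and D2: "dual_pair (opp R) F' F'' e2"
    and r: "\<And>i. i < n \<Longrightarrow> r i \<in> carrier R" and \<phi>: "\<And>i. i < n \<Longrightarrow> \<phi> i \<in> carrier F''"
    and rel: "msum F'' (\<lambda>i. r i \<odot>\<^bsub>F''\<^esub> \<phi> i) n = \<zero>\<^bsub>F''\<^esub>"
  obtains m :: nat and s :: "nat \<Rightarrow> nat \<Rightarrow> 'u" and \<psi> :: "nat \<Rightarrow> 'u"
  where "\<And>j i. j < m \<Longrightarrow> i < n \<Longrightarrow> s j i \<in> carrier R" "\<And>j. j < m \<Longrightarrow> \<psi> j \<in> carrier F''"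
    "\<And>j. j < m \<Longrightarrow> msum R (\<lambda>i. r i \<otimes>\<^bsub>R\<^esub> s j i) n = \<zero>\<^bsub>R\<^esub>"
    "\<And>i. i < n \<Longrightarrow> \<phi> i = msum F'' (\<lambda>j. s j i \<odot>\<^bsub>F''\<^esub> \<psi> j) m"
proof -
  note D' = dual_pairD[OF D] and D2' = dual_pairD[OF D2, simplified]
  interpret F': left_module "opp R" F' by (rule ModsD(1)[OF D'(1)])
  interpret F'': left_module R F'' by (rule ModsD(1)[OF D2'(1)])
  note F'g = F'.M.abelian_group_axioms and F''g = F''.M.abelian_group_axioms
  note e2D = balancedD[OF D2'(2), simplified]
  obtain m :: nat and s where s': "\<forall>j<m. \<forall>i<n. s j i \<in> carrier R"
    and rs': "\<forall>j<m. msum R (\<lambda>i. r i \<otimes>\<^bsub>R\<^esub> s j i) n = \<zero>\<^bsub>R\<^esub>"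
    and solve: "\<forall>\<chi>. (\<forall>i<n. \<chi> i \<in> carrier F') \<longrightarrow>
       (\<forall>j<m. msum F' (\<lambda>i. s j i \<odot>\<^bsub>F'\<^esub> \<chi> i) n = \<zero>\<^bsub>F'\<^esub>) \<longrightarrow>
       (\<exists>\<xi>\<in>carrier F'. \<forall>i<n. \<chi> i = r i \<odot>\<^bsub>F'\<^esub> \<xi>)"
    by (rule Flat_relations_finitely_generated[OF def R F D r]) blast
  from s' have s: "\<And>j i. j < m \<Longrightarrow> i < n \<Longrightarrow> s j i \<in> carrier R" by blast
  from rs' have rs: "\<And>j. j < m \<Longrightarrow> msum R (\<lambda>i. r i \<otimes>\<^bsub>R\<^esub> s j i) n = \<zero>\<^bsub>R\<^esub>" by blast
  have van: "(\<Sum>i<n. e2 (\<phi> i) (\<chi> i)) = 0"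
    if \<chi>: "\<forall>i<n. \<chi> i \<in> carrier F'" and \<chi>s: "\<forall>j<m. msum F' (\<lambda>i. s j i \<odot>\<^bsub>F'\<^esub> \<chi> i) n = \<zero>\<^bsub>F'\<^esub>" for \<chi>
  proof -
    obtain \<xi> where \<xi>: "\<xi> \<in> carrier F'" "\<And>i. i < n \<Longrightarrow> \<chi> i = r i \<odot>\<^bsub>F'\<^esub> \<xi>" using solve \<chi> \<chi>s by blast
    have "(\<Sum>i<n. e2 (\<phi> i) (\<chi> i)) = (\<Sum>i<n. e2 (r i \<odot>\<^bsub>F''\<^esub> \<phi> i) \<xi>)"
      by (rule sum.cong) (use \<xi> \<phi> r e2D(3) in simp_all)
    also have "\<dots> = e2 (msum F'' (\<lambda>i. r i \<odot>\<^bsub>F''\<^esub> \<phi> i) n) \<xi>"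
      by (rule msum_character[OF F''g balanced_character_left[OF D2'(2) \<xi>(1)], symmetric])
        (use r \<phi> in \<open>simp add: F''.smult_closed\<close>)
    also have "\<dots> = 0"
      unfolding rel by (rule character_zero[OF F''g balanced_character_left[OF D2'(2) \<xi>(1)]])
    finally show ?thesis .
  qed
  obtain \<psi> where \<psi>: "\<And>j. \<psi> j \<in> carrier F''"
    and \<phi>s: "\<And>i. i < n \<Longrightarrow> \<phi> i = msum F'' (\<lambda>j. s j i \<odot>\<^bsub>F''\<^esub> \<psi> j) m"
    by (rule bidual_factor[OF F'.left_module_axioms D2 s \<phi> van]) blast+
  show ?thesis
  proof (rule that[of m s \<psi>])
    show "s j i \<in> carrier R" if "j < m" "i < n" for j i by (rule s[OF that])
    show "\<psi> j \<in> carrier F''" for j by (rule \<psi>)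
    show "msum R (\<lambda>i. r i \<otimes>\<^bsub>R\<^esub> s j i) n = \<zero>\<^bsub>R\<^esub>" if "j < m" for j by (rule rs[OF that])
    show "\<phi> i = msum F'' (\<lambda>j. s j i \<odot>\<^bsub>F''\<^esub> \<psi> j) m" if "i < n" for i by (rule \<phi>s[OF that])
  qed
qed

text \<open>Baer's criterion turns the equational criterion for relations back into flatness.\<close>

lemma (in universe_type) bidual_Flat:
  fixes R :: "'u ring"
  assumes def: "definable R (GFlat R)" and R: "small (carrier R)" and F: "F \<in> Flat R"
    and D: "dual_pair R F F' e" and D2: "dual_pair (opp R) F' X e2"
  shows "X \<in> Flat R"
proof -
  note D2' = dual_pairD[OF D2, simplified]
  interpret X: left_module R X by (rule ModsD(1)[OF D2'(1)])
  note Xg = X.M.abelian_group_axioms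
  obtain X' e3 where D3: "dual_pair R X X' e3" using dual_pair_exists_Mods[OF D2'(1)] .
  note D3' = dual_pairD[OF D3]
  interpret X': left_module "opp R" X' by (rule ModsD(1)[OF D3'(1)])
  note e3D = balancedD[OF D3'(2)]
  \<comment> \<open>X' satisfies Baer's condition and hence is injective; J is a homomorphism from a
    right ideal to X'.\<close>
  have ideals: "\<exists>\<xi>\<in>carrier X'. \<forall>(r, y)\<in>J. y = r \<odot>\<^bsub>X'\<^esub> \<xi>"
    if J: "mod_graph (opp R) (regular (opp R)) X' J" for J
  proof -
    note g = mod_graphD[OF J, simplified]
    \<comment> \<open>The character that sends r x, with r in the ideal and x in X, to the value of
      J(r) at x, defined on the subgroup generated by such products. Any extension to X is an
      element of X' that represents J.\<close>
    define \<Gamma> where "\<Gamma> = {(msum X (\<lambda>i. r i \<odot>\<^bsub>X\<^esub> \<phi> i) n, \<Sum>i<n. e3 (y i) (\<phi> i)) | n r y \<phi>.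
      \<forall>i<n. (r i, y i) \<in> J \<and> \<phi> i \<in> carrier X}"
    have \<Gamma>I: "(a, b) \<in> \<Gamma>" if "a = msum X (\<lambda>i. r i \<odot>\<^bsub>X\<^esub> \<phi> i) n" "b = (\<Sum>i<n. e3 (y i) (\<phi> i))"
      "\<And>i. i < n \<Longrightarrow> (r i, y i) \<in> J" "\<And>i. i < n \<Longrightarrow> \<phi> i \<in> carrier X" for a b r y \<phi> n
      using that unfolding \<Gamma>_def by blast
    have \<Gamma>D: "\<exists>n r y \<phi>. a = msum X (\<lambda>i. r i \<odot>\<^bsub>X\<^esub> \<phi> i) n \<and> b = (\<Sum>i<n. e3 (y i) (\<phi> i)) \<and>
      (\<forall>i<n. (r i, y i) \<in> J) \<and> (\<forall>i<n. \<phi> i \<in> carrier X)" if "(a, b) \<in> \<Gamma>" for a b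
      using that unfolding \<Gamma>_def by blast
    obtain \<xi>c where \<xi>c: "character X \<xi>c" "\<And>a b. (a, b) \<in> \<Gamma> \<Longrightarrow> \<xi>c a = b"
    proof (rule character_extend[OF Xg])
      show "\<Gamma> \<subseteq> carrier X \<times> UNIV"
      proof
        fix p assume p: "p \<in> \<Gamma>"
        obtain a b where ab: "p = (a, b)" by (cases p)
        obtain n r y \<phi> where *: "a = msum X (\<lambda>i. r i \<odot>\<^bsub>X\<^esub> \<phi> i) n" "\<forall>i<n. (r i, y i) \<in> J" "\<forall>i<n. \<phi> i \<in> carrier X"
          using \<Gamma>D p ab by blast
        have "a \<in> carrier X"
          unfolding *(1) by (rule msum_closed[OF Xg]) (use * g(1) X.smult_closed in blast)
        then show "p \<in> carrier X \<times> UNIV" using ab by simp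
      qed
      show "(\<zero>\<^bsub>X\<^esub>, 0) \<in> \<Gamma>" by (rule \<Gamma>I[where n = 0]) simp_all
      fix a b assume ab: "(a, b) \<in> \<Gamma>"
      obtain n r y \<phi> where *: "a = msum X (\<lambda>i. r i \<odot>\<^bsub>X\<^esub> \<phi> i) n" "b = (\<Sum>i<n. e3 (y i) (\<phi> i))"
        "\<forall>i<n. (r i, y i) \<in> J" "\<forall>i<n. \<phi> i \<in> carrier X"
        using \<Gamma>D[OF ab] by blast
      have c: "r i \<in> carrier R" "y i \<in> carrier X'" "\<phi> i \<in> carrier X" if "i < n" for i
        using * that g(1,2) by blast+
      show "(\<ominus>\<^bsub>X\<^esub> a, - b) \<in> \<Gamma>"
      proof (rule \<Gamma>I[of _ r "\<lambda>i. \<ominus>\<^bsub>X\<^esub> \<phi> i" n _ y])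
        have "additive X X (\<lambda>x. \<ominus>\<^bsub>X\<^esub> x)" by (auto simp: additive_def X.M.minus_add)
        then have "\<ominus>\<^bsub>X\<^esub> a = msum X (\<lambda>i. \<ominus>\<^bsub>X\<^esub> (r i \<odot>\<^bsub>X\<^esub> \<phi> i)) n"
          unfolding * by (rule msum_additive[OF Xg Xg]) (use c X.smult_closed in blast)
        also have "\<dots> = msum X (\<lambda>i. r i \<odot>\<^bsub>X\<^esub> (\<ominus>\<^bsub>X\<^esub> \<phi> i)) n"
        proof (rule msum_cong)
          fix i assume i: "i < n"
          have "additive X X (\<lambda>x. r i \<odot>\<^bsub>X\<^esub> x)"
            using c(1)[OF i] by (auto simp: additive_def X.smult_r_distr X.smult_closed)
          from additive_inv[OF Xg Xg this c(3)[OF i]]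
          show "\<ominus>\<^bsub>X\<^esub> (r i \<odot>\<^bsub>X\<^esub> \<phi> i) = r i \<odot>\<^bsub>X\<^esub> (\<ominus>\<^bsub>X\<^esub> \<phi> i)" by simp
        qed
        finally show "\<ominus>\<^bsub>X\<^esub> a = msum X (\<lambda>i. r i \<odot>\<^bsub>X\<^esub> (\<ominus>\<^bsub>X\<^esub> \<phi> i)) n" .
        show "- b = (\<Sum>i<n. e3 (y i) (\<ominus>\<^bsub>X\<^esub> \<phi> i))"
          unfolding *(2) sum_negf[symmetric]
          by (rule sum.cong) (use c character_inv[OF Xg balanced_character_right[OF D3'(2)]] in simp_all)
      qed (use * in simp_all)
      fix a' b' assume ab': "(a', b') \<in> \<Gamma>"
      obtain n' r' y' \<phi>' where H': "a' = msum X (\<lambda>i. r' i \<odot>\<^bsub>X\<^esub> \<phi>' i) n'" "b' = (\<Sum>i<n'. e3 (y' i) (\<phi>' i))"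
        "\<forall>i<n'. (r' i, y' i) \<in> J" "\<forall>i<n'. \<phi>' i \<in> carrier X"
        using \<Gamma>D[OF ab'] by blast
      have c': "r' i \<in> carrier R" "y' i \<in> carrier X'" "\<phi>' i \<in> carrier X" if "i < n'" for i
        using H' that g(1,2) by blast+
      let ?cat = "\<lambda>f f' i. if i < n then f i else f' (i - n)"
      show "(a \<oplus>\<^bsub>X\<^esub> a', b + b') \<in> \<Gamma>"
      proof (rule \<Gamma>I[of _ "?cat r r'" "?cat \<phi> \<phi>'" "n + n'" _ "?cat y y'"])
        have "msum X (\<lambda>i. ?cat r r' i \<odot>\<^bsub>X\<^esub> ?cat \<phi> \<phi>' i) (n + n') =
          msum X (\<lambda>i. if i < n then r i \<odot>\<^bsub>X\<^esub> \<phi> i else r' (i - n) \<odot>\<^bsub>X\<^esub> \<phi>' (i - n)) (n + n')"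
          by (rule msum_cong) simp
        also have "\<dots> = a \<oplus>\<^bsub>X\<^esub> a'"
          unfolding * H' by (rule msum_append[OF Xg]) (use c c' X.smult_closed in blast)+
        finally show "a \<oplus>\<^bsub>X\<^esub> a' = msum X (\<lambda>i. ?cat r r' i \<odot>\<^bsub>X\<^esub> ?cat \<phi> \<phi>' i) (n + n')" by simp
        have "(\<Sum>i<n + n'. e3 (?cat y y' i) (?cat \<phi> \<phi>' i)) =
          (\<Sum>i<n + n'. if i < n then e3 (y i) (\<phi> i) else e3 (y' (i - n)) (\<phi>' (i - n)))"
          by (rule sum.cong) simp_all
        also have "\<dots> = b + b'" unfolding * H' by (rule sum_append)
        finally show "b + b' = (\<Sum>i<n + n'. e3 (?cat y y' i) (?cat \<phi> \<phi>' i))" by simp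
      qed (use * H' in auto)
    next
      fix b assume "(\<zero>\<^bsub>X\<^esub>, b) \<in> \<Gamma>"
      then obtain n r y \<phi> where *: "\<zero>\<^bsub>X\<^esub> = msum X (\<lambda>i. r i \<odot>\<^bsub>X\<^esub> \<phi> i) n" "b = (\<Sum>i<n. e3 (y i) (\<phi> i))"
        "\<forall>i<n. (r i, y i) \<in> J" "\<forall>i<n. \<phi> i \<in> carrier X"
        using \<Gamma>D by blast
      have c: "r i \<in> carrier R" "y i \<in> carrier X'" "\<phi> i \<in> carrier X" if "i < n" for i
        using * that g(1,2) by blast+
      \<comment> \<open>Single-valuedness: the criterion turns \<Sum> r i \<phi> i = 0 into
        coefficients with \<Sum> r i s j i = 0 for each j. As J is a homomorphism, \<Sum> s j i y i
        is its value at 0 and vanishes.\<close>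
      obtain m s \<psi> where s: "\<And>j i. j < m \<Longrightarrow> i < n \<Longrightarrow> s j i \<in> carrier R" and \<psi>: "\<And>j. j < m \<Longrightarrow> \<psi> j \<in> carrier X"
        and rs: "\<And>j. j < m \<Longrightarrow> msum R (\<lambda>i. r i \<otimes>\<^bsub>R\<^esub> s j i) n = \<zero>\<^bsub>R\<^esub>"
        and \<phi>s: "\<And>i. i < n \<Longrightarrow> \<phi> i = msum X (\<lambda>j. s j i \<odot>\<^bsub>X\<^esub> \<psi> j) m"
        by (rule bidual_relation[OF def R F D D2 c(1,3) *(1)[symmetric]]) blast+
      have "b = (\<Sum>i<n. \<Sum>j<m. e3 (y i) (s j i \<odot>\<^bsub>X\<^esub> \<psi> j))"
        unfolding *(2)
      proof (rule sum.cong)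
        fix i assume "i \<in> {..<n}"
        then show "e3 (y i) (\<phi> i) = (\<Sum>j<m. e3 (y i) (s j i \<odot>\<^bsub>X\<^esub> \<psi> j))"
          using \<phi>s s \<psi> c msum_character[OF Xg balanced_character_right[OF D3'(2)], of "y i" m "\<lambda>j. s j i \<odot>\<^bsub>X\<^esub> \<psi> j"]
          by (simp add: X.smult_closed)
      qed simp
      also have "\<dots> = (\<Sum>j<m. \<Sum>i<n. e3 (y i) (s j i \<odot>\<^bsub>X\<^esub> \<psi> j))" by (rule sum.swap)
      also have "\<dots> = (\<Sum>j<m. 0)"
      proof (rule sum.cong)
        fix j assume "j \<in> {..<m}"
        then have j: "j < m" by simp
        have graph: "l \<le> n \<Longrightarrow> (msum R (\<lambda>i. r i \<otimes>\<^bsub>R\<^esub> s j i) l, msum X' (\<lambda>i. s j i \<odot>\<^bsub>X'\<^esub> y i) l) \<in> J" for l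
        proof (induction l)
          case 0
          then show ?case using g(3) by simp
        next
          case (Suc l)
          then have "(r l \<otimes>\<^bsub>R\<^esub> s j l, s j l \<odot>\<^bsub>X'\<^esub> y l) \<in> J" using g(5) * s[OF j, of l] by simp
          then show ?case using Suc g(4) by simp
        qed
        have "msum X' (\<lambda>i. s j i \<odot>\<^bsub>X'\<^esub> y i) n = \<zero>\<^bsub>X'\<^esub>"
          using graph[of n] rs[OF j] g(6) by simp
        moreover have "(\<Sum>i<n. e3 (y i) (s j i \<odot>\<^bsub>X\<^esub> \<psi> j)) = (\<Sum>i<n. e3 (s j i \<odot>\<^bsub>X'\<^esub> y i) (\<psi> j))"
          by (rule sum.cong) (use e3D(3) s j \<psi> c in simp_all)
        moreover have "\<dots> = e3 (msum X' (\<lambda>i. s j i \<odot>\<^bsub>X'\<^esub> y i) n) (\<psi> j)"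
          by (rule msum_character[OF X'.M.abelian_group_axioms balanced_character_left[OF D3'(2) \<psi>[OF j]], symmetric])
            (use s j c in \<open>simp add: X'.smult_closed\<close>)
        ultimately show "(\<Sum>i<n. e3 (y i) (s j i \<odot>\<^bsub>X\<^esub> \<psi> j)) = 0"
          using balanced_zero(2)[OF X'.left_module_axioms X.left_module_axioms D3'(2) \<psi>[OF j]] by simp
      qed simp
      finally show "b = 0" by simp
    qed (rule that)
    obtain \<xi> where \<xi>: "\<xi> \<in> carrier X'" "\<And>x. x \<in> carrier X \<Longrightarrow> e3 \<xi> x = \<xi>c x" using D3'(4)[OF \<xi>c(1)] by blast
    have "y = r \<odot>\<^bsub>X'\<^esub> \<xi>" if ry: "(r, y) \<in> J" for r y
    proof (rule D3'(3))
      show "y \<in> carrier X'" "r \<odot>\<^bsub>X'\<^esub> \<xi> \<in> carrier X'" using g(1,2)[OF ry] \<xi>(1) X'.smult_closed by simp_all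
      fix x assume x: "x \<in> carrier X"
      have "(r \<odot>\<^bsub>X\<^esub> x, e3 y x) \<in> \<Gamma>"
        by (rule \<Gamma>I[of _ "\<lambda>_. r" "\<lambda>_. x" 1 _ "\<lambda>_. y"]) (use ry x g(1)[OF ry] in \<open>simp_all add: X.smult_closed\<close>)
      then have "\<xi>c (r \<odot>\<^bsub>X\<^esub> x) = e3 y x" by (rule \<xi>c(2))
      then show "e3 y x = e3 (r \<odot>\<^bsub>X'\<^esub> \<xi>) x"
        using e3D(3)[OF g(1)[OF ry] \<xi>(1) x] \<xi>(2) g(1)[OF ry] x by (simp add: X.smult_closed)
    qed
    then show ?thesis using \<xi>(1) by blast
  qed
  show ?thesis
    unfolding Flat_iff[OF D2'(1)]
  proof (intro ballI allI impI)
    fix A B f \<beta> assume A: "A \<in> Mods (opp R)" and B: "B \<in> Mods (opp R)" and f: "f \<in> Hom (opp R) A B"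
      and inj: "inj_on f (carrier A)" and \<beta>: "balanced R A X \<beta>"
    note fl = linearD[OF Hom_linear[OF f]]
    interpret A: left_module "opp R" A by (rule ModsD(1)[OF A])
    interpret B: left_module "opp R" B by (rule ModsD(1)[OF B])
    obtain t where t: "t \<in> Hom (opp R) A X'" "\<And>a x. a \<in> carrier A \<Longrightarrow> x \<in> carrier X \<Longrightarrow> e3 (t a) x = \<beta> a x"
      using dual_hom[OF D3 X.left_module_axioms A.left_module_axioms \<beta>] by blast
    note tl = linearD[OF Hom_linear[OF t(1)]]
    \<comment> \<open>The pairing \<beta> as a homomorphism t into X', moved to the image of f. It
      extends to B by injectivity of X', and a homomorphism from B to X' is again a pairing.\<close>
    define \<Gamma> where "\<Gamma> = {(f a, t a) | a. a \<in> carrier A}"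
    have f0: "f \<zero>\<^bsub>A\<^esub> = \<zero>\<^bsub>B\<^esub>" by (rule linear_zero[OF A.left_module_axioms B.left_module_axioms Hom_linear[OF f]])
    have t0: "t \<zero>\<^bsub>A\<^esub> = \<zero>\<^bsub>X'\<^esub>" by (rule linear_zero[OF A.left_module_axioms X'.left_module_axioms Hom_linear[OF t(1)]])
    have \<Gamma>I: "(f a, t a) \<in> \<Gamma>" if "a \<in> carrier A" for a using that by (auto simp: \<Gamma>_def)
    have "mod_graph (opp R) B X' \<Gamma>"
      unfolding mod_graph_def
    proof (intro conjI allI impI)
      show "\<Gamma> \<subseteq> carrier B \<times> carrier X'" using fl(1) tl(1) by (auto simp: \<Gamma>_def)
      show "(\<zero>\<^bsub>B\<^esub>, \<zero>\<^bsub>X'\<^esub>) \<in> \<Gamma>" using \<Gamma>I[OF A.M.zero_closed] f0 t0 by simp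
      fix b y b' y' assume "(b, y) \<in> \<Gamma>" "(b', y') \<in> \<Gamma>"
      then obtain a a' where "a \<in> carrier A" "b = f a" "y = t a" "a' \<in> carrier A" "b' = f a'" "y' = t a'"
        by (auto simp: \<Gamma>_def)
      then show "(b \<oplus>\<^bsub>B\<^esub> b', y \<oplus>\<^bsub>X'\<^esub> y') \<in> \<Gamma>" using \<Gamma>I[of "a \<oplus>\<^bsub>A\<^esub> a'"] fl(2) tl(2) by simp
    next
      fix r b y assume r: "r \<in> carrier (opp R)" and "(b, y) \<in> \<Gamma>"
      then obtain a where "a \<in> carrier A" "b = f a" "y = t a" by (auto simp: \<Gamma>_def)
      then show "(r \<odot>\<^bsub>B\<^esub> b, r \<odot>\<^bsub>X'\<^esub> y) \<in> \<Gamma>" using \<Gamma>I[of "r \<odot>\<^bsub>A\<^esub> a"] fl(3) tl(3) r A.smult_closed by simp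
    next
      fix y assume "(\<zero>\<^bsub>B\<^esub>, y) \<in> \<Gamma>"
      then obtain a where a: "a \<in> carrier A" "\<zero>\<^bsub>B\<^esub> = f a" "y = t a" by (auto simp: \<Gamma>_def)
      then have "a = \<zero>\<^bsub>A\<^esub>" using inj_onD[OF inj, of a "\<zero>\<^bsub>A\<^esub>"] f0 by simp
      then show "y = \<zero>\<^bsub>X'\<^esub>" using a t0 by simp
    qed
    from Baer[OF B.left_module_axioms X'.left_module_axioms ideals this]
    obtain h where h: "h \<in> Hom (opp R) B X'" "\<forall>(b, y)\<in>\<Gamma>. h b = y" by blast
    have "balanced R B X (\<lambda>b x. e3 (h b) x)"
      using D3'(2) Hom_linear[OF h(1)] by (auto simp: balanced_def linear_def additive_def Pi_def)
    moreover have "e3 (h (f a)) x = \<beta> a x" if "a \<in> carrier A" "x \<in> carrier X" for a x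
      using h(2) \<Gamma>I[OF that(1)] t(2)[OF that] by auto
    ultimately show "\<exists>\<beta>'. balanced R B X \<beta>' \<and> (\<forall>a\<in>carrier A. \<forall>x\<in>carrier X. \<beta>' (f a) x = \<beta> a x)"
      by (intro exI[of _ "\<lambda>b x. e3 (h b) x"]) simp
  qed
qed

section \<open>Tensor products with finitely presented modules\<close>

lemma free_mod_simps [simp]:
  "carrier (free_mod R n) = {..<n} \<rightarrow>\<^sub>E carrier R" "\<zero>\<^bsub>free_mod R n\<^esub> = (\<lambda>i\<in>{..<n}. \<zero>\<^bsub>R\<^esub>)"
  "x \<oplus>\<^bsub>free_mod R n\<^esub> y = (\<lambda>i\<in>{..<n}. x i \<oplus>\<^bsub>R\<^esub> y i)"
  "r \<odot>\<^bsub>free_mod R n\<^esub> x = (\<lambda>i\<in>{..<n}. r \<otimes>\<^bsub>R\<^esub> x i)"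
  by (simp_all add: free_mod_def)

lemma free_mod_linear_sum:
  assumes R: "ring R" and M: "left_module R M" and g: "linear R (free_mod R n) M g"
    and x: "x \<in> carrier (free_mod R n)"
  shows "g x = msum M (\<lambda>i. x i \<odot>\<^bsub>M\<^esub> g (unit_tuple n R i \<one>\<^bsub>R\<^esub>)) n"
proof -
  interpret R: ring R by fact
  interpret M: left_module R M by fact
  note gl = linearD[OF g]
  have xc: "x i \<in> carrier R" if "i < n" for i using x that by auto
  have unit: "unit_tuple n R i \<one>\<^bsub>R\<^esub> \<in> carrier (free_mod R n)" for i by (auto simp: unit_tuple_def)
  define W where "W k = (\<lambda>j\<in>{..<n}. if j < k then x j else \<zero>\<^bsub>R\<^esub>)" for k
  have Wc: "W k \<in> carrier (free_mod R n)" for k using xc by (auto simp: W_def)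
  have "k \<le> n \<Longrightarrow> g (W k) = msum M (\<lambda>i. x i \<odot>\<^bsub>M\<^esub> g (unit_tuple n R i \<one>\<^bsub>R\<^esub>)) k" for k
  proof (induction k)
    case 0
    have "W 0 \<oplus>\<^bsub>free_mod R n\<^esub> W 0 = W 0" by (auto simp: W_def fun_eq_iff)
    then have "g (W 0) \<oplus>\<^bsub>M\<^esub> g (W 0) = g (W 0)" using gl(2)[OF Wc Wc, of 0 0] by simp
    then show ?case using gl(1)[OF Wc, of 0] by simp
  next
    case (Suc k)
    have xk: "x k \<in> carrier R" using Suc xc by simp
    let ?u = "x k \<odot>\<^bsub>free_mod R n\<^esub> unit_tuple n R k \<one>\<^bsub>R\<^esub>"
    have W: "W (Suc k) = W k \<oplus>\<^bsub>free_mod R n\<^esub> ?u"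
      using Suc xc by (auto simp: W_def unit_tuple_def fun_eq_iff less_Suc_eq)
    have u: "?u \<in> carrier (free_mod R n)" using xk by (auto simp: unit_tuple_def)
    have "g (W (Suc k)) = g (W k) \<oplus>\<^bsub>M\<^esub> g ?u" unfolding W by (rule gl(2)[OF Wc u])
    also have "g ?u = x k \<odot>\<^bsub>M\<^esub> g (unit_tuple n R k \<one>\<^bsub>R\<^esub>)" by (rule gl(3)[OF xk unit])
    finally have "g (W (Suc k)) = g (W k) \<oplus>\<^bsub>M\<^esub> x k \<odot>\<^bsub>M\<^esub> g (unit_tuple n R k \<one>\<^bsub>R\<^esub>)" .
    then show ?case using Suc by simp
  qed
  moreover have "W n = x" using x by (auto simp: W_def fun_eq_iff PiE_def extensional_def)
  ultimately show ?thesis by auto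
qed

text \<open>The exact sequence R^m -> R^n -> A -> 0 of right modules in coordinates, with generators
  \<sigma> and the rows of \<alpha> as relations. Scalars act on the right, which is why the
  coefficients d stand behind \<alpha> in \<open>relations\<close>.\<close>

locale presented_module =
  fixes R :: "'u ring" and A :: "('u, 'a) module" and n m :: nat
    and \<sigma> :: "nat \<Rightarrow> 'a" and \<alpha> :: "nat \<Rightarrow> nat \<Rightarrow> 'u"
  assumes A: "left_module (opp R) A"
    and \<sigma>: "i < n \<Longrightarrow> \<sigma> i \<in> carrier A"
    and \<alpha>: "j < m \<Longrightarrow> i < n \<Longrightarrow> \<alpha> j i \<in> carrier R"
    and generated: "s \<in> carrier A \<Longrightarrow> \<exists>c. (\<forall>i<n. c i \<in> carrier R) \<and> s = msum A (\<lambda>i. c i \<odot>\<^bsub>A\<^esub> \<sigma> i) n"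
    and relation: "j < m \<Longrightarrow> msum A (\<lambda>i. \<alpha> j i \<odot>\<^bsub>A\<^esub> \<sigma> i) n = \<zero>\<^bsub>A\<^esub>"
    and relations: "\<forall>i<n. c i \<in> carrier R \<Longrightarrow> msum A (\<lambda>i. c i \<odot>\<^bsub>A\<^esub> \<sigma> i) n = \<zero>\<^bsub>A\<^esub> \<Longrightarrow>
      \<exists>d. (\<forall>j<m. d j \<in> carrier R) \<and> (\<forall>i<n. c i = msum R (\<lambda>j. \<alpha> j i \<otimes>\<^bsub>R\<^esub> d j) m)"

lemma msum_free_mod:
  assumes "\<And>j. j < k \<Longrightarrow> f j \<in> carrier (free_mod R n)" "i < n"
  shows "msum (free_mod R n) f k i = msum R (\<lambda>j. f j i) k"
  using assms by (induction k) auto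

lemma abelian_group_free_mod:
  assumes "ring R" shows "abelian_group (free_mod R n)"
proof -
  interpret R: ring R by fact
  interpret T: abelian_group "tuples n R" by (rule abelian_group_tuples[OF R.abelian_group_axioms])
  show ?thesis
    by (rule abelian_groupI)
      (use T.a_closed T.zero_closed T.a_assoc T.a_comm T.l_zero T.add.l_inv_ex in \<open>simp_all\<close>)
qed

lemma left_module_free_mod:
  assumes "ring R" shows "left_module R (free_mod R n)"
proof -
  interpret R: ring R by fact
  show ?thesis
    by (intro left_module.intro left_module_axioms.intro assms abelian_group_free_mod)
      (auto simp: fun_eq_iff PiE_iff extensional_def R.l_distr R.r_distr R.m_assoc)
qed

text \<open>Generators and relations are the images of the unit tuples under the two maps of the
  presentation.\<close>

lemma finitely_presentedE:
  assumes R: "ring R" and fp: "finitely_presented (opp R) A" and A: "left_module (opp R) A"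
  obtains n m \<sigma> \<alpha> where "presented_module R A n m \<sigma> \<alpha>"
proof -
  obtain m n f g where f: "f \<in> Hom (opp R) (free_mod (opp R) m) (free_mod (opp R) n)"
    and g: "g \<in> Hom (opp R) (free_mod (opp R) n) A"
    and im: "f ` carrier (free_mod (opp R) m) = a_kernel (free_mod (opp R) n) A g"
    and surj: "g ` carrier (free_mod (opp R) n) = carrier A"
    using fp unfolding finitely_presented_def by blast
  interpret R: ring R by fact
  interpret A: left_module "opp R" A by fact
  note Ro = ring_opp[OF R]
  note fl = Hom_linear[OF f] and gl = Hom_linear[OF g]
  define \<sigma> where "\<sigma> i = g (unit_tuple n (opp R) i \<one>\<^bsub>opp R\<^esub>)" for i
  define \<alpha> where "\<alpha> j = f (unit_tuple m (opp R) j \<one>\<^bsub>opp R\<^esub>)" for j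
  have unit: "unit_tuple k (opp R) i \<one>\<^bsub>opp R\<^esub> \<in> carrier (free_mod (opp R) k)" for k i
    by (auto simp: unit_tuple_def)
  have \<alpha>c: "\<alpha> j \<in> carrier (free_mod (opp R) n)" for j unfolding \<alpha>_def by (rule linearD(1)[OF fl unit])
  have gsum: "g c = msum A (\<lambda>i. c i \<odot>\<^bsub>A\<^esub> \<sigma> i) n" if "c \<in> carrier (free_mod (opp R) n)" for c
    using free_mod_linear_sum[OF Ro A.left_module_axioms gl that] by (simp add: \<sigma>_def)
  have "presented_module R A n m \<sigma> \<alpha>"
  proof (rule presented_module.intro)
    show "left_module (opp R) A" by fact
    show "\<sigma> i \<in> carrier A" for i unfolding \<sigma>_def by (rule linearD(1)[OF gl unit])
    show "\<alpha> j i \<in> carrier R" if "i < n" for j i using \<alpha>c[of j] that by auto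
    show "\<exists>c. (\<forall>i<n. c i \<in> carrier R) \<and> s = msum A (\<lambda>i. c i \<odot>\<^bsub>A\<^esub> \<sigma> i) n" if s: "s \<in> carrier A" for s
    proof -
      obtain c where c: "c \<in> carrier (free_mod (opp R) n)" "s = g c" using surj s by blast
      then show ?thesis using gsum[OF c(1)] by (intro exI[of _ c]) auto
    qed
    show "msum A (\<lambda>i. \<alpha> j i \<odot>\<^bsub>A\<^esub> \<sigma> i) n = \<zero>\<^bsub>A\<^esub>" for j
    proof -
      have "\<alpha> j \<in> a_kernel (free_mod (opp R) n) A g" unfolding im[symmetric] \<alpha>_def using unit by blast
      then show ?thesis using gsum[OF \<alpha>c] by (simp add: a_kernel_iff)
    qed
    fix c assume c: "\<forall>i<n. c i \<in> carrier R" and c0: "msum A (\<lambda>i. c i \<odot>\<^bsub>A\<^esub> \<sigma> i) n = \<zero>\<^bsub>A\<^esub>"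
    let ?c = "restrict c {..<n}"
    have cc: "?c \<in> carrier (free_mod (opp R) n)" using c by auto
    have "g ?c = msum A (\<lambda>i. c i \<odot>\<^bsub>A\<^esub> \<sigma> i) n" unfolding gsum[OF cc] by (rule msum_cong) simp
    then have "?c \<in> a_kernel (free_mod (opp R) n) A g" using cc c0 by (simp only: a_kernel_iff)
    then obtain d where d: "d \<in> carrier (free_mod (opp R) m)" "?c = f d" unfolding im[symmetric] by blast
    have dc: "d j \<in> carrier R" if "j < m" for j using d that by auto
    have "c i = msum R (\<lambda>j. \<alpha> j i \<otimes>\<^bsub>R\<^esub> d j) m" if i: "i < n" for i
    proof -
      have "f d = msum (free_mod (opp R) n) (\<lambda>j. d j \<odot>\<^bsub>free_mod (opp R) n\<^esub> \<alpha> j) m"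
        using free_mod_linear_sum[OF Ro left_module_free_mod[OF Ro] fl d(1)] by (simp add: \<alpha>_def)
      then have "c i = msum (free_mod (opp R) n) (\<lambda>j. d j \<odot>\<^bsub>free_mod (opp R) n\<^esub> \<alpha> j) m i"
        using fun_cong[OF d(2), of i] i by simp
      also have "\<dots> = msum (opp R) (\<lambda>j. (d j \<odot>\<^bsub>free_mod (opp R) n\<^esub> \<alpha> j) i) m"
        by (rule msum_free_mod) (use dc \<alpha>c i left_module_closed(2)[OF left_module_free_mod[OF Ro]] in simp_all)
      also have "\<dots> = msum (opp R) (\<lambda>j. \<alpha> j i \<otimes>\<^bsub>R\<^esub> d j) m" by (rule msum_cong) (use i in simp)
      also have "\<dots> = msum R (\<lambda>j. \<alpha> j i \<otimes>\<^bsub>R\<^esub> d j) m"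
        by (induction m) simp_all
      finally show ?thesis .
    qed
    then show "\<exists>d. (\<forall>j<m. d j \<in> carrier R) \<and> (\<forall>i<n. c i = msum R (\<lambda>j. \<alpha> j i \<otimes>\<^bsub>R\<^esub> d j) m)"
      using dc by blast
  qed
  then show ?thesis by (rule that)
qed

section \<open>Pairings and tensor products with a presented module\<close>

context presented_module
begin

lemma balanced_generators:
  assumes M: "left_module R M" and \<beta>: "balanced R A M \<beta>" and x: "x \<in> carrier M"
    and c: "\<forall>i<n. c i \<in> carrier R"
  shows "\<beta> (msum A (\<lambda>i. c i \<odot>\<^bsub>A\<^esub> \<sigma> i) n) x = (\<Sum>i<n. \<beta> (\<sigma> i) (c i \<odot>\<^bsub>M\<^esub> x))"
proof -
  interpret A: left_module "opp R" A by (rule A)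
  have "\<beta> (msum A (\<lambda>i. c i \<odot>\<^bsub>A\<^esub> \<sigma> i) n) x = (\<Sum>i<n. \<beta> (c i \<odot>\<^bsub>A\<^esub> \<sigma> i) x)"
    by (rule msum_character[OF A.M.abelian_group_axioms balanced_character_left[OF \<beta> x]])
      (use c \<sigma> A.smult_closed in simp)
  also have "\<dots> = (\<Sum>i<n. \<beta> (\<sigma> i) (c i \<odot>\<^bsub>M\<^esub> x))"
    by (rule sum.cong) (use c \<sigma> balancedD(3)[OF \<beta> _ _ x] in simp_all)
  finally show ?thesis .
qed

lemma balanced_determined:
  assumes M: "left_module R M" and \<beta>: "balanced R A M \<beta>" and \<gamma>: "balanced R A M \<gamma>"
    and eq: "\<And>i x. i < n \<Longrightarrow> x \<in> carrier M \<Longrightarrow> \<beta> (\<sigma> i) x = \<gamma> (\<sigma> i) x"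
    and s: "s \<in> carrier A" and x: "x \<in> carrier M"
  shows "\<beta> s x = \<gamma> s x"
proof -
  interpret M: left_module R M by fact
  obtain c where c: "\<forall>i<n. c i \<in> carrier R" "s = msum A (\<lambda>i. c i \<odot>\<^bsub>A\<^esub> \<sigma> i) n" using generated[OF s] by blast
  have "(\<Sum>i<n. \<beta> (\<sigma> i) (c i \<odot>\<^bsub>M\<^esub> x)) = (\<Sum>i<n. \<gamma> (\<sigma> i) (c i \<odot>\<^bsub>M\<^esub> x))"
    by (rule sum.cong) (use c x eq M.smult_closed in simp_all)
  then show ?thesis
    unfolding c(2) balanced_generators[OF M \<beta> x c(1)] balanced_generators[OF M \<gamma> x c(1)] .
qed

text \<open>Coefficients of the first factor with respect to the generators are moved to the second
  factor; sums are then collected generator by generator.\<close>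

lemma tensor_generators:
  assumes M: "left_module R M" and t: "t \<in> carrier (tensor R A M)"
  obtains x where "\<And>i. i < n \<Longrightarrow> x i \<in> carrier M" "t = msum (tensor_group R A M) (\<lambda>i. tensor_pure R A M (\<sigma> i) (x i)) n"
proof -
  interpret T: tensor_pair R A M by (rule tensor_pair.intro[OF A M])
  interpret A: left_module "opp R" A by (rule A)
  interpret M: left_module R M by (rule M)
  let ?G = "tensor_group R A M" and ?p = "tensor_pure R A M"
  note G = T.abelian_group_tensor
  interpret G: abelian_group ?G by (rule G)
  have pc: "?p (\<sigma> i) x \<in> carrier ?G" if "i < n" "x \<in> carrier M" for i x
    using T.pure_closed[OF \<sigma>[OF that(1)] that(2)] by simp
  from t have "\<exists>x. (\<forall>i<n. x i \<in> carrier M) \<and> t = msum ?G (\<lambda>i. ?p (\<sigma> i) (x i)) n"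
  proof (induction t rule: T.tensor_induct)
    case zero
    have 0: "?p (\<sigma> i) \<zero>\<^bsub>M\<^esub> = \<zero>\<^bsub>?G\<^esub>" if "i < n" for i
    proof -
      have "additive M ?G (?p (\<sigma> i))"
        using \<sigma>[OF that] by (auto simp: additive_def T.pure_closed T.pure_add_right)
      from additive_zero[OF M.M.abelian_group_axioms G this] show ?thesis .
    qed
    have "msum ?G (\<lambda>i. ?p (\<sigma> i) \<zero>\<^bsub>M\<^esub>) n = msum ?G (\<lambda>i. \<zero>\<^bsub>?G\<^esub>) n"
      by (rule msum_cong) (rule 0)
    also have "\<dots> = \<zero>\<^bsub>?G\<^esub>" by (induction n) (use G.l_zero G.zero_closed in \<open>simp_all del: tensor_group_simps\<close>)
    finally show ?case by (intro exI[of _ "\<lambda>_. \<zero>\<^bsub>M\<^esub>"]) simp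
  next
    case (pure s x)
    obtain c where c: "\<forall>i<n. c i \<in> carrier R" "s = msum A (\<lambda>i. c i \<odot>\<^bsub>A\<^esub> \<sigma> i) n" using generated[OF pure(1)] by blast
    have "additive A ?G (\<lambda>s. ?p s x)"
      using pure(2) by (auto simp: additive_def T.pure_closed T.pure_add_left)
    then have "?p s x = msum ?G (\<lambda>i. ?p (c i \<odot>\<^bsub>A\<^esub> \<sigma> i) x) n"
      unfolding c(2) by (rule msum_additive[OF A.M.abelian_group_axioms G]) (use c \<sigma> A.smult_closed in simp)
    also have "\<dots> = msum ?G (\<lambda>i. ?p (\<sigma> i) (c i \<odot>\<^bsub>M\<^esub> x)) n"
      by (rule msum_cong) (use c \<sigma> pure T.pure_smult in simp)
    finally show ?case using c(1) pure(2) M.smult_closed by (intro exI[of _ "\<lambda>i. c i \<odot>\<^bsub>M\<^esub> x"]) simp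
  next
    case (add t t')
    then obtain x x' where x: "\<forall>i<n. x i \<in> carrier M" "t = msum ?G (\<lambda>i. ?p (\<sigma> i) (x i)) n"
      and x': "\<forall>i<n. x' i \<in> carrier M" "t' = msum ?G (\<lambda>i. ?p (\<sigma> i) (x' i)) n" by blast
    have "t \<oplus>\<^bsub>?G\<^esub> t' = msum ?G (\<lambda>i. ?p (\<sigma> i) (x i) \<oplus>\<^bsub>?G\<^esub> ?p (\<sigma> i) (x' i)) n"
      unfolding x(2) x'(2) by (rule msum_add[OF G, symmetric]) (use pc x x' in blast)+
    also have "\<dots> = msum ?G (\<lambda>i. ?p (\<sigma> i) (x i \<oplus>\<^bsub>M\<^esub> x' i)) n"
      by (rule msum_cong) (use x x' \<sigma> T.pure_add_right in simp)
    finally show ?case using x(1) x'(1) by (intro exI[of _ "\<lambda>i. x i \<oplus>\<^bsub>M\<^esub> x' i"]) simp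
  qed
  then show ?thesis using that by blast
qed

text \<open>Right exactness of the tensor product in dual form: a pairing of A with M amounts to a
  tuple in M'^n that satisfies the relations \<alpha>. It is computed from any coefficients of an
  element of A.\<close>

lemma balanced_from_generators:
  assumes M: "left_module R M" and D: "dual_pair R M M' e"
    and \<xi>: "\<forall>i<n. \<xi> i \<in> carrier M'" and rel: "\<forall>j<m. msum M' (\<lambda>i. \<alpha> j i \<odot>\<^bsub>M'\<^esub> \<xi> i) n = \<zero>\<^bsub>M'\<^esub>"
  obtains \<beta> where "balanced R A M \<beta>" "\<And>i x. i < n \<Longrightarrow> x \<in> carrier M \<Longrightarrow> \<beta> (\<sigma> i) x = e (\<xi> i) x"
proof -
  interpret M: left_module R M by fact
  interpret A: left_module "opp R" A by (rule A)
  note D' = dual_pairD[OF D]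
  interpret M': left_module "opp R" M' by (rule ModsD(1)[OF D'(1)])
  note eD = balancedD[OF D'(2)]
  note Ag = A.M.abelian_group_axioms and Mg = M.M.abelian_group_axioms
  have echar: "character M (e (\<xi> i))" if "i < n" for i by (rule balanced_character_right[OF D'(2)]) (use \<xi> that in blast)
  define L where "L c = msum A (\<lambda>i. c i \<odot>\<^bsub>A\<^esub> \<sigma> i) n" for c
  define V where "V c x = (\<Sum>i<n. e (\<xi> i) (c i \<odot>\<^bsub>M\<^esub> x))" for c x
  define C where "C = {c. \<forall>i<n. c i \<in> carrier R}"
  have Cc: "c i \<in> carrier R" if "c \<in> C" "i < n" for c i using that by (simp add: C_def)
  have Ladd: "L (\<lambda>i. c i \<oplus>\<^bsub>R\<^esub> c' i) = L c \<oplus>\<^bsub>A\<^esub> L c'" if "c \<in> C" "c' \<in> C" for c c'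
  proof -
    have "L (\<lambda>i. c i \<oplus>\<^bsub>R\<^esub> c' i) = msum A (\<lambda>i. c i \<odot>\<^bsub>A\<^esub> \<sigma> i \<oplus>\<^bsub>A\<^esub> c' i \<odot>\<^bsub>A\<^esub> \<sigma> i) n"
      unfolding L_def by (rule msum_cong) (use that Cc \<sigma> A.smult_l_distr in simp)
    also have "\<dots> = L c \<oplus>\<^bsub>A\<^esub> L c'"
      unfolding L_def by (rule msum_add[OF Ag]) (use that Cc \<sigma> A.smult_closed in simp_all)
    finally show ?thesis .
  qed
  have Lmult: "L (\<lambda>i. c i \<otimes>\<^bsub>R\<^esub> r) = r \<odot>\<^bsub>A\<^esub> L c" if "c \<in> C" "r \<in> carrier R" for c r
  proof -
    have "r \<odot>\<^bsub>A\<^esub> L c = msum A (\<lambda>i. r \<odot>\<^bsub>A\<^esub> (c i \<odot>\<^bsub>A\<^esub> \<sigma> i)) n"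
      unfolding L_def by (rule msum_smult[OF A.left_module_axioms]) (use that Cc \<sigma> A.smult_closed in simp_all)
    also have "\<dots> = L (\<lambda>i. c i \<otimes>\<^bsub>R\<^esub> r)"
      unfolding L_def by (rule msum_cong) (use that Cc \<sigma> A.smult_assoc[of r, simplified] in simp)
    finally show ?thesis by simp
  qed
  \<comment> \<open>Coefficients that represent 0 are combinations of the rows of \<alpha>, and
    these rows annihilate \<xi>; so the choice of coefficients does not matter.\<close>
  have V0: "V c x = 0" if c: "c \<in> C" "L c = \<zero>\<^bsub>A\<^esub>" and x: "x \<in> carrier M" for c x
  proof -
    obtain d where d: "\<forall>j<m. d j \<in> carrier R" "\<forall>i<n. c i = msum R (\<lambda>j. \<alpha> j i \<otimes>\<^bsub>R\<^esub> d j) m"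
      using relations[of c] c unfolding C_def L_def by blast
    have "V c x = (\<Sum>i<n. \<Sum>j<m. e (\<xi> i) (\<alpha> j i \<odot>\<^bsub>M\<^esub> (d j \<odot>\<^bsub>M\<^esub> x)))"
      unfolding V_def
    proof (rule sum.cong)
      fix i assume "i \<in> {..<n}"
      then have i: "i < n" by simp
      have "additive R M (\<lambda>r. r \<odot>\<^bsub>M\<^esub> x)"
        using x by (auto simp: additive_def M.smult_l_distr M.smult_closed)
      then have "c i \<odot>\<^bsub>M\<^esub> x = msum M (\<lambda>j. (\<alpha> j i \<otimes>\<^bsub>R\<^esub> d j) \<odot>\<^bsub>M\<^esub> x) m"
        using d(2)[rule_format, OF i] msum_additive[OF M.R.abelian_group_axioms Mg, of "\<lambda>r. r \<odot>\<^bsub>M\<^esub> x" m "\<lambda>j. \<alpha> j i \<otimes>\<^bsub>R\<^esub> d j"] \<alpha> d(1) i by simp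
      also have "\<dots> = msum M (\<lambda>j. \<alpha> j i \<odot>\<^bsub>M\<^esub> (d j \<odot>\<^bsub>M\<^esub> x)) m"
        by (rule msum_cong) (use \<alpha> d(1) i x M.smult_assoc in simp)
      finally show "e (\<xi> i) (c i \<odot>\<^bsub>M\<^esub> x) = (\<Sum>j<m. e (\<xi> i) (\<alpha> j i \<odot>\<^bsub>M\<^esub> (d j \<odot>\<^bsub>M\<^esub> x)))"
        using msum_character[OF Mg echar[OF i], of m "\<lambda>j. \<alpha> j i \<odot>\<^bsub>M\<^esub> (d j \<odot>\<^bsub>M\<^esub> x)"] \<alpha> d(1) i x
        by (simp add: M.smult_closed)
    qed simp
    also have "\<dots> = (\<Sum>j<m. \<Sum>i<n. e (\<xi> i) (\<alpha> j i \<odot>\<^bsub>M\<^esub> (d j \<odot>\<^bsub>M\<^esub> x)))" by (rule sum.swap)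
    also have "\<dots> = (\<Sum>j<m. 0)"
    proof (rule sum.cong)
      fix j assume "j \<in> {..<m}"
      then have j: "j < m" by simp
      have dx: "d j \<odot>\<^bsub>M\<^esub> x \<in> carrier M" using d(1) j x M.smult_closed by simp
      have "(\<Sum>i<n. e (\<xi> i) (\<alpha> j i \<odot>\<^bsub>M\<^esub> (d j \<odot>\<^bsub>M\<^esub> x))) = (\<Sum>i<n. e (\<alpha> j i \<odot>\<^bsub>M'\<^esub> \<xi> i) (d j \<odot>\<^bsub>M\<^esub> x))"
        by (rule sum.cong) (use eD(3)[OF _ _ dx] \<alpha>[OF j] \<xi> in simp_all)
      also have "\<dots> = e (msum M' (\<lambda>i. \<alpha> j i \<odot>\<^bsub>M'\<^esub> \<xi> i) n) (d j \<odot>\<^bsub>M\<^esub> x)"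
        by (rule msum_character[OF M'.M.abelian_group_axioms balanced_character_left[OF D'(2) dx], symmetric])
          (use \<alpha>[OF j] \<xi> M'.smult_closed in simp)
      also have "\<dots> = 0"
        using rel j balanced_zero(2)[OF M'.left_module_axioms M.left_module_axioms D'(2) dx] by simp
      finally show "(\<Sum>i<n. e (\<xi> i) (\<alpha> j i \<odot>\<^bsub>M\<^esub> (d j \<odot>\<^bsub>M\<^esub> x))) = 0" .
    qed simp
    finally show ?thesis by simp
  qed
  have Vadd: "V (\<lambda>i. c i \<oplus>\<^bsub>R\<^esub> c' i) x = V c x + V c' x" if "c \<in> C" "c' \<in> C" "x \<in> carrier M" for c c' x
    unfolding V_def sum.distrib[symmetric]
    by (rule sum.cong) (use that Cc characterD[OF echar] in \<open>simp_all add: M.smult_l_distr M.smult_closed\<close>)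
  have Vindep: "V c x = V c' x" if c: "c \<in> C" "c' \<in> C" "L c = L c'" and x: "x \<in> carrier M" for c c' x
  proof -
    let ?d = "\<lambda>i. \<ominus>\<^bsub>R\<^esub> c' i"
    have d: "?d \<in> C" using c by (simp add: C_def)
    have z: "(\<lambda>i. c' i \<oplus>\<^bsub>R\<^esub> ?d i) \<in> C" "(\<lambda>i. c i \<oplus>\<^bsub>R\<^esub> ?d i) \<in> C" using c by (simp_all add: C_def)
    have "L (\<lambda>i. c' i \<oplus>\<^bsub>R\<^esub> ?d i) = msum A (\<lambda>i. \<zero>\<^bsub>A\<^esub>) n"
      unfolding L_def by (rule msum_cong) (use Cc[OF c(2)] \<sigma> A.smult_zero_left in \<open>simp add: M.R.r_neg\<close>)
    also have "\<dots> = \<zero>\<^bsub>A\<^esub>" by (induction n) auto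
    finally have L0: "L (\<lambda>i. c' i \<oplus>\<^bsub>R\<^esub> ?d i) = \<zero>\<^bsub>A\<^esub>" .
    then have "L (\<lambda>i. c i \<oplus>\<^bsub>R\<^esub> ?d i) = \<zero>\<^bsub>A\<^esub>" using Ladd c d by simp
    then have "V c x + V ?d x = 0" using V0[OF z(2) _ x] Vadd[OF c(1) d x] by simp
    moreover have "V c' x + V ?d x = 0" using V0[OF z(1) L0 x] Vadd[OF c(2) d x] by simp
    ultimately show ?thesis by (metis add_right_cancel)
  qed
  define cc where "cc a = (SOME c. c \<in> C \<and> L c = a)" for a
  have cc: "cc a \<in> C" "L (cc a) = a" if "a \<in> carrier A" for a
  proof -
    have "\<exists>c. c \<in> C \<and> L c = a" using generated[OF that] unfolding C_def L_def by blast
    from someI_ex[OF this] show "cc a \<in> C" "L (cc a) = a" by (simp_all add: cc_def)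
  qed
  show ?thesis
  proof (rule that[of "\<lambda>a x. V (cc a) x"])
    show "balanced R A M (\<lambda>a x. V (cc a) x)"
      unfolding balanced_def
    proof (intro conjI ballI)
      fix a b x assume *: "a \<in> carrier A" "b \<in> carrier A" "x \<in> carrier M"
      have "(\<lambda>i. cc a i \<oplus>\<^bsub>R\<^esub> cc b i) \<in> C" using cc(1)[OF *(1)] cc(1)[OF *(2)] by (simp add: C_def)
      then have "V (cc (a \<oplus>\<^bsub>A\<^esub> b)) x = V (\<lambda>i. cc a i \<oplus>\<^bsub>R\<^esub> cc b i) x"
        using * cc Ladd by (intro Vindep) simp_all
      then show "V (cc (a \<oplus>\<^bsub>A\<^esub> b)) x = V (cc a) x + V (cc b) x" using Vadd cc * by simp
    next
      fix a x x' assume *: "a \<in> carrier A" "x \<in> carrier M" "x' \<in> carrier M"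
      show "V (cc a) (x \<oplus>\<^bsub>M\<^esub> x') = V (cc a) x + V (cc a) x'"
        unfolding V_def sum.distrib[symmetric]
        by (rule sum.cong) (use * Cc[OF cc(1)] characterD[OF echar] in \<open>simp_all add: M.smult_r_distr M.smult_closed\<close>)
    next
      fix r a x assume *: "r \<in> carrier R" "a \<in> carrier A" "x \<in> carrier M"
      have "(\<lambda>i. cc a i \<otimes>\<^bsub>R\<^esub> r) \<in> C" using cc(1)[OF *(2)] * by (simp add: C_def)
      then have "V (cc (r \<odot>\<^bsub>A\<^esub> a)) x = V (\<lambda>i. cc a i \<otimes>\<^bsub>R\<^esub> r) x"
        using * cc Lmult A.smult_closed by (intro Vindep) simp_all
      also have "\<dots> = V (cc a) (r \<odot>\<^bsub>M\<^esub> x)"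
        unfolding V_def by (rule sum.cong) (use * Cc[OF cc(1)] in \<open>simp_all add: M.smult_assoc\<close>)
      finally show "V (cc (r \<odot>\<^bsub>A\<^esub> a)) x = V (cc a) (r \<odot>\<^bsub>M\<^esub> x)" .
    qed
    fix i x assume i: "i < n" and x: "x \<in> carrier M"
    let ?e = "\<lambda>j. if j = i then \<one>\<^bsub>R\<^esub> else \<zero>\<^bsub>R\<^esub>"
    have e: "?e \<in> C" by (simp add: C_def)
    have "k \<le> n \<Longrightarrow> msum A (\<lambda>j. ?e j \<odot>\<^bsub>A\<^esub> \<sigma> j) k = (if i < k then \<sigma> i else \<zero>\<^bsub>A\<^esub>)" for k
      using \<sigma> i A.smult_zero_left A.smult_one by (induction k) (auto simp: less_Suc_eq)
    then have Le: "L ?e = \<sigma> i" unfolding L_def using i by simp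
    have "V (cc (\<sigma> i)) x = V ?e x"
      by (rule Vindep[OF cc(1)[OF \<sigma>[OF i]] e _ x]) (simp only: cc(2)[OF \<sigma>[OF i]] Le)
    also have "\<dots> = (\<Sum>j<n. if j = i then e (\<xi> i) x else 0)"
      unfolding V_def
      by (rule sum.cong) (use x character_zero[OF Mg echar] in \<open>simp_all add: M.smult_one\<close>)
    also have "\<dots> = e (\<xi> i) x" using i by simp
    finally show "V (cc (\<sigma> i)) x = e (\<xi> i) x" .
  qed
qed

end

section \<open>Extension of scalars\<close>

locale ring_map =
  fixes R S :: "'u ring" and h :: "'u \<Rightarrow> 'u"
  assumes R: "ring R" and S: "ring S" and h: "h \<in> ring_hom R S"
begin

abbreviation "A \<equiv> restrict_right S h"
abbreviation "BC M \<equiv> base_change R S h M"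
abbreviation "bc_map M N f \<equiv> base_change_map R S h M N f"
abbreviation "pure M \<equiv> tensor_pure R A M"

lemma restrict_simps [simp]:
  "carrier A = carrier S" "\<zero>\<^bsub>A\<^esub> = \<zero>\<^bsub>S\<^esub>" "x \<oplus>\<^bsub>A\<^esub> y = x \<oplus>\<^bsub>S\<^esub> y" "r \<odot>\<^bsub>A\<^esub> x = x \<otimes>\<^bsub>S\<^esub> h r"
  by (simp_all add: restrict_right_def)

lemma A: "left_module (opp R) A"
proof -
  interpret R: ring R by (rule R)
  interpret S: ring S by (rule S)
  note [simp] = ring_hom_closed[OF h] ring_hom_add[OF h] ring_hom_mult[OF h] ring_hom_one[OF h]
  have "abelian_group A"
    by (rule abelian_groupI) (auto simp: S.a_ac)
  then show ?thesis
    by (intro left_module.intro left_module_axioms.intro ring_opp R)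
      (auto simp: S.l_distr S.r_distr S.m_assoc)
qed

lemma mult_linear: "s \<in> carrier S \<Longrightarrow> linear (opp R) A A (\<lambda>t. s \<otimes>\<^bsub>S\<^esub> t)"
proof -
  interpret S: ring S by (rule S)
  show "s \<in> carrier S \<Longrightarrow> linear (opp R) A A (\<lambda>t. s \<otimes>\<^bsub>S\<^esub> t)"
    by (rule linearI) (auto simp: S.r_distr S.m_assoc ring_hom_closed[OF h])
qed

lemma bc_simps [simp]:
  "carrier (BC M) = carrier (tensor R A M)" "\<zero>\<^bsub>BC M\<^esub> = \<one>\<^bsub>tensor R A M\<^esub>"
  "x \<oplus>\<^bsub>BC M\<^esub> y = x \<otimes>\<^bsub>tensor R A M\<^esub> y"
  by (simp_all add: base_change_def Let_def)

lemma bc_smult: "s \<odot>\<^bsub>BC M\<^esub> t = tensor_map R A M A M (\<lambda>t. s \<otimes>\<^bsub>S\<^esub> t) (\<lambda>x. x) t"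
  by (simp add: base_change_def Let_def)

lemma character_bc: "character (BC M) \<chi> \<longleftrightarrow> character (tensor_group R A M) \<chi>"
  by (simp add: character_def)

lemma tensor_pair: "left_module R M \<Longrightarrow> tensor_pair R A M"
  by (rule tensor_pair.intro[OF A])

lemma pure_closed: "left_module R M \<Longrightarrow> s \<in> carrier S \<Longrightarrow> x \<in> carrier M \<Longrightarrow> pure M s x \<in> carrier (tensor R A M)"
  using tensor_pair.pure_closed[OF tensor_pair] by simp

lemma bc_smult_props:
  assumes M: "left_module R M" and s: "s \<in> carrier S"
  shows "additive (tensor_group R A M) (tensor_group R A M) (\<lambda>t. s \<odot>\<^bsub>BC M\<^esub> t)"
    "\<And>t x. t \<in> carrier S \<Longrightarrow> x \<in> carrier M \<Longrightarrow> s \<odot>\<^bsub>BC M\<^esub> pure M t x = pure M (s \<otimes>\<^bsub>S\<^esub> t) x"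
  using tensor_map_pure_additive[OF A M A M mult_linear[OF s] linear_id] by (simp_all add: bc_smult)

lemma additive_sum:
  assumes G: "abelian_group G" and f: "additive P G f" and g: "additive P G g"
  shows "additive P G (\<lambda>x. f x \<oplus>\<^bsub>G\<^esub> g x)"
proof -
  interpret abelian_group G by fact
  show ?thesis using f g by (auto simp: additive_def Pi_def a_ac)
qed

lemma additive_comp: "additive P G f \<Longrightarrow> additive G H g \<Longrightarrow> additive P H (\<lambda>x. g (f x))"
  by (auto simp: additive_def Pi_def)

lemma additive_id: "additive P P (\<lambda>x. x)"
  by (auto simp: additive_def)

text \<open>Where elements of the tensor product have to be computed, both sides are additive in t
  and need to be compared on elementary tensors only.\<close>

lemma BC_module:
  assumes M: "left_module R M" shows "left_module S (BC M)"
proof -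
  interpret S: ring S by (rule S)
  interpret T: tensor_pair R A M by (rule tensor_pair[OF M])
  interpret G: comm_group "tensor R A M" by (rule T.comm_group_tensor)
  note sm = bc_smult_props[OF M]
  note TG = T.abelian_group_tensor
  have "abelian_group (BC M)"
    by (rule abelian_groupI) (auto simp: G.m_ac)
  then show ?thesis
  proof (intro left_module.intro left_module_axioms.intro S)
    fix a t assume a: "a \<in> carrier S" and t: "t \<in> carrier (BC M)"
    show "a \<odot>\<^bsub>BC M\<^esub> t \<in> carrier (BC M)" using additiveD(1)[OF sm(1)[OF a]] t by simp
    fix b assume b: "b \<in> carrier S"
    have "(a \<oplus>\<^bsub>S\<^esub> b) \<odot>\<^bsub>BC M\<^esub> t = a \<odot>\<^bsub>BC M\<^esub> t \<oplus>\<^bsub>tensor_group R A M\<^esub> b \<odot>\<^bsub>BC M\<^esub> t"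
      by (rule T.additive_eqI[OF TG sm(1)[OF S.a_closed[OF a b]] additive_sum[OF TG sm(1)[OF a] sm(1)[OF b]]])
        (use a b t sm(2) T.pure_add_left in \<open>simp_all add: S.l_distr\<close>)
    then show "(a \<oplus>\<^bsub>S\<^esub> b) \<odot>\<^bsub>BC M\<^esub> t = a \<odot>\<^bsub>BC M\<^esub> t \<oplus>\<^bsub>BC M\<^esub> b \<odot>\<^bsub>BC M\<^esub> t" by simp
    show "(a \<otimes>\<^bsub>S\<^esub> b) \<odot>\<^bsub>BC M\<^esub> t = a \<odot>\<^bsub>BC M\<^esub> (b \<odot>\<^bsub>BC M\<^esub> t)"
      by (rule T.additive_eqI[OF TG sm(1)[OF S.m_closed[OF a b]] additive_comp[OF sm(1)[OF b] sm(1)[OF a]]])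
        (use a b t sm(2) in \<open>simp_all add: S.m_assoc\<close>)
  next
    fix a t t' assume "a \<in> carrier S" "t \<in> carrier (BC M)" "t' \<in> carrier (BC M)"
    then show "a \<odot>\<^bsub>BC M\<^esub> (t \<oplus>\<^bsub>BC M\<^esub> t') = a \<odot>\<^bsub>BC M\<^esub> t \<oplus>\<^bsub>BC M\<^esub> a \<odot>\<^bsub>BC M\<^esub> t'"
      using additiveD(2)[OF sm(1)] by simp
  next
    fix t assume t: "t \<in> carrier (BC M)"
    show "\<one>\<^bsub>S\<^esub> \<odot>\<^bsub>BC M\<^esub> t = t"
      by (rule T.additive_eqI[OF TG sm(1)[OF S.one_closed] additive_id])
        (use t sm(2) in simp_all)
  qed
qed

lemma bc_map_props:
  assumes M: "left_module R M" and N: "left_module R N" and f: "linear R M N f"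
  shows "additive (tensor_group R A M) (tensor_group R A N) (bc_map M N f)"
    "\<And>s x. s \<in> carrier S \<Longrightarrow> x \<in> carrier M \<Longrightarrow> bc_map M N f (pure M s x) = pure N s (f x)"
  using tensor_map_pure_additive[OF A M A N linear_id f] by (simp_all add: base_change_map_def)

lemma bc_map_Hom:
  assumes M: "left_module R M" and N: "left_module R N" and f: "linear R M N f"
  shows "bc_map M N f \<in> Hom S (BC M) (BC N)"
proof -
  interpret S: ring S by (rule S)
  interpret T: tensor_pair R A M by (rule tensor_pair[OF M])
  interpret T': tensor_pair R A N by (rule tensor_pair[OF N])
  note p = bc_map_props[OF M N f] and sm = bc_smult_props
  show ?thesis
  proof (rule linear_Hom[OF linearI])
    fix x y assume "x \<in> carrier (BC M)" "y \<in> carrier (BC M)"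
    then show "bc_map M N f x \<in> carrier (BC N)"
      "bc_map M N f (x \<oplus>\<^bsub>BC M\<^esub> y) = bc_map M N f x \<oplus>\<^bsub>BC N\<^esub> bc_map M N f y"
      using additiveD[OF p(1)] by simp_all
  next
    fix s t assume s: "s \<in> carrier S" and t: "t \<in> carrier (BC M)"
    show "bc_map M N f (s \<odot>\<^bsub>BC M\<^esub> t) = s \<odot>\<^bsub>BC N\<^esub> bc_map M N f t"
      by (rule T.additive_eqI[OF T'.abelian_group_tensor additive_comp[OF sm(1)[OF M s] p(1)]
            additive_comp[OF p(1) sm(1)[OF N s]]])
        (use s t p(2) sm(2)[OF M s] sm(2)[OF N s] linearD(1)[OF f] in simp_all)
  qed (simp add: base_change_map_def tensor_map_def)
qed

text \<open>The composite k only has to agree with g after f on the carrier of M, so that restricted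
  maps and plain lambda terms can be exchanged.\<close>

lemma bc_map_comp:
  assumes M: "left_module R M" and N: "left_module R N" and P: "left_module R P"
    and f: "linear R M N f" and g: "linear R N P g" and k: "linear R M P k"
    and eq: "\<And>x. x \<in> carrier M \<Longrightarrow> k x = g (f x)" and t: "t \<in> carrier (tensor R A M)"
  shows "bc_map N P g (bc_map M N f t) = bc_map M P k t"
proof -
  interpret T: tensor_pair R A M by (rule tensor_pair[OF M])
  interpret T': tensor_pair R A P by (rule tensor_pair[OF P])
  show ?thesis
    by (rule T.additive_eqI[OF T'.abelian_group_tensor
          additive_comp[OF bc_map_props(1)[OF M N f] bc_map_props(1)[OF N P g]] bc_map_props(1)[OF M P k]])
      (use t eq bc_map_props(2)[OF M N f] bc_map_props(2)[OF N P g] bc_map_props(2)[OF M P k] linearD(1)[OF f] in simp_all)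
qed

lemma bc_map_id:
  assumes M: "left_module R M" and t: "t \<in> carrier (tensor R A M)"
  shows "bc_map M M (\<lambda>x. x) t = t"
proof -
  interpret T: tensor_pair R A M by (rule tensor_pair[OF M])
  show ?thesis
    by (rule T.additive_eqI[OF T.abelian_group_tensor bc_map_props(1)[OF M M linear_id] additive_id])
      (use t bc_map_props(2)[OF M M linear_id] in simp_all)
qed

text \<open>Elementary tensors lift along a surjection, and sums of lifts are lifts.\<close>

lemma bc_map_surj:
  assumes M: "left_module R M" and N: "left_module R N" and f: "linear R M N f"
    and surj: "f ` carrier M = carrier N"
  shows "bc_map M N f ` carrier (tensor R A M) = carrier (tensor R A N)"
proof
  note p = bc_map_props[OF M N f]
  interpret T: tensor_pair R A M by (rule tensor_pair[OF M])
  interpret T': tensor_pair R A N by (rule tensor_pair[OF N])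
  interpret G: abelian_group "tensor_group R A M" by (rule T.abelian_group_tensor)
  show "bc_map M N f ` carrier (tensor R A M) \<subseteq> carrier (tensor R A N)"
    using additiveD(1)[OF p(1)] by auto
  have "\<exists>s\<in>carrier (tensor R A M). t = bc_map M N f s" if "t \<in> carrier (tensor R A N)" for t
    using that
  proof (induction t rule: T'.tensor_induct)
    case zero
    then show ?case
      using additive_zero[OF T.abelian_group_tensor T'.abelian_group_tensor p(1)] G.zero_closed
      by (intro bexI[of _ "\<one>\<^bsub>tensor R A M\<^esub>"]) simp_all
  next
    case (pure s y)
    then obtain x where "x \<in> carrier M" "y = f x" using surj by blast
    then show ?case using pure p(2) T.pure_closed by (intro bexI[of _ "pure M s x"]) simp_all
  next
    case (add t t')
    then obtain s s' where "s \<in> carrier (tensor R A M)" "t = bc_map M N f s"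
      "s' \<in> carrier (tensor R A M)" "t' = bc_map M N f s'" by blast
    then show ?case
      using additiveD(2)[OF p(1), of s s'] G.a_closed[of s s'] by (intro bexI[of _ "s \<otimes>\<^bsub>tensor R A M\<^esub> s'"]) simp_all
  qed
  then show "carrier (tensor R A N) \<subseteq> bc_map M N f ` carrier (tensor R A M)" by blast
qed

end

text \<open>
  The map \<open>S \<otimes> M'' \<rightarrow> (S \<otimes> M)''\<close> sending \<open>s \<otimes> \<phi>\<close> to \<open>\<zeta> \<mapsto> \<phi> (\<zeta> (s \<otimes> -))\<close>; \<open>kappa \<zeta> t\<close> is the value
  at \<open>\<zeta>\<close> of the image of \<open>t\<close>.  It is bijective when \<open>S\<close> is finitely presented.
\<close>

locale ring_map_bidual = ring_map R S h for R S :: "'u ring" and h +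
  fixes M M' M'' :: "('u, 'u) module" and e e2
  assumes M: "left_module R M" and D: "dual_pair R M M' e" and D2: "dual_pair (opp R) M' M'' e2"
begin

lemmas D' = dual_pairD[OF D] and D2' = dual_pairD[OF D2, simplified]

lemma M': "left_module (opp R) M'" by (rule ModsD(1)[OF D'(1)])

lemma M'': "left_module R M''" by (rule ModsD(1)[OF D2'(1)])

lemma represent:
  assumes "character (BC M) \<zeta>" "s \<in> carrier S"
  shows "\<exists>\<xi>\<in>carrier M'. \<forall>x\<in>carrier M. e \<xi> x = \<zeta> (pure M s x)"
proof -
  have "balanced R A M (\<lambda>s x. \<zeta> (pure M s x))"
    by (rule tensor_pair.pure_balanced[OF tensor_pair[OF M]]) (use assms in \<open>simp add: character_bc\<close>)
  from D'(4)[OF balanced_character_right[OF this]] assms(2) show ?thesis by simp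
qed

definition kappa where
  "kappa \<zeta> = (SOME \<kappa>. character (BC M'') \<kappa> \<and> (\<forall>s\<in>carrier S. \<forall>\<phi>\<in>carrier M''. \<forall>\<xi>\<in>carrier M'.
     (\<forall>x\<in>carrier M. e \<xi> x = \<zeta> (pure M s x)) \<longrightarrow> \<kappa> (pure M'' s \<phi>) = e2 \<phi> \<xi>))"

text \<open>Sending s, \<phi> to \<phi>(\<zeta>(s \<otimes> -)) is a balanced pairing of S with M''
  and lifts to S \<otimes> M''. The \<xi> that represents \<zeta>(s \<otimes> -) is unique, so any
  \<xi> with these values may be used.\<close>

lemma kappa:
  assumes \<zeta>: "character (BC M) \<zeta>"
  shows "character (BC M'') (kappa \<zeta>)"
    "\<And>s \<phi> \<xi>. s \<in> carrier S \<Longrightarrow> \<phi> \<in> carrier M'' \<Longrightarrow> \<xi> \<in> carrier M' \<Longrightarrow>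
      (\<And>x. x \<in> carrier M \<Longrightarrow> e \<xi> x = \<zeta> (pure M s x)) \<Longrightarrow> kappa \<zeta> (pure M'' s \<phi>) = e2 \<phi> \<xi>"
proof -
  have "balanced R A M (\<lambda>s x. \<zeta> (pure M s x))"
    by (rule tensor_pair.pure_balanced[OF tensor_pair[OF M]]) (use \<zeta> in \<open>simp add: character_bc\<close>)
  from dual_hom[OF D M A this] obtain w where w: "w \<in> Hom (opp R) A M'"
    "\<And>s x. s \<in> carrier A \<Longrightarrow> x \<in> carrier M \<Longrightarrow> e (w s) x = \<zeta> (pure M s x)" by blast
  have "balanced R A M'' (\<lambda>s \<phi>. e2 \<phi> (w s))"
    using D2'(2) Hom_linear[OF w(1)] unfolding balanced_def linear_def additive_def by (auto simp: Pi_def)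
  then obtain \<kappa> where \<kappa>: "character (tensor_group R A M'') \<kappa>"
    "\<And>s \<phi>. s \<in> carrier A \<Longrightarrow> \<phi> \<in> carrier M'' \<Longrightarrow> \<kappa> (pure M'' s \<phi>) = e2 \<phi> (w s)"
    by (rule tensor_pair.balanced_lift[OF tensor_pair[OF M'']]) blast
  have "\<exists>\<kappa>. character (BC M'') \<kappa> \<and> (\<forall>s\<in>carrier S. \<forall>\<phi>\<in>carrier M''. \<forall>\<xi>\<in>carrier M'.
     (\<forall>x\<in>carrier M. e \<xi> x = \<zeta> (pure M s x)) \<longrightarrow> \<kappa> (pure M'' s \<phi>) = e2 \<phi> \<xi>)"
  proof (intro exI conjI ballI impI)
    show "character (BC M'') \<kappa>" using \<kappa>(1) by (simp add: character_bc)
    fix s \<phi> \<xi> assume *: "s \<in> carrier S" "\<phi> \<in> carrier M''" "\<xi> \<in> carrier M'"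
      "\<forall>x\<in>carrier M. e \<xi> x = \<zeta> (pure M s x)"
    have "w s = \<xi>"
      by (rule D'(3)) (use * w(2) linearD(1)[OF Hom_linear[OF w(1)]] in simp_all)
    then show "\<kappa> (pure M'' s \<phi>) = e2 \<phi> \<xi>" using \<kappa>(2) * by simp
  qed
  from someI_ex[OF this]
  show "character (BC M'') (kappa \<zeta>)" "\<And>s \<phi> \<xi>. s \<in> carrier S \<Longrightarrow> \<phi> \<in> carrier M'' \<Longrightarrow> \<xi> \<in> carrier M' \<Longrightarrow>
      (\<And>x. x \<in> carrier M \<Longrightarrow> e \<xi> x = \<zeta> (pure M s x)) \<Longrightarrow> kappa \<zeta> (pure M'' s \<phi>) = e2 \<phi> \<xi>"
    unfolding kappa_def by blast+
qed

text \<open>Only the values of \<zeta> on elementary tensors matter; needed since \<zeta> occurs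
  both as a lambda term and in restricted form.\<close>

lemma kappa_cong:
  assumes \<zeta>: "character (BC M) \<zeta>" and \<zeta>': "character (BC M) \<zeta>'"
    and eq: "\<And>s x. s \<in> carrier S \<Longrightarrow> x \<in> carrier M \<Longrightarrow> \<zeta> (pure M s x) = \<zeta>' (pure M s x)"
    and t: "t \<in> carrier (BC M'')"
  shows "kappa \<zeta> t = kappa \<zeta>' t"
proof (rule tensor_pair.character_tensor_eqI[OF tensor_pair[OF M'']])
  show "character (tensor_group R A M'') (kappa \<zeta>)" "character (tensor_group R A M'') (kappa \<zeta>')"
    using kappa(1)[OF \<zeta>] kappa(1)[OF \<zeta>'] by (simp_all add: character_bc)
  fix s \<phi> assume s: "s \<in> carrier A" and \<phi>: "\<phi> \<in> carrier M''"
  then obtain \<xi> where "\<xi> \<in> carrier M'" "\<forall>x\<in>carrier M. e \<xi> x = \<zeta> (pure M s x)" using represent[OF \<zeta>, of s] by auto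
  then show "kappa \<zeta> (pure M'' s \<phi>) = kappa \<zeta>' (pure M'' s \<phi>)"
    using kappa(2)[OF \<zeta>, of s \<phi> \<xi>] kappa(2)[OF \<zeta>', of s \<phi> \<xi>] s \<phi> eq by simp
qed (use t in simp)

lemma character_smult:
  "character (BC M) \<zeta> \<Longrightarrow> s \<in> carrier S \<Longrightarrow> character (BC M) (\<lambda>u. \<zeta> (s \<odot>\<^bsub>BC M\<^esub> u))"
  using character_comp[OF bc_smult_props(1)[OF M]] by (simp add: character_bc)

text \<open>S-linearity of S \<otimes> M'' -> (S \<otimes> M)'', where S acts on characters through
  their argument.\<close>

lemma kappa_smult:
  assumes \<zeta>: "character (BC M) \<zeta>" and s: "s \<in> carrier S" and t: "t \<in> carrier (BC M'')"
  shows "kappa \<zeta> (s \<odot>\<^bsub>BC M''\<^esub> t) = kappa (\<lambda>u. \<zeta> (s \<odot>\<^bsub>BC M\<^esub> u)) t"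
proof (rule tensor_pair.character_tensor_eqI[OF tensor_pair[OF M'']])
  interpret S: ring S by (rule S)
  note \<zeta>s = character_smult[OF \<zeta> s]
  show "character (tensor_group R A M'') (\<lambda>t. kappa \<zeta> (s \<odot>\<^bsub>BC M''\<^esub> t))"
    using character_comp[OF bc_smult_props(1)[OF M'' s]] kappa(1)[OF \<zeta>] by (simp add: character_bc)
  show "character (tensor_group R A M'') (kappa (\<lambda>u. \<zeta> (s \<odot>\<^bsub>BC M\<^esub> u)))"
    using kappa(1)[OF \<zeta>s] by (simp add: character_bc)
  fix r \<phi> assume r: "r \<in> carrier A" and \<phi>: "\<phi> \<in> carrier M''"
  then have r': "r \<in> carrier S" by simp
  obtain \<xi> where \<xi>: "\<xi> \<in> carrier M'" "\<forall>x\<in>carrier M. e \<xi> x = \<zeta> (pure M (s \<otimes>\<^bsub>S\<^esub> r) x)"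
    using represent[OF \<zeta>, of "s \<otimes>\<^bsub>S\<^esub> r"] s r' by auto
  have "kappa \<zeta> (pure M'' (s \<otimes>\<^bsub>S\<^esub> r) \<phi>) = e2 \<phi> \<xi>" by (rule kappa(2)[OF \<zeta>]) (use s r' \<phi> \<xi> in simp_all)
  moreover have "kappa (\<lambda>u. \<zeta> (s \<odot>\<^bsub>BC M\<^esub> u)) (pure M'' r \<phi>) = e2 \<phi> \<xi>"
    by (rule kappa(2)[OF \<zeta>s]) (use s r' \<phi> \<xi> bc_smult_props(2)[OF M s] in simp_all)
  ultimately show "kappa \<zeta> (s \<odot>\<^bsub>BC M''\<^esub> pure M'' r \<phi>) = kappa (\<lambda>u. \<zeta> (s \<odot>\<^bsub>BC M\<^esub> u)) (pure M'' r \<phi>)"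
    using bc_smult_props(2)[OF M'' s r' \<phi>] by simp
qed (use t in simp)

text \<open>Followed by S \<otimes> M'' -> (S \<otimes> M)'', the map S \<otimes> \<epsilon> becomes
  evaluation at elements of S \<otimes> M.\<close>

lemma kappa_embedding:
  assumes \<epsilon>: "linear R M M'' \<epsilon>" "\<And>x \<xi>. x \<in> carrier M \<Longrightarrow> \<xi> \<in> carrier M' \<Longrightarrow> e2 (\<epsilon> x) \<xi> = e \<xi> x"
    and \<zeta>: "character (BC M) \<zeta>" and t: "t \<in> carrier (BC M)"
  shows "kappa \<zeta> (bc_map M M'' \<epsilon> t) = \<zeta> t"
proof (rule tensor_pair.character_tensor_eqI[OF tensor_pair[OF M]])
  show "character (tensor_group R A M) (\<lambda>t. kappa \<zeta> (bc_map M M'' \<epsilon> t))"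
    using character_comp[OF bc_map_props(1)[OF M M'' \<epsilon>(1)]] kappa(1)[OF \<zeta>] by (simp add: character_bc)
  show "character (tensor_group R A M) \<zeta>" using \<zeta> by (simp add: character_bc)
  fix s x assume s: "s \<in> carrier A" and x: "x \<in> carrier M"
  obtain \<xi> where \<xi>: "\<xi> \<in> carrier M'" "\<forall>x\<in>carrier M. e \<xi> x = \<zeta> (pure M s x)" using represent[OF \<zeta>, of s] s by auto
  have "kappa \<zeta> (pure M'' s (\<epsilon> x)) = e2 (\<epsilon> x) \<xi>"
    by (rule kappa(2)[OF \<zeta>]) (use s x \<xi> linearD(1)[OF \<epsilon>(1)] in simp_all)
  then show "kappa \<zeta> (bc_map M M'' \<epsilon> (pure M s x)) = \<zeta> (pure M s x)"
    using bc_map_props(2)[OF M M'' \<epsilon>(1)] s x \<xi> \<epsilon>(2) by simp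
qed (use t in simp)

text \<open>Injectivity. Write t as \<Sum> \<sigma> i \<otimes> \<phi> i. Tuples in M'^n that
  satisfy the relations come from characters of S \<otimes> M, so \<phi> kills them all and is, by
  \<open>bidual_factor\<close>, a combination of the rows of \<alpha>. The relations between the
  \<sigma> i then make t vanish.\<close>

lemma kappa_zero:
  assumes pres: "presented_module R A n m \<sigma> \<alpha>" and t: "t \<in> carrier (BC M'')"
    and van: "\<And>\<zeta>. character (BC M) \<zeta> \<Longrightarrow> kappa \<zeta> t = 0"
  shows "t = \<zero>\<^bsub>BC M''\<^esub>"
proof -
  interpret P: presented_module R A n m \<sigma> \<alpha> by (rule pres)
  interpret T: tensor_pair R A M'' by (rule tensor_pair[OF M''])
  interpret M'': left_module R M'' by (rule M'')
  interpret A: left_module "opp R" A by (rule A)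
  note TG = T.abelian_group_tensor
  obtain \<phi> where \<phi>: "\<And>i. i < n \<Longrightarrow> \<phi> i \<in> carrier M''"
    "t = msum (tensor_group R A M'') (\<lambda>i. pure M'' (\<sigma> i) (\<phi> i)) n"
    using P.tensor_generators[OF M''] t by auto
  have \<sigma>S: "\<sigma> i \<in> carrier S" if "i < n" for i using P.\<sigma>[OF that] by simp
  have pc: "pure M'' (\<sigma> i) (\<phi> i) \<in> carrier (tensor_group R A M'')" if "i < n" for i
    using T.pure_closed P.\<sigma> \<phi>(1) that by simp
  have zero: "(\<Sum>i<n. e2 (\<phi> i) (\<xi> i)) = 0"
    if \<xi>: "\<forall>i<n. \<xi> i \<in> carrier M'" and rel: "\<forall>j<m. msum M' (\<lambda>i. \<alpha> j i \<odot>\<^bsub>M'\<^esub> \<xi> i) n = \<zero>\<^bsub>M'\<^esub>" for \<xi>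
  proof -
    obtain \<beta> where \<beta>: "balanced R A M \<beta>" "\<And>i x. i < n \<Longrightarrow> x \<in> carrier M \<Longrightarrow> \<beta> (\<sigma> i) x = e (\<xi> i) x"
      by (rule P.balanced_from_generators[OF M D \<xi> rel]) blast
    obtain \<zeta> where \<zeta>: "character (tensor_group R A M) \<zeta>"
      "\<And>s x. s \<in> carrier A \<Longrightarrow> x \<in> carrier M \<Longrightarrow> \<zeta> (pure M s x) = \<beta> s x"
      by (rule tensor_pair.balanced_lift[OF tensor_pair[OF M] \<beta>(1)]) blast
    have \<zeta>': "character (BC M) \<zeta>" using \<zeta>(1) by (simp add: character_bc)
    have kc: "character (tensor_group R A M'') (kappa \<zeta>)" using kappa(1)[OF \<zeta>'] by (simp add: character_bc)
    have "0 = kappa \<zeta> t" using van[OF \<zeta>'] by simp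
    also have "\<dots> = (\<Sum>i<n. kappa \<zeta> (pure M'' (\<sigma> i) (\<phi> i)))"
      unfolding \<phi>(2) by (rule msum_character[OF TG kc pc])
    also have "\<dots> = (\<Sum>i<n. e2 (\<phi> i) (\<xi> i))"
      by (rule sum.cong) (use kappa(2)[OF \<zeta>'] \<sigma>S \<phi>(1) \<xi> \<zeta>(2) \<beta>(2) in simp_all)
    finally show ?thesis by simp
  qed
  obtain \<psi> where \<psi>: "\<And>j. \<psi> j \<in> carrier M''" "\<And>i. i < n \<Longrightarrow> \<phi> i = msum M'' (\<lambda>j. \<alpha> j i \<odot>\<^bsub>M''\<^esub> \<psi> j) m"
    by (rule bidual_factor[OF M' D2 P.\<alpha> \<phi>(1) zero]) blast+
  have "t = \<zero>\<^bsub>tensor_group R A M''\<^esub>"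
  proof (rule character_eqI[OF TG])
    fix \<chi> assume \<chi>: "character (tensor_group R A M'') \<chi>"
    let ?b = "\<lambda>s y. \<chi> (pure M'' s y)"
    note b = T.pure_balanced[OF \<chi>]
    have "\<chi> t = (\<Sum>i<n. ?b (\<sigma> i) (\<phi> i))" unfolding \<phi>(2) by (rule msum_character[OF TG \<chi> pc])
    also have "\<dots> = (\<Sum>i<n. \<Sum>j<m. ?b (\<sigma> i) (\<alpha> j i \<odot>\<^bsub>M''\<^esub> \<psi> j))"
    proof (rule sum.cong)
      fix i assume "i \<in> {..<n}"
      then have i: "i < n" by simp
      show "?b (\<sigma> i) (\<phi> i) = (\<Sum>j<m. ?b (\<sigma> i) (\<alpha> j i \<odot>\<^bsub>M''\<^esub> \<psi> j))"
        unfolding \<psi>(2)[OF i]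
        by (rule msum_character[OF M''.M.abelian_group_axioms balanced_character_right[OF b P.\<sigma>[OF i]]])
          (use P.\<alpha> i \<psi>(1) M''.smult_closed in simp)
    qed simp
    also have "\<dots> = (\<Sum>j<m. \<Sum>i<n. ?b (\<sigma> i) (\<alpha> j i \<odot>\<^bsub>M''\<^esub> \<psi> j))" by (rule sum.swap)
    also have "\<dots> = (\<Sum>j<m. 0)"
    proof (rule sum.cong)
      fix j assume "j \<in> {..<m}"
      then have j: "j < m" by simp
      have "(\<Sum>i<n. ?b (\<sigma> i) (\<alpha> j i \<odot>\<^bsub>M''\<^esub> \<psi> j)) = ?b (msum A (\<lambda>i. \<alpha> j i \<odot>\<^bsub>A\<^esub> \<sigma> i) n) (\<psi> j)"
        by (rule P.balanced_generators[OF M'' b \<psi>(1), symmetric]) (use P.\<alpha>[OF j] in blast)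
      also have "\<dots> = 0"
        unfolding P.relation[OF j] by (rule balanced_zero(2)[OF A M'' b \<psi>(1)])
      finally show "(\<Sum>i<n. ?b (\<sigma> i) (\<alpha> j i \<odot>\<^bsub>M''\<^esub> \<psi> j)) = 0" .
    qed simp
    finally show "\<chi> t = \<chi> \<zero>\<^bsub>tensor_group R A M''\<^esub>" using character_zero[OF TG \<chi>] by simp
  next
    show "t \<in> carrier (tensor_group R A M'')" using t by simp
    show "\<zero>\<^bsub>tensor_group R A M''\<^esub> \<in> carrier (tensor_group R A M'')" by (rule abelian_groupE(2)[OF TG])
  qed
  then show ?thesis by simp
qed

lemma kappa_eqI:
  assumes pres: "presented_module R A n m \<sigma> \<alpha>" and t: "t \<in> carrier (BC M'')" "t' \<in> carrier (BC M'')"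
    and eq: "\<And>\<zeta>. character (BC M) \<zeta> \<Longrightarrow> kappa \<zeta> t = kappa \<zeta> t'"
  shows "t = t'"
proof -
  interpret B: left_module S "BC M''" by (rule BC_module[OF M''])
  note Bg = B.M.abelian_group_axioms
  have "t \<oplus>\<^bsub>BC M''\<^esub> \<ominus>\<^bsub>BC M''\<^esub> t' = \<zero>\<^bsub>BC M''\<^esub>"
  proof (rule kappa_zero[OF pres])
    show "t \<oplus>\<^bsub>BC M''\<^esub> \<ominus>\<^bsub>BC M''\<^esub> t' \<in> carrier (BC M'')" by (intro B.M.a_closed B.M.a_inv_closed t)
    fix \<zeta> assume \<zeta>: "character (BC M) \<zeta>"
    have "kappa \<zeta> (t \<oplus>\<^bsub>BC M''\<^esub> \<ominus>\<^bsub>BC M''\<^esub> t') = kappa \<zeta> t + - kappa \<zeta> t'"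
      using characterD[OF kappa(1)[OF \<zeta>] t(1) B.M.a_inv_closed[OF t(2)]]
        character_inv[OF Bg kappa(1)[OF \<zeta>] t(2)] by simp
    then show "kappa \<zeta> (t \<oplus>\<^bsub>BC M''\<^esub> \<ominus>\<^bsub>BC M''\<^esub> t') = 0" using eq[OF \<zeta>] by simp
  qed
  then show ?thesis using t by (metis B.M.a_inv_closed B.M.minus_equality B.M.minus_minus)
qed

text \<open>Restriction to generators embeds the dual of S \<otimes> M in M'^n. A character \<Phi>
  of this dual therefore extends to M'^n, where it is a tuple \<phi> in M''^n, and \<Sum> \<sigma> i
  \<otimes> \<phi> i is a preimage of \<Phi>.\<close>

lemma kappa_surj:
  assumes pres: "presented_module R A n m \<sigma> \<alpha>" and \<Phi>: "character (character_module (BC M)) \<Phi>"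
  shows "\<exists>t\<in>carrier (BC M''). \<forall>\<zeta>\<in>carrier (character_module (BC M)). kappa \<zeta> t = \<Phi> \<zeta>"
proof -
  interpret P: presented_module R A n m \<sigma> \<alpha> by (rule pres)
  interpret T: tensor_pair R A M'' by (rule tensor_pair[OF M''])
  interpret TM: tensor_pair R A M by (rule tensor_pair[OF M])
  interpret M': left_module "opp R" M' by (rule M')
  let ?C = "character_module (BC M)"
  interpret C: left_module "opp S" ?C by (rule left_module_character_module[OF BC_module[OF M]])
  note Cg = C.M.abelian_group_axioms and M'g = M'.M.abelian_group_axioms and TG = T.abelian_group_tensor
  have \<sigma>S: "\<sigma> i \<in> carrier S" if "i < n" for i using P.\<sigma>[OF that] by simp
  have Cc: "character (BC M) \<zeta>" "\<zeta> \<in> extensional (carrier (BC M))" if "\<zeta> \<in> carrier ?C" for \<zeta>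
    using that by (simp_all add: character_module_def)
  have Cadd: "(\<zeta> \<oplus>\<^bsub>?C\<^esub> \<zeta>') u = \<zeta> u + \<zeta>' u" if "u \<in> carrier (BC M)" for \<zeta> \<zeta>' u
    using that by (simp add: character_module_def)
  have C0: "\<zero>\<^bsub>?C\<^esub> u = 0" if "u \<in> carrier (BC M)" for u using that by (simp add: character_module_def)
  define w where "w \<zeta> i = (SOME \<xi>. \<xi> \<in> carrier M' \<and> (\<forall>x\<in>carrier M. e \<xi> x = \<zeta> (pure M (\<sigma> i) x)))" for \<zeta> i
  have w: "w \<zeta> i \<in> carrier M'" "\<And>x. x \<in> carrier M \<Longrightarrow> e (w \<zeta> i) x = \<zeta> (pure M (\<sigma> i) x)"
    if "\<zeta> \<in> carrier ?C" "i < n" for \<zeta> i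
  proof -
    have "\<exists>\<xi>. \<xi> \<in> carrier M' \<and> (\<forall>x\<in>carrier M. e \<xi> x = \<zeta> (pure M (\<sigma> i) x))"
      using represent[OF Cc(1)[OF that(1)] \<sigma>S[OF that(2)]] by blast
    from someI_ex[OF this] show "w \<zeta> i \<in> carrier M'" "\<And>x. x \<in> carrier M \<Longrightarrow> e (w \<zeta> i) x = \<zeta> (pure M (\<sigma> i) x)"
      unfolding w_def by blast+
  qed
  have pc: "pure M (\<sigma> i) x \<in> carrier (BC M)" if "i < n" "x \<in> carrier M" for i x
    using pure_closed[OF M \<sigma>S[OF that(1)] that(2)] by simp
  define W where "W \<zeta> = restrict (w \<zeta>) {..<n}" for \<zeta>
  have Wadd: "additive ?C (tuples n M') W"
    unfolding additive_def
  proof (intro conjI ballI funcsetI)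
    fix \<zeta> assume \<zeta>: "\<zeta> \<in> carrier ?C"
    show "W \<zeta> \<in> carrier (tuples n M')" using w \<zeta> by (auto simp: W_def)
    fix \<zeta>' assume \<zeta>': "\<zeta>' \<in> carrier ?C"
    have "w (\<zeta> \<oplus>\<^bsub>?C\<^esub> \<zeta>') i = w \<zeta> i \<oplus>\<^bsub>M'\<^esub> w \<zeta>' i" if i: "i < n" for i
    proof (rule D'(3))
      show "w (\<zeta> \<oplus>\<^bsub>?C\<^esub> \<zeta>') i \<in> carrier M'" by (rule w(1)[OF C.M.a_closed[OF \<zeta> \<zeta>'] i])
      show "w \<zeta> i \<oplus>\<^bsub>M'\<^esub> w \<zeta>' i \<in> carrier M'" by (intro M'.M.a_closed w \<zeta> \<zeta>' i)
      fix x assume x: "x \<in> carrier M"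
      show "e (w (\<zeta> \<oplus>\<^bsub>?C\<^esub> \<zeta>') i) x = e (w \<zeta> i \<oplus>\<^bsub>M'\<^esub> w \<zeta>' i) x"
        using w(2)[OF C.M.a_closed[OF \<zeta> \<zeta>'] i x] Cadd[OF pc[OF i x]] w[OF \<zeta> i] w[OF \<zeta>' i] x
        by (simp add: balancedD(1)[OF D'(2)])
    qed
    then show "W (\<zeta> \<oplus>\<^bsub>?C\<^esub> \<zeta>') = W \<zeta> \<oplus>\<^bsub>tuples n M'\<^esub> W \<zeta>'" by (auto simp: W_def fun_eq_iff)
  qed
  \<comment> \<open>A character of S \<otimes> M that vanishes at all \<sigma> i \<otimes> x is 0,
    so W is injective and \<Phi> extends along it.\<close>
  have ker: "\<Phi> \<zeta> = 0" if \<zeta>: "\<zeta> \<in> carrier ?C" and W0: "W \<zeta> = \<zero>\<^bsub>tuples n M'\<^esub>" for \<zeta>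
  proof -
    have w0: "w \<zeta> i = \<zero>\<^bsub>M'\<^esub>" if "i < n" for i using fun_cong[OF W0, of i] that by (simp add: W_def)
    have c: "character (tensor_group R A M) \<zeta>" using Cc(1)[OF \<zeta>] by (simp add: character_bc)
    have c0: "character (tensor_group R A M) (\<lambda>_. 0)" by (simp add: character_def)
    have "\<zeta> (pure M s x) = 0" if "s \<in> carrier A" "x \<in> carrier M" for s x
    proof (rule P.balanced_determined[OF M TM.pure_balanced[OF c] TM.pure_balanced[OF c0] _ that])
      fix i x assume i: "i < n" and x: "x \<in> carrier M"
      show "\<zeta> (pure M (\<sigma> i) x) = 0"
        using w(2)[OF \<zeta> i x] w0[OF i] balanced_zero(2)[OF M' M D'(2) x] by simp
    qed
    then have z: "\<zeta> u = 0" if "u \<in> carrier (BC M)" for u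
      using TM.character_tensor_eqI[OF c c0, of u] that by simp
    have "\<zeta> = \<zero>\<^bsub>?C\<^esub>"
      by (rule extensionalityI[OF Cc(2)[OF \<zeta>] Cc(2)[OF C.M.zero_closed]]) (simp only: z C0)
    then show ?thesis using character_zero[OF Cg \<Phi>] by simp
  qed
  obtain \<Psi> where \<Psi>: "character (tuples n M') \<Psi>" "\<And>\<zeta>. \<zeta> \<in> carrier ?C \<Longrightarrow> \<Psi> (W \<zeta>) = \<Phi> \<zeta>"
    by (rule character_factor[OF Cg abelian_group_tuples[OF M'g] Wadd \<Phi> ker]) blast+
  define \<phi> where "\<phi> i = (SOME p. p \<in> carrier M'' \<and> (\<forall>\<xi>\<in>carrier M'. e2 p \<xi> = \<Psi> (unit_tuple n M' i \<xi>)))" for i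
  have \<phi>: "\<phi> i \<in> carrier M''" "\<And>\<xi>. \<xi> \<in> carrier M' \<Longrightarrow> e2 (\<phi> i) \<xi> = \<Psi> (unit_tuple n M' i \<xi>)" for i
  proof -
    have "\<exists>p. p \<in> carrier M'' \<and> (\<forall>\<xi>\<in>carrier M'. e2 p \<xi> = \<Psi> (unit_tuple n M' i \<xi>))"
      using D2'(4)[OF character_tuples_component[OF M'g \<Psi>(1)]] by blast
    from someI_ex[OF this] show "\<phi> i \<in> carrier M''" "\<And>\<xi>. \<xi> \<in> carrier M' \<Longrightarrow> e2 (\<phi> i) \<xi> = \<Psi> (unit_tuple n M' i \<xi>)"
      unfolding \<phi>_def by blast+
  qed
  define t where "t = msum (tensor_group R A M'') (\<lambda>i. pure M'' (\<sigma> i) (\<phi> i)) n"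
  have pc'': "pure M'' (\<sigma> i) (\<phi> i) \<in> carrier (tensor_group R A M'')" if "i < n" for i
    using T.pure_closed[OF P.\<sigma>[OF that] \<phi>(1)] by simp
  have tc: "t \<in> carrier (BC M'')" using msum_closed[OF TG pc''] by (simp add: t_def)
  have "kappa \<zeta> t = \<Phi> \<zeta>" if \<zeta>: "\<zeta> \<in> carrier ?C" for \<zeta>
  proof -
    have kc: "character (tensor_group R A M'') (kappa \<zeta>)" using kappa(1)[OF Cc(1)[OF \<zeta>]] by (simp add: character_bc)
    have "kappa \<zeta> t = (\<Sum>i<n. kappa \<zeta> (pure M'' (\<sigma> i) (\<phi> i)))"
      unfolding t_def by (rule msum_character[OF TG kc pc''])
    also have "\<dots> = (\<Sum>i<n. \<Psi> (unit_tuple n M' i (W \<zeta> i)))"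
    proof (rule sum.cong)
      fix i assume "i \<in> {..<n}"
      then have i: "i < n" by simp
      have "kappa \<zeta> (pure M'' (\<sigma> i) (\<phi> i)) = e2 (\<phi> i) (w \<zeta> i)"
        by (rule kappa(2)[OF Cc(1)[OF \<zeta>] \<sigma>S[OF i] \<phi>(1) w[OF \<zeta> i]])
      then show "kappa \<zeta> (pure M'' (\<sigma> i) (\<phi> i)) = \<Psi> (unit_tuple n M' i (W \<zeta> i))"
        using \<phi>(2)[OF w(1)[OF \<zeta> i]] i by (simp add: W_def)
    qed simp
    also have "\<dots> = \<Psi> (W \<zeta>)"
      by (rule character_tuples_sum[OF M'g \<Psi>(1) additiveD(1)[OF Wadd \<zeta>], symmetric])
    finally show ?thesis using \<Psi>(2)[OF \<zeta>] by simp
  qed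
  then show ?thesis using tc by blast
qed

end

text \<open>A character of S \<otimes> M is determined by its values on elementary tensors, that is
  by a function from S x M to Q/Z; this avoids estimating the size of the tensor product
  itself.\<close>

lemma (in universe_type) small_sized_character_module_base_change:
  fixes R S :: "'u ring" and M :: "('u, 'u) module"
  assumes rm: "ring_map R S h" and sS: "small (carrier S)" and M: "M \<in> Mods R"
  shows "small_sized U (carrier (character_module (base_change R S h M)))"
proof -
  interpret ring_map R S h by (rule rm)
  note Ml = ModsD(1)[OF M]
  let ?C = "character_module (BC M)"
  let ?g = "\<lambda>\<zeta>. \<lambda>p\<in>carrier S \<times> carrier M. \<zeta> (pure M (fst p) (snd p))"
  have "inj_on ?g (carrier ?C)"
  proof (rule inj_onI)
    fix \<zeta> \<zeta>' assume \<zeta>: "\<zeta> \<in> carrier ?C" "\<zeta>' \<in> carrier ?C" and eq: "?g \<zeta> = ?g \<zeta>'"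
    have c: "character (tensor_group R A M) \<zeta>" "character (tensor_group R A M) \<zeta>'"
      and ext: "\<zeta> \<in> extensional (carrier (BC M))" "\<zeta>' \<in> extensional (carrier (BC M))"
      using \<zeta> by (simp_all add: character_module_def character_bc)
    have "\<zeta> (pure M s x) = \<zeta>' (pure M s x)" if "s \<in> carrier A" "x \<in> carrier M" for s x
      using fun_cong[OF eq, of "(s, x)"] that by simp
    then have "\<zeta> u = \<zeta>' u" if "u \<in> carrier (BC M)" for u
      using tensor_pair.character_tensor_eqI[OF tensor_pair[OF Ml] c, of u] that by simp
    then show "\<zeta> = \<zeta>'" by (rule extensionalityI[OF ext])
  qed
  moreover have "?g ` carrier ?C \<subseteq> carrier S \<times> carrier M \<rightarrow>\<^sub>E UNIV"
    by (intro image_subsetI) (simp add: PiE_def)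
  ultimately have le: "carrier ?C \<lesssim> (carrier S \<times> carrier M \<rightarrow>\<^sub>E (UNIV :: qz set))"
    unfolding lepoll_def by blast
  have "small_sized U (carrier S \<times> carrier M \<rightarrow>\<^sub>E (UNIV :: qz set))"
    by (intro small_sized_PiE small_sized_Times small_sizedI sS ModsD(2)[OF M] small_sized_countable countable_qz)
  then show ?thesis by (rule small_sized_lepoll[OF _ le])
qed

section \<open>Lifting maps out of flat modules\<close>

text \<open>
  A map \<open>b : Y \<rightarrow> S \<otimes> N\<close> is a pairing of \<open>(S \<otimes> N)'\<close> with \<open>Y\<close>.  As \<open>Y\<close> is flat, it extends along
  \<open>(S \<otimes> N)' \<rightarrow> (S \<otimes> F)'\<close>, and a pairing of \<open>(S \<otimes> F)'\<close> with \<open>Y\<close> is a map into \<open>(S \<otimes> F)'' = S \<otimes> F''\<close>.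
\<close>

lemma (in universe_type) flat_lift:
  fixes R S :: "'u ring"
  assumes rm: "ring_map R S h" and pres: "presented_module R (restrict_right S h) n m \<sigma> \<alpha>"
    and sS: "small (carrier S)" and F: "F \<in> Mods R" and N: "N \<in> Mods R"
    and q: "q \<in> Hom R F N" "q ` carrier F = carrier N"
    and DF: "dual_pair R F F' eF" and DF2: "dual_pair (opp R) F' F'' eF2"
    and DN: "dual_pair R N N' eN" and DN2: "dual_pair (opp R) N' N'' eN2"
    and q': "linear (opp R) N' F' q'" "\<And>\<eta> x. \<eta> \<in> carrier N' \<Longrightarrow> x \<in> carrier F \<Longrightarrow> eF (q' \<eta>) x = eN \<eta> (q x)"
    and q2: "linear R F'' N'' q2"
      "\<And>\<phi> \<eta>. \<phi> \<in> carrier F'' \<Longrightarrow> \<eta> \<in> carrier N' \<Longrightarrow> eN2 (q2 \<phi>) \<eta> = eF2 \<phi> (q' \<eta>)"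
    and \<epsilon>: "linear R N N'' \<epsilon>" "\<And>x \<eta>. x \<in> carrier N \<Longrightarrow> \<eta> \<in> carrier N' \<Longrightarrow> eN2 (\<epsilon> x) \<eta> = eN \<eta> x"
    and \<rho>: "linear R N'' N \<rho>" "\<And>x. x \<in> carrier N \<Longrightarrow> \<rho> (\<epsilon> x) = x"
    and Y: "Y \<in> Flat S" and b: "b \<in> Hom S Y (base_change R S h N)"
  obtains b' where "b' \<in> Hom S Y (base_change R S h F'')"
    "\<And>y. y \<in> carrier Y \<Longrightarrow> base_change_map R S h F'' N (\<lambda>\<phi>. \<rho> (q2 \<phi>)) (b' y) = b y"
proof -
  interpret ring_map R S h by (rule rm)
  note Fl = ModsD(1)[OF F] and Nl = ModsD(1)[OF N]
  interpret BF: ring_map_bidual R S h F F' F'' eF eF2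
    by (intro ring_map_bidual.intro ring_map_bidual_axioms.intro rm Fl DF DF2)
  interpret BN: ring_map_bidual R S h N N' N'' eN eN2
    by (intro ring_map_bidual.intro ring_map_bidual_axioms.intro rm Nl DN DN2)
  have Ym: "left_module S Y" using Y by (simp add: Flat_def ModsD)
  note Yc = left_module_closed[OF Ym]
  note ql = Hom_linear[OF q(1)] and bl = linearD[OF Hom_linear[OF b]]
  let ?CF = "character_module (BC F)" and ?CN = "character_module (BC N)"
  note CFm = left_module_character_module[OF BC_module[OF Fl]]
    and CNm = left_module_character_module[OF BC_module[OF Nl]]
  note CFc = left_module_closed[OF CFm]
  have sF: "small_sized U (carrier ?CF)" by (rule small_sized_character_module_base_change[OF rm sS F])
  have sN: "small_sized U (carrier ?CN)" by (rule small_sized_character_module_base_change[OF rm sS N])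
  have C_iff: "\<zeta> \<in> carrier (character_module (BC M)) \<longleftrightarrow>
      \<zeta> \<in> extensional (carrier (tensor R A M)) \<and> character (BC M) \<zeta>" for \<zeta> M
    by (simp add: character_module_def)
  have C_add: "\<zeta> \<oplus>\<^bsub>character_module (BC M)\<^esub> \<zeta>' = (\<lambda>u\<in>carrier (tensor R A M). \<zeta> u + \<zeta>' u)" for \<zeta> \<zeta>' M
    by (simp add: character_module_def)
  have C_smult: "s \<odot>\<^bsub>character_module (BC M)\<^esub> \<zeta> = (\<lambda>u\<in>carrier (tensor R A M). \<zeta> (s \<odot>\<^bsub>BC M\<^esub> u))" for s \<zeta> M
    by (simp add: character_module_def)
  note bq = bc_map_Hom[OF Fl Nl ql]
  note bql = linearD[OF Hom_linear[OF bq], simplified bc_simps(1)]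
  note BFcl = left_module_closed[OF BC_module[OF Fl], simplified bc_simps(1)]
    and BNcl = left_module_closed[OF BC_module[OF Nl], simplified bc_simps(1)]
  \<comment> \<open>The dual of S \<otimes> q. It is injective because S \<otimes> q inherits
    surjectivity from q.\<close>
  define pull where "pull \<zeta> = (\<lambda>u\<in>carrier (tensor R A F). \<zeta> (bc_map F N q u))" for \<zeta> :: "_ \<Rightarrow> qz"
  have pull_char: "character (BC F) (\<lambda>u. \<zeta> (bc_map F N q u))" if "character (BC N) \<zeta>" for \<zeta>
    using character_comp[OF linear_additive[OF Hom_linear[OF bq]] that] .
  have pull: "linear (opp S) ?CN ?CF pull"
  proof (rule linearI)
    fix \<zeta> assume "\<zeta> \<in> carrier ?CN"
    then have c: "character (BC F) (\<lambda>u. \<zeta> (bc_map F N q u))" using pull_char C_iff by blast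
    have "character (BC F) (pull \<zeta>)"
      using c BFcl(1) unfolding character_def pull_def by simp
    then show "pull \<zeta> \<in> carrier ?CF" by (simp add: C_iff pull_def)
  next
    fix \<zeta> \<zeta>' show "pull (\<zeta> \<oplus>\<^bsub>?CN\<^esub> \<zeta>') = pull \<zeta> \<oplus>\<^bsub>?CF\<^esub> pull \<zeta>'"
      unfolding pull_def C_add by (rule restrict_ext) (use bql(1) in simp)
  next
    fix s \<zeta> assume "s \<in> carrier (opp S)"
    then have s: "s \<in> carrier S" by simp
    show "pull (s \<odot>\<^bsub>?CN\<^esub> \<zeta>) = s \<odot>\<^bsub>?CF\<^esub> pull \<zeta>"
      unfolding pull_def C_smult by (rule restrict_ext) (use bql(1,3) BFcl(2) s in simp)
  qed
  have pull_inj: "inj_on pull (carrier ?CN)"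
  proof (rule inj_onI)
    fix \<zeta> \<zeta>' assume \<zeta>: "\<zeta> \<in> carrier ?CN" "\<zeta>' \<in> carrier ?CN" and eq: "pull \<zeta> = pull \<zeta>'"
    have ext: "\<zeta> \<in> extensional (carrier (tensor R A N))" "\<zeta>' \<in> extensional (carrier (tensor R A N))"
      using \<zeta> by (simp_all add: C_iff)
    show "\<zeta> = \<zeta>'"
    proof (rule extensionalityI[OF ext])
      fix v assume "v \<in> carrier (tensor R A N)"
      then obtain u where u: "u \<in> carrier (tensor R A F)" "v = bc_map F N q u"
        using bc_map_surj[OF Fl Nl ql q(2)] by blast
      then show "\<zeta> v = \<zeta>' v" using fun_cong[OF eq, of u] by (simp add: pull_def)
    qed
  qed
  have bal: "balanced S ?CN Y (\<lambda>\<zeta> y. \<zeta> (b y))"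
    unfolding balanced_def
  proof (intro conjI ballI)
    fix \<zeta> \<zeta>' y assume "y \<in> carrier Y"
    then show "(\<zeta> \<oplus>\<^bsub>?CN\<^esub> \<zeta>') (b y) = \<zeta> (b y) + \<zeta>' (b y)" using bl(1) by (simp add: C_add)
  next
    fix \<zeta> y y' assume \<zeta>: "\<zeta> \<in> carrier ?CN" and y: "y \<in> carrier Y" "y' \<in> carrier Y"
    have "character (BC N) \<zeta>" using \<zeta> C_iff by blast
    from characterD[OF this bl(1)[OF y(1)] bl(1)[OF y(2)]]
    show "\<zeta> (b (y \<oplus>\<^bsub>Y\<^esub> y')) = \<zeta> (b y) + \<zeta> (b y')" using bl(2)[OF y] by simp
  next
    fix s \<zeta> y assume "s \<in> carrier S" "y \<in> carrier Y"
    then show "(s \<odot>\<^bsub>?CN\<^esub> \<zeta>) (b y) = \<zeta> (b (s \<odot>\<^bsub>Y\<^esub> y))" using bl(1,3) by (simp add: C_smult)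
  qed
  \<comment> \<open>Flatness of Y over S. The character modules lie outside the universe type but
    are small, so \<open>Flat_extend\<close> covers them.\<close>
  obtain \<beta> where \<beta>: "balanced S ?CF Y \<beta>"
    "\<And>\<zeta> y. \<zeta> \<in> carrier ?CN \<Longrightarrow> y \<in> carrier Y \<Longrightarrow> \<beta> (pull \<zeta>) y = \<zeta> (b y)"
    using Flat_extend[OF Y CNm sN CFm sF pull pull_inj bal] by blast
  \<comment> \<open>\<open>kappa_surj\<close> turns the character sending \<zeta> to \<beta> \<zeta>
    y into an element of S \<otimes> F''. By \<open>kappa_eqI\<close> this element is unique, which
    makes b' linear.\<close>
  define b' where "b' = (\<lambda>y\<in>carrier Y. SOME t. t \<in> carrier (BC F'') \<and> (\<forall>\<zeta>\<in>carrier ?CF. BF.kappa \<zeta> t = \<beta> \<zeta> y))"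
  have b': "b' y \<in> carrier (BC F'')" "\<And>\<zeta>. \<zeta> \<in> carrier ?CF \<Longrightarrow> BF.kappa \<zeta> (b' y) = \<beta> \<zeta> y" if y: "y \<in> carrier Y" for y
  proof -
    have "\<exists>t. t \<in> carrier (BC F'') \<and> (\<forall>\<zeta>\<in>carrier ?CF. BF.kappa \<zeta> t = \<beta> \<zeta> y)"
      using BF.kappa_surj[OF pres balanced_character_left[OF \<beta>(1) y]] by blast
    from someI_ex[OF this] show "b' y \<in> carrier (BC F'')" "\<And>\<zeta>. \<zeta> \<in> carrier ?CF \<Longrightarrow> BF.kappa \<zeta> (b' y) = \<beta> \<zeta> y"
      using y unfolding b'_def by auto
  qed
  \<comment> \<open>Members of the dual are extensional whereas \<open>kappa\<close> takes any
    character; both forms give the same values.\<close>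
  have restr: "restrict \<zeta> (carrier (tensor R A F)) \<in> carrier ?CF"
    "\<And>t. t \<in> carrier (BC F'') \<Longrightarrow> BF.kappa \<zeta> t = BF.kappa (restrict \<zeta> (carrier (tensor R A F))) t"
    if \<zeta>: "character (BC F) \<zeta>" for \<zeta>
  proof -
    have c: "character (BC F) (restrict \<zeta> (carrier (tensor R A F)))"
      using \<zeta> BFcl(1) unfolding character_def by simp
    then show "restrict \<zeta> (carrier (tensor R A F)) \<in> carrier ?CF" by (simp add: C_iff)
    show "BF.kappa \<zeta> t = BF.kappa (restrict \<zeta> (carrier (tensor R A F))) t" if "t \<in> carrier (BC F'')" for t
      by (rule BF.kappa_cong[OF \<zeta> c _ that]) (use pure_closed[OF Fl] in simp)
  qed
  have kappa_eq: "t = t'" if "t \<in> carrier (BC F'')" "t' \<in> carrier (BC F'')"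
    "\<And>\<zeta>. \<zeta> \<in> carrier ?CF \<Longrightarrow> BF.kappa \<zeta> t = BF.kappa \<zeta> t'" for t t'
    by (rule BF.kappa_eqI[OF pres that(1,2)]) (use restr that in simp)
  note BXm = BC_module[OF BF.M'']
  note BXc = left_module_closed[OF BXm]
  have b'H: "b' \<in> Hom S Y (BC F'')"
  proof (rule linear_Hom[OF linearI])
    fix y y' assume y: "y \<in> carrier Y" "y' \<in> carrier Y"
    show "b' (y \<oplus>\<^bsub>Y\<^esub> y') = b' y \<oplus>\<^bsub>BC F''\<^esub> b' y'"
    proof (rule kappa_eq)
      show "b' (y \<oplus>\<^bsub>Y\<^esub> y') \<in> carrier (BC F'')" by (rule b'(1)[OF Yc(1)[OF y]])
      show "b' y \<oplus>\<^bsub>BC F''\<^esub> b' y' \<in> carrier (BC F'')" by (rule BXc(1)[OF b'(1)[OF y(1)] b'(1)[OF y(2)]])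
      fix \<zeta> assume \<zeta>: "\<zeta> \<in> carrier ?CF"
      then have c: "character (BC F) \<zeta>" by (simp add: C_iff)
      have "BF.kappa \<zeta> (b' y \<oplus>\<^bsub>BC F''\<^esub> b' y') = BF.kappa \<zeta> (b' y) + BF.kappa \<zeta> (b' y')"
        by (rule characterD[OF BF.kappa(1)[OF c] b'(1)[OF y(1)] b'(1)[OF y(2)]])
      also have "\<dots> = \<beta> \<zeta> (y \<oplus>\<^bsub>Y\<^esub> y')" using b'(2) \<zeta> y balancedD(2)[OF \<beta>(1) \<zeta> y] by simp
      also have "\<dots> = BF.kappa \<zeta> (b' (y \<oplus>\<^bsub>Y\<^esub> y'))" using b'(2)[OF Yc(1)[OF y] \<zeta>] by simp
      finally show "BF.kappa \<zeta> (b' (y \<oplus>\<^bsub>Y\<^esub> y')) = BF.kappa \<zeta> (b' y \<oplus>\<^bsub>BC F''\<^esub> b' y')" by (rule sym)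
    qed
  next
    fix s y assume s: "s \<in> carrier S" and y: "y \<in> carrier Y"
    show "b' (s \<odot>\<^bsub>Y\<^esub> y) = s \<odot>\<^bsub>BC F''\<^esub> b' y"
    proof (rule kappa_eq)
      show "b' (s \<odot>\<^bsub>Y\<^esub> y) \<in> carrier (BC F'')" by (rule b'(1)[OF Yc(2)[OF s y]])
      show "s \<odot>\<^bsub>BC F''\<^esub> b' y \<in> carrier (BC F'')" by (rule BXc(2)[OF s b'(1)[OF y]])
      fix \<zeta> assume \<zeta>: "\<zeta> \<in> carrier ?CF"
      then have c: "character (BC F) \<zeta>" by (simp add: C_iff)
      have "BF.kappa \<zeta> (s \<odot>\<^bsub>BC F''\<^esub> b' y) = BF.kappa (\<lambda>u. \<zeta> (s \<odot>\<^bsub>BC F\<^esub> u)) (b' y)"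
        by (rule BF.kappa_smult[OF c s b'(1)[OF y]])
      also have "\<dots> = BF.kappa (s \<odot>\<^bsub>?CF\<^esub> \<zeta>) (b' y)"
        using restr(2)[OF BF.character_smult[OF c s] b'(1)[OF y]] by (simp add: C_smult)
      also have "\<dots> = \<beta> (s \<odot>\<^bsub>?CF\<^esub> \<zeta>) y" by (rule b'(2)[OF y]) (use CFc(2) s \<zeta> in simp)
      also have "\<dots> = \<beta> \<zeta> (s \<odot>\<^bsub>Y\<^esub> y)" by (rule balancedD(3)[OF \<beta>(1) s \<zeta> y])
      also have "\<dots> = BF.kappa \<zeta> (b' (s \<odot>\<^bsub>Y\<^esub> y))" using b'(2)[OF Yc(2)[OF s y] \<zeta>] by simp
      finally show "BF.kappa \<zeta> (b' (s \<odot>\<^bsub>Y\<^esub> y)) = BF.kappa \<zeta> (s \<odot>\<^bsub>BC F''\<^esub> b' y)" by (rule sym)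
    qed
  qed (use b'(1) in \<open>simp_all add: b'_def\<close>)
  \<comment> \<open>The map S \<otimes> M'' -> (S \<otimes> M)'' is natural in M: S \<otimes> q2,
    with q2 the double dual of q, corresponds to the double dual of S \<otimes> q.\<close>
  have natural: "BN.kappa \<zeta> (bc_map F'' N'' q2 t) = BF.kappa (\<lambda>u. \<zeta> (bc_map F N q u)) t"
    if \<zeta>: "character (BC N) \<zeta>" and t: "t \<in> carrier (BC F'')" for \<zeta> t
  proof (rule tensor_pair.character_tensor_eqI[OF tensor_pair[OF BF.M'']])
    note p = bc_map_props[OF BF.M'' BN.M'' q2(1)]
    show "character (tensor_group R A F'') (\<lambda>t. BN.kappa \<zeta> (bc_map F'' N'' q2 t))"
      using character_comp[OF p(1)] BN.kappa(1)[OF \<zeta>] by (simp add: character_bc)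
    show "character (tensor_group R A F'') (BF.kappa (\<lambda>u. \<zeta> (bc_map F N q u)))"
      using BF.kappa(1)[OF pull_char[OF \<zeta>]] by (simp add: character_bc)
    fix s \<phi> assume s: "s \<in> carrier A" and \<phi>: "\<phi> \<in> carrier F''"
    then have s': "s \<in> carrier S" by simp
    obtain \<eta> where \<eta>: "\<eta> \<in> carrier N'" "\<forall>x\<in>carrier N. eN \<eta> x = \<zeta> (pure N s x)"
      using BN.represent[OF \<zeta> s'] by blast
    have "BN.kappa \<zeta> (pure N'' s (q2 \<phi>)) = eN2 (q2 \<phi>) \<eta>"
      by (rule BN.kappa(2)[OF \<zeta> s' linearD(1)[OF q2(1) \<phi>] \<eta>(1)]) (use \<eta>(2) in simp)
    also have "\<dots> = eF2 \<phi> (q' \<eta>)" by (rule q2(2)[OF \<phi> \<eta>(1)])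
    also have "\<dots> = BF.kappa (\<lambda>u. \<zeta> (bc_map F N q u)) (pure F'' s \<phi>)"
      by (rule BF.kappa(2)[OF pull_char[OF \<zeta>] s' \<phi> linearD(1)[OF q'(1) \<eta>(1)], symmetric])
        (use q'(2)[OF \<eta>(1)] \<eta>(2) linearD(1)[OF ql] bc_map_props(2)[OF Fl Nl ql s'] in simp)
    finally show "BN.kappa \<zeta> (bc_map F'' N'' q2 (pure F'' s \<phi>)) = BF.kappa (\<lambda>u. \<zeta> (bc_map F N q u)) (pure F'' s \<phi>)"
      using p(2)[OF s' \<phi>] by simp
  qed (use t in simp)
  have lift: "bc_map F'' N (\<lambda>\<phi>. \<rho> (q2 \<phi>)) (b' y) = b y" if y: "y \<in> carrier Y" for y
  proof -
    note b'y = b'(1)[OF y] and by' = bl(1)[OF y]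
    \<comment> \<open>The lift agrees with b after embedding N in N'', as tested by the characters
      of S \<otimes> N; the retraction \<rho> then removes \<epsilon>.\<close>
    have eq: "bc_map F'' N'' q2 (b' y) = bc_map N N'' \<epsilon> (b y)"
    proof (rule BN.kappa_eqI[OF pres])
      show "bc_map F'' N'' q2 (b' y) \<in> carrier (BC N'')"
        by (rule linearD(1)[OF Hom_linear[OF bc_map_Hom[OF BF.M'' BN.M'' q2(1)]] b'y])
      show "bc_map N N'' \<epsilon> (b y) \<in> carrier (BC N'')"
        by (rule linearD(1)[OF Hom_linear[OF bc_map_Hom[OF Nl BN.M'' \<epsilon>(1)]] by'])
      fix \<zeta> assume \<zeta>: "character (BC N) \<zeta>"
      let ?\<zeta> = "restrict \<zeta> (carrier (tensor R A N))"
      have r: "?\<zeta> \<in> carrier ?CN"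
        using \<zeta> BNcl(1) unfolding C_iff character_def by simp
      have pull_r: "pull ?\<zeta> = restrict (\<lambda>u. \<zeta> (bc_map F N q u)) (carrier (tensor R A F))"
        unfolding pull_def by (rule restrict_ext) (use bql(1) in simp)
      have "BN.kappa \<zeta> (bc_map F'' N'' q2 (b' y)) = BF.kappa (\<lambda>u. \<zeta> (bc_map F N q u)) (b' y)"
        by (rule natural[OF \<zeta> b'y])
      also have "\<dots> = BF.kappa (pull ?\<zeta>) (b' y)"
        unfolding pull_r by (rule restr(2)[OF pull_char[OF \<zeta>] b'y])
      also have "\<dots> = \<beta> (pull ?\<zeta>) y" by (rule b'(2)[OF y linearD(1)[OF pull r]])
      also have "\<dots> = ?\<zeta> (b y)" by (rule \<beta>(2)[OF r y])
      also have "\<dots> = \<zeta> (b y)" using by' by simp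
      also have "\<dots> = BN.kappa \<zeta> (bc_map N N'' \<epsilon> (b y))"
        by (rule BN.kappa_embedding[OF \<epsilon> \<zeta> by', symmetric])
      finally show "BN.kappa \<zeta> (bc_map F'' N'' q2 (b' y)) = BN.kappa \<zeta> (bc_map N N'' \<epsilon> (b y))" .
    qed
    have "bc_map F'' N (\<lambda>\<phi>. \<rho> (q2 \<phi>)) (b' y) = bc_map N'' N \<rho> (bc_map F'' N'' q2 (b' y))"
      by (rule bc_map_comp[OF BF.M'' BN.M'' Nl q2(1) \<rho>(1) linear_comp[OF q2(1) \<rho>(1)] refl, symmetric])
        (use b'y in simp)
    also have "\<dots> = bc_map N N (\<lambda>x. x) (b y)"
      unfolding eq by (rule bc_map_comp[OF Nl BN.M'' Nl \<epsilon>(1) \<rho>(1) linear_id]) (use \<rho>(2) by' in simp_all)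
    also have "\<dots> = b y" by (rule bc_map_id[OF Nl]) (use by' in simp)
    finally show ?thesis .
  qed
  show ?thesis by (rule that[OF b'H lift])
qed

text \<open>The lifting property is demanded over S, against flat S-modules, since the factorisation
  supplied by stable fullness lives there. The map p is the double dual of q followed by the
  retraction of N'' onto N.\<close>

lemma (in universe_type) FlatCot_lift:
  fixes R S :: "'u ring"
  assumes rm: "ring_map R S h" and sR: "small (carrier R)" and sS: "small (carrier S)"
    and fp: "finitely_presented (opp R) (restrict_right S h)" and def: "definable R (GFlat R)"
    and N: "N \<in> GFlat R" "N \<in> Pure_Injective R"
  obtains X p where "X \<in> FlatCot R" "p \<in> Hom R X N"
    "\<And>Y b. Y \<in> Flat S \<Longrightarrow> b \<in> Hom S Y (base_change R S h N) \<Longrightarrow>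
      \<exists>b'\<in>Hom S Y (base_change R S h X). \<forall>y\<in>carrier Y. base_change_map R S h X N p (b' y) = b y"
proof -
  interpret ring_map R S h by (rule rm)
  obtain n m \<sigma> \<alpha> where pres: "presented_module R A n m \<sigma> \<alpha>"
    using finitely_presentedE[OF ring_map.R[OF rm] fp A] by blast
  have Nm: "N \<in> Mods R" using N by (simp add: GFlat_def)
  obtain F q where F: "F \<in> Flat R" and q: "q \<in> Hom R F N" "q ` carrier F = carrier N"
    by (rule GFlat_resolution[OF N(1)]) blast
  have Fm: "F \<in> Mods R" using F by (simp add: Flat_def)
  note Fl = ModsD(1)[OF Fm] and Nl = ModsD(1)[OF Nm]
  obtain F' eF where DF: "dual_pair R F F' eF" using dual_pair_exists_Mods[OF Fm] .
  obtain F'' eF2 where DF2: "dual_pair (opp R) F' F'' eF2" using dual_pair_exists_Mods[OF dual_pairD(1)[OF DF]] .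
  obtain N' eN where DN: "dual_pair R N N' eN" using dual_pair_exists_Mods[OF Nm] .
  obtain N'' eN2 where DN2: "dual_pair (opp R) N' N'' eN2" using dual_pair_exists_Mods[OF dual_pairD(1)[OF DN]] .
  note F'D = dual_pairD[OF DF] and F''D = dual_pairD[OF DF2, simplified]
    and N'D = dual_pairD[OF DN] and N''D = dual_pairD[OF DN2, simplified]
  note F''l = ModsD(1)[OF F''D(1)] and N''l = ModsD(1)[OF N''D(1)]
  have "balanced R N' F (\<lambda>\<eta> x. eN \<eta> (q x))"
    using N'D(2) Hom_linear[OF q(1)] by (auto simp: balanced_def linear_def additive_def Pi_def)
  from dual_hom[OF DF Fl ModsD(1)[OF N'D(1)] this] obtain q' where q': "q' \<in> Hom (opp R) N' F'"
    "\<And>\<eta> x. \<eta> \<in> carrier N' \<Longrightarrow> x \<in> carrier F \<Longrightarrow> eF (q' \<eta>) x = eN \<eta> (q x)" by blast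
  have "balanced (opp R) F'' N' (\<lambda>\<phi> \<eta>. eF2 \<phi> (q' \<eta>))"
    using F''D(2) Hom_linear[OF q'(1)] by (auto simp: balanced_def linear_def additive_def Pi_def)
  from dual_hom[OF DN2 ModsD(1)[OF N'D(1)] _ this] F''l obtain q2 where q2: "q2 \<in> Hom R F'' N''"
    "\<And>\<phi> \<eta>. \<phi> \<in> carrier F'' \<Longrightarrow> \<eta> \<in> carrier N' \<Longrightarrow> eN2 (q2 \<phi>) \<eta> = eF2 \<phi> (q' \<eta>)" by auto
  obtain \<epsilon> where \<epsilon>: "\<epsilon> \<in> Hom R N N''" "\<And>x \<eta>. x \<in> carrier N \<Longrightarrow> \<eta> \<in> carrier N' \<Longrightarrow> eN2 (\<epsilon> x) \<eta> = eN \<eta> x"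
    and \<epsilon>p: "pure_mono R N N'' \<epsilon>"
    by (rule bidual_embedding[OF Nm DN DN2]) blast
  obtain \<rho> where \<rho>: "\<rho> \<in> Hom R N'' N" "\<And>x. x \<in> carrier N \<Longrightarrow> \<rho> (\<epsilon> x) = x"
    by (rule pure_injective_retract[OF N(2) N''D(1) \<epsilon>p]) blast
  have lin: "linear R F'' N (\<lambda>\<phi>. \<rho> (q2 \<phi>))" by (rule linear_comp[OF Hom_linear[OF q2(1)] Hom_linear[OF \<rho>(1)]])
  \<comment> \<open>\<open>Hom\<close> demands an extensional map; \<open>bcp\<close> shows that the
    restriction leaves the base change as it is.\<close>
  let ?p = "restrict (\<lambda>\<phi>. \<rho> (q2 \<phi>)) (carrier F'')"
  have p: "?p \<in> Hom R F'' N" by (rule linear_restrict_Hom[OF F''l lin])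
  have bcp: "bc_map F'' N ?p t = bc_map F'' N (\<lambda>\<phi>. \<rho> (q2 \<phi>)) t" if t: "t \<in> carrier (tensor R A F'')" for t
  proof -
    have "bc_map F'' N ?p t = bc_map F'' N ?p (bc_map F'' F'' (\<lambda>x. x) t)" using bc_map_id[OF F''l t] by simp
    also have "\<dots> = bc_map F'' N (\<lambda>\<phi>. \<rho> (q2 \<phi>)) t"
      by (rule bc_map_comp[OF F''l F''l Nl linear_id Hom_linear[OF p] lin _ t]) simp
    finally show ?thesis .
  qed
  show ?thesis
  proof (rule that[of F'' ?p])
    have "F'' \<in> Flat R" by (rule bidual_Flat[OF def sR F DF DF2])
    moreover have "F'' \<in> Cotorsion R"
      by (rule Pure_Injective_Cotorsion[OF dual_Pure_Injective[OF F'D(1) DF2]])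
    ultimately show "F'' \<in> FlatCot R" by (simp add: FlatCot_def)
    show "?p \<in> Hom R F'' N" by (rule p)
    fix Y b assume Y: "Y \<in> Flat S" and b: "b \<in> Hom S Y (BC N)"
    obtain b' where b': "b' \<in> Hom S Y (BC F'')"
      "\<And>y. y \<in> carrier Y \<Longrightarrow> bc_map F'' N (\<lambda>\<phi>. \<rho> (q2 \<phi>)) (b' y) = b y"
      by (rule flat_lift[OF rm pres sS Fm Nm q DF DF2 DN DN2 Hom_linear[OF q'(1)] q'(2)
            Hom_linear[OF q2(1)] q2(2) Hom_linear[OF \<epsilon>(1)] \<epsilon>(2) Hom_linear[OF \<rho>(1)] \<rho>(2) Y b]) blast+
    have "bc_map F'' N ?p (b' y) = b y" if "y \<in> carrier Y" for y
      using bcp[of "b' y"] linearD(1)[OF Hom_linear[OF b'(1)] that] b'(2)[OF that] by simp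
    then show "\<exists>b'\<in>Hom S Y (BC F''). \<forall>y\<in>carrier Y. bc_map F'' N ?p (b' y) = b y" using b'(1) by blast
  qed
qed

text \<open>Applied to the difference of a homomorphism with itself, this puts the homomorphism into
  its own stable class. The zero module, which is flat and pure injective, is the intermediate
  object.\<close>

lemma (in universe_type) factors_FlatCot_zero:
  fixes S :: "'u ring"
  assumes S: "ring S" "small (carrier S)" and M: "left_module S M" and N: "left_module S N"
  shows "factors_FlatCot S M N (\<lambda>x\<in>carrier M. \<zero>\<^bsub>N\<^esub>)"
proof -
  interpret N: left_module S N by (rule N)
  have reg: "regular S \<in> Mods S" using left_module_regular[OF S(1)] S(2) by (simp add: Mods_def)
  interpret Rg: left_module S "regular S" by (rule left_module_regular[OF S(1)])
  let ?Y = "zero_module (regular S)"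
  note Yl = left_module_zero_module[OF Rg.left_module_axioms]
  have Y: "?Y \<in> FlatCot S"
    using zero_module_Flat[OF reg] Pure_Injective_Cotorsion[OF zero_module_Pure_Injective[OF reg]]
    by (simp add: FlatCot_def)
  have a: "(\<lambda>x\<in>carrier M. \<zero>\<^bsub>regular S\<^esub>) \<in> Hom S M ?Y"
    by (rule linear_restrict_Hom[OF M linearI]) (use Rg.smult_zero_right Rg.M.l_zero Rg.M.zero_closed in \<open>simp_all del: regular_simps\<close>)
  have b: "(\<lambda>x\<in>carrier ?Y. \<zero>\<^bsub>N\<^esub>) \<in> Hom S ?Y N"
    by (rule linear_restrict_Hom[OF Yl linearI]) simp_all
  have "compose (carrier M) (\<lambda>x\<in>carrier ?Y. \<zero>\<^bsub>N\<^esub>) (\<lambda>x\<in>carrier M. \<zero>\<^bsub>regular S\<^esub>) = (\<lambda>x\<in>carrier M. \<zero>\<^bsub>N\<^esub>)"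
    by (auto simp: compose_def)
  then show ?thesis unfolding factors_FlatCot_def using Y a b by blast
qed

theorem theorem4p12:
  fixes R S :: "'u ring" and h :: "'u \<Rightarrow> 'u"
  assumes "universe TYPE('u)"
    and "ring R" and "ring S" and "small (carrier R)" and "small (carrier S)"
    and "h \<in> ring_hom R S"
    and "finitely_presented (opp R) (restrict_right S h)"
    and "finite_flat_dimension (opp R) (restrict_right S h)"
    and "definable R (GFlat R)" and "definable S (GFlat S)"
    and "stable_base_change_full R S h"
    and C1: "\<And>F M. F \<in> FlatCot R \<Longrightarrow> M \<in> GFlat R \<Longrightarrow> M \<in> Pure_Injective R \<Longrightarrow>
               base_change_surj R S h M F"
    and C2: "\<And>F M. F \<in> FlatCot R \<Longrightarrow> M \<in> GFlat R \<Longrightarrow> M \<in> Pure_Injective R \<Longrightarrow>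
               base_change_surj R S h F M"
  shows "\<forall>M N. M \<in> GFlat R \<longrightarrow> M \<in> Pure_Injective R \<longrightarrow>
               N \<in> GFlat R \<longrightarrow> N \<in> Pure_Injective R \<longrightarrow> base_change_surj R S h M N"
proof (intro allI impI)
  fix M N :: "('u, 'u) module"
  assume M: "M \<in> GFlat R" "M \<in> Pure_Injective R" and N: "N \<in> GFlat R" "N \<in> Pure_Injective R"
  interpret universe_type "TYPE('u)" by (rule universe_type.intro[OF assms(1)])
  have rm: "ring_map R S h" by (rule ring_map.intro[OF assms(2,3,6)])
  interpret ring_map R S h by (rule rm)
  have Mm: "M \<in> Mods R" and Nm: "N \<in> Mods R" using M N by (simp_all add: GFlat_def)
  note Ml = ModsD(1)[OF Mm] and Nl = ModsD(1)[OF Nm]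
  interpret Ml: left_module R M by (rule Ml)
  interpret Nl: left_module R N by (rule Nl)
  interpret BM: left_module S "BC M" by (rule BC_module[OF Ml])
  interpret BN: left_module S "BC N" by (rule BC_module[OF Nl])
  obtain X p where X: "X \<in> FlatCot R" and p: "p \<in> Hom R X N"
    and lift: "\<And>Y b. Y \<in> Flat S \<Longrightarrow> b \<in> Hom S Y (BC N) \<Longrightarrow>
      \<exists>b'\<in>Hom S Y (BC X). \<forall>y\<in>carrier Y. bc_map X N p (b' y) = b y"
    by (rule FlatCot_lift[OF rm assms(4,5,7,9) N]) blast
  have Xl: "left_module R X" using X by (simp add: FlatCot_def Flat_def ModsD)
  have "g \<in> base_change_map R S h M N ` Hom R M N" if g: "g \<in> Hom S (BC M) (BC N)" for g
  proof -
    note gl = Hom_linear[OF g]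
    let ?rel = "stable_rel S (BC M) (BC N)"
    have "(\<lambda>x\<in>carrier (BC M). g x \<ominus>\<^bsub>BC N\<^esub> g x) = (\<lambda>x\<in>carrier (BC M). \<zero>\<^bsub>BC N\<^esub>)"
      by (rule restrict_ext) (simp only: a_minus_def BN.M.r_neg linearD(1)[OF gl])
    then have gg: "(g, g) \<in> ?rel"
      using factors_FlatCot_zero[OF assms(3,5) BM.left_module_axioms BN.left_module_axioms] g
      by (simp add: stable_rel_def)
    have "M \<in> GFlatCot R" "N \<in> GFlatCot R"
      using M N Pure_Injective_Cotorsion by (simp_all add: GFlatCot_def)
    moreover have "?rel `` {g} \<in> stable_Hom S (BC M) (BC N)"
      unfolding stable_Hom_def by (rule quotientI[OF g])
    ultimately obtain c where c: "c \<in> stable_Hom R M N" "stable_base_change_map R S h M N c = ?rel `` {g}"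
      using assms(11) unfolding stable_base_change_full_def by blast
    have "g \<in> stable_base_change_map R S h M N c" unfolding c(2) using gg by blast
    \<comment> \<open>The induced map on classes is a union over representatives; g belongs to it,
      so some representative f has S \<otimes> f stably equal to g.\<close>
    then obtain f where f: "f \<in> c" "(bc_map M N f, g) \<in> ?rel"
      unfolding stable_base_change_map_def by blast
    have fH: "f \<in> Hom R M N"
      using c(1) f(1) unfolding stable_Hom_def by (auto simp: quotient_def stable_rel_def)
    have "factors_FlatCot S (BC M) (BC N) (\<lambda>x\<in>carrier (BC M). bc_map M N f x \<ominus>\<^bsub>BC N\<^esub> g x)"
      using f(2) by (simp add: stable_rel_def)
    then obtain Y a b where Y: "Y \<in> FlatCot S" and a: "a \<in> Hom S (BC M) Y" and b: "b \<in> Hom S Y (BC N)"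
      and ab: "compose (carrier (BC M)) b a = (\<lambda>x\<in>carrier (BC M). bc_map M N f x \<ominus>\<^bsub>BC N\<^esub> g x)"
      unfolding factors_FlatCot_def by blast
    \<comment> \<open>Y need not come from R, but X does: with b lifted to S \<otimes> X, the
      composite S \<otimes> M -> S \<otimes> X is a map between base changes, and (C1) realises it
      by u.\<close>
    obtain b' where b': "b' \<in> Hom S Y (BC X)" "\<And>y. y \<in> carrier Y \<Longrightarrow> bc_map X N p (b' y) = b y"
      using lift[of Y b] Y b unfolding FlatCot_def by blast
    have "restrict (\<lambda>t. b' (a t)) (carrier (BC M)) \<in> Hom S (BC M) (BC X)"
      by (rule linear_restrict_Hom[OF BM.left_module_axioms linear_comp[OF Hom_linear[OF a] Hom_linear[OF b'(1)]]])
    then have "restrict (\<lambda>t. b' (a t)) (carrier (BC M)) \<in> bc_map M X ` Hom R M X"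
      using C1[OF X M] by (simp only: base_change_surj_def)
    then obtain u where u: "u \<in> Hom R M X" "bc_map M X u = restrict (\<lambda>t. b' (a t)) (carrier (BC M))"
      by (elim imageE) (rule that, assumption, erule sym)
    have v: "linear R M N (\<lambda>x. p (u x))" by (rule linear_comp[OF Hom_linear[OF u(1)] Hom_linear[OF p]])
    have bv: "bc_map M N (\<lambda>x. p (u x)) t = bc_map M N f t \<ominus>\<^bsub>BC N\<^esub> g t" if t: "t \<in> carrier (BC M)" for t
    proof -
      have "bc_map M N (\<lambda>x. p (u x)) t = bc_map X N p (bc_map M X u t)"
        by (rule bc_map_comp[OF Ml Xl Nl Hom_linear[OF u(1)] Hom_linear[OF p] v refl, symmetric]) (use t in simp)
      also have "\<dots> = b (a t)" using u(2) b'(2) linearD(1)[OF Hom_linear[OF a] t] t by simp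
      also have "\<dots> = bc_map M N f t \<ominus>\<^bsub>BC N\<^esub> g t"
        using fun_cong[OF ab, of t] t by (simp add: compose_def)
      finally show ?thesis .
    qed
    \<comment> \<open>The error term S \<otimes> f - g equals S \<otimes> (p u), so g is the base
      change of f - p u.\<close>
    define k where "k = (\<lambda>x\<in>carrier M. f x \<oplus>\<^bsub>N\<^esub> \<ominus>\<^bsub>N\<^esub> p (u x))"
    note fl = linearD[OF Hom_linear[OF fH]] and vl = linearD[OF v]
    have k: "k \<in> Hom R M N"
      unfolding k_def
    proof (rule linear_restrict_Hom[OF Ml linearI])
      fix x y assume "x \<in> carrier M" "y \<in> carrier M"
      then show "f (x \<oplus>\<^bsub>M\<^esub> y) \<oplus>\<^bsub>N\<^esub> \<ominus>\<^bsub>N\<^esub> p (u (x \<oplus>\<^bsub>M\<^esub> y)) =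
          f x \<oplus>\<^bsub>N\<^esub> \<ominus>\<^bsub>N\<^esub> p (u x) \<oplus>\<^bsub>N\<^esub> (f y \<oplus>\<^bsub>N\<^esub> \<ominus>\<^bsub>N\<^esub> p (u y))"
        using fl vl by (simp add: Nl.M.minus_add Nl.M.a_ac)
    next
      fix r x assume rx: "r \<in> carrier R" "x \<in> carrier M"
      have "additive N N (\<lambda>y. r \<odot>\<^bsub>N\<^esub> y)"
        using rx by (auto simp: additive_def Nl.smult_r_distr Nl.smult_closed)
      from additive_inv[OF Nl.M.abelian_group_axioms Nl.M.abelian_group_axioms this vl(1)[OF rx(2)]]
      show "f (r \<odot>\<^bsub>M\<^esub> x) \<oplus>\<^bsub>N\<^esub> \<ominus>\<^bsub>N\<^esub> p (u (r \<odot>\<^bsub>M\<^esub> x)) = r \<odot>\<^bsub>N\<^esub> (f x \<oplus>\<^bsub>N\<^esub> \<ominus>\<^bsub>N\<^esub> p (u x))"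
        using fl(1,3) vl(1,3) rx by (simp add: Nl.smult_r_distr)
    qed (use fl vl in simp)
    have "g t = bc_map M N k t" if t: "t \<in> carrier (BC M)" for t
    proof -
      interpret T: tensor_pair R A M by (rule tensor_pair[OF Ml])
      interpret T': tensor_pair R A N by (rule tensor_pair[OF Nl])
      note TG = T'.abelian_group_tensor
      note pk = bc_map_props[OF Ml Nl Hom_linear[OF k]] and pf = bc_map_props[OF Ml Nl Hom_linear[OF fH]]
        and pv = bc_map_props[OF Ml Nl v]
      have "bc_map M N k t \<oplus>\<^bsub>tensor_group R A N\<^esub> bc_map M N (\<lambda>x. p (u x)) t = bc_map M N f t"
      proof (rule T.additive_eqI[OF TG additive_sum[OF TG pk(1) pv(1)] pf(1)])
        fix s x assume s: "s \<in> carrier A" and x: "x \<in> carrier M"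
        then have s': "s \<in> carrier S" by simp
        have kx: "k x \<in> carrier N" "k x \<oplus>\<^bsub>N\<^esub> p (u x) = f x"
          using x fl(1) vl(1) by (simp_all add: k_def Nl.M.a_assoc Nl.M.l_neg)
        then show "bc_map M N k (pure M s x) \<oplus>\<^bsub>tensor_group R A N\<^esub> bc_map M N (\<lambda>x. p (u x)) (pure M s x) =
            bc_map M N f (pure M s x)"
          using pk(2)[OF s' x] pv(2)[OF s' x] pf(2)[OF s' x] T'.pure_add_right[OF s kx(1) vl(1)[OF x]] by simp
      qed (use t in simp)
      then have e: "bc_map M N k t \<oplus>\<^bsub>BC N\<^esub> (bc_map M N f t \<ominus>\<^bsub>BC N\<^esub> g t) = bc_map M N f t"
        using bv[OF t] by simp
      have c: "bc_map M N k t \<in> carrier (BC N)" "bc_map M N f t \<in> carrier (BC N)" "g t \<in> carrier (BC N)"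
        using additiveD(1)[OF pk(1)] additiveD(1)[OF pf(1)] linearD(1)[OF gl] t by simp_all
      have "bc_map M N f t \<oplus>\<^bsub>BC N\<^esub> (bc_map M N k t \<oplus>\<^bsub>BC N\<^esub> \<ominus>\<^bsub>BC N\<^esub> g t) = bc_map M N f t \<oplus>\<^bsub>BC N\<^esub> \<zero>\<^bsub>BC N\<^esub>"
        using e c unfolding a_minus_def
        by (metis BN.M.a_inv_closed BN.M.a_lcomm BN.M.r_zero)
      then have "bc_map M N k t \<oplus>\<^bsub>BC N\<^esub> \<ominus>\<^bsub>BC N\<^esub> g t = \<zero>\<^bsub>BC N\<^esub>"
        using c by (metis BN.M.a_closed BN.M.a_inv_closed BN.M.r_neg1 BN.M.zero_closed)
      then show ?thesis using c by (metis BN.M.a_inv_closed BN.M.minus_equality BN.M.minus_minus)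
    qed
    then have "g = bc_map M N k"
      by (rule extensionalityI[OF Hom_extensional[OF g] Hom_extensional[OF bc_map_Hom[OF Ml Nl Hom_linear[OF k]]]])
    then show ?thesis using k by blast
  qed
  moreover have "base_change_map R S h M N ` Hom R M N \<subseteq> Hom S (BC M) (BC N)"
    using bc_map_Hom[OF Ml Nl Hom_linear] by blast
  ultimately show "base_change_surj R S h M N"
    unfolding base_change_surj_def by blast
qed

end
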